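(* Let $R$ be a commutative Noetherian ring, let $A$ be a projective Noetherian $R$-algebra and let $\Lambda$ be a finite poset. Then there exist modules $\{\Delta(\lambda)\colon\lambda\in\Lambda\}$ such that $(A,\{\Delta(\lambda)\}_{\lambda\in\Lambda})$ is split quasi-hereditary if and only if there exist modules $\{\nabla(\lambda)\colon\lambda\in\Lambda\}$ satisfying the following properties: (i) The modules $\nabla(\lambda)\in A\text{-mod}$ are projective over $R$ for every $\lambda\in\Lambda$. (ii) Given $\alpha,\beta\in\Lambda$, if $\operatorname{Hom}_A(\nabla(\alpha),\nabla(\beta))\neq0$, then $\alpha\ge\beta$. (iii) $\operatorname{End}_A(\nabla(\lambda))\simeq R$ for all $\lambda\in\Lambda$. (iv) For each $\lambda\in\Lambda$ there exists an $(A,R)$-injective module $I(\lambda)$ which is projective as an $R$-module, together with an exact sequence $0\to\nabla(\lambda)\to I(\lambda)\to K(\lambda)\to0$ with $K(\lambda)\in\mathcal{F}(\tilde{\nabla}_{\mu>\lambda})$. (v) $DA_A\in\operatorname{add}_A\left(\bigoplus_{\lambda\in\Lambda}I(\lambda)\right)$, where $A_A$ denotes the right regular $A$-module.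
   Context: A projective Noetherian $R$-algebra is an $R$-algebra that is finitely generated and projective as an $R$-module. $A\text{-mod}$ denotes finitely generated left $A$-modules, $A\text{-proj}$ (resp. $R\text{-proj}$) the finitely generated projective ones, $\operatorname{add}_A M$ the full subcategory of direct summands of finite direct sums of copies of $M$, and $D=\operatorname{Hom}_R(-,R)$ the duality functor between left and right finitely generated $A$-modules. A module $M\in A\text{-mod}$ that is projective over $R$ is $(A,R)$-injective if $M\in\operatorname{add}_A DA$. For a set $\theta$ of $A$-modules, $\mathcal{F}(\theta)$ is the full subcategory of $A\text{-mod}$ of modules admitting a finite filtration with successive quotients (isomorphic to modules) in $\theta$ (including the zero module). $\tilde\nabla_{\mu>\lambda}=\{\nabla(\mu)\otimes_R U\colon\mu\in\Lambda,\ \mu>\lambda,\ U\in R\text{-proj}\}$. $(A,\{\Delta(\lambda)\}_{\lambda\in\Lambda})$, with $\Delta(\lambda)\in A\text{-mod}$, is a split quasi-hereditary $R$-algebra if: (1) each $\Delta(\lambda)$ is projective over $R$; (2) $\operatorname{Hom}_A(\Delta(\lambda),\Delta(\mu))\neq0$ implies $\lambda\le\mu$; (3) $\operatorname{End}_A(\Delta(\lambda))\simeq R$; (4) for each $\lambda$ there is $P(\lambda)\in A\text{-proj}$ and an exact sequence $0\to C(\lambda)\to P(\lambda)\to\Delta(\lambda)\to0$ such that $C(\lambda)$ has a finite filtration by modules $\Delta(\mu)\otimes_R U_\mu$ with $U_\mu\in R\text{-proj}$, $\mu>\lambda$; (5) $\operatorname{add}_A(\bigoplus_{\lambda}P(\lambda))=A\text{-proj}$.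 *)

theory Defs
  imports "HOL-Algebra.Ring_Divisibility" "HOL-Algebra.Free_Abelian_Groups"
begin

section \<open>Modules over non-commutative rings\<close>

text \<open>
  The library locale \<^locale>\<open>module\<close> fixes a commutative ring of scalars; \<open>left_module\<close> has the same
  axioms over an arbitrary ring.  Modules reuse the record type \<^typ>\<open>('a, 'm) module\<close>; its fields
  \<open>mult\<close> and \<open>one\<close> play no role for modules and are filled with \<^const>\<open>undefined\<close>.
  Submodules are those of the library (\<^const>\<open>submodule\<close> does not assume commutativity).
\<close>

locale left_module = A?: ring A + M?: abelian_group M
  for A :: "('a, 'x) ring_scheme" (structure) and M :: "('a, 'm, 'y) module_scheme" (structure) +
  assumes smult_closed [simp, intro]:
      "\<lbrakk> a \<in> carrier A; x \<in> carrier M \<rbrakk> \<Longrightarrow> a \<odot>\<^bsub>M\<^esub> x \<in> carrier M"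
    and smult_l_distr:
      "\<lbrakk> a \<in> carrier A; b \<in> carrier A; x \<in> carrier M \<rbrakk> \<Longrightarrow>
      (a \<oplus> b) \<odot>\<^bsub>M\<^esub> x = a \<odot>\<^bsub>M\<^esub> x \<oplus>\<^bsub>M\<^esub> b \<odot>\<^bsub>M\<^esub> x"
    and smult_r_distr:
      "\<lbrakk> a \<in> carrier A; x \<in> carrier M; y \<in> carrier M \<rbrakk> \<Longrightarrow>
      a \<odot>\<^bsub>M\<^esub> (x \<oplus>\<^bsub>M\<^esub> y) = a \<odot>\<^bsub>M\<^esub> x \<oplus>\<^bsub>M\<^esub> a \<odot>\<^bsub>M\<^esub> y"
    and smult_assoc1:
      "\<lbrakk> a \<in> carrier A; b \<in> carrier A; x \<in> carrier M \<rbrakk> \<Longrightarrow>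
      (a \<otimes> b) \<odot>\<^bsub>M\<^esub> x = a \<odot>\<^bsub>M\<^esub> (b \<odot>\<^bsub>M\<^esub> x)"
    and smult_one [simp]:
      "x \<in> carrier M \<Longrightarrow> \<one> \<odot>\<^bsub>M\<^esub> x = x"

definition mk_module ::
  "'m set \<Rightarrow> 'm \<Rightarrow> ('m \<Rightarrow> 'm \<Rightarrow> 'm) \<Rightarrow> ('a \<Rightarrow> 'm \<Rightarrow> 'm) \<Rightarrow> ('a, 'm) module" where
  "mk_module C z p s =
     \<lparr>carrier = C, mult = undefined, one = undefined, ring.zero = z, add = p, smult = s\<rparr>"

definition mod_hom ::
  "('a, 'x) ring_scheme \<Rightarrow> ('a, 'm, 'y) module_scheme \<Rightarrow> ('a, 'n, 'z) module_scheme \<Rightarrow> ('m \<Rightarrow> 'n) set"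
  where
  "mod_hom A M N = {f \<in> carrier M \<rightarrow> carrier N.
     (\<forall>x\<in>carrier M. \<forall>y\<in>carrier M. f (x \<oplus>\<^bsub>M\<^esub> y) = f x \<oplus>\<^bsub>N\<^esub> f y) \<and>
     (\<forall>a\<in>carrier A. \<forall>x\<in>carrier M. f (a \<odot>\<^bsub>M\<^esub> x) = a \<odot>\<^bsub>N\<^esub> f x)}"

definition hom_nonzero ::
  "('a, 'x) ring_scheme \<Rightarrow> ('a, 'm, 'y) module_scheme \<Rightarrow> ('a, 'n, 'z) module_scheme \<Rightarrow> bool" where
  "hom_nonzero A M N \<longleftrightarrow> (\<exists>f\<in>mod_hom A M N. \<exists>x\<in>carrier M. f x \<noteq> \<zero>\<^bsub>N\<^esub>)"

definition mod_iso ::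
  "('a, 'x) ring_scheme \<Rightarrow> ('a, 'm, 'y) module_scheme \<Rightarrow> ('a, 'n, 'z) module_scheme \<Rightarrow> bool" where
  "mod_iso A M N \<longleftrightarrow> (\<exists>f\<in>mod_hom A M N. bij_betw f (carrier M) (carrier N))"

definition short_exact ::
  "('a, 'x) ring_scheme \<Rightarrow> ('a, 'l, 'w) module_scheme \<Rightarrow> ('l \<Rightarrow> 'm) \<Rightarrow>
   ('a, 'm, 'y) module_scheme \<Rightarrow> ('m \<Rightarrow> 'n) \<Rightarrow> ('a, 'n, 'z) module_scheme \<Rightarrow> bool" where
  "short_exact A L i M p N \<longleftrightarrow>
     i \<in> mod_hom A L M \<and> p \<in> mod_hom A M N \<and>
     inj_on i (carrier L) \<and> i ` carrier L = a_kernel M N p \<and> p ` carrier M = carrier N"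

definition regular :: "('a, 'x) ring_scheme \<Rightarrow> ('a, 'a) module" where
  "regular A = \<lparr>carrier = carrier A, mult = (\<otimes>\<^bsub>A\<^esub>), one = \<one>\<^bsub>A\<^esub>,
     ring.zero = \<zero>\<^bsub>A\<^esub>, add = (\<oplus>\<^bsub>A\<^esub>), smult = (\<otimes>\<^bsub>A\<^esub>)\<rparr>"

definition direct_sum :: "'i set \<Rightarrow> ('i \<Rightarrow> ('a, 'm, 'y) module_scheme) \<Rightarrow> ('a, 'i \<Rightarrow> 'm) module" where
  "direct_sum I M = mk_module
     {f \<in> (\<Pi>\<^sub>E i\<in>I. carrier (M i)). finite {i \<in> I. f i \<noteq> \<zero>\<^bsub>M i\<^esub>}}
     (\<lambda>i\<in>I. \<zero>\<^bsub>M i\<^esub>)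
     (\<lambda>f g. \<lambda>i\<in>I. f i \<oplus>\<^bsub>M i\<^esub> g i)
     (\<lambda>a f. \<lambda>i\<in>I. a \<odot>\<^bsub>M i\<^esub> f i)"

definition quotient_module :: "('a, 'm, 'y) module_scheme \<Rightarrow> 'm set \<Rightarrow> ('a, 'm set) module" where
  "quotient_module M N = mk_module (a_rcosets\<^bsub>M\<^esub> N) N (set_add M)
     (\<lambda>a X. \<Union>x\<in>X. N +>\<^bsub>M\<^esub> (a \<odot>\<^bsub>M\<^esub> x))"

definition fin_gen :: "('a, 'x) ring_scheme \<Rightarrow> ('a, 'm, 'y) module_scheme \<Rightarrow> bool" where
  "fin_gen A M \<longleftrightarrow> (\<exists>S. finite S \<and> S \<subseteq> carrier M \<and>
     carrier M = {(\<Oplus>\<^bsub>M\<^esub> s\<in>S. c s \<odot>\<^bsub>M\<^esub> s) | c. c \<in> S \<rightarrow> carrier A})"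

definition fg_module :: "('a, 'x) ring_scheme \<Rightarrow> ('a, 'm, 'y) module_scheme \<Rightarrow> bool" where
  "fg_module A M \<longleftrightarrow> left_module A M \<and> fin_gen A M"

text \<open>\<open>M\<close> is, up to isomorphism, a direct summand of \<open>N\<close>.\<close>

definition direct_summand ::
  "('a, 'x) ring_scheme \<Rightarrow> ('a, 'm, 'y) module_scheme \<Rightarrow> ('a, 'n, 'z) module_scheme \<Rightarrow> bool" where
  "direct_summand A M N \<longleftrightarrow> (\<exists>X Y. submodule X A N \<and> submodule Y A N \<and>
     X \<inter> Y = {\<zero>\<^bsub>N\<^esub>} \<and> X <+>\<^bsub>N\<^esub> Y = carrier N \<and> mod_iso A M (N\<lparr>carrier := X\<rparr>))"

text \<open>
  Projective modules are the direct summands of free modules.  Index sets inside the element type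
  of \<open>P\<close> suffice: a projective \<open>P\<close> is a direct summand of the free module on \<^term>\<open>carrier P\<close>.
\<close>

definition projective_module :: "('a, 'x) ring_scheme \<Rightarrow> ('a, 'p, 'y) module_scheme \<Rightarrow> bool" where
  "projective_module A P \<longleftrightarrow> left_module A P \<and>
     (\<exists>I :: 'p set. direct_summand A P (direct_sum I (\<lambda>_. regular A)))"

definition fg_projective :: "('a, 'x) ring_scheme \<Rightarrow> ('a, 'p, 'y) module_scheme \<Rightarrow> bool" where
  "fg_projective A P \<longleftrightarrow> fg_module A P \<and> projective_module A P"

definition in_add ::
  "('a, 'x) ring_scheme \<Rightarrow> ('a, 'm, 'y) module_scheme \<Rightarrow> ('a, 'n, 'z) module_scheme \<Rightarrow> bool" where
  "in_add A M N \<longleftrightarrow> left_module A N \<and>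
     (\<exists>n::nat. direct_summand A N (direct_sum {..<n} (\<lambda>_. M)))"

text \<open>
  HOL cannot quantify over modules of all types.  Every finitely generated \<open>A\<close>-module is isomorphic
  to a quotient of some \<open>A\<^sup>n\<close>, whose elements are cosets in \<^typ>\<open>nat \<Rightarrow> 'a\<close>; hence quantifying over
  modules with elements of the following type reaches every finitely generated module up to
  isomorphism.
\<close>

type_synonym 'a fgmod = "('a, (nat \<Rightarrow> 'a) set) module"


section \<open>Algebras over a commutative ring\<close>

text \<open>As the library locale \<^locale>\<open>algebra\<close>, but without commutativity of \<open>A\<close>.\<close>

locale assoc_algebra = module R A + ring A
  for R :: "('r, 'x) ring_scheme" (structure) and A :: "('r, 'a, 'y) module_scheme" (structure) +
  assumes smult_mult_left:
      "\<lbrakk> r \<in> carrier R; x \<in> carrier A; y \<in> carrier A \<rbrakk> \<Longrightarrow>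
      (r \<odot>\<^bsub>A\<^esub> x) \<otimes>\<^bsub>A\<^esub> y = r \<odot>\<^bsub>A\<^esub> (x \<otimes>\<^bsub>A\<^esub> y)"
    and smult_mult_right:
      "\<lbrakk> r \<in> carrier R; x \<in> carrier A; y \<in> carrier A \<rbrakk> \<Longrightarrow>
      x \<otimes>\<^bsub>A\<^esub> (r \<odot>\<^bsub>A\<^esub> y) = r \<odot>\<^bsub>A\<^esub> (x \<otimes>\<^bsub>A\<^esub> y)"

definition projective_noetherian_algebra ::
  "('r, 'x) ring_scheme \<Rightarrow> ('r, 'a, 'y) module_scheme \<Rightarrow> bool" where
  "projective_noetherian_algebra R A \<longleftrightarrow> assoc_algebra R A \<and> fg_projective R A"

text \<open>An \<open>A\<close>-module viewed as an \<open>R\<close>-module along \<open>r \<mapsto> r \<cdot> 1\<^sub>A\<close>.\<close>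

definition restrict_scalars ::
  "('r, 'a, 'y) module_scheme \<Rightarrow> ('a, 'm, 'z) module_scheme \<Rightarrow> ('r, 'm) module" where
  "restrict_scalars A M = mk_module (carrier M) \<zero>\<^bsub>M\<^esub> (\<oplus>\<^bsub>M\<^esub>)
     (\<lambda>r x. (r \<odot>\<^bsub>A\<^esub> \<one>\<^bsub>A\<^esub>) \<odot>\<^bsub>M\<^esub> x)"

definition End_algebra ::
  "('r, 'a, 'y) module_scheme \<Rightarrow> ('a, 'm, 'z) module_scheme \<Rightarrow> ('r, 'm \<Rightarrow> 'm) module" where
  "End_algebra A M =
     \<lparr>carrier = mod_hom A M M \<inter> extensional (carrier M),
      mult = compose (carrier M),
      one = (\<lambda>x\<in>carrier M. x),
      ring.zero = (\<lambda>x\<in>carrier M. \<zero>\<^bsub>M\<^esub>),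
      add = (\<lambda>f g. \<lambda>x\<in>carrier M. f x \<oplus>\<^bsub>M\<^esub> g x),
      smult = (\<lambda>r f. \<lambda>x\<in>carrier M. r \<odot>\<^bsub>restrict_scalars A M\<^esub> f x)\<rparr>"

definition algebra_iso ::
  "('r, 'x) ring_scheme \<Rightarrow> ('r, 'b, 'y) module_scheme \<Rightarrow> ('r, 'c, 'z) module_scheme \<Rightarrow> bool" where
  "algebra_iso R B C \<longleftrightarrow> (\<exists>\<phi>\<in>ring_iso B C.
     \<forall>r\<in>carrier R. \<forall>b\<in>carrier B. \<phi> (r \<odot>\<^bsub>B\<^esub> b) = r \<odot>\<^bsub>C\<^esub> \<phi> b)"

definition opposite :: "('r, 'a, 'y) module_scheme \<Rightarrow> ('r, 'a, 'y) module_scheme" where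
  "opposite A = A\<lparr>mult := (\<lambda>x y. y \<otimes>\<^bsub>A\<^esub> x)\<rparr>"

text \<open>
  Right \<open>A\<close>-modules are left modules over \<^term>\<open>opposite A\<close>.  For a left \<open>B\<close>-module \<open>M\<close>, the module
  \<open>dual R B M\<close> is \<open>Hom\<^sub>R(M, R)\<close> with \<open>(b f)(m) = f (b m)\<close>, a left module over \<^term>\<open>opposite B\<close>.
  In particular \<open>dual_regular R A\<close> is the left \<open>A\<close>-module \<open>D(A\<^sub>A)\<close>, with \<open>(a f)(x) = f (x a)\<close>.
\<close>

definition dual ::
  "('r, 'x) ring_scheme \<Rightarrow> ('r, 'b, 'y) module_scheme \<Rightarrow> ('b, 'm, 'z) module_scheme \<Rightarrow>
   ('b, 'm \<Rightarrow> 'r) module" where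
  "dual R B M = mk_module
     (mod_hom R (restrict_scalars B M) (regular R) \<inter> extensional (carrier M))
     (\<lambda>x\<in>carrier M. \<zero>\<^bsub>R\<^esub>)
     (\<lambda>f g. \<lambda>x\<in>carrier M. f x \<oplus>\<^bsub>R\<^esub> g x)
     (\<lambda>b f. \<lambda>x\<in>carrier M. f (b \<odot>\<^bsub>M\<^esub> x))"

definition dual_regular ::
  "('r, 'x) ring_scheme \<Rightarrow> ('r, 'a, 'y) module_scheme \<Rightarrow> ('a, 'a \<Rightarrow> 'r) module" where
  "dual_regular R A = dual R (opposite A) (regular (opposite A))"

definition relative_injective ::
  "('r, 'x) ring_scheme \<Rightarrow> ('r, 'a, 'y) module_scheme \<Rightarrow> ('a, 'm, 'z) module_scheme \<Rightarrow> bool" where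
  "relative_injective R A M \<longleftrightarrow>
     fg_module A M \<and> projective_module R (restrict_scalars A M) \<and> in_add A (dual_regular R A) M"

text \<open>
  \<open>M \<otimes>\<^sub>R U\<close> is the free abelian group on \<open>M \<times> U\<close> modulo the subgroup generated by the
  balanced-biadditivity relations; \<open>A\<close> acts by \<open>a (m \<otimes> u) = (a m) \<otimes> u\<close>.
\<close>

definition tensor_relations ::
  "('r, 'x) ring_scheme \<Rightarrow> ('r, 'a, 'y) module_scheme \<Rightarrow> ('a, 'm, 'z) module_scheme \<Rightarrow>
   ('r, 'u, 'w) module_scheme \<Rightarrow> ('m \<times> 'u \<Rightarrow>\<^sub>0 int) set" where
  "tensor_relations R A M U =
     {frag_of (m \<oplus>\<^bsub>M\<^esub> m', u) - frag_of (m, u) - frag_of (m', u) | m m' u.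
        m \<in> carrier M \<and> m' \<in> carrier M \<and> u \<in> carrier U} \<union>
     {frag_of (m, u \<oplus>\<^bsub>U\<^esub> u') - frag_of (m, u) - frag_of (m, u') | m u u'.
        m \<in> carrier M \<and> u \<in> carrier U \<and> u' \<in> carrier U} \<union>
     {frag_of (r \<odot>\<^bsub>restrict_scalars A M\<^esub> m, u) - frag_of (m, r \<odot>\<^bsub>U\<^esub> u) | r m u.
        r \<in> carrier R \<and> m \<in> carrier M \<and> u \<in> carrier U}"

definition tensor ::
  "('r, 'x) ring_scheme \<Rightarrow> ('r, 'a, 'y) module_scheme \<Rightarrow> ('a, 'm, 'z) module_scheme \<Rightarrow>
   ('r, 'u, 'w) module_scheme \<Rightarrow> ('a, ('m \<times> 'u \<Rightarrow>\<^sub>0 int) set) module" where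
  "tensor R A M U =
     (let F = free_Abelian_group (carrier M \<times> carrier U)
      in quotient_module
           (mk_module (carrier F) 0 (+) (\<lambda>a. frag_extend (\<lambda>(m, u). frag_of (a \<odot>\<^bsub>M\<^esub> m, u))))
           (generate F (tensor_relations R A M U)))"


section \<open>Filtrations and split quasi-hereditary algebras\<close>

definition filtered ::
  "('a, 'x) ring_scheme \<Rightarrow> ('a, 't) module set \<Rightarrow> ('a, 'm, 'y) module_scheme \<Rightarrow> bool" where
  "filtered A \<theta> M \<longleftrightarrow> fg_module A M \<and>
     (\<exists>(n::nat) F. (\<forall>i\<le>n. submodule (F i) A M) \<and> F 0 = {\<zero>\<^bsub>M\<^esub>} \<and> F n = carrier M \<and>
       (\<forall>i<n. F i \<subseteq> F (Suc i) \<and>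
         (\<exists>X\<in>\<theta>. mod_iso A (quotient_module (M\<lparr>carrier := F (Suc i)\<rparr>) (F i)) X)))"

definition tensor_above ::
  "('r, 'x) ring_scheme \<Rightarrow> ('r, 'a, 'y) module_scheme \<Rightarrow> 'l::order set \<Rightarrow>
   ('l \<Rightarrow> ('a, 'm, 'z) module_scheme) \<Rightarrow> 'l \<Rightarrow>
   ('a, ('m \<times> (nat \<Rightarrow> 'r) set \<Rightarrow>\<^sub>0 int) set) module set" where
  "tensor_above R A \<Lambda> X \<alpha> =
     {tensor R A (X \<mu>) U | \<mu> (U :: 'r fgmod). \<mu> \<in> \<Lambda> \<and> \<alpha> < \<mu> \<and> fg_projective R U}"

definition split_quasi_hereditary ::
  "('r, 'x) ring_scheme \<Rightarrow> ('r, 'a, 'y) module_scheme \<Rightarrow> 'l::order set \<Rightarrow> ('l \<Rightarrow> 'a fgmod) \<Rightarrow> bool"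
  where
  "split_quasi_hereditary R A \<Lambda> \<Delta> \<longleftrightarrow>
     (\<forall>\<alpha>\<in>\<Lambda>. fg_module A (\<Delta> \<alpha>)) \<and>
     (\<forall>\<alpha>\<in>\<Lambda>. projective_module R (restrict_scalars A (\<Delta> \<alpha>))) \<and>
     (\<forall>\<alpha>\<in>\<Lambda>. \<forall>\<mu>\<in>\<Lambda>. hom_nonzero A (\<Delta> \<alpha>) (\<Delta> \<mu>) \<longrightarrow> \<alpha> \<le> \<mu>) \<and>
     (\<forall>\<alpha>\<in>\<Lambda>. algebra_iso R (End_algebra A (\<Delta> \<alpha>)) (regular R)) \<and>
     (\<exists>P :: 'l \<Rightarrow> 'a fgmod.
        (\<forall>\<alpha>\<in>\<Lambda>. fg_projective A (P \<alpha>) \<and>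
           (\<exists>(C :: 'a fgmod) i p. short_exact A C i (P \<alpha>) p (\<Delta> \<alpha>) \<and>
              filtered A (tensor_above R A \<Lambda> \<Delta> \<alpha>) C)) \<and>
        (\<forall>M :: 'a fgmod. in_add A (direct_sum \<Lambda> P) M \<longleftrightarrow> fg_projective A M))"

end

theory Submission
  imports Defs
begin

text \<open>
 Both sides of the equivalence are brought into the same form.  A \<^emph>\<open>standard system\<close> consists of lattices
 (modules that are finitely generated and projective over \<open>R\<close>) \<open>D \<alpha>\<close> with endomorphism ring \<open>R\<close>,
 homomorphisms only upwards, and surjections \<open>p \<alpha>\<close> from projective modules \<open>P \<alpha>\<close> onto \<open>D \<alpha>\<close> whose kernels
 have filtrations with layers in the additive closures of the \<open>D \<mu>\<close>, \<open>\<mu> > \<alpha>\<close>; the \<open>P \<alpha>\<close> generate the regular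
 module.  A \<^emph>\<open>costandard system\<close> is the same with arrows reversed and with the dual of the regular right
 module in place of the regular module.  Since \<open>D \<mu>\<close> has endomorphism ring \<open>R\<close>, the modules
 \<open>D \<mu> \<otimes>\<^sub>R U\<close> with \<open>U\<close> finitely generated projective are exactly the modules in the additive closure of
 \<open>D \<mu>\<close> (\<open>tensor_add_of\<close>, \<open>add_of_is_tensor\<close>), so these systems express the two sides of the theorem.

 Two symmetries give the theorem.  The functor \<open>Hom\<^sub>R(-, R)\<close> is an exact duality between lattices over \<open>A\<close>
 and over the opposite algebra, and exchanges standard systems over one with costandard systems over the
 other (\<open>dual_of_standard_system\<close>, \<open>dual_of_costandard_system\<close>).  And an algebra with a standard system has
 one over its opposite (\<open>opposite_standard_system\<close>).  Going from \<open>A\<close> to the opposite algebra by one of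
 them and back by the other proves both implications.

 The second symmetry is the main work.  Number \<open>\<Lambda>\<close> so that larger elements come first, and let \<open>T k\<close> be the sum
 of the images of all \<open>P \<mu> \<rightarrow> A\<close> with \<open>\<mu>\<close> numbered below \<open>k\<close>, a two-sided ideal.  Because the \<open>P \<mu>\<close> are
 projective, the layers of any filtered module can be sorted by their types: its traces have the layer of
 number \<open>k\<close> in the additive closure of the corresponding \<open>D \<kappa>\<close> (\<open>Filt_trace_layer\<close>); this passes from the
 \<open>P \<alpha>\<close> to \<open>A\<close> (\<open>regular_trace_layer\<close>).  The projective modules used over the opposite algebra are
 \<open>H \<alpha> = Hom\<^sub>A(P \<alpha>, A)\<close>, and the new standard module \<open>Q \<kappa>\<close> is the quotient of \<open>H \<kappa>\<close> by the maps with image in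
 the ideal numbered by \<open>\<kappa>\<close>.  Morally \<open>T (Suc k) / T k = D \<kappa> \<otimes>\<^sub>R Q \<kappa>\<close>, so that the maps \<open>P \<alpha> \<rightarrow> A\<close> with image in
 the ideals \<open>T k\<close> filter \<open>H \<alpha>\<close> with layers \<open>Hom\<^sub>A(P \<alpha>, D \<kappa>) \<otimes>\<^sub>R Q \<kappa>\<close>.  Here \<open>Hom\<^sub>A(P \<alpha>, D \<kappa>)\<close> is projective over \<open>R\<close>
 and vanishes unless \<open>\<alpha> \<le> \<kappa>\<close>, so the layers lie in the additive closure of \<open>Q \<kappa>\<close> (\<open>HF_layer\<close>) and only
 types above \<open>\<alpha>\<close> occur in the kernel of \<open>H \<alpha> \<rightarrow> Q \<alpha>\<close> (\<open>H_filt\<close>).  Homomorphisms \<open>H \<alpha> \<rightarrow> Q \<beta>\<close> are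
 precompositions with maps \<open>P \<beta> \<rightarrow> P \<alpha>\<close> (\<open>hom_H_Q\<close>), which yields the order condition and the endomorphism rings.
\<close>

section \<open>Modules, homomorphisms, submodules\<close>

text \<open>Operations of a module or ring given by its name, without subscripts.\<close>

abbreviation (input) add_in ("(_ +[_]/ _)" [65, 0, 66] 65) where "x +[M] y \<equiv> add M x y"
abbreviation (input) smult_in ("(_ *[_]/ _)" [71, 0, 70] 70) where "a *[M] x \<equiv> smult M a x"
abbreviation (input) mult_in ("(_ **[_]/ _)" [70, 0, 71] 70) where "a **[A] b \<equiv> monoid.mult A a b"
abbreviation (input) zero_in ("0[_]") where "0[M] \<equiv> ring.zero M"
abbreviation (input) one_in ("1[_]") where "1[A] \<equiv> monoid.one A"
abbreviation (input) neg_in ("-[_] _" [0, 81] 80) where "-[M] x \<equiv> a_inv M x"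
abbreviation (input) minus_in ("(_ -[_]/ _)" [65, 0, 66] 65) where "x -[M] y \<equiv> a_minus M x y"

lemma (in abelian_group) neg_zero [simp]: "\<ominus> \<zero> = \<zero>" by (rule minus_equality) auto

lemma (in abelian_group) diff_zero_iff:
 assumes "x : carrier G" "y : carrier G"
 shows "x \<oplus> \<ominus> y = \<zero> \<longleftrightarrow> x = y"
proof
 assume "x \<oplus> \<ominus> y = \<zero>"
 then have "\<ominus> (\<ominus> y) = x" using assms by (intro minus_equality) auto
 then show "x = y" using assms by simp
qed (use assms in "simp add: r_neg")

context left_module
begin

lemma smult_l_null [simp]:
 assumes "x : carrier M" shows "0[A] *[M] x = 0[M]"
proof -
 have "0[A] *[M] x +[M] 0[A] *[M] x = 0[A] *[M] x" using smult_l_distr[of "0[A]" "0[A]" x] assms by simp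
 then show ?thesis using assms by (metis A.zero_closed M.add.r_cancel_one' smult_closed)
qed

lemma smult_r_null [simp]:
 assumes "a : carrier A" shows "a *[M] 0[M] = 0[M]"
proof -
 have "a *[M] 0[M] +[M] a *[M] 0[M] = a *[M] 0[M]" using smult_r_distr[of a "0[M]" "0[M]"] assms by simp
 then show ?thesis using assms by (metis M.zero_closed M.add.r_cancel_one' smult_closed)
qed

lemma smult_minus_one:
 assumes "x : carrier M" shows "(-[A] 1[A]) *[M] x = -[M] x"
proof -
 have "(-[A] 1[A]) *[M] x +[M] x = 0[M]" using smult_l_distr[of "-[A] 1[A]" "1[A]" x] assms by (simp add: A.l_neg)
 then show ?thesis using assms by (metis A.a_inv_closed A.one_closed M.minus_equality smult_closed)
qed

end

lemma left_moduleI: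
 assumes "ring A" "abelian_group M"
  and "!!a x. [| a : carrier A; x : carrier M |] ==> a *[M] x : carrier M"
  and "!!a b x. [| a : carrier A; b : carrier A; x : carrier M |] ==>
   (a +[A] b) *[M] x = a *[M] x +[M] b *[M] x"
  and "!!a x y. [| a : carrier A; x : carrier M; y : carrier M |] ==>
   a *[M] (x +[M] y) = a *[M] x +[M] a *[M] y"
  and "!!a b x. [| a : carrier A; b : carrier A; x : carrier M |] ==>
   (a **[A] b) *[M] x = a *[M] (b *[M] x)"
  and "!!x. x : carrier M ==> 1[A] *[M] x = x"
 shows "left_module A M" using assms by (simp add: left_module_def left_module_axioms_def)

lemma left_module_group: "left_module A M ==> abelian_group M"
 and left_module_ring: "left_module A M ==> ring A" by (simp_all add: left_module_def)

lemma mod_homI: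
 assumes "!!x. x : carrier M ==> f x : carrier N"
  and "!!x y. [|x : carrier M; y : carrier M|] ==> f (x +[M] y) = f x +[N] f y"
  and "!!a x. [|a : carrier A; x : carrier M|] ==> f (a *[M] x) = a *[N] f x"
 shows "f : mod_hom A M N" using assms by (simp add: mod_hom_def)

lemma mod_hom_closed: "[|f : mod_hom A M N; x : carrier M|] ==> f x : carrier N" by (auto simp: mod_hom_def)

lemma mod_hom_add:
 "[|f : mod_hom A M N; x : carrier M; y : carrier M|] ==> f (x +[M] y) = f x +[N] f y" by (auto simp: mod_hom_def)

lemma mod_hom_smult:
 "[|f : mod_hom A M N; a : carrier A; x : carrier M|] ==> f (a *[M] x) = a *[N] f x" by (auto simp: mod_hom_def)

lemma mod_hom_zero:
 assumes "left_module A M" "left_module A N" "f : mod_hom A M N"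
 shows "f 0[M] = 0[N]"
proof -
 interpret M: left_module A M by fact
 interpret N: left_module A N by fact
 have "f (0[A] *[M] 0[M]) = 0[A] *[N] f 0[M]" using assms(3) by (intro mod_hom_smult) auto
 then show ?thesis using mod_hom_closed[OF assms(3)] by simp
qed

lemma mod_hom_minus:
 assumes "left_module A M" "left_module A N" "f : mod_hom A M N" "x : carrier M"
 shows "f (-[M] x) = -[N] f x"
proof -
 interpret M: left_module A M by fact
 interpret N: left_module A N by fact
 have "f ((-[A] 1[A]) *[M] x) = (-[A] 1[A]) *[N] f x" using assms(3,4) by (intro mod_hom_smult) auto
 then show ?thesis using mod_hom_closed[OF assms(3,4)] assms(4) by (simp add: M.smult_minus_one N.smult_minus_one)
qed

lemma mod_hom_comp:
 "[|f : mod_hom A L M; g : mod_hom A M N|] ==> (%x. g (f x)) : mod_hom A L N" by (auto simp: mod_hom_def Pi_iff)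

lemma mod_hom_id: "(%x. x) : mod_hom A M M" by (auto simp: mod_hom_def)

lemma mod_hom_cong:
 assumes "left_module A M" "f : mod_hom A M N" "!!x. x : carrier M ==> g x = f x"
 shows "g : mod_hom A M N"
proof -
 interpret M: left_module A M by fact
 show ?thesis using assms(2,3) by (intro mod_homI) (auto simp: mod_hom_def)
qed

lemma mod_hom_restrict:
 assumes "left_module A M" "f : mod_hom A M N"
 shows "restrict f (carrier M) : mod_hom A M N" by (rule mod_hom_cong[OF assms]) simp

lemma mod_hom_zero_map:
 assumes "left_module A N"
 shows "(%x. 0[N]) : mod_hom A M N"
proof -
 interpret N: left_module A N by fact
 show ?thesis by (intro mod_homI) auto
qed

lemma mod_hom_plus:
 assumes "left_module A N" "f : mod_hom A M N" "g : mod_hom A M N"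
 shows "(%x. f x +[N] g x) : mod_hom A M N"
proof -
 interpret N: left_module A N by fact
 show ?thesis using assms(2,3) mod_hom_closed[OF assms(2)] mod_hom_closed[OF assms(3)] by (intro mod_homI)
   (auto simp: mod_hom_add[OF assms(2)] mod_hom_add[OF assms(3)] mod_hom_smult[OF assms(2)]
    mod_hom_smult[OF assms(3)] N.smult_r_distr N.M.a_ac)
qed

lemma mod_hom_uminus:
 assumes "left_module A N" "f : mod_hom A M N"
 shows "(%x. -[N] f x) : mod_hom A M N"
proof -
 interpret N: left_module A N by fact
 have "a *[N] (-[N] y) = -[N] (a *[N] y)" if "a : carrier A" "y : carrier N" for a y
 proof -
  have "a *[N] (-[N] y) +[N] a *[N] y = 0[N]" using that by (simp add: N.smult_r_distr[symmetric] N.M.l_neg)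
  then show ?thesis using that by (simp add: N.M.minus_equality)
 qed
 then show ?thesis using assms(2) mod_hom_closed[OF assms(2)] by (intro mod_homI)
   (auto simp: mod_hom_add[OF assms(2)] mod_hom_smult[OF assms(2)] N.M.minus_add)
qed

lemma submodule_intro:
 assumes "left_module A M" "H <= carrier M" "0[M] : H"
  and "!!x y. [|x : H; y : H|] ==> x +[M] y : H"
  and "!!a x. [|a : carrier A; x : H|] ==> a *[M] x : H"
 shows "submodule H A M"
proof -
 interpret M: left_module A M by fact
 have inv: "-[M] x : H" if "x : H" for x
  using assms(5)[of "-[A] 1[A]" x] assms(2) that by (auto simp: M.smult_minus_one)
 show ?thesis by (intro submodule.intro subgroup.intro)
   (use assms inv in "auto simp: submodule_axioms_def a_inv_def")
qed

lemma submodule_subset: "submodule H A M ==> H <= carrier M"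
 and submodule_zero: "submodule H A M ==> 0[M] : H"
 and submodule_add: "[|submodule H A M; x : H; y : H|] ==> x +[M] y : H"
 and submodule_smult: "[|submodule H A M; a : carrier A; x : H|] ==> a *[M] x : H"
 and submodule_subgroup: "submodule H A M ==> subgroup H (add_monoid M)"
 using subgroup.subset[OF submodule.axioms(1), of H A M]
  subgroup.one_closed[OF submodule.axioms(1), of H A M]
  subgroup.m_closed[OF submodule.axioms(1), of H A M x y] by (auto simp: submodule_def submodule_axioms_def)

lemma submodule_minus:
 assumes "left_module A M" "submodule H A M" "x : H" shows "-[M] x : H"
 using subgroup.m_inv_closed[OF submodule_subgroup[OF assms(2)] assms(3)] by (simp add: a_inv_def)

lemma submodule_module:
 assumes "left_module A M" "submodule H A M"
 shows "left_module A (M(|carrier := H|))"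
proof -
 interpret M: left_module A M by fact
 have sub: "x : H ==> x : carrier M" for x using submodule_subset[OF assms(2)] by auto
 have neg: "\<exists>y\<in>H. x +[M] y = 0[M]" if "x : H" for x
  using submodule_minus[OF assms that] sub that by (auto intro!: bexI[of _ "-[M] x"] simp: M.M.r_neg)
 show ?thesis by (rule left_moduleI)
   (auto intro!: abelian_groupI M.A.ring_axioms submodule_add[OF assms(2)] submodule_smult[OF assms(2)]
    simp: sub submodule_zero[OF assms(2)] M.M.a_ac M.smult_l_distr M.smult_r_distr M.smult_assoc1 neg)
qed

lemma mod_hom_into_submodule:
 assumes "f : mod_hom A L M" "!!x. x : carrier L ==> f x : H"
 shows "f : mod_hom A L (M(|carrier := H|))" using assms by (auto simp: mod_hom_def)

lemma mod_hom_from_submodule: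
 assumes "f : mod_hom A M N" "H <= carrier M"
 shows "f : mod_hom A (M(|carrier := H|)) N" using assms by (auto simp: mod_hom_def subset_iff Pi_iff)

lemma mod_hom_out_of_submodule:
 assumes "f : mod_hom A L (M(|carrier := H|))" "H <= carrier M"
 shows "f : mod_hom A L M" using assms by (auto simp: mod_hom_def)

lemma a_kernel_eq: "a_kernel M N f = {x : carrier M. f x = 0[N]}" by (auto simp: a_kernel_def kernel_def)

lemma kernel_submodule:
 assumes "left_module A M" "left_module A N" "f : mod_hom A M N"
 shows "submodule (a_kernel M N f) A M"
proof -
 interpret M: left_module A M by fact
 interpret N: left_module A N by fact
 show ?thesis by (rule submodule_intro[OF assms(1)])
   (auto simp: a_kernel_eq mod_hom_add[OF assms(3)] mod_hom_smult[OF assms(3)] mod_hom_zero[OF assms])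
qed

lemma image_submodule:
 assumes "left_module A M" "left_module A N" "f : mod_hom A M N" "submodule H A M"
 shows "submodule (f ` H) A N"
proof (rule submodule_intro[OF assms(2)])
 note sub = subsetD[OF submodule_subset[OF assms(4)]]
 show "f ` H <= carrier N" using mod_hom_closed[OF assms(3)] sub by auto
 show "0[N] : f ` H" using mod_hom_zero[OF assms(1-3)] submodule_zero[OF assms(4)] by (metis imageI)
 show "x +[N] y : f ` H" if "x : f ` H" "y : f ` H" for x y
  using that submodule_add[OF assms(4)] mod_hom_add[OF assms(3)] sub by (smt (verit) image_iff)
 show "a *[N] x : f ` H" if "a : carrier A" "x : f ` H" for a x
  using that submodule_smult[OF assms(4)] mod_hom_smult[OF assms(3)] sub by (smt (verit) image_iff)
qed

lemma preimage_submodule: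
 assumes "left_module A M" "left_module A N" "f : mod_hom A M N" "submodule H A N"
 shows "submodule {x : carrier M. f x : H} A M"
proof -
 interpret M: left_module A M by fact
 show ?thesis by (rule submodule_intro[OF assms(1)])
   (auto simp: mod_hom_add[OF assms(3)] mod_hom_smult[OF assms(3)] mod_hom_zero[OF assms(1-3)]
    submodule_zero[OF assms(4)] submodule_add[OF assms(4)] submodule_smult[OF assms(4)])
qed

lemma carrier_submodule: "left_module A M ==> submodule (carrier M) A M"
 and zero_submodule: "left_module A M ==> submodule {0[M]} A M"
proof -
 assume "left_module A M"
 then interpret left_module A M .
 show "submodule (carrier M) A M" "submodule {0[M]} A M" by (rule submodule_intro[OF left_module_axioms]; auto)+
qed

lemma submodule_of_submodule:
 assumes "left_module A M" "submodule W A M" "submodule F A M" "F <= W"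
 shows "submodule F A (M(|carrier := W|))" using assms by (intro submodule_intro submodule_module)
  (auto simp: submodule_zero submodule_add submodule_smult dest: submodule_subset)

lemma mod_hom_inverse:
 assumes "left_module A M" "f : mod_hom A M N" "bij_betw f (carrier M) (carrier N)"
 shows "inv_into (carrier M) f : mod_hom A N M"
proof -
 interpret M: left_module A M by fact
 let ?g = "inv_into (carrier M) f"
 have g: "?g y : carrier M" "f (?g y) = y" if "y : carrier N" for y
  using that assms(3) by (auto simp: bij_betw_def f_inv_into_f inv_into_into)
 have gf: "?g (f x) = x" if "x : carrier M" for x using that assms(3) by (auto simp: bij_betw_def)
 show ?thesis
 proof (rule mod_homI)
  fix x y assume xy: "x : carrier N" "y : carrier N"
  show "?g (x +[N] y) = ?g x +[M] ?g y" using gf[of "?g x +[M] ?g y"] g xy by (simp add: mod_hom_add[OF assms(2)])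
 next
  fix a x assume ax: "a : carrier A" "x : carrier N"
  show "?g (a *[N] x) = a *[M] ?g x" using gf[of "a *[M] ?g x"] g ax by (simp add: mod_hom_smult[OF assms(2)])
 qed (use g in auto)
qed

text \<open>Isomorphisms are handled as mutually inverse pairs of homomorphisms.\<close>

lemma mod_iso_obtain:
 assumes "left_module A M" "mod_iso A M N"
 obtains f g where "f : mod_hom A M N" "g : mod_hom A N M"
  "!!x. x : carrier M ==> g (f x) = x" "!!y. y : carrier N ==> f (g y) = y"
proof -
 obtain f where f: "f : mod_hom A M N" "bij_betw f (carrier M) (carrier N)"
  using assms(2) by (auto simp: mod_iso_def)
 show ?thesis by (rule that[OF f(1) mod_hom_inverse[OF assms(1) f]])
   (use f(2) in "auto simp: bij_betw_def f_inv_into_f")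
qed

lemma mod_isoI:
 assumes "f : mod_hom A M N" "g : mod_hom A N M"
  "!!x. x : carrier M ==> g (f x) = x" "!!y. y : carrier N ==> f (g y) = y"
 shows "mod_iso A M N" unfolding mod_iso_def by (rule bexI[OF _ assms(1)], rule bij_betwI[where g=g])
  (use assms mod_hom_closed[OF assms(1)] mod_hom_closed[OF assms(2)] in auto)

lemma mod_iso_sym:
 assumes "left_module A M" "mod_iso A M N" shows "mod_iso A N M"
proof -
 obtain f g where fg: "f : mod_hom A M N" "g : mod_hom A N M"
  "!!x. x : carrier M ==> g (f x) = x" "!!y. y : carrier N ==> f (g y) = y"
  by (rule mod_iso_obtain[OF assms]) (rule that)
 then show ?thesis by (intro mod_isoI[OF fg(2,1)])
qed

section \<open>Quotient modules\<close>

text \<open>The hypotheses ask for the module axioms only modulo \<open>N\<close>, so that the lemma also covers the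
 tensor product, where the action on the free abelian group is additive but not a module.\<close>

lemma quotient_module_general:
 assumes A: "ring A" and G: "abelian_group M" and N: "subgroup N (add_monoid M)"
  and cl: "!!a x. [|a : carrier A; x : carrier M|] ==> a *[M] x : carrier M"
  and dr: "!!a x y. [|a : carrier A; x : carrier M; y : carrier M|] ==>
    a *[M] (x +[M] y) = a *[M] x +[M] a *[M] y"
  and nn: "!!a x. [|a : carrier A; x : N|] ==> a *[M] x : N"
  and dl: "!!a b x. [|a : carrier A; b : carrier A; x : carrier M|] ==>
    N +>\<^bsub>M\<^esub> ((a +[A] b) *[M] x) = N +>\<^bsub>M\<^esub> (a *[M] x +[M] b *[M] x)"
  and as: "!!a b x. [|a : carrier A; b : carrier A; x : carrier M|] ==>
    N +>\<^bsub>M\<^esub> ((a **[A] b) *[M] x) = N +>\<^bsub>M\<^esub> (a *[M] (b *[M] x))"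
  and on: "!!x. x : carrier M ==> N +>\<^bsub>M\<^esub> (1[A] *[M] x) = N +>\<^bsub>M\<^esub> x"
 shows "left_module A (quotient_module M N)"
  and "carrier (quotient_module M N) = (%x. N +>\<^bsub>M\<^esub> x) ` carrier M"
  and "0[quotient_module M N] = N"
  and "!!x y. [|x : carrier M; y : carrier M|] ==>
   (N +>\<^bsub>M\<^esub> x) +[quotient_module M N] (N +>\<^bsub>M\<^esub> y) = N +>\<^bsub>M\<^esub> (x +[M] y)"
  and "!!a x. [|a : carrier A; x : carrier M|] ==>
   a *[quotient_module M N] (N +>\<^bsub>M\<^esub> x) = N +>\<^bsub>M\<^esub> (a *[M] x)"
  and "!!x y. [|x : carrier M; y : carrier M|] ==> N +>\<^bsub>M\<^esub> x = N +>\<^bsub>M\<^esub> y \<longleftrightarrow> x -[M] y : N"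
proof -
 interpret G: abelian_group M by fact
 interpret A: ring A by fact
 interpret N: abelian_subgroup N M by (rule abelian_subgroupI3) (use N G in "auto simp: additive_subgroup_def")
 let ?Q = "quotient_module M N"
 show car: "carrier ?Q = (%x. N +>\<^bsub>M\<^esub> x) ` carrier M"
  by (auto simp: quotient_module_def mk_module_def A_RCOSETS_def')
 show zero: "0[?Q] = N" by (simp add: quotient_module_def mk_module_def)
 show eq: "N +>\<^bsub>M\<^esub> x = N +>\<^bsub>M\<^esub> y \<longleftrightarrow> x -[M] y : N" if "x : carrier M" "y : carrier M" for x y
 proof -
  have "x -[M] y : N \<longleftrightarrow> x : N +>\<^bsub>M\<^esub> y" using N.a_rcos_module[OF that(2,1)] by (simp add: a_minus_def)
  moreover have "x : N +>\<^bsub>M\<^esub> y \<longleftrightarrow> N +>\<^bsub>M\<^esub> y = N +>\<^bsub>M\<^esub> x"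
   using N.a_repr_independence'[OF _ that(2)] N.a_repr_independenceD[OF that(1)] by blast
  ultimately show ?thesis by auto
 qed
 show add: "(N +>\<^bsub>M\<^esub> x) +[?Q] (N +>\<^bsub>M\<^esub> y) = N +>\<^bsub>M\<^esub> (x +[M] y)"
  if "x : carrier M" "y : carrier M" for x y
  using that by (simp add: quotient_module_def mk_module_def N.a_rcos_sum)
 show sm: "a *[?Q] (N +>\<^bsub>M\<^esub> x) = N +>\<^bsub>M\<^esub> (a *[M] x)" if "a : carrier A" "x : carrier M" for a x
 proof -
  have "N +>\<^bsub>M\<^esub> (a *[M] z) = N +>\<^bsub>M\<^esub> (a *[M] x)" if "z : N +>\<^bsub>M\<^esub> x" for z
  proof -
   obtain n where n: "n : N" "z = n +[M] x" using \<open>z : _\<close> by (auto simp: a_r_coset_def')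
   have "a *[M] z = a *[M] n +[M] a *[M] x" using n \<open>a : _\<close> \<open>x : _\<close> N.a_subset by (auto simp: dr)
   then have "a *[M] z : N +>\<^bsub>M\<^esub> (a *[M] x)" using nn[OF \<open>a : _\<close> n(1)] by (auto simp: a_r_coset_def')
   then show ?thesis using N.a_repr_independence'[OF _ cl[OF \<open>a : _\<close> \<open>x : _\<close>]] by simp
  qed
  moreover have "x : N +>\<^bsub>M\<^esub> x" by (rule N.a_rcos_self[OF \<open>x : carrier M\<close>])
  ultimately have "(\<Union>z\<in>N +>\<^bsub>M\<^esub> x. N +>\<^bsub>M\<^esub> (a *[M] z)) = N +>\<^bsub>M\<^esub> (a *[M] x)" by blast
  then show ?thesis by (simp add: quotient_module_def mk_module_def)
 qed
 have grp: "abelian_group ?Q"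
 proof (rule abelian_groupI)
  show "0[?Q] : carrier ?Q" using N.a_subgroup_in_rcosets by (simp add: quotient_module_def mk_module_def)
  fix X assume "X : carrier ?Q"
  then obtain x where x: "x : carrier M" "X = N +>\<^bsub>M\<^esub> x" by (auto simp: car)
  have N0: "N +>\<^bsub>M\<^esub> 0[M] = N" using N.a_subset by simp
  show "0[?Q] +[?Q] X = X" using x zero N0 add[of "0[M]" x] by simp
  show "\<exists>Y\<in>carrier ?Q. Y +[?Q] X = 0[?Q]"
   using x zero N0 add[of "-[M] x" x] by (auto simp: car G.l_neg intro!: bexI[of _ "-[M] x"])
 qed (auto simp: car add G.a_ac)
 show "left_module A ?Q" by (rule left_moduleI[OF A grp]) (auto simp: car sm add cl dl dr as on)
qed

context
 fixes A :: "('a, 'x) ring_scheme" and M :: "('a, 'm, 'y) module_scheme" and N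
 assumes M: "left_module A M" and N: "submodule N A M"
begin

lemma
 shows quotient_left_module: "left_module A (quotient_module M N)"
  and quotient_carrier: "carrier (quotient_module M N) = (%x. N +>\<^bsub>M\<^esub> x) ` carrier M"
  and quotient_zero: "0[quotient_module M N] = N"
  and quotient_add: "!!x y. [|x : carrier M; y : carrier M|] ==>
   (N +>\<^bsub>M\<^esub> x) +[quotient_module M N] (N +>\<^bsub>M\<^esub> y) = N +>\<^bsub>M\<^esub> (x +[M] y)"
  and quotient_smult: "!!a x. [|a : carrier A; x : carrier M|] ==>
   a *[quotient_module M N] (N +>\<^bsub>M\<^esub> x) = N +>\<^bsub>M\<^esub> (a *[M] x)"
  and quotient_eq_iff: "!!x y. [|x : carrier M; y : carrier M|] ==>
   N +>\<^bsub>M\<^esub> x = N +>\<^bsub>M\<^esub> y \<longleftrightarrow> x -[M] y : N"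
proof -
 interpret M: left_module A M by (fact M)
 note * = quotient_module_general[OF M.A.ring_axioms M.M.abelian_group_axioms submodule_subgroup[OF N]]
 show "left_module A (quotient_module M N)"
  "carrier (quotient_module M N) = (%x. N +>\<^bsub>M\<^esub> x) ` carrier M"
  "0[quotient_module M N] = N"
  "!!x y. [|x : carrier M; y : carrier M|] ==>
   (N +>\<^bsub>M\<^esub> x) +[quotient_module M N] (N +>\<^bsub>M\<^esub> y) = N +>\<^bsub>M\<^esub> (x +[M] y)"
  "!!a x. [|a : carrier A; x : carrier M|] ==>
   a *[quotient_module M N] (N +>\<^bsub>M\<^esub> x) = N +>\<^bsub>M\<^esub> (a *[M] x)"
  "!!x y. [|x : carrier M; y : carrier M|] ==>
   N +>\<^bsub>M\<^esub> x = N +>\<^bsub>M\<^esub> y \<longleftrightarrow> x -[M] y : N"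
  by ((rule *; simp add: submodule_smult[OF N] M.smult_l_distr M.smult_r_distr M.smult_assoc1)+)
qed

lemma quotient_proj: "(%x. N +>\<^bsub>M\<^esub> x) : mod_hom A M (quotient_module M N)"
 by (rule mod_homI) (auto simp: quotient_carrier quotient_add quotient_smult)

lemma quotient_proj_kernel: "x : carrier M ==> N +>\<^bsub>M\<^esub> x = 0[quotient_module M N] \<longleftrightarrow> x : N"
proof -
 assume x: "x : carrier M"
 interpret M: left_module A M by (fact M)
 have "N +>\<^bsub>M\<^esub> 0[M] = N" using submodule_subset[OF N] by simp
 then show ?thesis using quotient_eq_iff[OF x M.M.zero_closed] x
  by (simp add: quotient_zero a_minus_def M.M.neg_zero)
qed

end

lemma short_exact_quotient:
 assumes "left_module A M" "submodule N A M"
 shows "short_exact A (M(|carrier := N|)) (%x. x) M (%x. N +>\<^bsub>M\<^esub> x) (quotient_module M N)" unfolding short_exact_def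
proof (intro conjI)
 note sub = submodule_subset[OF assms(2)]
 show "(%x. x) : mod_hom A (M(|carrier := N|)) M" by (rule mod_hom_from_submodule[OF mod_hom_id sub])
 show "(%x. x) ` carrier (M(|carrier := N|)) = a_kernel M (quotient_module M N) ((+>\<^bsub>M\<^esub>) N)"
  using sub quotient_proj_kernel[OF assms] unfolding a_kernel_eq by auto
qed (simp_all add: quotient_proj[OF assms] quotient_carrier[OF assms])

lemma mod_hom_factor:
 assumes M: "left_module A M" and X: "left_module A X" and Y: "left_module A Y"
  and p: "p : mod_hom A M X" "p ` carrier M = carrier X"
  and h: "h : mod_hom A M Y"
  and k: "!!x. [|x : carrier M; p x = 0[X]|] ==> h x = 0[Y]"
 obtains g where "g : mod_hom A X Y" "!!x. x : carrier M ==> g (p x) = h x"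
proof -
 interpret M: left_module A M by fact
 interpret X: left_module A X by fact
 interpret Y: left_module A Y by fact
 let ?g = "%y. h (inv_into (carrier M) p y)"
 have eq: "h x = h y" if "x : carrier M" "y : carrier M" "p x = p y" for x y
 proof -
  have "p (x +[M] -[M] y) = 0[X]" using that mod_hom_closed[OF p(1)]
   by (simp add: mod_hom_add[OF p(1)] mod_hom_minus[OF M X p(1)] X.M.r_neg)
  then have "h (x +[M] -[M] y) = 0[Y]" using that k by simp
  then have "h x +[Y] -[Y] h y = 0[Y]" using that by (simp add: mod_hom_add[OF h] mod_hom_minus[OF M Y h])
  then show ?thesis using that mod_hom_closed[OF h] Y.M.diff_zero_iff by blast
 qed
 have gp: "?g (p x) = h x" if "x : carrier M" for x
 proof (rule eq)
  show "inv_into (carrier M) p (p x) : carrier M" using that by (intro inv_into_into) simp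
  show "p (inv_into (carrier M) p (p x)) = p x" using that by (intro f_inv_into_f) simp
 qed (fact that)
 have "?g : mod_hom A X Y"
 proof (rule mod_homI)
  fix x assume "x : carrier X"
  then obtain u where u: "x = p u" "u : carrier M" using p(2) by auto
  show "?g x : carrier Y" using u gp mod_hom_closed[OF h] by simp
  fix a assume a: "a : carrier A"
  have "?g (p (a *[M] u)) = a *[Y] ?g (p u)" using gp[of u] gp[of "a *[M] u"] a u by (simp add: mod_hom_smult[OF h])
  then show "?g (a *[X] x) = a *[Y] ?g x" using a u by (simp add: mod_hom_smult[OF p(1)])
 next
  fix x y assume "x : carrier X" "y : carrier X"
  then obtain u v where u: "x = p u" "u : carrier M" "y = p v" "v : carrier M" unfolding p(2)[symmetric] by auto
  have "?g (p (u +[M] v)) = ?g (p u) +[Y] ?g (p v)"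
   using gp[of u] gp[of v] gp[of "u +[M] v"] u by (simp add: mod_hom_add[OF h])
  then show "?g (x +[X] y) = ?g x +[Y] ?g y" using u by (simp add: mod_hom_add[OF p(1)])
 qed
 then show ?thesis using gp that by blast
qed

text \<open>Each surjection factors through the other.\<close>

lemma surjections_same_kernel_iso:
 assumes M: "left_module A M" and X: "left_module A X" and Y: "left_module A Y"
  and p: "p : mod_hom A M X" "p ` carrier M = carrier X"
  and q: "q : mod_hom A M Y" "q ` carrier M = carrier Y"
  and k: "!!x. x : carrier M ==> p x = 0[X] \<longleftrightarrow> q x = 0[Y]"
 shows "mod_iso A X Y"
proof -
 obtain g where g: "g : mod_hom A X Y" "!!x. x : carrier M ==> g (p x) = q x"
  using mod_hom_factor[OF M X Y p q(1)] k by blast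
 obtain h where h: "h : mod_hom A Y X" "!!x. x : carrier M ==> h (q x) = p x"
  using mod_hom_factor[OF M Y X q p(1)] k by blast
 show ?thesis
 proof (rule mod_isoI[OF g(1) h(1)])
  fix x assume "x : carrier X"
  then obtain u where "u : carrier M" "x = p u" using p(2) by auto
  then show "h (g x) = x" using g(2) h(2) by simp
 next
  fix y assume "y : carrier Y"
  then obtain u where "u : carrier M" "y = q u" using q(2) by auto
  then show "g (h y) = y" using g(2) h(2) by simp
 qed
qed

lemma quotient_iso:
 assumes "left_module A M" "left_module A X" "p : mod_hom A M X" "p ` carrier M = carrier X"
  "submodule N A M" "!!x. x : carrier M ==> p x = 0[X] \<longleftrightarrow> x : N"
 shows "mod_iso A (quotient_module M N) X"
proof (rule surjections_same_kernel_iso[OF assms(1) quotient_left_module[OF assms(1,5)] assms(2)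
   quotient_proj[OF assms(1,5)] quotient_carrier[OF assms(1,5), symmetric] assms(3,4)])
 fix x assume x: "x : carrier M"
 show "(N +>\<^bsub>M\<^esub> x = 0[quotient_module M N]) = (p x = 0[X])"
  unfolding quotient_proj_kernel[OF assms(1,5) x] assms(6)[OF x] ..
qed

section \<open>Sums over lists\<close>

definition lsum :: "('a, 'b) ring_scheme => ('c => 'a) => 'c list => 'a" where
 "lsum M f xs = foldr (%x s. f x +[M] s) xs 0[M]"

lemma lsum_Nil [simp]: "lsum M f [] = 0[M]"
 and lsum_Cons [simp]: "lsum M f (x # xs) = f x +[M] lsum M f xs" by (simp_all add: lsum_def)

lemma lsum_map: "lsum M f (map g xs) = lsum M (%x. f (g x)) xs" by (induction xs) auto

lemma lsum_cong: "(!!x. x : set xs ==> f x = g x) ==> lsum M f xs = lsum M g xs" by (induction xs) auto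

lemma (in abelian_monoid) lsum_closed:
 "(!!x. x : set xs ==> f x : carrier G) ==> lsum G f xs : carrier G" by (induction xs) auto

lemma (in abelian_monoid) lsum_append:
 "[|!!x. x : set xs ==> f x : carrier G; !!x. x : set ys ==> f x : carrier G|] ==>
  lsum G f (xs @ ys) = lsum G f xs \<oplus> lsum G f ys" by (induction xs) (auto simp: lsum_closed a_assoc)

lemma (in abelian_monoid) lsum_add:
 "[|!!x. x : set xs ==> f x : carrier G; !!x. x : set xs ==> g x : carrier G|] ==>
  lsum G (%x. f x \<oplus> g x) xs = lsum G f xs \<oplus> lsum G g xs" by (induction xs) (auto simp: lsum_closed a_ac)

lemma (in abelian_monoid) lsum_zero:
 "(!!x. x : set xs ==> f x = \<zero>) ==> lsum G f xs = \<zero>" by (induction xs) auto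

lemma lsum_hom:
 assumes "left_module A M" "left_module A N" "h : mod_hom A M N"
  and "!!x. x : set xs ==> f x : carrier M"
 shows "h (lsum M f xs) = lsum N (%x. h (f x)) xs"
proof -
 interpret M: left_module A M by fact
 show ?thesis using assms(4)
 proof (induction xs)
  case Nil then show ?case by (simp add: mod_hom_zero[OF assms(1-3)])
 next
  case (Cons x xs)
  have "lsum M f xs : carrier M" using Cons.prems by (intro M.M.lsum_closed) auto
  then show ?case using Cons by (simp add: mod_hom_add[OF assms(3)])
 qed
qed

lemma lsum_in_submodule:
 assumes "submodule H A M" "!!x. x : set xs ==> f x : H"
 shows "lsum M f xs : H"
 using assms(2) by (induction xs) (simp_all add: submodule_zero[OF assms(1)] submodule_add[OF assms(1)])

lemma (in left_module) lsum_smult: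
 assumes "a : carrier A" "!!x. x : set xs ==> f x : carrier M"
 shows "a *[M] lsum M f xs = lsum M (%x. a *[M] f x) xs" using assms(2)
proof (induction xs)
 case (Cons x xs)
 then show ?case using assms(1) M.lsum_closed[of xs f] by (simp add: smult_r_distr)
qed (use assms(1) in simp)

lemma (in left_module) lsum_smult_left:
 assumes "m : carrier M" "!!x. x : set xs ==> f x : carrier A"
 shows "lsum A f xs *[M] m = lsum M (%x. f x *[M] m) xs" using assms(2)
proof (induction xs)
 case (Cons x xs)
 then show ?case using assms(1) A.lsum_closed[of xs f] by (simp add: smult_l_distr)
qed (use assms(1) in simp)

lemma mod_hom_lsum:
 assumes "left_module A N" "!!x. x : set xs ==> f x : mod_hom A M N"
 shows "(%m. lsum N (%x. f x m) xs) : mod_hom A M N" using assms(2)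
proof (induction xs)
 case Nil
 then show ?case using mod_hom_zero_map[OF assms(1)] by simp
next
 case (Cons x xs)
 then show ?case using mod_hom_plus[OF assms(1), of "f x" M "%m. lsum N (%x. f x m) xs"] by simp
qed

section \<open>Direct summands and finite sums of composites\<close>

text \<open>A module \<open>X\<close> lies in the additive closure of a class \<open>Ms\<close> precisely when its identity is a
 finite sum of composites \<open>X \<rightarrow> M \<rightarrow> X\<close> with \<open>M\<close> in "Ms".  Taking this as the working notion makes
 closure properties (transitivity, functoriality, duality) inductions on the number of composites.\<close>

inductive sum_factors ::
 "('a, 'x) ring_scheme => ('a, 'm, 'y) module_scheme set => ('a, 'u, 'z) module_scheme =>
  ('a, 'v, 'w) module_scheme => ('u => 'v) => bool" for A Ms X Y where
 zero: "(!!x. x : carrier X ==> h x = 0[Y]) ==> sum_factors A Ms X Y h"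
| step: "[|sum_factors A Ms X Y g; M : Ms; t : mod_hom A X M; s : mod_hom A M Y;
  !!x. x : carrier X ==> h x = s (t x) +[Y] g x|] ==> sum_factors A Ms X Y h"

definition add_of ::
 "('a, 'x) ring_scheme => ('a, 'm, 'y) module_scheme set => ('a, 'u, 'z) module_scheme => bool" where
 "add_of A Ms X \<longleftrightarrow> sum_factors A Ms X X (%x. x)"

lemma sum_factors_cong:
 assumes "sum_factors A Ms X Y h" "!!x. x : carrier X ==> h' x = h x"
 shows "sum_factors A Ms X Y h'" using assms(1)
proof (cases rule: sum_factors.cases)
 case zero
 show ?thesis by (rule sum_factors.zero) (simp only: assms(2) zero)
next
 case (step g M t s)
 show ?thesis by (rule sum_factors.step[of A Ms X Y g M t s, OF step(1-4)]) (simp only: assms(2) step(5))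
qed

lemma sum_factors_hom:
 assumes "left_module A X" "left_module A Y" "sum_factors A Ms X Y h"
 shows "h : mod_hom A X Y" using assms(3)
proof induction
 case (zero h)
 then show ?case by (intro mod_hom_cong[OF assms(1) mod_hom_zero_map[OF assms(2)]])
next
 case (step g M t s h)
 show ?case by (rule mod_hom_cong[OF assms(1) mod_hom_plus[OF assms(2) mod_hom_comp[OF step(3,4)] step.IH]])
   (rule step(5))
qed

lemma sum_factors_single:
 assumes "left_module A X" "left_module A Y" "M : Ms" "t : mod_hom A X M" "s : mod_hom A M Y"
 shows "sum_factors A Ms X Y (%x. s (t x))"
proof -
 interpret Y: left_module A Y by fact
 show ?thesis by (rule sum_factors.step[OF sum_factors.zero[of X "%_. 0[Y]" Y A Ms] assms(3-5)])
   (use mod_hom_closed[OF mod_hom_comp[OF assms(4,5)]] in auto)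
qed

lemma sum_factors_add:
 assumes X: "left_module A X" and Y: "left_module A Y"
  and h: "sum_factors A Ms X Y h" and k: "sum_factors A Ms X Y k"
 shows "sum_factors A Ms X Y (%x. h x +[Y] k x)" using h
proof induction
 interpret Y: left_module A Y by fact
 note kc = mod_hom_closed[OF sum_factors_hom[OF X Y k]]
 {
  case (zero h)
  then show ?case using kc by (intro sum_factors_cong[OF k]) simp
 next
  case (step g M t s h)
  note gc = mod_hom_closed[OF sum_factors_hom[OF X Y step(1)]]
  show ?case by (rule sum_factors.step[OF step.IH step(2-4)])
    (use step(5) kc gc mod_hom_closed[OF mod_hom_comp[OF step(3,4)]] in "auto simp: Y.M.a_assoc")
 }
qed

lemma sum_factors_pre:
 assumes "sum_factors A Ms X Y h" "u : mod_hom A W X"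
 shows "sum_factors A Ms W Y (%x. h (u x))" using assms(1)
proof induction
 case (zero h)
 then show ?case using mod_hom_closed[OF assms(2)] by (intro sum_factors.zero) simp
next
 case (step g M t s h)
 show ?case by (rule sum_factors.step[OF step.IH step(2) mod_hom_comp[OF assms(2) step(3)] step(4)])
   (use step(5) mod_hom_closed[OF assms(2)] in simp)
qed

lemma sum_factors_post:
 assumes "left_module A X" "left_module A Y" "left_module A Z"
  and "sum_factors A Ms X Y h" "v : mod_hom A Y Z"
 shows "sum_factors A Ms X Z (%x. v (h x))" using assms(4)
proof induction
 case (zero h)
 then show ?case using mod_hom_zero[OF assms(2,3,5)] by (intro sum_factors.zero) simp
next
 case (step g M t s h)
 note gc = mod_hom_closed[OF sum_factors_hom[OF assms(1,2) step(1)]]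
 show ?case by (rule sum_factors.step[OF step.IH step(2,3) mod_hom_comp[OF step(4) assms(5)]])
   (use step(5) gc mod_hom_closed[OF mod_hom_comp[OF step(3,4)]] mod_hom_add[OF assms(5)] in simp)
qed

lemma sum_factors_trans:
 assumes X: "left_module A X" and Y: "left_module A Y"
  and Ms: "!!M. M : Ms ==> left_module A M & add_of A Ns M"
  and h: "sum_factors A Ms X Y h"
 shows "sum_factors A Ns X Y h" using h
proof induction
 case (zero h)
 then show ?case by (rule sum_factors.zero)
next
 case (step g M t s h)
 have "sum_factors A Ns M M (%x. x)" "left_module A M" using Ms[OF step(2)] by (simp_all add: add_of_def)
 then have "sum_factors A Ns X Y (%x. s (t x))"
  by (intro sum_factors_post[OF X _ Y sum_factors_pre[of A Ns M M "%x. x" t X] step(4)] step(3))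
 from sum_factors_add[OF X Y this step.IH] show ?case by (rule sum_factors_cong) (rule step(5))
qed

lemma add_of_trans:
 assumes "left_module A X" "!!M. M : Ms ==> left_module A M & add_of A Ns M" "add_of A Ms X"
 shows "add_of A Ns X"
 unfolding add_of_def by (rule sum_factors_trans[OF assms(1,1,2) assms(3)[unfolded add_of_def]])

lemma add_of_retract:
 assumes "left_module A X" "left_module A Y" "f : mod_hom A X Y" "g : mod_hom A Y X"
  and "!!x. x : carrier X ==> g (f x) = x" "add_of A Ms Y"
 shows "add_of A Ms X"
proof -
 have "sum_factors A Ms X Y (%x. f x)" by (rule sum_factors_pre[OF assms(6)[unfolded add_of_def] assms(3)])
 note * = sum_factors_post[OF assms(1,2,1) this assms(4)]
 show ?thesis unfolding add_of_def by (rule sum_factors_cong[OF *]) (simp add: assms(5))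
qed

lemma add_of_self: "[|left_module A M; M : Ms|] ==> add_of A Ms M"
 unfolding add_of_def using sum_factors_single[of A M M M Ms "%x. x" "%x. x"] mod_hom_id[of A M] by simp

lemma add_of_iso:
 assumes "left_module A X" "left_module A Y" "mod_iso A X Y" "add_of A Ms Y"
 shows "add_of A Ms X"
proof (rule mod_iso_obtain[OF assms(1,3)])
 fix f g assume "f : mod_hom A X Y" "g : mod_hom A Y X" "!!x. x : carrier X ==> g (f x) = x"
 then show ?thesis by (rule add_of_retract[OF assms(1,2) _ _ _ assms(4)])
qed

lemma add_of_mono:
 assumes "left_module A X" "!!M. M : Ms ==> left_module A M" "Ms <= Ns" "add_of A Ms X"
 shows "add_of A Ns X"
proof (rule add_of_trans[OF assms(1) _ assms(4)])
 fix M assume "M : Ms"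
 then show "left_module A M & add_of A Ns M" using assms(2)[of M] assms(3) add_of_self[of A M Ns] by blast
qed

lemma sum_factors_list:
 assumes "sum_factors A {M} X Y h"
 obtains L where "!!t s. (t, s) : set L ==> t : mod_hom A X M & s : mod_hom A M Y"
  "!!x. x : carrier X ==> h x = lsum Y (%(t, s). s (t x)) L"
proof -
 have "\<exists>L. (\<forall>(t, s) \<in> set L. t : mod_hom A X M & s : mod_hom A M Y) \<and>
  (\<forall>x \<in> carrier X. h x = lsum Y (%(t, s). s (t x)) L)" using assms
 proof induction
  case (zero h)
  then show ?case by (simp add: exI[of _ "[]"])
 next
  case (step g N t s h)
  then obtain L where "(\<forall>(t, s) \<in> set L. t : mod_hom A X M & s : mod_hom A M Y)"
   "(\<forall>x \<in> carrier X. g x = lsum Y (%(t, s). s (t x)) L)" by blast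
  then show ?case using step by (intro exI[of _ "(t, s) # L"]) auto
 qed
 then show ?thesis using that by blast
qed

lemma sum_factors_of_list:
 assumes "left_module A X" "left_module A Y"
  and "!!t s. (t, s) : set L ==> t : mod_hom A X M & s : mod_hom A M Y"
  and "!!x. x : carrier X ==> h x = lsum Y (%(t, s). s (t x)) L"
 shows "sum_factors A {M} X Y h" using assms(3,4)
proof (induction L arbitrary: h)
 case Nil
 then show ?case by (intro sum_factors.zero) simp
next
 case (Cons p L)
 obtain t s where p: "p = (t, s)" by force
 have "sum_factors A {M} X Y (%x. lsum Y (%(t, s). s (t x)) L)" using Cons.prems(1) by (intro Cons.IH) auto
 then show ?case by (rule sum_factors.step[of _ _ _ _ _ M t s]) (use Cons.prems p in auto)
qed

section \<open>The regular module and dual bases\<close>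

lemma regular_simps [simp]:
 "carrier (regular A) = carrier A" "0[regular A] = 0[A]"
 "x +[regular A] y = x +[A] y" "a *[regular A] x = a **[A] x"
 "x **[regular A] y = x **[A] y" "1[regular A] = 1[A]" by (simp_all add: regular_def)

lemma mk_module_simps [simp]:
 "carrier (mk_module C z p s) = C" "0[mk_module C z p s] = z"
 "x +[mk_module C z p s] y = p x y" "a *[mk_module C z p s] x = s a x" by (simp_all add: mk_module_def)

lemma regular_left_module:
 assumes "ring A" shows "left_module A (regular A)"
proof -
 interpret ring A by fact
 show ?thesis by (rule left_moduleI[OF assms])
   (auto intro!: abelian_groupI simp: a_ac l_distr r_distr m_assoc intro: r_neg)
qed

lemma mod_hom_from_regular:
 assumes "left_module A M" "m : carrier M"
 shows "(%a. a *[M] m) : mod_hom A (regular A) M"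
proof -
 interpret M: left_module A M by fact
 show ?thesis using assms(2) by (intro mod_homI) (auto simp: M.smult_l_distr M.smult_assoc1)
qed

lemma mod_hom_regular_one:
 assumes "ring A" "s : mod_hom A (regular A) M" "a : carrier A"
 shows "s a = a *[M] s 1[A]"
proof -
 interpret ring A by fact
 show ?thesis using mod_hom_smult[OF assms(2), of a "1[A]"] assms(3) by simp
qed

text \<open>A map from the regular module is right multiplication by an element, so a factorisation through
 copies of it is a dual basis.\<close>

lemma dual_basis:
 assumes "left_module A X" "add_of A {regular A} X"
 obtains L where "!!x \<phi>. (x, \<phi>) : set L ==> x : carrier X & \<phi> : mod_hom A X (regular A)"
  "!!y. y : carrier X ==> y = lsum X (%(x, \<phi>). \<phi> y *[X] x) L"
proof -
 interpret X: left_module A X by fact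
 obtain L where L: "!!t s. (t, s) : set L ==> t : mod_hom A X (regular A) & s : mod_hom A (regular A) X"
  "!!x. x : carrier X ==> x = lsum X (%(t, s). s (t x)) L"
  by (rule sum_factors_list[OF assms(2)[unfolded add_of_def]]) (rule that)
 show ?thesis
 proof (rule that[of "map (%(t, s). (s 1[A], t)) L"])
  fix x \<phi> assume "(x, \<phi>) : set (map (%(t, s). (s 1[A], t)) L)"
  then show "x : carrier X & \<phi> : mod_hom A X (regular A)"
   using L(1) mod_hom_closed[of _ A "regular A" X "1[A]"] by auto
 next
  fix y assume y: "y : carrier X"
  have "s (t y) = t y *[X] s 1[A]" if "(t, s) : set L" for t s
   using mod_hom_regular_one[OF X.A.ring_axioms, of s X "t y"] mod_hom_closed[of t A X "regular A" y]
    L(1)[OF that] y by simp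
  then have "lsum X (%(t, s). s (t y)) L = lsum X (%(t, s). t y *[X] s 1[A]) L" by (intro lsum_cong) auto
  then show "y = lsum X (%(x, \<phi>). \<phi> y *[X] x) (map (%(t, s). (s 1[A], t)) L)"
   using L(2)[OF y] by (simp add: lsum_map case_prod_unfold)
 qed
qed

lemma add_of_regularI:
 assumes "left_module A X"
  and "!!x \<phi>. (x, \<phi>) : set L ==> x : carrier X & \<phi> : mod_hom A X (regular A)"
  and "!!y. y : carrier X ==> y = lsum X (%(x, \<phi>). \<phi> y *[X] x) L"
 shows "add_of A {regular A} X" unfolding add_of_def
proof (rule sum_factors_of_list[OF assms(1,1), of "map (%(x, \<phi>). (\<phi>, %a. a *[X] x)) L"])
 fix t s assume "(t, s) : set (map (%(x, \<phi>). (\<phi>, %a. a *[X] x)) L)"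
 then show "t : mod_hom A X (regular A) & s : mod_hom A (regular A) X"
  using assms(2) mod_hom_from_regular[OF assms(1)] by auto
qed (use assms(3) in "simp add: lsum_map case_prod_unfold")

text \<open>Lift the images of a dual basis.\<close>

lemma projective_lifting:
 assumes P: "left_module A P" "add_of A {regular A} P" and M: "left_module A M" and N: "left_module A N"
  and p: "p : mod_hom A M N" "p ` carrier M = carrier N" and h: "h : mod_hom A P N"
 obtains g where "g : mod_hom A P M" "!!x. x : carrier P ==> p (g x) = h x"
proof -
 interpret N: left_module A N by fact
 have "\<exists>g \<in> mod_hom A P M. \<forall>x \<in> carrier P. p (g x) = h (u x)" if "sum_factors A {regular A} P P u" for u using that
 proof induction
  case (zero u)
  have "\<forall>x\<in>carrier P. p 0[M] = h (u x)" using zero mod_hom_zero[OF M N p(1)] mod_hom_zero[OF P(1) N h] by simp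
  then show ?case by (rule bexI[OF _ mod_hom_zero_map[OF M]])
 next
  case (step v Q t s u)
  then obtain g where g: "g : mod_hom A P M" "\<forall>x \<in> carrier P. p (g x) = h (v x)" by blast
  have s: "s : mod_hom A (regular A) P" and t: "t : mod_hom A P (regular A)" using step by auto
  note tc = mod_hom_closed[OF t, simplified]
  have s1: "s 1[A] : carrier P" using mod_hom_closed[OF s] by simp
  then obtain m where m: "m : carrier M" "p m = h (s 1[A])" using p(2) mod_hom_closed[OF h] by (metis imageE)
  let ?g = "%x. t x *[M] m +[M] g x"
  have tm: "(%x. t x *[M] m) : mod_hom A P M" using mod_hom_comp[OF t mod_hom_from_regular[OF M m(1)]] .
  have "?g : mod_hom A P M" using mod_hom_plus[OF M tm g(1)] .
  moreover have "p (?g x) = h (u x)" if x: "x : carrier P" for x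
  proof -
   have "p (?g x) = t x *[N] h (s 1[A]) +[N] h (v x)"
    using mod_hom_add[OF p(1) mod_hom_closed[OF tm x] mod_hom_closed[OF g(1) x]]
     mod_hom_smult[OF p(1) tc[OF x] m(1)] g(2) m(2) x by simp
   also have "\<dots> = h (s (t x)) +[N] h (v x)"
    using mod_hom_regular_one[OF left_module_ring[OF P(1)] s tc[OF x]] mod_hom_smult[OF h tc[OF x] s1] by simp
   also have "\<dots> = h (u x)" using step(5)[OF x] mod_hom_add[OF h] mod_hom_closed[OF s, simplified, OF tc[OF x]]
     mod_hom_closed[OF sum_factors_hom[OF P(1,1) step(1)] x] by simp
   finally show ?thesis .
  qed
  ultimately show ?case by (intro bexI[of _ ?g] ballI)
 qed
 from this[OF P(2)[unfolded add_of_def]] obtain g where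
  "g : mod_hom A P M" "\<forall>x\<in>carrier P. p (g x) = h x" by (elim bexE)
 then show ?thesis by (intro that[of g]) simp_all
qed

section \<open>Direct sums and direct summands\<close>

lemma (in abelian_group) add_sub_cancel:
 assumes "x : carrier G" "y : carrier G"
 shows "(x \<oplus> y) \<oplus> \<ominus> x = y" "x \<oplus> (y \<oplus> \<ominus> x) = y"
proof -
 have "(x \<oplus> y) \<oplus> \<ominus> x = (y \<oplus> x) \<oplus> \<ominus> x" using assms by (simp only: a_comm)
 also have "\<dots> = y" using assms by (simp add: a_assoc r_neg)
 finally show *: "(x \<oplus> y) \<oplus> \<ominus> x = y" .
 have "x \<oplus> (y \<oplus> \<ominus> x) = (x \<oplus> y) \<oplus> \<ominus> x" using assms by (simp add: a_assoc)
 then show "x \<oplus> (y \<oplus> \<ominus> x) = y" using * by simp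
qed

lemma direct_sum_simps:
 "carrier (direct_sum I M) = {f : (\<Pi>\<^sub>E i\<in>I. carrier (M i)). finite {i : I. f i \<noteq> 0[M i]}}"
 "0[direct_sum I M] = (\<lambda>i\<in>I. 0[M i])"
 "f +[direct_sum I M] g = (\<lambda>i\<in>I. f i +[M i] g i)"
 "a *[direct_sum I M] f = (\<lambda>i\<in>I. a *[M i] f i)" by (simp_all add: direct_sum_def)

lemma direct_sum_memD:
 assumes "f : carrier (direct_sum I M)"
 shows "i : I ==> f i : carrier (M i)" "f : extensional I" "finite {i : I. f i \<noteq> 0[M i]}"
 using assms by (auto simp: direct_sum_simps PiE_def)

lemma direct_sum_memI:
 assumes "!!i. i : I ==> f i : carrier (M i)" "finite S" "!!i. [|i : I; i \<notin> S|] ==> f i = 0[M i]"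
 shows "(\<lambda>i\<in>I. f i) : carrier (direct_sum I M)"
proof -
 have "{i : I. restrict f I i \<noteq> 0[M i]} <= S" using assms(3) by auto
 then show ?thesis using assms(1) finite_subset[OF _ assms(2)] by (simp add: direct_sum_simps)
qed

lemma direct_sum_eqI:
 assumes "f : extensional I" "g : extensional I" "!!i. i : I ==> f i = g i"
 shows "f = g" using assms by (rule extensionalityI)

lemma direct_sum_left_module:
 assumes A: "ring A" and M: "!!i. i : I ==> left_module A (M i)"
 shows "left_module A (direct_sum I M)"
proof -
 interpret A: ring A by fact
 let ?D = "direct_sum I M"
 have grp: "abelian_group (M i)" if "i : I" for i using left_module_group[OF M[OF that]] .
 have mon: "abelian_monoid (M i)" if "i : I" for i using grp[OF that] by (simp add: abelian_group_def)
 note cl = abelian_monoid.a_closed[OF mon] and z = abelian_monoid.zero_closed[OF mon]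
 have addc: "f +[?D] g : carrier ?D" if "f : carrier ?D" "g : carrier ?D" for f g unfolding direct_sum_simps(3)
  by (rule direct_sum_memI[where S="{i : I. f i \<noteq> 0[M i]} \<union> {i : I. g i \<noteq> 0[M i]}"])
   (use direct_sum_memD[OF that(1)] direct_sum_memD[OF that(2)] cl
    abelian_monoid.l_zero[OF mon] z in "auto")
 have zc: "0[?D] : carrier ?D" unfolding direct_sum_simps(2) by (rule direct_sum_memI[where S="{}"]) (use z in auto)
 have sc: "a *[?D] f : carrier ?D" if "a : carrier A" "f : carrier ?D" for a f unfolding direct_sum_simps(4)
  by (rule direct_sum_memI[where S="{i : I. f i \<noteq> 0[M i]}"])
   (use direct_sum_memD[OF that(2)] that(1) left_module.smult_closed[OF M]
     left_module.smult_r_null[OF M] in auto)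
 show ?thesis
 proof (rule left_moduleI[OF A])
  show "abelian_group ?D"
  proof (rule abelian_groupI)
   fix f g h assume f: "f : carrier ?D" and g: "g : carrier ?D" and h: "h : carrier ?D"
   note fm = direct_sum_memD(1)[OF f] and gm = direct_sum_memD(1)[OF g] and hm = direct_sum_memD(1)[OF h]
   show "f +[?D] g +[?D] h = f +[?D] (g +[?D] h)" unfolding direct_sum_simps
    by (rule restrict_ext) (simp add: abelian_monoid.a_assoc[OF mon] fm gm hm)
   show "f +[?D] g = g +[?D] f" unfolding direct_sum_simps
    by (rule restrict_ext) (simp add: abelian_monoid.a_comm[OF mon] fm gm)
  next
   fix f assume f: "f : carrier ?D"
   note fm = direct_sum_memD[OF f]
   show "0[?D] +[?D] f = f" unfolding direct_sum_simps
    by (rule direct_sum_eqI[OF _ fm(2)]) (simp_all add: abelian_monoid.l_zero[OF mon] fm(1))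
   have "(\<lambda>i\<in>I. -[M i] f i) : carrier ?D" by (rule direct_sum_memI[OF _ fm(3)])
     (auto simp: fm(1) abelian_group.a_inv_closed[OF grp] abelian_group.neg_zero[OF grp])
   moreover have "(\<lambda>i\<in>I. -[M i] f i) +[?D] f = 0[?D]" unfolding direct_sum_simps
    by (rule restrict_ext) (simp add: fm(1) abelian_group.l_neg[OF grp])
   ultimately show "\<exists>g\<in>carrier ?D. g +[?D] f = 0[?D]" by (intro bexI[of _ "\<lambda>i\<in>I. -[M i] f i"])
  qed (fact addc zc)+
  fix a b f g assume a: "a : carrier A" and b: "b : carrier A"
   and f: "f : carrier ?D" and g: "g : carrier ?D"
  note fm = direct_sum_memD(1)[OF f] and gm = direct_sum_memD(1)[OF g]
  show "(a +[A] b) *[?D] f = a *[?D] f +[?D] b *[?D] f" unfolding direct_sum_simps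
   by (rule restrict_ext) (simp add: fm a b left_module.smult_l_distr[OF M])
  show "a *[?D] (f +[?D] g) = a *[?D] f +[?D] a *[?D] g" unfolding direct_sum_simps
   by (rule restrict_ext) (simp add: fm gm a left_module.smult_r_distr[OF M])
  show "(a **[A] b) *[?D] f = a *[?D] (b *[?D] f)" unfolding direct_sum_simps
   by (rule restrict_ext) (simp add: fm a b left_module.smult_assoc1[OF M])
 next
  fix f assume f: "f : carrier ?D"
  note fm = direct_sum_memD[OF f]
  show "1[A] *[?D] f = f" unfolding direct_sum_simps
   by (rule direct_sum_eqI[OF _ fm(2)]) (simp_all add: fm(1) left_module.smult_one[OF M])
 qed (fact sc)
qed

definition ds_inj :: "'i set => ('i => ('a, 'm, 'y) module_scheme) => 'i => 'm => 'i => 'm" where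
 "ds_inj I M i x = (\<lambda>j\<in>I. if j = i then x else 0[M j])"

context
 fixes A :: "('a, 'x) ring_scheme" and I :: "'i set" and M :: "'i => ('a, 'm, 'y) module_scheme"
 assumes A: "ring A" and M: "!!i. i : I ==> left_module A (M i)"
begin

lemma ds_inj_hom: "i : I ==> ds_inj I M i : mod_hom A (M i) (direct_sum I M)"
proof -
 assume i: "i : I"
 note mon = abelian_group.axioms(1)[OF left_module_group[OF M]]
 note z = abelian_monoid.zero_closed[OF mon] abelian_monoid.l_zero[OF mon]
 show ?thesis
 proof (rule mod_homI)
  fix x assume x: "x : carrier (M i)"
  show "ds_inj I M i x : carrier (direct_sum I M)"
   unfolding ds_inj_def by (rule direct_sum_memI[where S="{i}"]) (use x z in auto)
  fix a assume a: "a : carrier A"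
  show "ds_inj I M i (a *[M i] x) = a *[direct_sum I M] ds_inj I M i x" unfolding ds_inj_def direct_sum_simps
   by (rule restrict_ext) (simp add: a left_module.smult_r_null[OF M])
 next
  fix x y assume "x : carrier (M i)" "y : carrier (M i)"
  then show "ds_inj I M i (x +[M i] y) = ds_inj I M i x +[direct_sum I M] ds_inj I M i y"
   unfolding ds_inj_def direct_sum_simps by (intro restrict_ext) (simp add: z)
 qed
qed

lemma ds_proj_hom: "i : I ==> (%f. f i) : mod_hom A (direct_sum I M) (M i)"
 by (rule mod_homI) (simp_all add: direct_sum_memD(1), simp_all add: direct_sum_simps)

lemma ds_proj_inj: "i : I ==> ds_inj I M i x i = x" by (simp add: ds_inj_def)

lemma ds_truncate:
 assumes "finite J" "J <= I"
 shows "sum_factors A (M ` I) (direct_sum I M) (direct_sum I M)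
  (%f. \<lambda>i\<in>I. if i : J then f i else 0[M i])" using assms
proof (induction J)
 case empty
 show ?case by (rule sum_factors.zero, unfold direct_sum_simps(2), rule restrict_ext) simp
next
 case (insert j J)
 have j: "j : I" "j \<notin> J" "J <= I" using insert.prems insert.hyps by simp_all
 note IH = insert.IH[OF j(3)]
 note mon = abelian_group.axioms(1)[OF left_module_group[OF M]]
 show ?case
 proof (rule sum_factors.step[OF IH imageI[OF j(1)] ds_proj_hom[OF j(1)] ds_inj_hom[OF j(1)]])
  fix f assume f: "f : carrier (direct_sum I M)"
  show "(\<lambda>i\<in>I. if i : insert j J then f i else 0[M i]) = ds_inj I M j (f j) +[direct_sum I M]
   (\<lambda>i\<in>I. if i : J then f i else 0[M i])" unfolding ds_inj_def direct_sum_simps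
  proof (rule restrict_ext)
   fix i assume i: "i : I"
   show "(if i : insert j J then f i else 0[M i]) =
    restrict (%ja. if ja = j then f j else 0[M ja]) I i +[M i]
    restrict (%i. if i : J then f i else 0[M i]) I i"
    using i j direct_sum_memD(1)[OF f i] abelian_monoid.l_zero[OF mon[OF i]]
     abelian_monoid.r_zero[OF mon[OF i]] abelian_monoid.zero_closed[OF mon[OF i]] by (cases "i = j") simp_all
  qed
 qed
qed

lemma add_of_direct_sum: "finite I ==> add_of A (M ` I) (direct_sum I M)" unfolding add_of_def
proof (rule sum_factors_cong[OF ds_truncate[of I]])
 fix f assume f: "f : carrier (direct_sum I M)"
 show "f = (\<lambda>i\<in>I. if i : I then f i else 0[M i])" by (rule direct_sum_eqI[OF direct_sum_memD(2)[OF f]]) simp_all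
qed simp_all

lemma add_of_component: "i : I ==> add_of A {direct_sum I M} (M i)"
 by (rule add_of_retract[OF M direct_sum_left_module[OF A M] ds_inj_hom ds_proj_hom])
  (simp_all add: ds_proj_inj add_of_self direct_sum_left_module[OF A M])

lemma add_of_direct_sum_iff:
 assumes "finite I" "left_module A X"
 shows "add_of A {direct_sum I M} X \<longleftrightarrow> add_of A (M ` I) X"
proof
 assume "add_of A {direct_sum I M} X"
 then show "add_of A (M ` I) X" by (rule add_of_trans[OF assms(2), rotated])
   (simp add: direct_sum_left_module[OF A M] add_of_direct_sum[OF assms(1)])
next
 assume "add_of A (M ` I) X"
 then show "add_of A {direct_sum I M} X"
  by (rule add_of_trans[OF assms(2), rotated]) (use M add_of_component in auto)
qed

end

lemma direct_summand_iff:
 assumes M: "left_module A M" and N: "left_module A N"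
 shows "direct_summand A M N \<longleftrightarrow>
  (\<exists>f\<in>mod_hom A M N. \<exists>g\<in>mod_hom A N M. \<forall>x\<in>carrier M. g (f x) = x)"
proof
 interpret N: left_module A N by fact
 assume "direct_summand A M N"
 then obtain X Y where X: "submodule X A N" and Y: "submodule Y A N" and XY: "X \<inter> Y = {0[N]}"
  "X <+>\<^bsub>N\<^esub> Y = carrier N" and iso: "mod_iso A M (N(|carrier := X|))" unfolding direct_summand_def by blast
 let ?X = "N(|carrier := X|)" and ?Q = "quotient_module N Y"
 note Xs = submodule_subset[OF X] and Ys = submodule_subset[OF Y]
 have XM: "left_module A ?X" by (rule submodule_module[OF N X])
 have q: "(%x. Y +>\<^bsub>N\<^esub> x) : mod_hom A ?X ?Q" by (rule mod_hom_from_submodule[OF quotient_proj[OF N Y] Xs])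
 have bij: "bij_betw (%x. Y +>\<^bsub>N\<^esub> x) (carrier ?X) (carrier ?Q)"
 proof (rule bij_betw_imageI)
  show "inj_on (%x. Y +>\<^bsub>N\<^esub> x) (carrier ?X)"
  proof (rule inj_onI)
   fix x y assume xy: "x : carrier ?X" "y : carrier ?X" "Y +>\<^bsub>N\<^esub> x = Y +>\<^bsub>N\<^esub> y"
   then have c: "x : X" "y : X" "x : carrier N" "y : carrier N" using Xs by auto
   have "x +[N] -[N] y : Y" using quotient_eq_iff[OF N Y c(3,4)] xy(3) by (simp add: a_minus_def)
   moreover have "x +[N] -[N] y : X" by (rule submodule_add[OF X c(1) submodule_minus[OF N X c(2)]])
   ultimately have "x +[N] -[N] y = 0[N]" using XY(1) by blast
   then show "x = y" using N.M.diff_zero_iff[OF c(3,4)] by simp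
  qed
  show "(%x. Y +>\<^bsub>N\<^esub> x) ` carrier ?X = carrier ?Q"
  proof
   show "(%x. Y +>\<^bsub>N\<^esub> x) ` carrier ?X <= carrier ?Q" using Xs unfolding quotient_carrier[OF N Y] by auto
   show "carrier ?Q <= (%x. Y +>\<^bsub>N\<^esub> x) ` carrier ?X"
   proof
    fix z assume "z : carrier ?Q"
    then obtain n where n: "n : carrier N" "z = Y +>\<^bsub>N\<^esub> n" unfolding quotient_carrier[OF N Y] by auto
    then obtain x y where xy: "x : X" "y : Y" "n = x +[N] y" using XY(2) unfolding set_add_def' by blast
    then have c: "x : carrier N" "y : carrier N" using Xs Ys by auto
    have "n +[N] -[N] x = y" using c xy(3) N.M.add_sub_cancel(1) by simp
    then have "z = Y +>\<^bsub>N\<^esub> x" using quotient_eq_iff[OF N Y n(1) c(1)] xy(2) n(2) by (simp add: a_minus_def)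
    then show "z : (%x. Y +>\<^bsub>N\<^esub> x) ` carrier ?X" using xy(1) by simp
   qed
  qed
 qed
 let ?k = "inv_into (carrier ?X) (%x. Y +>\<^bsub>N\<^esub> x)"
 have k: "?k : mod_hom A ?Q ?X" by (rule mod_hom_inverse[OF XM q bij])
 have kq: "?k (Y +>\<^bsub>N\<^esub> x) = x" if "x : X" for x using bij that by (intro inv_into_f_f) (auto simp: bij_betw_def)
 show "\<exists>f\<in>mod_hom A M N. \<exists>g\<in>mod_hom A N M. \<forall>x\<in>carrier M. g (f x) = x"
 proof (rule mod_iso_obtain[OF M iso])
  fix f g assume f: "f : mod_hom A M ?X" and g: "g : mod_hom A ?X M"
   and gf: "!!x. x : carrier M ==> g (f x) = x"
  have "f : mod_hom A M N" by (rule mod_hom_out_of_submodule[OF f Xs])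
  moreover have "(%n. g (?k (Y +>\<^bsub>N\<^esub> n))) : mod_hom A N M"
   by (rule mod_hom_comp[OF mod_hom_comp[OF quotient_proj[OF N Y] k] g])
  moreover have "\<forall>x\<in>carrier M. g (?k (Y +>\<^bsub>N\<^esub> (f x))) = x" using mod_hom_closed[OF f] kq gf by simp
  ultimately show ?thesis by (intro bexI)
 qed
next
 interpret M: left_module A M by fact
 interpret N: left_module A N by fact
 assume "\<exists>f\<in>mod_hom A M N. \<exists>g\<in>mod_hom A N M. \<forall>x\<in>carrier M. g (f x) = x"
 then obtain f g where f: "f : mod_hom A M N" and g: "g : mod_hom A N M"
  and gf: "!!x. x : carrier M ==> g (f x) = x" by blast
 let ?X = "f ` carrier M" and ?Y = "a_kernel N M g"
 note fc = mod_hom_closed[OF f] and gc = mod_hom_closed[OF g]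
 have X: "submodule ?X A N" by (rule image_submodule[OF M N f carrier_submodule[OF M]])
 have Y: "submodule ?Y A N" by (rule kernel_submodule[OF N M g])
 have "?X \<inter> ?Y = {0[N]}"
 proof
  show "?X \<inter> ?Y <= {0[N]}" using gf mod_hom_zero[OF M N f] unfolding a_kernel_eq by auto
  show "{0[N]} <= ?X \<inter> ?Y" using submodule_zero[OF X] submodule_zero[OF Y] by simp
 qed
 moreover have "?X <+>\<^bsub>N\<^esub> ?Y = carrier N"
 proof
  show "?X <+>\<^bsub>N\<^esub> ?Y <= carrier N" using fc unfolding set_add_def' a_kernel_eq by auto
  show "carrier N <= ?X <+>\<^bsub>N\<^esub> ?Y"
  proof
   fix n assume n: "n : carrier N"
   let ?x = "f (g n)"
   have x: "?x : carrier N" "?x : ?X" using fc gc n by auto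
   have "g (n +[N] -[N] ?x) = 0[M]"
    using n x gf gc mod_hom_add[OF g] mod_hom_minus[OF N M g] by (simp add: M.M.r_neg)
   then have "n +[N] -[N] ?x : ?Y" using n x by (simp add: a_kernel_eq)
   moreover have "n = ?x +[N] (n +[N] -[N] ?x)" using n x(1) N.M.add_sub_cancel(2) by simp
   ultimately show "n : ?X <+>\<^bsub>N\<^esub> ?Y" unfolding set_add_def' using x(2) by blast
  qed
 qed
 moreover have "mod_iso A M (N(|carrier := ?X|))"
  by (rule mod_isoI[OF mod_hom_into_submodule[OF f] mod_hom_from_submodule[OF g]])
   (use fc gf in auto)
 ultimately show "direct_summand A M N" unfolding direct_summand_def using X Y by blast
qed

text \<open>The maps into and out of \<open>M\<^sup>n\<close> assembled from a list of composites.\<close>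

lemma in_add_iff:
 assumes M: "left_module A M"
 shows "in_add A M N \<longleftrightarrow> left_module A N & add_of A {M} N"
proof -
 have A: "ring A" by (rule left_module_ring[OF M])
 have D: "left_module A (direct_sum {..<n} (%_. M))" for n :: nat by (rule direct_sum_left_module[OF A M])
 show ?thesis
 proof
  assume "in_add A M N"
  then obtain n :: nat where N: "left_module A N" and ds: "direct_summand A N (direct_sum {..<n} (%_. M))"
   by (auto simp: in_add_def)
  obtain f g where f: "f : mod_hom A N (direct_sum {..<n} (%_. M))"
   "g : mod_hom A (direct_sum {..<n} (%_. M)) N" "\<forall>x\<in>carrier N. g (f x) = x"
   using ds unfolding direct_summand_iff[OF N D] by blast
  have "add_of A ((%_. M) ` {..<n}) (direct_sum {..<n} (%_. M))" by (rule add_of_direct_sum[OF A M]) simp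
  then have "add_of A {M} (direct_sum {..<n} (%_. M))" by (rule add_of_mono[OF D, rotated 2]) (use M in auto)
  then show "left_module A N & add_of A {M} N" using add_of_retract[OF N D f(1,2)] f(3) N by simp
 next
  assume *: "left_module A N & add_of A {M} N"
  then have N: "left_module A N" by simp
  obtain L where L: "!!t s. (t, s) : set L ==> t : mod_hom A N M & s : mod_hom A M N"
   "!!x. x : carrier N ==> x = lsum N (%(t, s). s (t x)) L"
   by (rule sum_factors_list[OF conjunct2[OF *, unfolded add_of_def]]) (rule that)
  let ?n = "length L"
  let ?D = "direct_sum {..<?n} (%_. M)"
  have L': "fst (L ! i) : mod_hom A N M" "snd (L ! i) : mod_hom A M N" if "i < ?n" for i
   using L(1)[of "fst (L ! i)" "snd (L ! i)"] that by simp_all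
  let ?f = "%y. \<lambda>i\<in>{..<?n}. fst (L ! i) y"
  let ?g = "%v. lsum N (%i. snd (L ! i) (v i)) [0..<?n]"
  have f: "?f : mod_hom A N ?D"
  proof (rule mod_homI)
   show "?f x : carrier ?D" if "x : carrier N" for x
    by (rule direct_sum_memI[where S="{..<?n}"]) (use mod_hom_closed[OF L'(1)] that in auto)
  qed (unfold direct_sum_simps, (rule restrict_ext, simp add: mod_hom_add[OF L'(1)] mod_hom_smult[OF L'(1)])+)
  have g: "?g : mod_hom A ?D N"
  proof (rule mod_hom_lsum[OF N])
   fix i assume "i : set [0..<?n]"
   then show "(%v. snd (L ! i) (v i)) : mod_hom A ?D N"
    using mod_hom_comp[OF ds_proj_hom[OF A M, of i "{..<?n}"] L'(2)[of i]] by simp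
  qed
  have "?g (?f y) = y" if y: "y : carrier N" for y
  proof -
   have "?g (?f y) = lsum N (%i. snd (L ! i) (fst (L ! i) y)) [0..<?n]" by (rule lsum_cong) simp
   also have "\<dots> = lsum N (%(t, s). s (t y)) (map ((!) L) [0..<?n])" by (simp add: lsum_map case_prod_unfold)
   also have "\<dots> = y" unfolding map_nth by (rule L(2)[OF y, symmetric])
   finally show ?thesis .
  qed
  then have "\<forall>y\<in>carrier N. ?g (?f y) = y" by (intro ballI)
  then have "direct_summand A N ?D" unfolding direct_summand_iff[OF N D] by (rule bexI[OF bexI[OF _ g] f])
  then show "in_add A M N" unfolding in_add_def using N by (intro conjI exI[of _ ?n])
 qed
qed

lemma in_add_direct_sum_iff:
 assumes "ring A" "finite I" "!!i. i : I ==> left_module A (M i)"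
 shows "in_add A (direct_sum I M) N \<longleftrightarrow> left_module A N & add_of A (M ` I) N"
proof -
 have D: "left_module A (direct_sum I M)" by (rule direct_sum_left_module[OF assms(1,3)])
 show ?thesis
 proof (cases "left_module A N")
  case True
  have "add_of A {direct_sum I M} N \<longleftrightarrow> add_of A (M ` I) N" by (rule add_of_direct_sum_iff) (fact assms True)+
  then show ?thesis unfolding in_add_iff[OF D] by simp
 next
  case False
  then show ?thesis unfolding in_add_iff[OF D] by simp
 qed
qed

section \<open>Finite generation and projectivity\<close>

inductive_set lspan :: "('a, 'x) ring_scheme => ('a, 'm, 'y) module_scheme => 'm set => 'm set"
 for A M S where
 zero: "0[M] : lspan A M S"
| step: "[|a : carrier A; s : S; y : lspan A M S|] ==> a *[M] s +[M] y : lspan A M S"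

lemma lspan_least:
 assumes "submodule H A M" "S <= H" shows "lspan A M S <= H"
proof
 fix x assume "x : lspan A M S"
 then show "x : H" by induction (use assms in "auto intro!: submodule_zero submodule_add submodule_smult")
qed

lemma lspan_submodule:
 assumes M: "left_module A M" and S: "S <= carrier M"
 shows "submodule (lspan A M S) A M"
proof -
 interpret M: left_module A M by fact
 have sub: "lspan A M S <= carrier M" by (rule lspan_least[OF carrier_submodule[OF M] S])
 show ?thesis
 proof (rule submodule_intro[OF M sub lspan.zero])
  fix x y assume x: "x : lspan A M S" and y: "y : lspan A M S"
  from x show "x +[M] y : lspan A M S"
  proof induction
   case zero
   then show ?case using y sub by auto
  next
   case (step a s z)
   have "a *[M] s +[M] z +[M] y = a *[M] s +[M] (z +[M] y)" using step y sub S by (intro M.M.a_assoc) auto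
   then show ?case using lspan.step[OF step(1,2) step.IH] by simp
  qed
 next
  fix b x assume b: "b : carrier A" and x: "x : lspan A M S"
  from x show "b *[M] x : lspan A M S"
  proof induction
   case zero
   then show ?case using b lspan.zero[of M A S] by simp
  next
   case (step a s z)
   have "b *[M] (a *[M] s +[M] z) = (b **[A] a) *[M] s +[M] b *[M] z"
    using step b sub S by (subst M.smult_r_distr) (auto simp: M.smult_assoc1)
   then show ?case using lspan.step[of "b **[A] a" A s S, OF _ step(2) step.IH] b step(1) by simp
  qed
 qed
qed

lemma lspan_base: "[|left_module A M; S <= carrier M; s : S|] ==> s : lspan A M S"
proof -
 assume M: "left_module A M" and S: "S <= carrier M" and s: "s : S"
 interpret M: left_module A M by fact
 show "s : lspan A M S" using lspan.step[OF M.A.one_closed s lspan.zero[of M A S]] S s by auto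
qed

lemma fin_gen_iff:
 assumes M: "left_module A M"
 shows "fin_gen A M \<longleftrightarrow> (\<exists>S. finite S & S <= carrier M & carrier M <= lspan A M S)"
proof -
 interpret M: left_module A M by fact
 show ?thesis
 proof
  assume "fin_gen A M"
  then obtain S where S: "finite S" "S <= carrier M"
   "carrier M = {(\<Oplus>\<^bsub>M\<^esub> s\<in>S. c s *[M] s) | c. c : S \<rightarrow> carrier A}" unfolding fin_gen_def by blast
  have "(\<Oplus>\<^bsub>M\<^esub> s\<in>T. c s *[M] s) : lspan A M S" if c: "c : S \<rightarrow> carrier A" and T: "T <= S" for c T
   using finite_subset[OF T S(1)] T
  proof induction
   case empty
   then show ?case using lspan.zero[of M A S] by simp
  next
   case (insert t T)
   have "(\<Oplus>\<^bsub>M\<^esub> s\<in>insert t T. c s *[M] s) = c t *[M] t +[M] (\<Oplus>\<^bsub>M\<^esub> s\<in>T. c s *[M] s)"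
    using insert c S(2) by (intro M.M.finsum_insert) (auto simp: Pi_iff subset_iff)
   then show ?case using insert c lspan.step[of "c t" A t S] by (simp add: Pi_iff)
  qed
  then have "carrier M <= lspan A M S" unfolding S(3) by blast
  then show "\<exists>S. finite S & S <= carrier M & carrier M <= lspan A M S" using S(1,2) by blast
 next
  assume "\<exists>S. finite S & S <= carrier M & carrier M <= lspan A M S"
  then obtain S where S: "finite S" "S <= carrier M" "carrier M <= lspan A M S" by blast
  have fin: "(\<Oplus>\<^bsub>M\<^esub> s\<in>T. c s *[M] s) : carrier M" if "c : S \<rightarrow> carrier A" "T <= S" for c T
   using that S(2) by (intro M.M.finsum_closed) (auto simp: Pi_iff subset_iff)
  have "\<exists>c\<in>S \<rightarrow> carrier A. x = (\<Oplus>\<^bsub>M\<^esub> s\<in>S. c s *[M] s)" if "x : lspan A M S" for x using that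
  proof induction
   case zero
   have "(\<Oplus>\<^bsub>M\<^esub> s\<in>S. 0[A] *[M] s) = 0[M]" using S(2) by (intro M.M.add.finprod_one_eqI) auto
   then show ?case by (intro bexI[of _ "%_. 0[A]"]) auto
  next
   case (step a t y)
   then obtain c where c: "c : S \<rightarrow> carrier A" "y = (\<Oplus>\<^bsub>M\<^esub> s\<in>S. c s *[M] s)" by blast
   let ?T = "S - {t}" and ?d = "c(t := a +[A] c t)"
   have SS: "S = insert t ?T" using step(2) by blast
   have tM: "t : carrier M" and ct: "c t : carrier A" using step(2) S(2) c(1) by auto
   have ins: "(\<Oplus>\<^bsub>M\<^esub> s\<in>S. e s *[M] s) = e t *[M] t +[M] (\<Oplus>\<^bsub>M\<^esub> s\<in>?T. e s *[M] s)"
    if e: "e : S \<rightarrow> carrier A" for e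
   proof -
    have "(\<Oplus>\<^bsub>M\<^esub> s\<in>insert t ?T. e s *[M] s) = e t *[M] t +[M] (\<Oplus>\<^bsub>M\<^esub> s\<in>?T. e s *[M] s)"
     using e S step(2) by (intro M.M.finsum_insert) (auto simp: Pi_iff subset_iff)
    then show ?thesis using SS by simp
   qed
   have d: "?d : S \<rightarrow> carrier A" using c(1) step(1) ct by auto
   have eq: "(\<Oplus>\<^bsub>M\<^esub> s\<in>?T. ?d s *[M] s) = (\<Oplus>\<^bsub>M\<^esub> s\<in>?T. c s *[M] s)"
    using c(1) S(2) by (intro M.M.finsum_cong') (auto simp: Pi_iff subset_iff)
   have "(\<Oplus>\<^bsub>M\<^esub> s\<in>S. ?d s *[M] s) = (a +[A] c t) *[M] t +[M] (\<Oplus>\<^bsub>M\<^esub> s\<in>?T. c s *[M] s)" using ins[OF d] eq by simp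
   also have "\<dots> = a *[M] t +[M] y" unfolding c(2) ins[OF c(1)]
    using step(1) ct tM fin[OF c(1), of ?T] by (simp add: M.smult_l_distr M.M.a_assoc)
   finally show ?case using d by (intro bexI[of _ ?d]) simp_all
  qed
  then have "carrier M = {(\<Oplus>\<^bsub>M\<^esub> s\<in>S. c s *[M] s) | c. c : S \<rightarrow> carrier A}" using S(3) fin[of _ S] by blast
  then show "fin_gen A M" unfolding fin_gen_def using S(1,2) by blast
 qed
qed

lemma (in abelian_monoid) lsum_single:
 assumes "distinct xs" "i : set xs" "f i : carrier G" "!!j. [|j : set xs; j \<noteq> i|] ==> f j = \<zero>"
 shows "lsum G f xs = f i" using assms
proof (induction xs)
 case (Cons j xs)
 show ?case
 proof (cases "j = i")
  case True
  then have "lsum G f xs = \<zero>" using Cons.prems by (intro lsum_zero) auto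
  then show ?thesis using True Cons.prems(3) by simp
 next
  case False
  then have "i : set xs" "f j = \<zero>" using Cons.prems by auto
  then show ?thesis using Cons by simp
 qed
qed simp

lemma presentation:
 assumes X: "left_module A X" and xs: "distinct xs" and e: "!!i. i : set xs ==> e i : carrier X"
  and span: "carrier X <= lspan A X (e ` set xs)"
 obtains g where "g : mod_hom A (direct_sum (set xs) (%_. regular A)) X"
  "g ` carrier (direct_sum (set xs) (%_. regular A)) = carrier X"
proof -
 interpret X: left_module A X by fact
 let ?D = "direct_sum (set xs) (%_. regular A)"
 note reg = regular_left_module[OF X.A.ring_axioms]
 have D: "left_module A ?D" by (rule direct_sum_left_module[OF X.A.ring_axioms reg])
 let ?g = "%v. lsum X (%i. v i *[X] e i) xs"
 have g: "?g : mod_hom A ?D X"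
 proof (rule mod_hom_lsum[OF X])
  fix i assume i: "i : set xs"
  show "(%v. v i *[X] e i) : mod_hom A ?D X"
   by (rule mod_hom_comp[OF ds_proj_hom[OF X.A.ring_axioms reg i] mod_hom_from_regular[OF X e[OF i]]])
 qed
 have im: "submodule (?g ` carrier ?D) A X" by (rule image_submodule[OF D X g carrier_submodule[OF D]])
 have "e i : ?g ` carrier ?D" if i: "i : set xs" for i
 proof -
  let ?v = "ds_inj (set xs) (%_. regular A) i 1[A]"
  have v: "?v : carrier ?D" using mod_hom_closed[OF ds_inj_hom[OF X.A.ring_axioms reg i], of "1[A]"] by simp
  have "?g ?v = ?v i *[X] e i" by (rule X.M.lsum_single[OF xs i]) (simp_all add: ds_inj_def e i)
  then have "e i = ?g ?v" by (simp add: ds_inj_def e i)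
  then show ?thesis using v by (rule image_eqI)
 qed
 then have "lspan A X (e ` set xs) <= ?g ` carrier ?D" by (intro lspan_least[OF im] image_subsetI)
 then have "?g ` carrier ?D = carrier X" using span submodule_subset[OF im] by (intro antisym) simp_all
 then show ?thesis by (rule that[OF g])
qed

lemma fin_gen_of_add:
 assumes X: "left_module A X" and a: "add_of A {regular A} X"
 obtains S where "finite S" "S <= carrier X" "carrier X <= lspan A X S"
proof -
 interpret X: left_module A X by fact
 obtain L where L: "!!x \<phi>. (x, \<phi>) : set L ==> x : carrier X & \<phi> : mod_hom A X (regular A)"
  "!!y. y : carrier X ==> y = lsum X (%(x, \<phi>). \<phi> y *[X] x) L" by (rule dual_basis[OF X a]) (rule that)
 let ?S = "fst ` set L"
 have S: "?S <= carrier X"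
 proof (rule image_subsetI)
  fix p assume "p : set L"
  then show "fst p : carrier X" using L(1)[of "fst p" "snd p"] by simp
 qed
 have "y : lspan A X ?S" if y: "y : carrier X" for y
 proof -
  have "lsum X (%(x, \<phi>). \<phi> y *[X] x) L : lspan A X ?S"
  proof (rule lsum_in_submodule[OF lspan_submodule[OF X S]])
   fix p assume p: "p : set L"
   obtain x \<phi> where [simp]: "p = (x, \<phi>)" by (cases p)
   have "\<phi> y : carrier A" using mod_hom_closed[of \<phi> A X "regular A" y] L(1) p y by simp
   moreover have "x : lspan A X ?S" using p by (intro lspan_base[OF X S]) force
   ultimately show "(case p of (x, \<phi>) => \<phi> y *[X] x) : lspan A X ?S"
    by (simp add: submodule_smult[OF lspan_submodule[OF X S]])
  qed
  then show ?thesis using L(2)[OF y] by (rule ssubst[rotated])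
 qed
 then show ?thesis using S by (intro that[of ?S]) (simp_all add: subset_iff)
qed

text \<open>The definition allows infinite free modules.  A finite generating set has its image in finitely
 many coordinates, and truncating to these gives finitely many composites.\<close>

lemma fg_projective_iff:
 fixes X :: "('a, 'p, 'y) module_scheme"
 assumes A: "ring A"
 shows "fg_projective A X \<longleftrightarrow> left_module A X & add_of A {regular A} X"
proof
 note reg = regular_left_module[OF A]
 assume "fg_projective A X"
 then have X: "left_module A X" and fg: "fin_gen A X" and pr: "projective_module A X"
  by (auto simp: fg_projective_def fg_module_def)
 from pr obtain I :: "'p set" where I: "direct_summand A X (direct_sum I (%_. regular A))"
  unfolding projective_module_def by blast
 let ?D = "direct_sum I (%_. regular A)"
 have D: "left_module A ?D" by (rule direct_sum_left_module[OF A reg])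
 obtain f g where f: "f : mod_hom A X ?D" and g: "g : mod_hom A ?D X" and gf: "\<forall>x\<in>carrier X. g (f x) = x"
  using I unfolding direct_summand_iff[OF X D] by blast
 obtain S where S: "finite S" "S <= carrier X" "carrier X <= lspan A X S"
  using fg unfolding fin_gen_iff[OF X] by blast
 define J where "J = (\<Union>s\<in>S. {i : I. f s i \<noteq> 0[A]})"
 have J: "finite J" "J <= I" using S direct_sum_memD(3)[OF mod_hom_closed[OF f]] by (auto simp: J_def)
 let ?H = "{v : carrier ?D. \<forall>i\<in>I. i \<notin> J \<longrightarrow> v i = 0[A]}"
 interpret A: ring A by fact
 interpret D: left_module A ?D by fact
 have H: "submodule ?H A ?D"
 proof (rule submodule_intro[OF D])
  show "0[?D] : ?H" using D.M.zero_closed by (simp add: direct_sum_simps)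
  show "x +[?D] y : ?H" if "x : ?H" "y : ?H" for x y
   using that D.M.a_closed[of x y] unfolding direct_sum_simps(3) by simp
  show "a *[?D] x : ?H" if "a : carrier A" "x : ?H" for a x
   using that D.smult_closed[of a x] unfolding direct_sum_simps(4) by simp
 qed simp
 have "lspan A X S <= {x : carrier X. f x : ?H}"
 proof (rule lspan_least[OF preimage_submodule[OF X D f H]], rule subsetI)
  fix s assume s: "s : S"
  then have "f s : ?H" using mod_hom_closed[OF f] S(2) by (auto simp: J_def)
  then show "s : {x : carrier X. f x : ?H}" using s S(2) by auto
 qed
 then have fH: "f x : ?H" if "x : carrier X" for x using S(3) that by blast
 let ?tau = "%v. \<lambda>i\<in>I. if i : J then v i else 0[regular A]"
 have tau: "?tau v = v" if "v : ?H" for v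
  by (rule direct_sum_eqI[of _ I]) (use that direct_sum_memD(2)[of v I "%_. regular A"] in auto)
 have t: "sum_factors A ((%_. regular A) ` I) ?D ?D ?tau" by (rule ds_truncate[OF A reg J])
 have "sum_factors A {regular A} ?D ?D ?tau" by (rule sum_factors_trans[OF D D _ t]) (auto simp: reg add_of_self)
 from sum_factors_post[OF X D X sum_factors_pre[OF this f] g]
 have "sum_factors A {regular A} X X (%x. g (?tau (f x)))" .
 then have "add_of A {regular A} X" unfolding add_of_def by (rule sum_factors_cong) (simp only: tau fH gf)
 with X show "left_module A X & add_of A {regular A} X" ..
next
 note reg = regular_left_module[OF A]
 assume "left_module A X & add_of A {regular A} X"
 then have X: "left_module A X" and a: "add_of A {regular A} X" by auto
 obtain S where S: "finite S" "S <= carrier X" "carrier X <= lspan A X S"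
  by (rule fin_gen_of_add[OF X a]) (rule that)
 obtain xs where xs: "set xs = S" "distinct xs" using finite_distinct_list[OF S(1)] by blast
 let ?D = "direct_sum (set xs) (%_. regular A)"
 have D: "left_module A ?D" by (rule direct_sum_left_module[OF A reg])
 obtain g where g: "g : mod_hom A ?D X" "g ` carrier ?D = carrier X"
  by (rule presentation[OF X xs(2), of "%x. x"]) (use S xs in auto)
 obtain f where f: "f : mod_hom A X ?D" "!!x. x : carrier X ==> g (f x) = x"
  by (rule projective_lifting[OF X a D X g mod_hom_id]) (rule that)
 have "direct_summand A X ?D"
  unfolding direct_summand_iff[OF X D] by (intro bexI[OF bexI[OF _ g(1)] f(1)] ballI f(2))
 then have "projective_module A X" unfolding projective_module_def using X by (intro conjI exI)
 moreover have "fin_gen A X" unfolding fin_gen_iff[OF X] using S by (intro exI[of _ S]) simp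
 ultimately show "fg_projective A X" using X by (simp add: fg_projective_def fg_module_def)
qed

lemma fin_gen_image:
 assumes M: "left_module A M" and N: "left_module A N" and f: "f : mod_hom A M N" "f ` carrier M = carrier N"
  and "fin_gen A M"
 shows "fin_gen A N"
proof -
 obtain S where S: "finite S" "S <= carrier M" "carrier M <= lspan A M S"
  using assms(5) unfolding fin_gen_iff[OF M] by blast
 have fS: "f ` S <= carrier N" using S(2) f(2) by auto
 have "lspan A M S <= {x : carrier M. f x : lspan A N (f ` S)}"
  by (rule lspan_least[OF preimage_submodule[OF M N f(1) lspan_submodule[OF N fS]]], rule subsetI)
   (use S(2) lspan_base[OF N fS] in auto)
 then have "f ` carrier M <= lspan A N (f ` S)" using S(3) by blast
 then have "carrier N <= lspan A N (f ` S)" unfolding f(2) .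
 then show ?thesis unfolding fin_gen_iff[OF N] using fS S(1) by (intro exI[of _ "f ` S"]) simp
qed

lemma mod_iso_surj: "mod_iso A M N ==> \<exists>f\<in>mod_hom A M N. f ` carrier M = carrier N"
 by (auto simp: mod_iso_def bij_betw_def)

text \<open>A presentation by \<open>A\<^sup>n\<close> realises the module as a set of cosets in "nat => 'a".\<close>

lemma fgmod_copy:
 fixes A :: "('a, 'x) ring_scheme"
 assumes "fg_module A M"
 obtains M' :: "'a fgmod" where "fg_module A M'" "mod_iso A M' M"
proof -
 have M: "left_module A M" and fg: "fin_gen A M" using assms by (auto simp: fg_module_def)
 have A: "ring A" by (rule left_module_ring[OF M])
 obtain S where S: "finite S" "S <= carrier M" "carrier M <= lspan A M S"
  using fg unfolding fin_gen_iff[OF M] by blast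
 obtain ys where ys: "set ys = S" using finite_list[OF S(1)] by blast
 let ?xs = "[0..<length ys]"
 have im: "(!) ys ` set ?xs = S" unfolding ys[symmetric] set_upt by (auto simp: in_set_conv_nth)
 let ?D = "direct_sum (set ?xs) (%_. regular A) :: ('a, nat => 'a) module"
 have D: "left_module A ?D" by (rule direct_sum_left_module[OF A regular_left_module[OF A]])
 obtain g where g: "g : mod_hom A ?D M" "g ` carrier ?D = carrier M"
  by (rule presentation[OF M distinct_upt, of 0 "length ys" "(!) ys"])
   (use S im in "auto intro: that")
 let ?K = "a_kernel ?D M g"
 have K: "submodule ?K A ?D" by (rule kernel_submodule[OF D M g(1)])
 let ?Q = "quotient_module ?D ?K"
 have Q: "left_module A ?Q" by (rule quotient_left_module[OF D K])
 have iso: "mod_iso A ?Q M" by (rule quotient_iso[OF D M g K]) (simp add: a_kernel_eq)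
 obtain f where "f : mod_hom A M ?Q" "f ` carrier M = carrier ?Q"
  using mod_iso_surj[OF mod_iso_sym[OF Q iso]] by blast
 then have "fin_gen A ?Q" by (rule fin_gen_image[OF M Q _ _ fg])
 then show ?thesis using Q iso by (intro that[of ?Q]) (simp_all add: fg_module_def)
qed

section \<open>Restriction of scalars and lattices\<close>

text \<open>For an algebra over \<open>R\<close>, \<open>sc A M r x\<close> is the action of the scalar \<open>r\<close> on an \<open>A\<close>-module.\<close>

abbreviation sc :: "('r, 'a, 'y) module_scheme => ('a, 'm, 'z) module_scheme => 'r => 'm => 'm" where
 "sc A M r x \<equiv> (r *[A] 1[A]) *[M] x"

lemma restrict_scalars_simps [simp]:
 "carrier (restrict_scalars A M) = carrier M" "0[restrict_scalars A M] = 0[M]"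
 "x +[restrict_scalars A M] y = x +[M] y" "r *[restrict_scalars A M] x = sc A M r x"
 by (simp_all add: restrict_scalars_def)

context assoc_algebra
begin

lemma one_scalar_closed [simp]: "r : carrier R ==> r *[A] 1[A] : carrier A" by (rule smult_closed) simp_all

lemma scalar_mult_left: "[|r : carrier R; a : carrier A|] ==> (r *[A] 1[A]) **[A] a = r *[A] a"
 using smult_mult_left[of r "1[A]" a] by simp

lemma scalar_mult_right: "[|r : carrier R; a : carrier A|] ==> a **[A] (r *[A] 1[A]) = r *[A] a"
 using smult_mult_right[of r a "1[A]"] by simp

lemma ring_R: "ring R" and ring_A: "ring A" by (rule R.ring_axioms, rule ring_axioms)

lemma self_left_module: "left_module R A" by (rule left_moduleI[OF ring_R])
  (simp_all add: smult_l_distr smult_r_distr smult_assoc1 abelian_group_axioms)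

lemma sc_closed: "[|left_module A M; r : carrier R; x : carrier M|] ==> sc A M r x : carrier M"
 by (rule left_module.smult_closed[of A M]) (simp_all only: one_scalar_closed)

lemma sc_commute:
 assumes "left_module A M" "r : carrier R" "a : carrier A" "x : carrier M"
 shows "a *[M] sc A M r x = sc A M r (a *[M] x)" using left_module.smult_assoc1[OF assms(1), of a "r *[A] 1[A]" x]
  left_module.smult_assoc1[OF assms(1), of "r *[A] 1[A]" a x] assms(2-4)
 by (simp add: scalar_mult_left scalar_mult_right)

lemma restrict_left_module:
 assumes M: "left_module A M" shows "left_module R (restrict_scalars A M)"
proof -
 interpret M: left_module A M by fact
 have grp: "abelian_group (restrict_scalars A M)"
 proof (rule abelian_groupI)
  fix x assume "x : carrier (restrict_scalars A M)"
  then show "\<exists>y\<in>carrier (restrict_scalars A M). y +[restrict_scalars A M] x = 0[restrict_scalars A M]"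
   by (intro bexI[of _ "-[M] x"]) (simp_all add: M.M.l_neg)
 qed (simp_all add: M.M.a_ac)
 show ?thesis
 proof (rule left_moduleI[OF ring_R grp])
  fix a b x assume "a : carrier R" "b : carrier R" "x : carrier (restrict_scalars A M)"
  then show "(a +[R] b) *[restrict_scalars A M] x = a *[restrict_scalars A M] x
    +[restrict_scalars A M] b *[restrict_scalars A M] x"
   and "(a **[R] b) *[restrict_scalars A M] x = a *[restrict_scalars A M] (b *[restrict_scalars A M] x)"
   using M.smult_assoc1[of "a *[A] 1[A]" "b *[A] 1[A]" x]
   by (simp_all add: smult_l_distr M.smult_l_distr scalar_mult_left smult_assoc1)
 qed (simp_all add: M.smult_r_distr)
qed

lemma mod_hom_sc:
 "[|f : mod_hom A M N; r : carrier R; x : carrier M|] ==> f (sc A M r x) = sc A N r (f x)"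
 by (rule mod_hom_smult[of f A M N]) (simp_all only: one_scalar_closed)

lemma mod_hom_restrict_scalars:
 "f : mod_hom A M N ==> f : mod_hom R (restrict_scalars A M) (restrict_scalars A N)"
 by (rule mod_homI) (simp_all add: mod_hom_closed mod_hom_add mod_hom_sc)

lemma mod_hom_scalar:
 assumes "left_module A M" "r : carrier R"
 shows "(%x. sc A M r x) : mod_hom A M M"
proof -
 interpret M: left_module A M by fact
 show ?thesis using assms by (intro mod_homI) (simp_all add: M.smult_r_distr sc_commute)
qed

lemma submodule_restrict_scalars:
 assumes "left_module A M" "submodule H A M" shows "submodule H R (restrict_scalars A M)"
 by (rule submodule_intro[OF restrict_left_module[OF assms(1)]])
  (simp_all add: submodule_subset[OF assms(2)] submodule_zero[OF assms(2)] submodule_add[OF assms(2)]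
   submodule_smult[OF assms(2)])

end

text \<open>A lattice is an \<open>A\<close>-module that is finitely generated and projective over \<open>R\<close>.\<close>

definition lattice ::
 "('r, 'x) ring_scheme => ('r, 'a, 'y) module_scheme => ('a, 'm, 'z) module_scheme => bool" where
 "lattice R A M \<longleftrightarrow> left_module A M & add_of R {regular R} (restrict_scalars A M)"

lemma lattice_module: "lattice R A M ==> left_module A M" by (simp add: lattice_def)

context assoc_algebra
begin

lemma lattice_fg_projective:
 assumes "lattice R A M"
 shows "fg_module A M" "projective_module R (restrict_scalars A M)"
proof -
 have M: "left_module A M" and a: "add_of R {regular R} (restrict_scalars A M)"
  using assms by (auto simp: lattice_def)
 note MR = restrict_left_module[OF M]
 have fp: "fg_projective R (restrict_scalars A M)" using fg_projective_iff[OF ring_R, of "restrict_scalars A M"] MR a by simp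
 then show "projective_module R (restrict_scalars A M)" by (simp add: fg_projective_def)
 obtain S where S: "finite S" "S <= carrier (restrict_scalars A M)"
  "carrier (restrict_scalars A M) <= lspan R (restrict_scalars A M) S" by (rule fin_gen_of_add[OF MR a]) (rule that)
 have S': "S <= carrier M" using S(2) by simp
 have "lspan R (restrict_scalars A M) S <= lspan A M S"
  by (rule lspan_least[OF submodule_restrict_scalars[OF M lspan_submodule[OF M S']]], rule subsetI)
   (rule lspan_base[OF M S'])
 then have "fin_gen A M" unfolding fin_gen_iff[OF M] using S S' by (intro exI[of _ S]) simp
 then show "fg_module A M" using M by (simp add: fg_module_def)
qed

text \<open>Generators over \<open>A\<close> times generators of \<open>A\<close> over \<open>R\<close> generate over \<open>R\<close>.\<close>

lemma latticeI:
 assumes A: "fin_gen R A" and fg: "fg_module A M" and pr: "projective_module R (restrict_scalars A M)"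
 shows "lattice R A M"
proof -
 have M: "left_module A M" and fM: "fin_gen A M" using fg by (auto simp: fg_module_def)
 interpret M: left_module A M by fact
 let ?M = "restrict_scalars A M"
 note MR = restrict_left_module[OF M]
 obtain G where G: "finite G" "G <= carrier A" "carrier A <= lspan R A G"
  using A unfolding fin_gen_iff[OF self_left_module] by blast
 obtain S where S: "finite S" "S <= carrier M" "carrier M <= lspan A M S"
  using fM unfolding fin_gen_iff[OF M] by blast
 let ?T = "(%(g, s). g *[M] s) ` (G \<times> S)"
 have T: "?T <= carrier ?M" using G(2) S(2) by auto
 note H = lspan_submodule[OF MR T]
 have as: "a *[M] s : lspan R ?M ?T" if a: "a : carrier A" and s: "s : S" for a s
 proof -
  have sM: "s : carrier M" using s S(2) by auto
  have h: "(%a. a *[M] s) : mod_hom R A ?M"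
  proof (rule mod_homI)
   fix r a assume ra: "r : carrier R" "a : carrier A"
   show "(r *[A] a) *[M] s = r *[?M] (a *[M] s)"
    using M.smult_assoc1[of "r *[A] 1[A]" a s] ra sM by (simp add: scalar_mult_left)
  qed (use sM in "simp_all add: M.smult_l_distr")
  have "lspan R A G <= {a : carrier A. a *[M] s : lspan R ?M ?T}"
   by (rule lspan_least[OF preimage_submodule[OF self_left_module MR h H]], rule subsetI)
    (use G(2) s lspan_base[OF MR T] in force)
  then show ?thesis using G(3) a by blast
 qed
 have "x : lspan R ?M ?T" if "x : lspan A M S" for x using that
 proof induction
  case zero
  show ?case using submodule_zero[OF H] by simp
 next
  case (step a s y)
  show ?case using submodule_add[OF H as[OF step(1,2)] step.IH] by simp
 qed
 then have "carrier ?M <= lspan R ?M ?T" using S(3) by auto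
 then have "fin_gen R ?M" unfolding fin_gen_iff[OF MR] using T G(1) S(1) by (intro exI[of _ ?T]) simp
 then have "fg_projective R ?M" using pr MR by (simp add: fg_projective_def fg_module_def)
 then show ?thesis using fg_projective_iff[OF ring_R, of ?M] M by (simp add: lattice_def)
qed

lemma lattice_retract:
 assumes "left_module A X" "lattice R A Y" "f : mod_hom A X Y" "g : mod_hom A Y X"
  and "!!x. x : carrier X ==> g (f x) = x"
 shows "lattice R A X"
proof -
 note Y = lattice_module[OF assms(2)]
 have "add_of R {regular R} (restrict_scalars A X)"
  by (rule add_of_retract[OF restrict_left_module[OF assms(1)] restrict_left_module[OF Y]
     mod_hom_restrict_scalars[OF assms(3)] mod_hom_restrict_scalars[OF assms(4)]])
   (use assms(2,5) in "simp_all add: lattice_def")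
 then show ?thesis using assms(1) by (simp add: lattice_def)
qed

lemma lattice_iso:
 assumes "left_module A X" "lattice R A Y" "mod_iso A X Y" shows "lattice R A X"
 by (rule mod_iso_obtain[OF assms(1,3)], rule lattice_retract[OF assms(1,2)])

text \<open>A lattice stays one under finite sums of composites: if the identity of \<open>X\<close> factors through
 lattices, it factors over \<open>R\<close> through free modules.\<close>

lemma lattice_add_of:
 assumes X: "left_module A X" and Ms: "!!M. M : Ms ==> lattice R A M" and a: "add_of A Ms X"
 shows "lattice R A X"
proof -
 note XR = restrict_left_module[OF X]
 have "sum_factors R {regular R} (restrict_scalars A X) (restrict_scalars A X) h"
  if "sum_factors A Ms X X h" for h using that
 proof induction
  case (zero h)
  then show ?case by (intro sum_factors.zero) simp
 next
  case (step g M t s h)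
  have M: "left_module A M" and aM: "sum_factors R {regular R} (restrict_scalars A M) (restrict_scalars A M) (%x. x)"
   using Ms[OF step(2)] by (auto simp: lattice_def add_of_def)
  note MR = restrict_left_module[OF M]
  have "sum_factors R {regular R} (restrict_scalars A X) (restrict_scalars A X) (%x. s (t x))"
   by (rule sum_factors_post[OF XR MR XR sum_factors_pre[OF aM mod_hom_restrict_scalars[OF step(3)]]
      mod_hom_restrict_scalars[OF step(4)]])
  from sum_factors_add[OF XR XR this step.IH] show ?case by (rule sum_factors_cong) (simp add: step(5))
 qed
 then show ?thesis using a X by (simp add: lattice_def add_of_def)
qed

end

section \<open>Endomorphism algebras equal to the ground ring\<close>

definition scalar_end ::
 "('r, 'x) ring_scheme => ('r, 'a, 'y) module_scheme => ('a, 'm, 'z) module_scheme => bool" where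
 "scalar_end R A M \<longleftrightarrow>
   (\<forall>h\<in>mod_hom A M M. \<exists>r\<in>carrier R. \<forall>x\<in>carrier M. h x = sc A M r x) \<and>
   (\<forall>r\<in>carrier R. (\<forall>x\<in>carrier M. sc A M r x = 0[M]) \<longrightarrow> r = 0[R])"

context assoc_algebra
begin

lemma scalar_end_scalar:
 assumes "scalar_end R A M" "h : mod_hom A M M"
 obtains r where "r : carrier R" "!!x. x : carrier M ==> h x = sc A M r x"
 using assms unfolding scalar_end_def by blast

lemma scalar_end_unique:
 assumes M: "left_module A M" and se: "scalar_end R A M" and r: "r : carrier R" "s : carrier R"
  and eq: "!!x. x : carrier M ==> sc A M r x = sc A M s x"
 shows "r = s"
proof -
 interpret M: left_module A M by fact
 interpret MR: left_module R "restrict_scalars A M" by (rule restrict_left_module[OF M])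
 have "sc A M (r +[R] -[R] s) x = 0[M]" if x: "x : carrier M" for x
 proof -
  have "sc A M (r +[R] -[R] s) x = sc A M r x +[M] sc A M (-[R] s) x"
   using MR.smult_l_distr[of r "-[R] s" x] r x by simp
  also have "\<dots> = sc A M s x +[M] sc A M (-[R] s) x" by (simp only: eq[OF x])
  also have "\<dots> = sc A M (s +[R] -[R] s) x" using MR.smult_l_distr[of s "-[R] s" x] r x by simp
  also have "\<dots> = 0[M]" using MR.smult_l_null[of x] x r by (simp add: R.r_neg)
  finally show ?thesis .
 qed
 then have "r +[R] -[R] s = 0[R]" using se r unfolding scalar_end_def by simp
 then show ?thesis using R.diff_zero_iff[OF r] by simp
qed

text \<open>The isomorphism \<open>End\<^sub>A(M) \<rightarrow> R\<close> as a function on all homomorphisms.\<close>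

lemma scalar_coefficient:
 assumes M: "left_module A M" and se: "scalar_end R A M"
 obtains \<phi> where "!!h. h : mod_hom A M M ==> \<phi> h : carrier R"
  "!!h x. [|h : mod_hom A M M; x : carrier M|] ==> h x = sc A M (\<phi> h) x"
  "!!h r. [|h : mod_hom A M M; r : carrier R; \<forall>x\<in>carrier M. h x = sc A M r x|] ==> \<phi> h = r"
proof -
 have "\<forall>h\<in>mod_hom A M M. \<exists>r. r : carrier R & (\<forall>x\<in>carrier M. h x = sc A M r x)"
  using se unfolding scalar_end_def by blast
 from bchoice[OF this] obtain \<phi> where
  p: "\<forall>h\<in>mod_hom A M M. \<phi> h : carrier R & (\<forall>x\<in>carrier M. h x = sc A M (\<phi> h) x)" by (elim exE) (rule that)
 show ?thesis
 proof (rule that[of \<phi>])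
  show c: "\<phi> h : carrier R" and e: "x : carrier M ==> h x = sc A M (\<phi> h) x" if "h : mod_hom A M M" for h x
   using bspec[OF p that] by simp_all
  show "\<phi> h = r" if h: "h : mod_hom A M M" and r: "r : carrier R" "\<forall>x\<in>carrier M. h x = sc A M r x" for h r
   by (rule scalar_end_unique[OF M se c[OF h] r(1)]) (simp add: e[OF h, symmetric] r(2))
 qed
qed

text \<open>An \<open>R\<close>-algebra isomorphism to \<open>R\<close> sends \<open>r \<cdot> id\<close> to \<open>r\<close>, so every endomorphism is a scalar;
 conversely the coefficient of an endomorphism is multiplicative because it is unique.\<close>

lemma End_algebra_iff:
 assumes M: "left_module A M"
 shows "algebra_iso R (End_algebra A M) (regular R) \<longleftrightarrow> scalar_end R A M"
proof
 interpret M: left_module A M by fact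
 interpret MR: left_module R "restrict_scalars A M" by (rule restrict_left_module[OF M])
 let ?E = "End_algebra A M"
 let ?s = "%r. \<lambda>x\<in>carrier M. sc A M r x"
 have sE: "?s r : carrier ?E" if "r : carrier R" for r
  using mod_hom_restrict[OF M mod_hom_scalar[OF M that]] by (simp add: End_algebra_def)
 {
  assume "algebra_iso R ?E (regular R)"
  then obtain \<phi> where p: "\<phi> : ring_iso ?E (regular R)"
   and lin: "!!r b. [|r : carrier R; b : carrier ?E|] ==> \<phi> (r *[?E] b) = r *[regular R] \<phi> b"
   unfolding algebra_iso_def by blast
  have one: "\<phi> 1[?E] = 1[R]" using p by (simp add: ring_iso_def ring_hom_def)
  have inj: "inj_on \<phi> (carrier ?E)" and cl: "!!h. h : carrier ?E ==> \<phi> h : carrier R"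
   using p by (auto simp: ring_iso_def ring_hom_def bij_betw_def)
  have oneE: "1[?E] : carrier ?E" using mod_hom_restrict[OF M mod_hom_id] by (simp add: End_algebra_def)
  have s: "\<phi> (?s r) = r" if r: "r : carrier R" for r
  proof -
   have "r *[?E] 1[?E] = ?s r" by (rule extensionalityI[of _ "carrier M"]) (simp_all add: End_algebra_def)
   then show ?thesis using lin[OF r oneE] one r by simp
  qed
  show "scalar_end R A M" unfolding scalar_end_def
  proof (intro conjI ballI impI)
   fix h assume h: "h : mod_hom A M M"
   let ?h = "restrict h (carrier M)"
   have hE: "?h : carrier ?E" using mod_hom_restrict[OF M h] by (simp add: End_algebra_def)
   have r: "\<phi> ?h : carrier R" by (rule cl[OF hE])
   have eq: "?h = ?s (\<phi> ?h)" by (rule inj_onD[OF inj _ hE sE[OF r]]) (simp only: s[OF r])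
   show "\<exists>r\<in>carrier R. \<forall>x\<in>carrier M. h x = sc A M r x"
   proof (rule bexI[OF _ r], rule ballI)
    fix x assume "x : carrier M"
    then show "h x = sc A M (\<phi> ?h) x" using fun_cong[OF eq, of x] by simp
   qed
  next
   fix r assume r: "r : carrier R" and z: "\<forall>x\<in>carrier M. sc A M r x = 0[M]"
   have "?s r = ?s 0[R]"
   proof (rule restrict_ext)
    fix x assume "x : carrier M"
    then show "sc A M r x = sc A M 0[R] x" using z MR.smult_l_null[of x] by simp
   qed
   then show "r = 0[R]" using s[OF r] s[OF R.zero_closed] by simp
  qed
 next
  assume se: "scalar_end R A M"
  obtain \<phi> where ph: "!!h. h : mod_hom A M M ==> \<phi> h : carrier R"
   "!!h x. [|h : mod_hom A M M; x : carrier M|] ==> h x = sc A M (\<phi> h) x"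
   "!!h r. [|h : mod_hom A M M; r : carrier R; \<forall>x\<in>carrier M. h x = sc A M r x|] ==> \<phi> h = r"
   by (rule scalar_coefficient[OF M se]) (rule that)
  have hE: "h : carrier ?E \<longleftrightarrow> h : mod_hom A M M & h : extensional (carrier M)" for h by (simp add: End_algebra_def)
  have Eh: "h : mod_hom A M M" if "h : carrier ?E" for h using that hE by simp
  note pc = ph(1)[OF Eh] and pe = ph(2)[OF Eh] and pu = ph(3)[OF Eh _ ballI]
  have hc: "h x : carrier M" if "h : carrier ?E" "x : carrier M" for h x
   using that hE mod_hom_closed[of h A M M x] by simp
  have "\<phi> : ring_hom ?E (regular R)"
  proof (rule ring_hom_memI)
   fix h assume h: "h : carrier ?E"
   show "\<phi> h : carrier (regular R)" using pc[OF h] by simp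
   fix k assume k: "k : carrier ?E"
   have kh: "k : mod_hom A M M" "h : mod_hom A M M" using h k hE by simp_all
   have "h **[?E] k = (\<lambda>x\<in>carrier M. h (k x))" by (simp add: End_algebra_def compose_def)
   then have "\<phi> (h **[?E] k) = \<phi> h **[R] \<phi> k"
   proof (intro pu)
    assume e: "h **[?E] k = (\<lambda>x\<in>carrier M. h (k x))"
    show "h **[?E] k : carrier ?E" unfolding e hE using mod_hom_restrict[OF M mod_hom_comp[OF kh]] by simp
    fix x assume x: "x : carrier M"
    show "(h **[?E] k) x = sc A M (\<phi> h **[R] \<phi> k) x"
     using e x pe[OF h hc[OF k x]] pe[OF k x] MR.smult_assoc1[OF pc[OF h] pc[OF k]] by simp
   qed (simp add: pc h k)
   then show "\<phi> (h **[?E] k) = \<phi> h **[regular R] \<phi> k" by simp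
   have "h +[?E] k = (\<lambda>x\<in>carrier M. h x +[M] k x)" by (simp add: End_algebra_def)
   then have "\<phi> (h +[?E] k) = \<phi> h +[R] \<phi> k"
   proof (intro pu)
    assume e: "h +[?E] k = (\<lambda>x\<in>carrier M. h x +[M] k x)"
    show "h +[?E] k : carrier ?E" unfolding e hE using mod_hom_restrict[OF M mod_hom_plus[OF M kh(2,1)]] by simp
    fix x assume x: "x : carrier M"
    show "(h +[?E] k) x = sc A M (\<phi> h +[R] \<phi> k) x"
     using e x pe[OF h x] pe[OF k x] MR.smult_l_distr[OF pc[OF h] pc[OF k]] by simp
   qed (simp add: pc h k)
   then show "\<phi> (h +[?E] k) = \<phi> h +[regular R] \<phi> k" by simp
  next
   have "\<phi> 1[?E] = 1[R]"
   proof (rule pu)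
    show "1[?E] : carrier ?E" using mod_hom_restrict[OF M mod_hom_id] by (simp add: End_algebra_def)
    show "1[?E] x = sc A M 1[R] x" if "x : carrier M" for x
     using MR.smult_one[of x] that by (simp add: End_algebra_def)
   qed simp
   then show "\<phi> 1[?E] = 1[regular R]" by simp
  qed
  moreover have "bij_betw \<phi> (carrier ?E) (carrier (regular R))"
  proof (rule bij_betwI[where g = ?s])
   fix h assume h: "h : carrier ?E"
   show "?s (\<phi> h) = h" by (rule extensionalityI[of _ "carrier M"]) (use h hE pe[OF h] in simp_all)
  next
   fix r assume "r : carrier (regular R)"
   then have r: "r : carrier R" by simp
   show "\<phi> (?s r) = r" by (rule pu[OF sE[OF r] r]) simp
  qed (simp_all add: pc sE Pi_iff)
  moreover have "\<phi> (r *[?E] h) = r *[regular R] \<phi> h" if r: "r : carrier R" and h: "h : carrier ?E" for r h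
  proof -
   have hm: "h : mod_hom A M M" using h hE by simp
   have e: "r *[?E] h = (\<lambda>x\<in>carrier M. sc A M r (h x))" by (simp add: End_algebra_def)
   have "\<phi> (r *[?E] h) = r **[R] \<phi> h"
   proof (rule pu)
    show "r *[?E] h : carrier ?E" unfolding e hE
     using mod_hom_restrict[OF M mod_hom_comp[OF hm mod_hom_scalar[OF M r]]] by simp
    show "(r *[?E] h) x = sc A M (r **[R] \<phi> h) x" if x: "x : carrier M" for x
     unfolding e using x pe[OF h x] MR.smult_assoc1[OF r pc[OF h]] by simp
   qed (simp add: r pc h)
   then show ?thesis by simp
  qed
  ultimately show "algebra_iso R ?E (regular R)" unfolding algebra_iso_def ring_iso_def
   by (intro bexI[of _ \<phi>]) simp_all
 }
qed

lemma scalar_end_iso: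
 assumes M: "left_module A M" and N: "left_module A N" and iso: "mod_iso A M N" and se: "scalar_end R A N"
 shows "scalar_end R A M"
proof (rule mod_iso_obtain[OF M iso])
 fix f g assume f: "f : mod_hom A M N" and g: "g : mod_hom A N M"
  and gf: "!!x. x : carrier M ==> g (f x) = x" and fg: "!!y. y : carrier N ==> f (g y) = y"
 note fc = mod_hom_closed[OF f] and gc = mod_hom_closed[OF g]
 show ?thesis unfolding scalar_end_def
 proof (intro conjI ballI impI)
  fix h assume h: "h : mod_hom A M M"
  have "(%y. f (h (g y))) : mod_hom A N N" by (rule mod_hom_comp[OF mod_hom_comp[OF g h] f])
  then obtain r where r: "r : carrier R" "!!y. y : carrier N ==> f (h (g y)) = sc A N r y"
   by (rule scalar_end_scalar[OF se]) (rule that)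
  have "h x = sc A M r x" if x: "x : carrier M" for x
  proof -
   have "f (h x) = f (sc A M r x)" using r(2)[OF fc[OF x]] gf[OF x] mod_hom_sc[OF f r(1) x] by simp
   then have "g (f (h x)) = g (f (sc A M r x))" by simp
   then show ?thesis using gf[OF mod_hom_closed[OF h x]] gf[OF sc_closed[OF M r(1) x]] by simp
  qed
  then show "\<exists>r\<in>carrier R. \<forall>x\<in>carrier M. h x = sc A M r x" by (intro bexI[OF _ r(1)] ballI)
 next
  fix r assume r: "r : carrier R" and z: "\<forall>x\<in>carrier M. sc A M r x = 0[M]"
  have "sc A N r y = 0[N]" if y: "y : carrier N" for y
   using z gc[OF y] mod_hom_sc[OF f r gc[OF y]] fg[OF y] mod_hom_zero[OF M N f] by simp
  then show "r = 0[R]" using se r unfolding scalar_end_def by simp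
 qed
qed

end

lemma hom_nonzero_iso:
 assumes "left_module A M" "left_module A M'" "left_module A N" "left_module A N'"
  and "mod_iso A M M'" "mod_iso A N N'" "hom_nonzero A M N"
 shows "hom_nonzero A M' N'"
proof (rule mod_iso_obtain[OF assms(1,5)], rule mod_iso_obtain[OF assms(3,6)])
 fix f g u v
 assume f: "f : mod_hom A M M'" and g: "g : mod_hom A M' M" and gf: "!!x. x : carrier M ==> g (f x) = x"
  and u: "u : mod_hom A N N'" and v: "v : mod_hom A N' N" and vu: "!!x. x : carrier N ==> v (u x) = x"
 obtain h x where h: "h : mod_hom A M N" "x : carrier M" "h x \<noteq> 0[N]"
  using assms(7) unfolding hom_nonzero_def by blast
 have "(%y. u (h (g y))) : mod_hom A M' N'" by (rule mod_hom_comp[OF mod_hom_comp[OF g h(1)] u])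
 moreover have "u (h (g (f x))) \<noteq> 0[N']"
 proof
  assume "u (h (g (f x))) = 0[N']"
  then have "v (u (h x)) = 0[N]" using gf[OF h(2)] mod_hom_zero[OF assms(4,3) v] by simp
  then show False using vu[OF mod_hom_closed[OF h(1,2)]] h(3) by simp
 qed
 ultimately show ?thesis unfolding hom_nonzero_def
  using mod_hom_closed[OF f h(2)] by (intro bexI[of _ "%y. u (h (g y))"] bexI[of _ "f x"])
qed

lemma lsum_restrict_scalars [simp]: "lsum (restrict_scalars A M) f xs = lsum M f xs" by (induction xs) simp_all

lemma equalizer_submodule:
 assumes "left_module A M" "left_module A N" "f : mod_hom A M N" "g : mod_hom A M N"
 shows "submodule {x : carrier M. f x = g x} A M"
proof -
 interpret M: left_module A M by fact
 show ?thesis by (rule submodule_intro[OF assms(1)])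
   (simp_all add: mod_hom_zero[OF assms(1-3)] mod_hom_zero[OF assms(1,2,4)] mod_hom_add[OF assms(3)]
    mod_hom_add[OF assms(4)] mod_hom_smult[OF assms(3)] mod_hom_smult[OF assms(4)] subset_iff)
qed

section \<open>Modules of homomorphisms\<close>

text \<open>\<open>Hom\<^sub>A(M, X)\<close> with a second ring acting on the target by \<open>act\<close>; used both for the \<open>R\<close>-module
 \<open>Hom\<^sub>A(M, X)\<close> and for the right \<open>A\<close>-module \<open>Hom\<^sub>A(P, A)\<close>.\<close>

definition hom_module ::
 "('s => 'n => 'n) => ('a, 'x) ring_scheme => ('a, 'm, 'y) module_scheme => ('a, 'n, 'z) module_scheme =>
  ('s, 'm => 'n) module" where
 "hom_module act A M X = mk_module (mod_hom A M X \<inter> extensional (carrier M))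
   (\<lambda>x\<in>carrier M. 0[X]) (%f g. \<lambda>x\<in>carrier M. f x +[X] g x) (%s f. \<lambda>x\<in>carrier M. act s (f x))"

lemma hom_module_simps:
 "f : carrier (hom_module act A M X) \<longleftrightarrow> f : mod_hom A M X & f : extensional (carrier M)"
 "0[hom_module act A M X] = (\<lambda>x\<in>carrier M. 0[X])"
 "f +[hom_module act A M X] g = (\<lambda>x\<in>carrier M. f x +[X] g x)"
 "s *[hom_module act A M X] f = (\<lambda>x\<in>carrier M. act s (f x))" by (simp_all add: hom_module_def)

lemma hom_module_eqI:
 assumes "f : carrier (hom_module act A M X)" "g : carrier (hom_module act A M X)"
  "!!x. x : carrier M ==> f x = g x"
 shows "f = g" by (rule extensionalityI[of f "carrier M" g]) (use assms in "simp_all add: hom_module_simps")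

lemma hom_module_restrict:
 "[|left_module A M; f : mod_hom A M X|] ==> restrict f (carrier M) : carrier (hom_module act A M X)"
 by (simp add: hom_module_simps mod_hom_restrict)

lemma hom_module_left_module:
 assumes M: "left_module A M" and X: "left_module A X" and S: "ring S"
  and c: "!!s x. [|s : carrier S; x : carrier X|] ==> act s x : carrier X"
  and ar: "!!s x y. [|s : carrier S; x : carrier X; y : carrier X|] ==> act s (x +[X] y) = act s x +[X] act s y"
  and al: "!!s t x. [|s : carrier S; t : carrier S; x : carrier X|] ==> act (s +[S] t) x = act s x +[X] act t x"
  and as: "!!s t x. [|s : carrier S; t : carrier S; x : carrier X|] ==> act (s **[S] t) x = act s (act t x)"
  and o: "!!x. x : carrier X ==> act 1[S] x = x"
  and lin: "!!s a x. [|s : carrier S; a : carrier A; x : carrier X|] ==> act s (a *[X] x) = a *[X] act s x"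
 shows "left_module S (hom_module act A M X)"
proof -
 interpret M: left_module A M by fact
 interpret X: left_module A X by fact
 let ?H = "hom_module act A M X"
 have fc: "f x : carrier X" if "f : carrier ?H" "x : carrier M" for f x
  using that mod_hom_closed[of f A M X x] by (simp add: hom_module_simps)
 have hm: "f : mod_hom A M X" if "f : carrier ?H" for f using that by (simp add: hom_module_simps)
 have addc: "f +[?H] g : carrier ?H" if "f : carrier ?H" "g : carrier ?H" for f g unfolding hom_module_simps(3)
  by (rule hom_module_restrict[OF M mod_hom_plus[OF X hm[OF that(1)] hm[OF that(2)]]])
 have zc: "0[?H] : carrier ?H"
  unfolding hom_module_simps(2) by (rule hom_module_restrict[OF M mod_hom_zero_map[OF X]])
 have sc: "s *[?H] f : carrier ?H" if s: "s : carrier S" and f: "f : carrier ?H" for s f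
 proof -
  have "(%x. act s x) : mod_hom A X X" using c ar lin s by (intro mod_homI) simp_all
  then show ?thesis unfolding hom_module_simps(4) by (intro hom_module_restrict[OF M] mod_hom_comp[OF hm[OF f]])
 qed
 show ?thesis
 proof (rule left_moduleI[OF S])
  show "abelian_group ?H"
  proof (rule abelian_groupI)
   fix f g h assume f: "f : carrier ?H" and g: "g : carrier ?H" and h: "h : carrier ?H"
   show "f +[?H] g +[?H] h = f +[?H] (g +[?H] h)"
    unfolding hom_module_simps by (rule restrict_ext) (simp add: fc f g h X.M.a_assoc)
   show "f +[?H] g = g +[?H] f" unfolding hom_module_simps by (rule restrict_ext) (simp add: fc f g X.M.a_comm)
  next
   fix f assume f: "f : carrier ?H"
   show "0[?H] +[?H] f = f" by (rule hom_module_eqI[OF addc[OF zc f] f]) (simp add: hom_module_simps(2,3) fc f)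
   let ?g = "\<lambda>x\<in>carrier M. -[X] f x"
   have "?g : carrier ?H" by (rule hom_module_restrict[OF M mod_hom_uminus[OF X hm[OF f]]])
   moreover have "?g +[?H] f = 0[?H]"
    unfolding hom_module_simps(2,3) by (rule restrict_ext) (simp add: fc f X.M.l_neg)
   ultimately show "\<exists>g\<in>carrier ?H. g +[?H] f = 0[?H]" by (intro bexI[of _ ?g])
  qed (fact addc zc)+
  fix s t f g assume s: "s : carrier S" and t: "t : carrier S" and f: "f : carrier ?H" and g: "g : carrier ?H"
  show "(s +[S] t) *[?H] f = s *[?H] f +[?H] t *[?H] f"
   unfolding hom_module_simps by (rule restrict_ext) (simp add: fc f s t al)
  show "s *[?H] (f +[?H] g) = s *[?H] f +[?H] s *[?H] g"
   unfolding hom_module_simps by (rule restrict_ext) (simp add: fc f g s ar)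
  show "(s **[S] t) *[?H] f = s *[?H] (t *[?H] f)"
   unfolding hom_module_simps by (rule restrict_ext) (simp add: fc f s t as)
 next
  fix f assume f: "f : carrier ?H"
  show "1[S] *[?H] f = f"
   by (rule hom_module_eqI[OF sc[OF ring.ring_simprules(6)[OF S] f] f]) (simp add: hom_module_simps(4) fc f o)
 qed (fact sc)
qed

section \<open>Tensor products\<close>

definition tensor_pre ::
 "('a, 'm, 'z) module_scheme => ('r, 'u, 'w) module_scheme => ('a, 'm \<times> 'u \<Rightarrow>\<^sub>0 int) module" where
 "tensor_pre M U = mk_module (carrier (free_Abelian_group (carrier M \<times> carrier U))) 0 (+)
   (%a. frag_extend (%(m, u). frag_of (a *[M] m, u)))"

definition tensor_rel where
 "tensor_rel R A M U = generate (free_Abelian_group (carrier M \<times> carrier U)) (tensor_relations R A M U)"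

definition pure_tensor where
 "pure_tensor R A M U m u = tensor_rel R A M U +>\<^bsub>tensor_pre M U\<^esub> frag_of (m, u)"

lemma tensor_eq: "tensor R A M U = quotient_module (tensor_pre M U) (tensor_rel R A M U)"
 by (simp add: tensor_def tensor_pre_def tensor_rel_def Let_def)

lemma coset_eqI:
 assumes "abelian_group G" "subgroup N (add_monoid G)" "x : carrier G" "y : carrier G" "x +[G] -[G] y : N"
 shows "N +>\<^bsub>G\<^esub> x = N +>\<^bsub>G\<^esub> y"
proof -
 interpret G: abelian_group G by fact
 interpret N: abelian_subgroup N G by (rule abelian_subgroupI3) (simp_all add: additive_subgroup_def assms(1,2))
 show ?thesis using N.a_repr_independence'[OF N.a_rcos_module_rev[OF assms(4,3,5)] assms(4)] by simp
qed

context assoc_algebra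
begin

context
 fixes M :: "('a, 'm, 'z) module_scheme" and U :: "('r, 'u, 'w) module_scheme"
 assumes M: "left_module A M" and U: "left_module R U"
begin

interpretation M: left_module A M by (fact M)
interpretation U: left_module R U by (fact U)

abbreviation (input) "TP \<equiv> tensor_pre M U"
abbreviation (input) "TN \<equiv> tensor_rel R A M U"

lemma tensor_pre_carrier: "x : carrier TP \<longleftrightarrow> Poly_Mapping.keys x <= carrier M \<times> carrier U"
 by (simp add: tensor_pre_def)

lemma tensor_pre_ops: "x +[TP] y = x + y" "0[TP] = 0"
 "a *[TP] x = frag_extend (%(m, u). frag_of (a *[M] m, u)) x" by (simp_all add: tensor_pre_def)

lemma tensor_pre_group: "abelian_group TP"
proof (rule abelian_groupI)
 fix x y assume "x : carrier TP" "y : carrier TP"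
 then show "x +[TP] y : carrier TP" unfolding tensor_pre_carrier tensor_pre_ops using keys_add[of x y] by blast
next
 fix x assume "x : carrier TP"
 then show "\<exists>y\<in>carrier TP. y +[TP] x = 0[TP]"
  by (intro bexI[of _ "- x"]) (simp_all add: tensor_pre_carrier tensor_pre_ops)
qed (simp_all add: tensor_pre_carrier tensor_pre_ops algebra_simps)

lemma tensor_pre_minus: "x : carrier TP ==> -[TP] x = - x" by (rule abelian_group.minus_equality[OF tensor_pre_group])
  (simp_all add: tensor_pre_carrier tensor_pre_ops)

lemma tensor_pre_coset_eq:
 assumes "x : carrier TP" "y : carrier TP" "x - y : TN"
  "subgroup TN (add_monoid TP)"
 shows "TN +>\<^bsub>TP\<^esub> x = TN +>\<^bsub>TP\<^esub> y" by (rule coset_eqI[OF tensor_pre_group assms(4,1,2)])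
  (simp add: tensor_pre_minus[OF assms(2)] tensor_pre_ops assms(3))

lemma tensor_relations_in: "tensor_relations R A M U <= carrier TP"
proof -
 have k2: "Poly_Mapping.keys (x - y - z) <= S"
  if "Poly_Mapping.keys x <= S" "Poly_Mapping.keys y <= S" "Poly_Mapping.keys z <= S"
  for x y z :: "'m \<times> 'u \<Rightarrow>\<^sub>0 int" and S using keys_diff[of "x - y" z] keys_diff[of x y] that by blast
 have k1: "Poly_Mapping.keys (x - y) <= S"
  if "Poly_Mapping.keys x <= S" "Poly_Mapping.keys y <= S"
  for x y :: "'m \<times> 'u \<Rightarrow>\<^sub>0 int" and S using keys_diff[of x y] that by blast
 show ?thesis
 proof
  fix x assume "x : tensor_relations R A M U"
  then have "Poly_Mapping.keys x <= carrier M \<times> carrier U" unfolding tensor_relations_def Un_iff mem_Collect_eq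
   by (elim disjE exE conjE) (simp_all add: k1 k2 sc_closed[OF M])
  then show "x : carrier TP" by (simp add: tensor_pre_carrier)
 qed
qed

lemma tensor_rel_add: "[|x : TN; y : TN|] ==> x + y : TN"
 unfolding tensor_rel_def using generate.eng[of x "free_Abelian_group (carrier M \<times> carrier U)" _ y] by simp

lemma tensor_rel_zero: "0 : TN"
 unfolding tensor_rel_def using generate.one[of "free_Abelian_group (carrier M \<times> carrier U)"] by simp

lemma tensor_rel_incl: "x : tensor_relations R A M U ==> x : TN" unfolding tensor_rel_def by (rule generate.incl)

lemma tensor_rel_induct:
 assumes x: "x : TN" and z: "P 0" and r: "!!y. y : tensor_relations R A M U ==> P y"
  and d: "!!y. P y ==> P (- y)" and a: "!!y z. [|P y; P z|] ==> P (y + z)"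
 shows "P x" using x unfolding tensor_rel_def
proof induction
 case one
 then show ?case using z by simp
next
 case (incl h)
 then show ?case by (rule r)
next
 case (inv h)
 have "h : carrier TP" using inv tensor_relations_in by blast
 then show ?case using d[OF r[OF inv]] by (simp add: tensor_pre_carrier)
next
 case (eng g h)
 then show ?case using a by simp
qed

lemma tensor_rel_subgroup: "subgroup TN (free_Abelian_group (carrier M \<times> carrier U))" unfolding tensor_rel_def
 by (rule group.generate_is_subgroup[OF group_free_Abelian_group])
  (use tensor_relations_in in "simp add: subset_iff tensor_pre_carrier")

lemma tensor_rel_in: "x : TN ==> x : carrier TP"
 using subgroup.subset[OF tensor_rel_subgroup] by (auto simp: tensor_pre_carrier subset_iff)

lemma tensor_rel_minus: "x : TN ==> - x : TN"
 using subgroup.m_inv_closed[OF tensor_rel_subgroup, of x] tensor_rel_in[of x] by (simp add: tensor_pre_carrier)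

lemma tensor_rel_diff: "[|x : TN; y : TN|] ==> x - y : TN" using tensor_rel_add[OF _ tensor_rel_minus, of x y] by simp

lemma tensor_rel_sub: "subgroup TN (add_monoid TP)"
proof (rule subgroup.intro)
 show "TN <= carrier (add_monoid TP)" using tensor_rel_in by auto
 fix x assume x: "x : TN"
 show "inv\<^bsub>add_monoid TP\<^esub> x : TN"
  using tensor_pre_minus[OF tensor_rel_in[OF x]] tensor_rel_minus[OF x] by (simp add: a_inv_def)
qed (simp_all add: tensor_pre_ops tensor_rel_add tensor_rel_zero)

lemmas tensor_coset_eq = tensor_pre_coset_eq[OF _ _ _ tensor_rel_sub]

lemma tensor_pre_smult_closed:
 assumes "a : carrier A" "x : carrier TP"
 shows "a *[TP] x : carrier TP"
proof -
 have "Poly_Mapping.keys (case p of (m, u) => frag_of (a *[M] m, u)) <= carrier M \<times> carrier U"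
  if "p : carrier M \<times> carrier U" for p using that assms(1) by auto
 then have "(\<Union>p\<in>Poly_Mapping.keys x. Poly_Mapping.keys (case p of (m, u) => frag_of (a *[M] m, u)))
   <= carrier M \<times> carrier U" using assms(2) unfolding tensor_pre_carrier by (intro UN_least) blast
 then show ?thesis unfolding tensor_pre_carrier tensor_pre_ops by (rule order_trans[OF keys_frag_extend])
qed

lemma tensor_pre_induct:
 assumes x: "x : carrier TP" and z: "P 0"
  and p: "!!m u. [|m : carrier M; u : carrier U|] ==> P (frag_of (m, u))"
  and d: "!!x y. [|x : carrier TP; y : carrier TP; P x; P y|] ==> P (x - y)"
 shows "P x"
proof (rule free_Abelian_group_induct[of x "carrier M \<times> carrier U"])
 show "Poly_Mapping.keys x <= carrier M \<times> carrier U" using x by (simp add: tensor_pre_carrier)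
 show "P (frag_of a)" if "a : carrier M \<times> carrier U" for a using p that by auto
qed (simp_all add: z d tensor_pre_carrier)

text \<open>The action of \<open>A\<close> sends each of the generating relations to a relation of the same kind.\<close>

lemma tensor_rel_smult:
 assumes a: "a : carrier A" and x: "x : TN"
 shows "a *[TP] x : TN" using x
proof (rule tensor_rel_induct)
 show "a *[TP] 0 : TN" by (simp add: tensor_pre_ops tensor_rel_zero)
 fix y assume "y : tensor_relations R A M U"
 then show "a *[TP] y : TN" unfolding tensor_relations_def Un_iff mem_Collect_eq
 proof (elim disjE exE conjE)
  fix m m' u assume y: "y = frag_of (m +[M] m', u) - frag_of (m, u) - frag_of (m', u)"
   and c: "m : carrier M" "m' : carrier M" "u : carrier U"
  have "a *[TP] y =
    frag_of (a *[M] m +[M] a *[M] m', u) - frag_of (a *[M] m, u) - frag_of (a *[M] m', u)"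
   using c a by (simp add: y tensor_pre_ops frag_extend_diff M.smult_r_distr)
  moreover have "a *[M] m : carrier M" "a *[M] m' : carrier M" using c a by auto
  ultimately show ?thesis using c(3) by (intro tensor_rel_incl) (unfold tensor_relations_def, blast)
 next
  fix m u u' assume y: "y = frag_of (m, u +[U] u') - frag_of (m, u) - frag_of (m, u')"
   and c: "m : carrier M" "u : carrier U" "u' : carrier U"
  have "a *[TP] y =
    frag_of (a *[M] m, u +[U] u') - frag_of (a *[M] m, u) - frag_of (a *[M] m, u')"
   by (simp add: y tensor_pre_ops frag_extend_diff)
  moreover have "a *[M] m : carrier M" using c a by auto
  ultimately show ?thesis using c(2,3) by (intro tensor_rel_incl) (unfold tensor_relations_def, blast)
 next
  fix r m u assume y: "y = frag_of (r *[restrict_scalars A M] m, u) - frag_of (m, r *[U] u)"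
   and c: "r : carrier R" "m : carrier M" "u : carrier U"
  have "a *[TP] y =
    frag_of (r *[restrict_scalars A M] (a *[M] m), u) - frag_of (a *[M] m, r *[U] u)"
   using sc_commute[OF M c(1) a c(2)] by (simp add: y tensor_pre_ops frag_extend_diff)
  moreover have "a *[M] m : carrier M" using c a by auto
  ultimately show ?thesis using c(1,3) by (intro tensor_rel_incl) (unfold tensor_relations_def, blast)
 qed
next
 fix y assume "a *[TP] y : TN"
 then show "a *[TP] (- y) : TN" using tensor_rel_minus by (simp add: tensor_pre_ops frag_extend_minus)
next
 fix y z assume "a *[TP] y : TN" "a *[TP] z : TN"
 then show "a *[TP] (y + z) : TN" using tensor_rel_add by (simp add: tensor_pre_ops frag_extend_add)
qed

lemma tensor_pre_distr:
 assumes a: "a : carrier A" and b: "b : carrier A" and x: "x : carrier TP"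
 shows "(a +[A] b) *[TP] x - (a *[TP] x + b *[TP] x) : TN"
  (is "?D x : _") using x
proof (rule tensor_pre_induct)
 show "?D 0 : TN" by (simp add: tensor_pre_ops tensor_rel_zero)
 fix m u assume c: "m : carrier M" "u : carrier U"
 have "?D (frag_of (m, u)) =
   frag_of (a *[M] m +[M] b *[M] m, u) - frag_of (a *[M] m, u) - frag_of (b *[M] m, u)"
  using c a b by (simp add: tensor_pre_ops M.smult_l_distr algebra_simps)
 moreover have "a *[M] m : carrier M" "b *[M] m : carrier M" using c a b by auto
 ultimately show "?D (frag_of (m, u)) : TN" using c(2)
  by (intro tensor_rel_incl) (unfold tensor_relations_def, blast)
next
 fix x y assume "?D x : TN" "?D y : TN"
 moreover have "?D (x - y) = ?D x - ?D y" by (simp add: tensor_pre_ops frag_extend_diff algebra_simps)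
 ultimately show "?D (x - y) : TN" using tensor_rel_diff by simp
qed

lemma tensor_pre_assoc:
 assumes a: "a : carrier A" and b: "b : carrier A" and x: "x : carrier TP"
 shows "(a **[A] b) *[TP] x = a *[TP] (b *[TP] x)" using x by (rule tensor_pre_induct)
  (use a b in "simp_all add: tensor_pre_ops M.smult_assoc1 frag_extend_diff")

lemma tensor_pre_one:
 assumes x: "x : carrier TP"
 shows "1[A] *[TP] x = x" using x by (rule tensor_pre_induct) (simp_all add: tensor_pre_ops frag_extend_diff)

lemma tensor_facts:
 shows tensor_left_module: "left_module A (tensor R A M U)"
  and tensor_carrier: "carrier (tensor R A M U) = (%x. TN +>\<^bsub>TP\<^esub> x) ` carrier TP"
  and tensor_add: "!!x y. [|x : carrier TP; y : carrier TP|] ==>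
   (TN +>\<^bsub>TP\<^esub> x) +[tensor R A M U] (TN +>\<^bsub>TP\<^esub> y)
   = TN +>\<^bsub>TP\<^esub> (x + y)"
  and tensor_smult: "!!a x. [|a : carrier A; x : carrier TP|] ==>
   a *[tensor R A M U] (TN +>\<^bsub>TP\<^esub> x)
   = TN +>\<^bsub>TP\<^esub> (a *[TP] x)"
  and tensor_eq_iff: "!!x y. [|x : carrier TP; y : carrier TP|] ==>
   TN +>\<^bsub>TP\<^esub> x = TN +>\<^bsub>TP\<^esub> y
   \<longleftrightarrow> x - y : TN"
proof -
 have dr: "a *[TP] (x +[TP] y)
   = a *[TP] x +[TP] a *[TP] y" for a x y by (simp add: tensor_pre_ops frag_extend_add)
 have dl: "TN +>\<^bsub>TP\<^esub> ((a +[A] b) *[TP] x)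
   = TN +>\<^bsub>TP\<^esub> (a *[TP] x +[TP] b *[TP] x)"
  if "a : carrier A" "b : carrier A" "x : carrier TP" for a b x using that abelian_groupE(1)[OF tensor_pre_group]
  by (intro tensor_coset_eq)
   (simp_all add: tensor_pre_smult_closed tensor_pre_distr[folded tensor_pre_ops(1)])
 note * = quotient_module_general[OF ring_A tensor_pre_group tensor_rel_sub tensor_pre_smult_closed dr
   tensor_rel_smult dl, folded tensor_eq]
 show "left_module A (tensor R A M U)"
  "carrier (tensor R A M U) = (%x. TN +>\<^bsub>TP\<^esub> x) ` carrier TP"
  "!!x y. [|x : carrier TP; y : carrier TP|] ==>
   (TN +>\<^bsub>TP\<^esub> x) +[tensor R A M U] (TN +>\<^bsub>TP\<^esub> y)
   = TN +>\<^bsub>TP\<^esub> (x + y)"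
  "!!a x. [|a : carrier A; x : carrier TP|] ==>
   a *[tensor R A M U] (TN +>\<^bsub>TP\<^esub> x)
   = TN +>\<^bsub>TP\<^esub> (a *[TP] x)" unfolding tensor_pre_ops(1)[symmetric]
  by (rule *; simp add: tensor_pre_assoc tensor_pre_one)+
 fix x y assume xy: "x : carrier TP" "y : carrier TP"
 have "TN +>\<^bsub>TP\<^esub> x = TN +>\<^bsub>TP\<^esub> y
   \<longleftrightarrow> x -[TP] y : TN" by (rule *; simp add: tensor_pre_assoc tensor_pre_one xy)
 then show "TN +>\<^bsub>TP\<^esub> x = TN +>\<^bsub>TP\<^esub> y
   \<longleftrightarrow> x - y : TN" by (simp add: a_minus_def tensor_pre_minus[OF xy(2)] tensor_pre_ops)
qed

lemma frag_in_pre: "[|m : carrier M; u : carrier U|] ==> frag_of (m, u) : carrier TP"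
 by (simp add: tensor_pre_carrier)

lemma diff_in_pre: "[|x : carrier TP; y : carrier TP|] ==> x - y : carrier TP"
 using keys_diff[of x y] unfolding tensor_pre_carrier by blast

lemma add_in_pre: "[|x : carrier TP; y : carrier TP|] ==> x + y : carrier TP"
 using keys_add[of x y] unfolding tensor_pre_carrier by blast

lemma pure_tensor_closed: "[|m : carrier M; u : carrier U|] ==> pure_tensor R A M U m u : carrier (tensor R A M U)"
 unfolding pure_tensor_def tensor_carrier by (rule imageI) (rule frag_in_pre)

lemma pure_tensor_add_left:
 assumes c: "m : carrier M" "m' : carrier M" "u : carrier U"
 shows "pure_tensor R A M U (m +[M] m') u = pure_tensor R A M U m u +[tensor R A M U] pure_tensor R A M U m' u"
proof -
 have "frag_of (m +[M] m', u) - (frag_of (m, u) + frag_of (m', u))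
   = frag_of (m +[M] m', u) - frag_of (m, u) - frag_of (m', u)" by (simp add: algebra_simps)
 also have "\<dots> : TN" using c by (intro tensor_rel_incl) (unfold tensor_relations_def, blast)
 finally show ?thesis using c unfolding pure_tensor_def
  by (simp add: tensor_add tensor_eq_iff frag_in_pre add_in_pre)
qed

lemma pure_tensor_add_right:
 assumes c: "m : carrier M" "u : carrier U" "u' : carrier U"
 shows "pure_tensor R A M U m (u +[U] u') = pure_tensor R A M U m u +[tensor R A M U] pure_tensor R A M U m u'"
proof -
 have "frag_of (m, u +[U] u') - (frag_of (m, u) + frag_of (m, u'))
   = frag_of (m, u +[U] u') - frag_of (m, u) - frag_of (m, u')" by (simp add: algebra_simps)
 also have "\<dots> : TN" using c by (intro tensor_rel_incl) (unfold tensor_relations_def, blast)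
 finally show ?thesis using c unfolding pure_tensor_def
  by (simp add: tensor_add tensor_eq_iff frag_in_pre add_in_pre)
qed

lemma pure_tensor_balanced:
 assumes c: "r : carrier R" "m : carrier M" "u : carrier U"
 shows "pure_tensor R A M U (sc A M r m) u = pure_tensor R A M U m (r *[U] u)"
proof -
 have "frag_of (r *[restrict_scalars A M] m, u) - frag_of (m, r *[U] u) : TN"
  using c by (intro tensor_rel_incl) (unfold tensor_relations_def, blast)
 then show ?thesis using c unfolding pure_tensor_def by (simp add: tensor_eq_iff frag_in_pre sc_closed[OF M])
qed

lemma pure_tensor_smult:
 assumes "a : carrier A" "m : carrier M" "u : carrier U"
 shows "a *[tensor R A M U] pure_tensor R A M U m u = pure_tensor R A M U (a *[M] m) u"
 unfolding pure_tensor_def using assms by (simp add: tensor_smult frag_in_pre tensor_pre_ops)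

lemma tensor_least:
 assumes H: "submodule H A (tensor R A M U)"
  and p: "!!m u. [|m : carrier M; u : carrier U|] ==> pure_tensor R A M U m u : H"
 shows "carrier (tensor R A M U) <= H"
proof -
 let ?T = "tensor R A M U" and ?c = "%x. TN +>\<^bsub>TP\<^esub> x"
 interpret T: left_module A ?T by (rule tensor_left_module)
 have "?c x : H" if x: "x : carrier TP" for x using x
 proof (rule tensor_pre_induct)
  have z0: "0 : carrier TP" by (simp add: tensor_pre_carrier)
  have cz: "?c 0 : carrier ?T" unfolding tensor_carrier by (rule imageI[OF z0])
  have "?c 0 +[?T] ?c 0 = ?c 0" using tensor_add[OF z0 z0] by simp
  then have "?c 0 = 0[?T]" using cz T.M.add.r_cancel_one' by metis
  then show "?c 0 : H" using submodule_zero[OF H] by simp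
 next
  fix x y assume x: "x : carrier TP" and y: "y : carrier TP"
   and xH: "?c x : H" and yH: "?c y : H"
  have cT: "?c (x - y) : carrier ?T" "?c y : carrier ?T" unfolding tensor_carrier by (intro imageI diff_in_pre x y)+
  have "?c y +[?T] ?c (x - y) = ?c x" using tensor_add[OF y diff_in_pre[OF x y]] by simp
  then have "?c (x - y) = ?c x +[?T] -[?T] ?c y" using T.M.add_sub_cancel(1)[OF cT(2,1)] by simp
  then show "?c (x - y) : H" using submodule_add[OF H xH submodule_minus[OF tensor_left_module H yH]] by simp
 qed (use p in "simp add: pure_tensor_def")
 then show ?thesis unfolding tensor_carrier by (rule image_subsetI)
qed

text \<open>Pure tensors generate, and the equalizer of two homomorphisms is a submodule.\<close>

lemma tensor_hom_eqI:
 assumes Y: "left_module A Y" and f: "f : mod_hom A (tensor R A M U) Y" and g: "g : mod_hom A (tensor R A M U) Y"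
  and e: "!!m u. [|m : carrier M; u : carrier U|] ==> f (pure_tensor R A M U m u) = g (pure_tensor R A M U m u)"
  and x: "x : carrier (tensor R A M U)"
 shows "f x = g x"
proof -
 have "carrier (tensor R A M U) <= {x : carrier (tensor R A M U). f x = g x}"
  by (rule tensor_least[OF equalizer_submodule[OF tensor_left_module Y f g]]) (simp add: e pure_tensor_closed)
 then show ?thesis using x by blast
qed

text \<open>A balanced biadditive map extends to the free abelian group and kills the relations.\<close>

lemma tensor_universal:
 assumes Y: "left_module A Y"
  and c: "!!m u. [|m : carrier M; u : carrier U|] ==> \<beta> m u : carrier Y"
  and al: "!!m m' u. [|m : carrier M; m' : carrier M; u : carrier U|] ==> \<beta> (m +[M] m') u = \<beta> m u +[Y] \<beta> m' u"
  and ar: "!!m u u'. [|m : carrier M; u : carrier U; u' : carrier U|] ==> \<beta> m (u +[U] u') = \<beta> m u +[Y] \<beta> m u'"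
  and b: "!!r m u. [|r : carrier R; m : carrier M; u : carrier U|] ==> \<beta> (sc A M r m) u = \<beta> m (r *[U] u)"
  and s: "!!a m u. [|a : carrier A; m : carrier M; u : carrier U|] ==> \<beta> (a *[M] m) u = a *[Y] \<beta> m u"
 obtains h where "h : mod_hom A (tensor R A M U) Y"
  "!!m u. [|m : carrier M; u : carrier U|] ==> h (pure_tensor R A M U m u) = \<beta> m u"
proof -
 interpret Y: left_module A Y by fact
 let ?F = "free_Abelian_group (carrier M \<times> carrier U)" and ?T = "tensor R A M U"
 let ?c = "%x. TN +>\<^bsub>TP\<^esub> x"
 obtain k where k: "k : hom ?F (add_monoid Y)" "!!p. p : carrier M \<times> carrier U ==> k (frag_of p) = (case p of (m, u) => \<beta> m u)"
 proof (rule comm_group.free_Abelian_group_universal[OF Y.M.a_comm_group, of "%(m, u). \<beta> m u" "carrier M \<times> carrier U"])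
  show "(%(m, u). \<beta> m u) ` (carrier M \<times> carrier U) <= carrier (add_monoid Y)" using c by auto
 qed (rule that)
 have kc: "k x : carrier Y" if "x : carrier TP" for x
  using hom_in_carrier[OF k(1), of x] that by (simp add: tensor_pre_carrier)
 have ka: "k (x + y) = k x +[Y] k y" if "x : carrier TP" "y : carrier TP" for x y
  using hom_mult[OF k(1), of x y] that by (simp add: tensor_pre_carrier)
 have kd: "k (x - y) = k x +[Y] -[Y] k y" if "x : carrier TP" "y : carrier TP" for x y
  using ka[OF that(2) diff_in_pre[OF that]] Y.M.add_sub_cancel(1)[OF kc[OF that(2)] kc[OF diff_in_pre[OF that]]] by simp
 have k0: "k 0 = 0[Y]" using kd[of 0 0] kc[of 0] by (simp add: tensor_pre_carrier Y.M.r_neg)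
 have kp: "k (frag_of (m, u)) = \<beta> m u" if "m : carrier M" "u : carrier U" for m u
  using k(2)[of "(m, u)"] that by simp
 have ks: "k (a *[TP] x) = a *[Y] k x" if a: "a : carrier A" and x: "x : carrier TP" for a x using x
 proof (rule tensor_pre_induct)
  show "k (a *[TP] 0) = a *[Y] k 0" using a by (simp add: tensor_pre_ops k0)
 next
  fix m u assume mu: "m : carrier M" "u : carrier U"
  then show "k (a *[TP] frag_of (m, u)) = a *[Y] k (frag_of (m, u))" using a by (simp add: tensor_pre_ops kp s)
 next
  fix x y assume x: "x : carrier TP" and y: "y : carrier TP"
   and e: "k (a *[TP] x) = a *[Y] k x" "k (a *[TP] y) = a *[Y] k y"
  have 1: "a *[TP] (x - y) = a *[TP] x - a *[TP] y" by (simp add: tensor_pre_ops frag_extend_diff)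
  have 2: "a *[Y] (-[Y] k y) = -[Y] (a *[Y] k y)" by (rule Y.M.minus_equality[symmetric])
    (use a kc[OF y] in "simp_all add: Y.smult_r_distr[symmetric] Y.M.l_neg")
  show "k (a *[TP] (x - y)) = a *[Y] k (x - y)"
   unfolding 1 kd[OF tensor_pre_smult_closed[OF a x] tensor_pre_smult_closed[OF a y]] kd[OF x y] e
   using a kc[OF x] kc[OF y] by (simp add: Y.smult_r_distr 2)
 qed
 have kr: "k x = 0[Y] & x : carrier TP" if "x : TN" for x using that
 proof (rule tensor_rel_induct)
  show "k 0 = 0[Y] & 0 : carrier TP" by (simp add: k0 tensor_pre_carrier)
  fix y assume y: "y : tensor_relations R A M U"
  have "k y = 0[Y]" using y unfolding tensor_relations_def Un_iff mem_Collect_eq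
  proof (elim disjE exE conjE)
   fix m m' u assume y: "y = frag_of (m +[M] m', u) - frag_of (m, u) - frag_of (m', u)"
    and q: "m : carrier M" "m' : carrier M" "u : carrier U"
   show ?thesis unfolding y using q c[OF q(1,3)] c[OF q(2,3)]
    by (simp add: kd frag_in_pre diff_in_pre kp al Y.M.add_sub_cancel Y.M.r_neg)
  next
   fix m u u' assume y: "y = frag_of (m, u +[U] u') - frag_of (m, u) - frag_of (m, u')"
    and q: "m : carrier M" "u : carrier U" "u' : carrier U"
   show ?thesis unfolding y using q c[OF q(1,2)] c[OF q(1,3)]
    by (simp add: kd frag_in_pre diff_in_pre kp ar Y.M.add_sub_cancel Y.M.r_neg)
  next
   fix r m u assume y: "y = frag_of (r *[restrict_scalars A M] m, u) - frag_of (m, r *[U] u)"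
    and q: "r : carrier R" "m : carrier M" "u : carrier U"
   show ?thesis unfolding y using q c[OF q(2), of "r *[U] u"]
    by (simp add: kd frag_in_pre sc_closed[OF M] kp b Y.M.r_neg)
  qed
  then show "k y = 0[Y] & y : carrier TP" using y tensor_relations_in by blast
 next
  fix y assume y: "k y = 0[Y] & y : carrier TP"
  then show "k (- y) = 0[Y] & - y : carrier TP" using kd[of 0 y] by (simp add: tensor_pre_carrier k0)
 next
  fix y z assume "k y = 0[Y] & y : carrier TP" "k z = 0[Y] & z : carrier TP"
  then show "k (y + z) = 0[Y] & y + z : carrier TP" by (simp add: ka add_in_pre)
 qed
 define h where "h X = k (SOME x. x : carrier TP & X = ?c x)" for X
 have hk: "h (?c x) = k x" if x: "x : carrier TP" for x
 proof -
  define y where "y = (SOME y. y : carrier TP & ?c x = ?c y)"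
  have y: "y : carrier TP & ?c x = ?c y" unfolding y_def by (rule someI[of _ x]) (simp add: x)
  then have yp: "y : carrier TP" and "x - y : TN" using tensor_eq_iff[OF x, of y] by simp_all
  from conjunct1[OF kr[OF this(2)]] have "k x +[Y] -[Y] k y = 0[Y]" unfolding kd[OF x yp] .
  then have "k x = k y" using Y.M.diff_zero_iff[OF kc[OF x] kc[OF yp]] by simp
  then show ?thesis by (simp add: h_def y_def)
 qed
 have "h : mod_hom A ?T Y"
 proof (rule mod_homI)
  fix X assume "X : carrier ?T"
  then obtain x where x: "x : carrier TP" "X = ?c x" unfolding tensor_carrier by blast
  show "h X : carrier Y" using x by (simp add: hk kc)
  fix a assume a: "a : carrier A"
  show "h (a *[?T] X) = a *[Y] h X"
   unfolding x(2) tensor_smult[OF a x(1)] hk[OF tensor_pre_smult_closed[OF a x(1)]] hk[OF x(1)] by (rule ks[OF a x(1)])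
 next
  fix X Z assume "X : carrier ?T" "Z : carrier ?T"
  then obtain x z where x: "x : carrier TP" "X = ?c x" and z: "z : carrier TP" "Z = ?c z"
   unfolding tensor_carrier by blast
  show "h (X +[?T] Z) = h X +[Y] h Z"
   unfolding x(2) z(2) tensor_add[OF x(1) z(1)] hk[OF add_in_pre[OF x(1) z(1)]] hk[OF x(1)] hk[OF z(1)]
   by (rule ka[OF x(1) z(1)])
 qed
 moreover have "h (pure_tensor R A M U m u) = \<beta> m u" if "m : carrier M" "u : carrier U" for m u
  unfolding pure_tensor_def hk[OF frag_in_pre[OF that]] by (rule kp[OF that])
 ultimately show ?thesis by (rule that)
qed

end

end

section \<open>Twists by projective \<open>R\<close>-modules and additive closures\<close>

context assoc_algebra
begin

lemma pure_tensor_hom_left: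
 assumes M: "left_module A M" and U: "left_module R U" and u: "u : carrier U"
 shows "(%m. pure_tensor R A M U m u) : mod_hom A M (tensor R A M U)"
 using u pure_tensor_closed[OF M U] pure_tensor_add_left[OF M U] pure_tensor_smult[OF M U]
 by (intro mod_homI) simp_all

lemma pure_tensor_hom_right:
 assumes M: "left_module A M" and U: "left_module R U" and m: "m : carrier M"
 shows "(%u. pure_tensor R A M U m u) : mod_hom R U (restrict_scalars A (tensor R A M U))"
proof (rule mod_homI)
 interpret M: left_module A M by fact
 fix r u assume "r : carrier R" "u : carrier U"
 then show "pure_tensor R A M U m (r *[U] u) = r *[restrict_scalars A (tensor R A M U)] pure_tensor R A M U m u"
  using pure_tensor_balanced[OF M U, of r m u] pure_tensor_smult[OF M U one_scalar_closed, of r m u] m by simp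
qed (use m pure_tensor_closed[OF M U] pure_tensor_add_right[OF M U] in simp_all)

text \<open>A dual basis of \<open>U\<close> exhibits \<open>M \<otimes>\<^sub>R U\<close> as a direct summand of a power of \<open>M\<close>.\<close>

lemma tensor_add_of:
 assumes M: "left_module A M" and U: "fg_projective R U"
 shows "add_of A {M} (tensor R A M U)"
proof -
 have Um: "left_module R U" and Ua: "add_of R {regular R} U" using U fg_projective_iff[OF ring_R, of U] by simp_all
 let ?T = "tensor R A M U" and ?p = "pure_tensor R A M U"
 note T = tensor_left_module[OF M Um]
 interpret M: left_module A M by fact
 interpret T: left_module A ?T by fact
 interpret MR: left_module R "restrict_scalars A M" by (rule restrict_left_module[OF M])
 obtain L where L: "!!u \<phi>. (u, \<phi>) : set L ==> u : carrier U & \<phi> : mod_hom R U (regular R)"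
  "!!y. y : carrier U ==> y = lsum U (%(u, \<phi>). \<phi> y *[U] u) L" by (rule dual_basis[OF Um Ua]) (rule that)
 have ex: "\<exists>t. t : mod_hom A ?T M & (\<forall>m\<in>carrier M. \<forall>u\<in>carrier U. t (?p m u) = sc A M (\<phi> u) m)"
  if ph: "\<phi> : mod_hom R U (regular R)" for \<phi>
 proof -
  note pc = mod_hom_closed[OF ph, simplified]
  have comm: "sc A M r (sc A M s m) = sc A M s (sc A M r m)"
   if "r : carrier R" "s : carrier R" "m : carrier M" for r s m
   using sc_commute[OF M that(2) one_scalar_closed[OF that(1)] that(3)] .
  obtain t where "t : mod_hom A ?T M"
   "!!m u. [|m : carrier M; u : carrier U|] ==> t (?p m u) = sc A M (\<phi> u) m"
  proof (rule tensor_universal[OF M Um M, of "%m u. sc A M (\<phi> u) m"])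
   fix r m u assume r: "r : carrier R" and m: "m : carrier M" and u: "u : carrier U"
   have "sc A M (\<phi> (r *[U] u)) m = sc A M (r **[R] \<phi> u) m" using mod_hom_smult[OF ph r u] by simp
   also have "\<dots> = sc A M r (sc A M (\<phi> u) m)" using MR.smult_assoc1[OF r pc[OF u], of m] m by simp
   finally show "sc A M (\<phi> u) (sc A M r m) = sc A M (\<phi> (r *[U] u)) m" using comm[OF r pc[OF u] m] by simp
  next
   fix m u u' assume c: "m : carrier M" "u : carrier U" "u' : carrier U"
   show "sc A M (\<phi> (u +[U] u')) m = sc A M (\<phi> u) m +[M] sc A M (\<phi> u') m"
    using MR.smult_l_distr[OF pc[OF c(2)] pc[OF c(3)], of m] mod_hom_add[OF ph c(2,3)] c(1) by simp
  next
   fix a m u assume c: "a : carrier A" "m : carrier M" "u : carrier U"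
   show "sc A M (\<phi> u) (a *[M] m) = a *[M] sc A M (\<phi> u) m" by (rule sc_commute[OF M pc[OF c(3)] c(1,2), symmetric])
  next
   fix m u assume "m : carrier M" "u : carrier U"
   then show "sc A M (\<phi> u) m : carrier M" by (intro sc_closed[OF M] pc)
  next
   fix m m' u assume c: "m : carrier M" "m' : carrier M" "u : carrier U"
   show "sc A M (\<phi> u) (m +[M] m') = sc A M (\<phi> u) m +[M] sc A M (\<phi> u) m'"
    by (rule M.smult_r_distr[OF one_scalar_closed[OF pc[OF c(3)]] c(1,2)])
  qed (rule that)
  then show ?thesis by (intro exI[of _ t] conjI ballI)
 qed
 define tt where "tt \<phi> = (SOME t. t : mod_hom A ?T M & (\<forall>m\<in>carrier M. \<forall>u\<in>carrier U. t (?p m u) = sc A M (\<phi> u) m))" for \<phi>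
 have tt: "tt \<phi> : mod_hom A ?T M" "!!m u. [|m : carrier M; u : carrier U|] ==> tt \<phi> (?p m u) = sc A M (\<phi> u) m"
  if "\<phi> : mod_hom R U (regular R)" for \<phi> using someI_ex[OF ex[OF that]] unfolding tt_def[symmetric] by simp_all
 note ph = pure_tensor_hom_left[OF M Um] and pr = pure_tensor_hom_right[OF M Um]
 let ?L = "map (%(u, \<phi>). (tt \<phi>, %m. ?p m u)) L"
 have Lh: "t : mod_hom A ?T M & s : mod_hom A M ?T" if "(t, s) : set ?L" for t s using that L(1) tt(1) ph by auto
 show ?thesis unfolding add_of_def
 proof (rule sum_factors_of_list[OF T T Lh])
  fix x assume x: "x : carrier ?T"
  have h: "(%x. lsum ?T (%(t, s). s (t x)) ?L) : mod_hom A ?T ?T"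
   by (rule sum_factors_hom[OF T T sum_factors_of_list[OF T T Lh]]) simp_all
  show "x = lsum ?T (%(t, s). s (t x)) ?L"
  proof (rule tensor_hom_eqI[OF M Um T mod_hom_id h _ x])
   fix m u assume m: "m : carrier M" and u: "u : carrier U"
   have "lsum ?T (%(t, s). s (t (?p m u))) ?L = lsum ?T (%(w, \<phi>). ?p m (\<phi> u *[U] w)) L" unfolding lsum_map
   proof (rule lsum_cong)
    fix q assume q: "q : set L"
    obtain w \<phi> where [simp]: "q = (w, \<phi>)" by (cases q)
    have w: "w : carrier U" "\<phi> : mod_hom R U (regular R)" using L(1) q by simp_all
    show "(case case q of (u, \<phi>) => (tt \<phi>, %m. ?p m u) of (t, s) => s (t (?p m u))) =
     (case q of (w, \<phi>) => ?p m (\<phi> u *[U] w))"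
     using tt(2)[OF w(2) m u] pure_tensor_balanced[OF M Um mod_hom_closed[OF w(2) u, simplified] m w(1)] by simp
   qed
   also have "\<dots> = lsum (restrict_scalars A ?T) (%q. ?p m (case q of (w, \<phi>) => \<phi> u *[U] w)) L"
    by (simp add: case_prod_unfold)
   also have "\<dots> = ?p m (lsum U (%(w, \<phi>). \<phi> u *[U] w) L)"
   proof (rule lsum_hom[OF Um restrict_left_module[OF T] pr[OF m], symmetric])
    fix q assume q: "q : set L"
    obtain w \<phi> where [simp]: "q = (w, \<phi>)" by (cases q)
    show "(case q of (w, \<phi>) => \<phi> u *[U] w) : carrier U"
     using L(1)[of w \<phi>] q left_module.smult_closed[OF Um, of "\<phi> u" w] mod_hom_closed[of \<phi> R U "regular R" u] u by simp
   qed
   also have "\<dots> = ?p m u" using arg_cong[OF L(2)[OF u], of "?p m"] by (rule sym)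
   finally show "?p m u = lsum ?T (%(t, s). s (t (?p m u))) ?L" by (rule sym)
  qed
 qed
qed

text \<open>Conversely, if \<open>End\<^sub>A(M) = R\<close>, a summand \<open>X\<close> of a power of \<open>M\<close> is \<open>M \<otimes>\<^sub>R Hom\<^sub>A(M, X)\<close> by
 evaluation, and \<open>Hom\<^sub>A(M, X)\<close> is finitely generated projective over \<open>R\<close>.  So for such \<open>M\<close> the
 twists \<open>M \<otimes>\<^sub>R U\<close> are exactly the additive closure of \<open>M\<close>.\<close>

lemma add_of_is_tensor:
 fixes M :: "('a, 'm, 'z) module_scheme" and X :: "('a, 'n, 'w) module_scheme"
 assumes M: "left_module A M" and X: "left_module A X" and se: "scalar_end R A M" and a: "add_of A {M} X"
 obtains U :: "'r fgmod" where "fg_projective R U" "mod_iso A X (tensor R A M U)"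
proof -
 interpret M: left_module A M by fact
 interpret X: left_module A X by fact
 interpret XR: left_module R "restrict_scalars A X" by (rule restrict_left_module[OF X])
 let ?H = "hom_module (sc A X) A M X"
 have H: "left_module R ?H"
 proof (rule hom_module_left_module[OF M X ring_R])
  fix s a x assume "s : carrier R" "a : carrier A" "x : carrier X"
  then show "sc A X s (a *[X] x) = a *[X] sc A X s x" by (simp add: sc_commute[OF X])
 next
  fix s t x assume c: "s : carrier R" "t : carrier R" "x : carrier X"
  show "sc A X (s +[R] t) x = sc A X s x +[X] sc A X t x" using XR.smult_l_distr[of s t x] c by simp
  show "sc A X (s **[R] t) x = sc A X s (sc A X t x)" using XR.smult_assoc1[of s t x] c by simp
 next
  fix x assume "x : carrier X"
  then show "sc A X 1[R] x = x" using XR.smult_one[of x] by simp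
 qed (simp_all add: X.smult_r_distr)
 have Hm: "f : mod_hom A M X" if "f : carrier ?H" for f using that by (simp add: hom_module_simps)
 have ev: "(%f. f m) : mod_hom R ?H (restrict_scalars A X)" if "m : carrier M" for m
  using that mod_hom_closed[OF Hm] by (intro mod_homI) (simp_all add: hom_module_simps(3,4))
 obtain L where L: "!!t s. (t, s) : set L ==> t : mod_hom A X M & s : mod_hom A M X"
  "!!x. x : carrier X ==> x = lsum X (%(t, s). s (t x)) L"
  by (rule sum_factors_list[OF a[unfolded add_of_def]]) (rule that)
 obtain \<eta> where eta: "!!h. h : mod_hom A M M ==> \<eta> h : carrier R"
  "!!h x. [|h : mod_hom A M M; x : carrier M|] ==> h x = sc A M (\<eta> h) x"
  "!!h r. [|h : mod_hom A M M; r : carrier R; \<forall>x\<in>carrier M. h x = sc A M r x|] ==> \<eta> h = r"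
  by (rule scalar_coefficient[OF M se]) (rule that)
 define \<rho> where "\<rho> t f = \<eta> (%m. t (f m))" for t :: "'n => 'm" and f :: "'m => 'n"
 have tf: "(%m. t (f m)) : mod_hom A M M" if "t : mod_hom A X M" "f : carrier ?H" for t f
  by (rule mod_hom_comp[OF Hm[OF that(2)] that(1)])
 have rc: "\<rho> t f : carrier R" and re: "m : carrier M ==> t (f m) = sc A M (\<rho> t f) m"
  if "t : mod_hom A X M" "f : carrier ?H" for t f m
  unfolding \<rho>_def by (rule eta(1)[OF tf[OF that]], rule eta(2)[OF tf[OF that]])
 interpret MR: left_module R "restrict_scalars A M" by (rule restrict_left_module[OF M])
 interpret H: left_module R ?H by (fact H)
 have rhom: "\<rho> t : mod_hom R ?H (regular R)" if t: "t : mod_hom A X M" for t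
 proof (rule mod_homI)
  fix f assume f: "f : carrier ?H"
  show "\<rho> t f : carrier (regular R)" using rc[OF t f] by simp
  note fc = mod_hom_closed[OF Hm[OF f]]
  {
   fix r assume r: "r : carrier R"
   have rf: "r *[?H] f : carrier ?H" using r f by simp
   have "\<rho> t (r *[?H] f) = r **[R] \<rho> t f" unfolding \<rho>_def[of t "r *[?H] f"]
   proof (rule eta(3)[OF tf[OF t rf] _ ballI])
    show "t ((r *[?H] f) m) = sc A M (r **[R] \<rho> t f) m" if m: "m : carrier M" for m
     using mod_hom_sc[OF t r fc[OF m]] re[OF t f m] MR.smult_assoc1[OF r rc[OF t f], of m] m
     by (simp add: hom_module_simps(4))
   qed (use r rc[OF t f] in simp)
   then show "\<rho> t (r *[?H] f) = r *[regular R] \<rho> t f" by simp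
  next
   fix g assume g: "g : carrier ?H"
   have fg: "f +[?H] g : carrier ?H" using f g by simp
   have "\<rho> t (f +[?H] g) = \<rho> t f +[R] \<rho> t g" unfolding \<rho>_def[of t "f +[?H] g"]
   proof (rule eta(3)[OF tf[OF t fg] _ ballI])
    show "t ((f +[?H] g) m) = sc A M (\<rho> t f +[R] \<rho> t g) m" if m: "m : carrier M" for m
     using mod_hom_add[OF t fc[OF m] mod_hom_closed[OF Hm[OF g] m]] re[OF t f m] re[OF t g m]
      MR.smult_l_distr[OF rc[OF t f] rc[OF t g], of m] m by (simp add: hom_module_simps(3))
   qed (use rc[OF t f] rc[OF t g] in simp)
   then show "\<rho> t (f +[?H] g) = \<rho> t f +[regular R] \<rho> t g" by simp
  }
 qed
 let ?rs = "%s. restrict s (carrier M)"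
 have sH: "?rs s : carrier ?H" if "s : mod_hom A M X" for s by (rule hom_module_restrict[OF M that])
 have LH: "\<rho> t f *[?H] ?rs s : carrier ?H" if "(t, s) : set L" "f : carrier ?H" for t s f
  using H.smult_closed rc[of t f] sH[of s] L(1)[OF that(1)] that(2) by simp
 have basis: "f = lsum ?H (%(t, s). \<rho> t f *[?H] ?rs s) L" if f: "f : carrier ?H" for f
 proof (rule hom_module_eqI[OF f])
  show "lsum ?H (%(t, s). \<rho> t f *[?H] ?rs s) L : carrier ?H" by (rule H.M.lsum_closed) (use LH f in auto)
  fix m assume m: "m : carrier M"
  have "f m = lsum X (%(t, s). s (t (f m))) L" by (rule L(2)[OF mod_hom_closed[OF Hm[OF f] m]])
  also have "\<dots> = lsum X (%q. (case q of (t, s) => \<rho> t f *[?H] ?rs s) m) L"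
  proof (rule lsum_cong)
   fix q assume q: "q : set L"
   obtain t s where [simp]: "q = (t, s)" by (cases q)
   have ts: "t : mod_hom A X M" "s : mod_hom A M X" using L(1) q by simp_all
   have "s (t (f m)) = sc A X (\<rho> t f) (s m)"
    unfolding re[OF ts(1) f m] by (rule mod_hom_sc[OF ts(2) rc[OF ts(1) f] m])
   then show "(case q of (t, s) => s (t (f m))) = (case q of (t, s) => \<rho> t f *[?H] ?rs s) m"
    using m by (simp add: hom_module_simps(4))
  qed
  also have "\<dots> = (lsum ?H (%(t, s). \<rho> t f *[?H] ?rs s) L) m"
  proof -
   have "(lsum ?H (%(t, s). \<rho> t f *[?H] ?rs s) L) m
     = lsum (restrict_scalars A X) (%q. (case q of (t, s) => \<rho> t f *[?H] ?rs s) m) L"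
    by (rule lsum_hom[OF H restrict_left_module[OF X] ev[OF m]]) (use LH f in auto)
   then show ?thesis by simp
  qed
  finally show "f m = (lsum ?H (%(t, s). \<rho> t f *[?H] ?rs s) L) m" .
 qed
 have "add_of R {regular R} ?H"
 proof (rule add_of_regularI[OF H, of "map (%(t, s). (?rs s, \<rho> t)) L"])
  fix x \<phi> assume "(x, \<phi>) : set (map (%(t, s). (?rs s, \<rho> t)) L)"
  then show "x : carrier ?H & \<phi> : mod_hom R ?H (regular R)" using L(1) sH rhom by auto
 next
  fix f assume "f : carrier ?H"
  from basis[OF this] show "f = lsum ?H (%(x, \<phi>). \<phi> f *[?H] x) (map (%(t, s). (?rs s, \<rho> t)) L)"
   by (simp add: lsum_map case_prod_unfold)
 qed
 then have fpH: "fg_projective R ?H" using fg_projective_iff[OF ring_R, of ?H] H by simp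
 obtain U :: "'r fgmod" where U: "fg_module R U" "mod_iso R U ?H"
  by (rule fgmod_copy[of R ?H]) (use fpH in "simp_all add: fg_projective_def")
 have Um: "left_module R U" using U(1) by (simp add: fg_module_def)
 have Ua: "add_of R {regular R} U"
  by (rule add_of_iso[OF Um H U(2)]) (use fpH fg_projective_iff[OF ring_R, of ?H] in simp)
 have fpU: "fg_projective R U" using fg_projective_iff[OF ring_R, of U] Um Ua by simp
 obtain j k where j: "j : mod_hom R U ?H" and k: "k : mod_hom R ?H U"
  and kj: "!!u. u : carrier U ==> k (j u) = u" and jk: "!!f. f : carrier ?H ==> j (k f) = f"
  by (rule mod_iso_obtain[OF Um U(2)]) (rule that)
 let ?T = "tensor R A M U" and ?p = "pure_tensor R A M U"
 note T = tensor_left_module[OF M Um]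
 have jm: "j u : mod_hom A M X" if "u : carrier U" for u using Hm[OF mod_hom_closed[OF j that]] .
 obtain e where e: "e : mod_hom A ?T X" "!!m u. [|m : carrier M; u : carrier U|] ==> e (?p m u) = j u m"
 proof (rule tensor_universal[OF M Um X, of "%m u. j u m"])
  fix m u assume m: "m : carrier M" and u: "u : carrier U"
  show "j u m : carrier X" by (rule mod_hom_closed[OF jm[OF u] m])
  show "j u (m +[M] m') = j u m +[X] j u m'" if "m' : carrier M" for m' by (rule mod_hom_add[OF jm[OF u] m that])
  show "j (u +[U] u') m = j u m +[X] j u' m" if "u' : carrier U" for u'
   using m by (simp add: mod_hom_add[OF j u that] hom_module_simps(3))
  show "j u (sc A M r m) = j (r *[U] u) m" if "r : carrier R" for r
   using m by (simp add: mod_hom_smult[OF j that u] hom_module_simps(4) mod_hom_sc[OF jm[OF u] that m])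
  show "j u (a *[M] m) = a *[X] j u m" if "a : carrier A" for a by (rule mod_hom_smult[OF jm[OF u] that m])
 qed (rule that)
 note ph = pure_tensor_hom_left[OF M Um] and pr = pure_tensor_hom_right[OF M Um]
 have ks: "k (?rs s) : carrier U" if "s : mod_hom A M X" for s by (rule mod_hom_closed[OF k sH[OF that]])
 let ?i = "%x. lsum ?T (%q. case q of (t, s) => ?p (t x) (k (?rs s))) L"
 have i: "?i : mod_hom A X ?T"
 proof (rule mod_hom_lsum[OF T])
  fix q assume q: "q : set L"
  obtain t s where [simp]: "q = (t, s)" by (cases q)
  have ts: "t : mod_hom A X M" "s : mod_hom A M X" using L(1) q by simp_all
  show "(%x. case q of (t, s) => ?p (t x) (k (?rs s))) : mod_hom A X ?T"
   using mod_hom_comp[OF ts(1) ph[OF ks[OF ts(2)]]] by simp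
 qed
 have "mod_iso A X ?T"
 proof (rule mod_isoI[OF i e(1)])
  fix x assume x: "x : carrier X"
  have "e (?i x) = lsum X (%q. e (case q of (t, s) => ?p (t x) (k (?rs s)))) L"
  proof (rule lsum_hom[OF T X e(1)])
   fix q assume q: "q : set L"
   obtain t s where [simp]: "q = (t, s)" by (cases q)
   have ts: "t : mod_hom A X M" "s : mod_hom A M X" using L(1) q by simp_all
   show "(case q of (t, s) => ?p (t x) (k (?rs s))) : carrier ?T"
    using pure_tensor_closed[OF M Um mod_hom_closed[OF ts(1) x] ks[OF ts(2)]] by simp
  qed
  also have "\<dots> = lsum X (%(t, s). s (t x)) L"
  proof (rule lsum_cong)
   fix q assume q: "q : set L"
   obtain t s where [simp]: "q = (t, s)" by (cases q)
   have ts: "t : mod_hom A X M" "s : mod_hom A M X" using L(1) q by simp_all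
   show "e (case q of (t, s) => ?p (t x) (k (?rs s))) = (case q of (t, s) => s (t x))"
    using e(2)[OF mod_hom_closed[OF ts(1) x] ks[OF ts(2)]] jk[OF sH[OF ts(2)]] mod_hom_closed[OF ts(1) x] by simp
  qed
  also have "\<dots> = x" by (rule L(2)[OF x, symmetric])
  finally show "e (?i x) = x" .
 next
  fix z assume z: "z : carrier ?T"
  show "?i (e z) = z"
  proof (rule tensor_hom_eqI[OF M Um T mod_hom_comp[OF e(1) i] mod_hom_id _ z])
   fix m u assume m: "m : carrier M" and u: "u : carrier U"
   note ju = mod_hom_closed[OF j u]
   have "?i (e (?p m u)) = lsum ?T (%q. ?p m (k (case q of (t, s) => \<rho> t (j u) *[?H] ?rs s))) L"
    unfolding e(2)[OF m u]
   proof (rule lsum_cong)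
    fix q assume q: "q : set L"
    obtain t s where [simp]: "q = (t, s)" by (cases q)
    have ts: "t : mod_hom A X M" "s : mod_hom A M X" using L(1) q by simp_all
    have "?p (t (j u m)) (k (?rs s)) = ?p m (\<rho> t (j u) *[U] k (?rs s))"
     unfolding re[OF ts(1) ju m] by (rule pure_tensor_balanced[OF M Um rc[OF ts(1) ju] m ks[OF ts(2)]])
    then show "(case q of (t, s) => ?p (t (j u m)) (k (?rs s))) = ?p m (k (case q of (t, s) => \<rho> t (j u) *[?H] ?rs s))"
     using mod_hom_smult[OF k rc[OF ts(1) ju] sH[OF ts(2)]] by simp
   qed
   also have "\<dots> = ?p m (k (lsum ?H (%(t, s). \<rho> t (j u) *[?H] ?rs s) L))"
   proof -
    have "?p m (k (lsum ?H (%(t, s). \<rho> t (j u) *[?H] ?rs s) L))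
      = lsum (restrict_scalars A ?T) (%q. ?p m (k (case q of (t, s) => \<rho> t (j u) *[?H] ?rs s))) L"
     by (rule lsum_hom[OF H restrict_left_module[OF T] mod_hom_comp[OF k pr[OF m]]]) (use LH ju in auto)
    then show ?thesis by simp
   qed
   also have "\<dots> = ?p m (k (j u))" using arg_cong[OF basis[OF ju], of "%f. ?p m (k f)"] by (rule sym)
   also have "\<dots> = ?p m u" by (simp only: kj[OF u])
   finally show "?i (e (?p m u)) = ?p m u" .
  qed
 qed
 with fpU show ?thesis by (rule that)
qed

end

section \<open>Filtrations with layers in additive closures\<close>

text \<open>The layers lie in the additive closure of one module \<open>X\<close> each.  For modules with endomorphism ring
 \<open>R\<close> these are the filtrations by twists \<open>X \<otimes>\<^sub>R U\<close>, but no tensor product occurs, and the notion is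
 visibly preserved by dualizing.\<close>

inductive Filt ::
 "('a, 'x) ring_scheme => ('a, 't, 'z) module_scheme set => ('a, 'm, 'y) module_scheme => 'm set => bool"
 for A Ms M where
 zero: "Filt A Ms M {0[M]}"
| step: "[|Filt A Ms M F; submodule W A M; F <= W; X : Ms;
  add_of A {X} (quotient_module (M(|carrier := W|)) F)|] ==> Filt A Ms M W"

lemma Filt_submodule: "[|Filt A Ms M F; left_module A M|] ==> submodule F A M"
 by (cases rule: Filt.cases) (simp_all add: zero_submodule)

lemma layer_module:
 assumes "left_module A M" "submodule W A M" "submodule F A M" "F <= W"
 shows "left_module A (quotient_module (M(|carrier := W|)) F)"
 by (rule quotient_left_module[OF submodule_module[OF assms(1,2)] submodule_of_submodule[OF assms]])

lemma filtered_imp_Filt: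
 assumes M: "left_module A M" and th: "!!X. X : \<theta> ==> left_module A X & (\<exists>Y\<in>Ms. add_of A {Y} X)"
  and f: "filtered A \<theta> M"
 shows "Filt A Ms M (carrier M)"
proof -
 obtain n F where F: "\<forall>i\<le>n. submodule (F i) A M" "F 0 = {0[M]}" "F n = carrier M"
  "\<forall>i<n. F i <= F (Suc i) & (\<exists>X\<in>\<theta>. mod_iso A (quotient_module (M(|carrier := F (Suc i)|)) (F i)) X)"
  using f unfolding filtered_def by blast
 have "Filt A Ms M (F i)" if "i \<le> n" for i using that
 proof (induction i)
  case 0
  show ?case unfolding F(2) by (rule Filt.zero)
 next
  case (Suc i)
  then have i: "i < n" "i \<le> n" by simp_all
  have sub: "submodule (F i) A M" "submodule (F (Suc i)) A M" "F i <= F (Suc i)"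
   using F(1,4) Suc.prems i by simp_all
  obtain X where X: "X : \<theta>" "mod_iso A (quotient_module (M(|carrier := F (Suc i)|)) (F i)) X"
   using F(4) i(1) by blast
  obtain Y where Y: "Y : Ms" "add_of A {Y} X" and Xm: "left_module A X" using th[OF X(1)] by blast
  show ?case by (rule Filt.step[OF Suc.IH[OF i(2)] sub(2,3) Y(1)])
    (rule add_of_iso[OF layer_module[OF M sub(2,1,3)] Xm X(2) Y(2)])
 qed
 from this[of n] show ?thesis using F(3) by simp
qed

lemma Filt_imp_filtered:
 assumes M: "left_module A M"
  and th: "!!Y (Q :: ('a, 'm set) module). [|Y : Ms; left_module A Q; add_of A {Y} Q|] ==> \<exists>X\<in>\<theta>. mod_iso A Q X"
  and f: "Filt A Ms (M :: ('a, 'm, 'y) module_scheme) (carrier M)" and fg: "fin_gen A M"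
 shows "filtered A \<theta> M"
proof -
 have "\<exists>(n::nat) F. (\<forall>i\<le>n. submodule (F i) A M) & F 0 = {0[M]} & F n = W \<and>
    (\<forall>i<n. F i <= F (Suc i) \<and>
     (\<exists>X\<in>\<theta>. mod_iso A (quotient_module (M(|carrier := F (Suc i)|)) (F i)) X))"
  if "Filt A Ms M W" for W using that
 proof induction
  case zero
  show ?case by (intro exI[of _ "0::nat"] exI[of _ "%_. {0[M]}"]) (simp add: zero_submodule[OF M])
 next
  case (step E W Y)
  obtain n :: nat and F where F: "\<forall>i\<le>n. submodule (F i) A M" "F 0 = {0[M]}" "F n = E"
   "\<forall>i<n. F i <= F (Suc i) & (\<exists>X\<in>\<theta>. mod_iso A (quotient_module (M(|carrier := F (Suc i)|)) (F i)) X)"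
   using step.IH by blast
  have E: "submodule E A M" by (rule Filt_submodule[OF step(1) M])
  have last: "\<exists>X\<in>\<theta>. mod_iso A (quotient_module (M(|carrier := W|)) E) X"
   by (rule th[OF step(4) layer_module[OF M step(2) E step(3)] step(5)])
  let ?G = "F(Suc n := W)"
  have "\<forall>i\<le>Suc n. submodule (?G i) A M" using F(1) step(2) by (simp add: le_Suc_eq)
  moreover have "?G 0 = {0[M]}" "?G (Suc n) = W" using F(2) by simp_all
  moreover have "\<forall>i<Suc n. ?G i <= ?G (Suc i) \<and>
    (\<exists>X\<in>\<theta>. mod_iso A (quotient_module (M(|carrier := ?G (Suc i)|)) (?G i)) X)"
  proof (intro allI impI)
   fix i assume "i < Suc n"
   then consider "i = n" | "i < n" by linarith
   then show "?G i <= ?G (Suc i) & (\<exists>X\<in>\<theta>. mod_iso A (quotient_module (M(|carrier := ?G (Suc i)|)) (?G i)) X)"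
   proof cases
    case 1
    then show ?thesis using F(3) step(3) last by simp
   next
    case 2
    then show ?thesis using F(4) by simp
   qed
  qed
  ultimately show ?case by (intro exI[of _ "Suc n"] exI[of _ ?G] conjI)
 qed
 from this[OF f] show ?thesis unfolding filtered_def fg_module_def using M fg by simp
qed

text \<open>Twists by projective \<open>R\<close>-modules and additive closures agree because the endomorphism rings are \<open>R\<close>.\<close>

lemma (in assoc_algebra) filtered_tensor_above_iff:
 fixes M :: "('a, 'm, 'z) module_scheme"
 assumes M: "left_module A M" and fg: "fin_gen A M"
  and D: "!!\<mu>. \<mu> : \<Lambda> ==> left_module A (D \<mu>)" and se: "!!\<mu>. \<mu> : \<Lambda> ==> scalar_end R A (D \<mu>)"
 shows "filtered A (tensor_above R A \<Lambda> D \<alpha>) M \<longleftrightarrow> Filt A (D ` {\<mu> : \<Lambda>. \<alpha> < \<mu>}) M (carrier M)"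
proof
 assume "filtered A (tensor_above R A \<Lambda> D \<alpha>) M"
 then show "Filt A (D ` {\<mu> : \<Lambda>. \<alpha> < \<mu>}) M (carrier M)"
 proof (rule filtered_imp_Filt[OF M, rotated])
  fix X assume "X : tensor_above R A \<Lambda> D \<alpha>"
  then obtain \<mu> and U :: "'r fgmod" where X: "X = tensor R A (D \<mu>) U" "\<mu> : \<Lambda>" "\<alpha> < \<mu>" "fg_projective R U"
   unfolding tensor_above_def by blast
  have U: "left_module R U" using X(4) fg_projective_iff[OF ring_R, of U] by simp
  show "left_module A X & (\<exists>Y\<in>D ` {\<mu> : \<Lambda>. \<alpha> < \<mu>}. add_of A {Y} X)"
   using X(2,3) tensor_left_module[OF D[OF X(2)] U] tensor_add_of[OF D[OF X(2)] X(4)] unfolding X(1)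
   by (intro conjI bexI[of _ "D \<mu>"]) simp_all
 qed
next
 assume "Filt A (D ` {\<mu> : \<Lambda>. \<alpha> < \<mu>}) M (carrier M)"
 then show "filtered A (tensor_above R A \<Lambda> D \<alpha>) M"
 proof (rule Filt_imp_filtered[OF M _ _ fg, rotated])
  fix Y and Q :: "('a, 'm set) module"
  assume "Y : D ` {\<mu> : \<Lambda>. \<alpha> < \<mu>}" and Q: "left_module A Q" "add_of A {Y} Q"
  then obtain \<mu> where m: "\<mu> : \<Lambda>" "\<alpha> < \<mu>" "Y = D \<mu>" by blast
  obtain U :: "'r fgmod" where U: "fg_projective R U" "mod_iso A Q (tensor R A (D \<mu>) U)"
   by (rule add_of_is_tensor[OF D[OF m(1)] Q(1) se[OF m(1)] Q(2)[unfolded m(3)]]) (rule that)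
  show "\<exists>X\<in>tensor_above R A \<Lambda> D \<alpha>. mod_iso A Q X" using U(2) by (rule bexI[of _ "tensor R A (D \<mu>) U"])
    (use m U(1) in "unfold tensor_above_def, blast")
 qed
qed

section \<open>Moving filtrations along homomorphisms\<close>

lemma carrier_update_twice [simp]: "M(|carrier := W, carrier := F|) = M(|carrier := F|)" by simp

text \<open>Continue a filtration of the kernel by the preimages of a filtration of the target.\<close>

lemma Filt_preimage:
 assumes M: "left_module A M" and N: "left_module A N" and p: "p : mod_hom A M N" "p ` carrier M = carrier N"
  and k: "Filt A Ms M {y : carrier M. p y = 0[N]}" and f: "Filt A Ms N G"
 shows "Filt A Ms M {y : carrier M. p y : G}" using f
proof induction
 case zero
 show ?case using k by simp
next
 case (step F W X)
 have F: "submodule F A N" by (rule Filt_submodule[OF step(1) N])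
 note W = step(2)
 let ?W = "{y : carrier M. p y : W}" and ?F = "{y : carrier M. p y : F}"
 have pW: "submodule ?W A M" and pF: "submodule ?F A M" by (rule preimage_submodule[OF M N p(1)], fact)+
 have sub: "?F <= ?W" using step(3) by blast
 let ?MW = "M(|carrier := ?W|)" and ?NW = "N(|carrier := W|)"
 have MW: "left_module A ?MW" and NW: "left_module A ?NW"
  by (rule submodule_module[OF M pW], rule submodule_module[OF N W])
 have FW: "submodule F A ?NW" by (rule submodule_of_submodule[OF N W F step(3)])
 have pFW: "submodule ?F A ?MW" by (rule submodule_of_submodule[OF M pW pF sub])
 have pr: "p : mod_hom A ?MW ?NW" by (rule mod_hom_into_submodule[OF mod_hom_from_submodule[OF p(1)]]) auto
 have q: "(%y. F +>\<^bsub>?NW\<^esub> p y) : mod_hom A ?MW (quotient_module ?NW F)"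
  by (rule mod_hom_comp[OF pr quotient_proj[OF NW FW]])
 have pW_surj: "p ` ?W = W" using p(2) submodule_subset[OF W] by force
 have "mod_iso A (quotient_module ?MW ?F) (quotient_module ?NW F)"
 proof (rule quotient_iso[OF MW layer_module[OF N W F step(3)] q _ pFW])
  have "(%y. F +>\<^bsub>?NW\<^esub> p y) ` carrier ?MW = (%x. F +>\<^bsub>?NW\<^esub> x) ` (p ` ?W)" by (simp add: image_image)
  then show "(%y. F +>\<^bsub>?NW\<^esub> p y) ` carrier ?MW = carrier (quotient_module ?NW F)"
   unfolding quotient_carrier[OF NW FW] pW_surj by simp
  fix y assume y: "y : carrier ?MW"
  then have "p y : carrier ?NW" by simp
  then show "(F +>\<^bsub>?NW\<^esub> p y = 0[quotient_module ?NW F]) = (y : ?F)"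
   using quotient_proj_kernel[OF NW FW, of "p y"] y by simp
 qed
 from add_of_iso[OF layer_module[OF M pW pF sub] layer_module[OF N W F step(3)] this step(5)]
 show ?case by (rule Filt.step[OF step.IH pW sub step(4)])
qed

lemma Filt_iso:
 assumes M: "left_module A M" and N: "left_module A N" and iso: "mod_iso A M N" and f: "Filt A Ms N (carrier N)"
 shows "Filt A Ms M (carrier M)"
proof (rule mod_iso_obtain[OF M iso])
 fix p g assume p: "p : mod_hom A M N" and g: "g : mod_hom A N M"
  and gp: "!!x. x : carrier M ==> g (p x) = x" and pg: "!!y. y : carrier N ==> p (g y) = y"
 have s: "p ` carrier M = carrier N"
  using mod_hom_closed[OF p] mod_hom_closed[OF g] pg by (metis (no_types, lifting) image_iff subsetI subset_antisym image_subsetI)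
 have k: "{y : carrier M. p y = 0[N]} = {0[M]}"
 proof
  show "{y : carrier M. p y = 0[N]} <= {0[M]}"
  proof
   fix y assume "y : {y : carrier M. p y = 0[N]}"
   then show "y : {0[M]}" using gp[of y] mod_hom_zero[OF N M g] by simp
  qed
  show "{0[M]} <= {y : carrier M. p y = 0[N]}"
   using mod_hom_zero[OF M N p] submodule_zero[OF carrier_submodule[OF M]] by simp
 qed
 have "Filt A Ms M {y : carrier M. p y : carrier N}" by (rule Filt_preimage[OF M N p s _ f]) (simp only: k Filt.zero)
 moreover have "{y : carrier M. p y : carrier N} = carrier M" using mod_hom_closed[OF p] by blast
 ultimately show ?thesis by simp
qed

lemma Filt_image:
 assumes M: "left_module A M" and N: "left_module A N" and i: "i : mod_hom A M N" "inj_on i (carrier M)"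
  and f: "Filt A Ms M G"
 shows "Filt A Ms N (i ` G)" using f
proof induction
 case zero
 show ?case using Filt.zero[of A Ms N] mod_hom_zero[OF M N i(1)] by simp
next
 case (step F W X)
 have F: "submodule F A M" by (rule Filt_submodule[OF step(1) M])
 note W = step(2)
 note Ws = submodule_subset[OF W]
 have iW: "submodule (i ` W) A N" and iF: "submodule (i ` F) A N" by (rule image_submodule[OF M N i(1)], fact)+
 have sub: "i ` F <= i ` W" using step(3) by blast
 let ?MW = "M(|carrier := W|)" and ?NW = "N(|carrier := i ` W|)"
 have MW: "left_module A ?MW" and NW: "left_module A ?NW"
  by (rule submodule_module[OF M W], rule submodule_module[OF N iW])
 have FW: "submodule F A ?MW" by (rule submodule_of_submodule[OF M W F step(3)])
 have iFW: "submodule (i ` F) A ?NW" by (rule submodule_of_submodule[OF N iW iF sub])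
 have ih: "i : mod_hom A ?MW ?NW" by (rule mod_hom_into_submodule[OF mod_hom_from_submodule[OF i(1) Ws]]) auto
 have q: "(%y. i ` F +>\<^bsub>?NW\<^esub> i y) : mod_hom A ?MW (quotient_module ?NW (i ` F))"
  by (rule mod_hom_comp[OF ih quotient_proj[OF NW iFW]])
 have iso: "mod_iso A (quotient_module ?MW F) (quotient_module ?NW (i ` F))"
 proof (rule quotient_iso[OF MW layer_module[OF N iW iF sub] q _ FW])
  show "(%y. i ` F +>\<^bsub>?NW\<^esub> i y) ` carrier ?MW = carrier (quotient_module ?NW (i ` F))"
   unfolding quotient_carrier[OF NW iFW] by (simp add: image_image)
  fix y assume y: "y : carrier ?MW"
  then have y': "y : carrier M" "i y : carrier ?NW" using Ws by auto
  have "i y : i ` F \<longleftrightarrow> y : F" by (rule inj_on_image_mem_iff[OF i(2) y'(1) submodule_subset[OF F]])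
  then show "(i ` F +>\<^bsub>?NW\<^esub> i y = 0[quotient_module ?NW (i ` F)]) = (y : F)"
   using quotient_proj_kernel[OF NW iFW y'(2)] by simp
 qed
 have "mod_iso A (quotient_module ?NW (i ` F)) (quotient_module ?MW F)"
  by (rule mod_iso_sym[OF layer_module[OF M W F step(3)] iso])
 from add_of_iso[OF layer_module[OF N iW iF sub] layer_module[OF M W F step(3)] this step(5)]
 show ?case by (rule Filt.step[OF step.IH iW sub step(4)])
qed

lemma Filt_extension:
 assumes L: "left_module A L" and M: "left_module A M" and N: "left_module A N"
  and ex: "short_exact A L i M p N" and X: "X : Ms" "add_of A {X} L" and f: "Filt A Ms N (carrier N)"
 shows "Filt A Ms M (carrier M)"
proof -
 have i: "i : mod_hom A L M" "inj_on i (carrier L)" and p: "p : mod_hom A M N" "p ` carrier M = carrier N"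
  and ik: "i ` carrier L = {y : carrier M. p y = 0[N]}" using ex by (simp_all add: short_exact_def a_kernel_eq)
 have "Filt A {X} L (carrier L)"
 proof (rule Filt.step[OF Filt.zero carrier_submodule[OF L]])
  show "{0[L]} <= carrier L" using submodule_zero[OF carrier_submodule[OF L]] by simp
  have z: "submodule {0[L]} A L" by (rule zero_submodule[OF L])
  have "mod_iso A (quotient_module L {0[L]}) L" by (rule quotient_iso[OF L L mod_hom_id _ z]) simp_all
  then have "add_of A {X} (quotient_module L {0[L]})" by (rule add_of_iso[OF quotient_left_module[OF L z] L _ X(2)])
  then show "add_of A {X} (quotient_module (L(|carrier := carrier L|)) {0[L]})" by simp
 qed simp
 then have "Filt A Ms L (carrier L)"
 proof (induction)
  case zero
  show ?case by (rule Filt.zero)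
 next
  case (step F W Y)
  then show ?case using X(1) by (intro Filt.step[of A Ms L F W Y]) simp_all
 qed
 from Filt_image[OF L M i this] have "Filt A Ms M {y : carrier M. p y = 0[N]}" unfolding ik .
 from Filt_preimage[OF M N p this f] have "Filt A Ms M {y : carrier M. p y : carrier N}" .
 moreover have "{y : carrier M. p y : carrier N} = carrier M" using mod_hom_closed[OF p(1)] by blast
 ultimately show ?thesis by simp
qed

text \<open>Additive closures compose, so a layer may be moved to a larger one.\<close>

lemma Filt_change:
 assumes M: "left_module A M" and ms: "!!X. X : Ms ==> left_module A X & (\<exists>Y\<in>Ns. add_of A {Y} X)"
  and f: "Filt A Ms M F"
 shows "Filt A Ns M F" using f
proof induction
 case zero
 show ?case by (rule Filt.zero)
next
 case (step F W X)
 obtain Y where Y: "Y : Ns" "add_of A {Y} X" and X: "left_module A X" using ms[OF step(4)] by blast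
 have Q: "left_module A (quotient_module (M(|carrier := W|)) F)"
  by (rule layer_module[OF M step(2) Filt_submodule[OF step(1) M] step(3)])
 have "add_of A {Y} (quotient_module (M(|carrier := W|)) F)"
  by (rule add_of_trans[OF Q _ step(5)]) (use X Y(2) in simp)
 then show ?case by (rule Filt.step[OF step.IH step(2,3) Y(1)])
qed

section \<open>Split sequences\<close>

text \<open>Lift the identity of the projective \<open>N\<close>.\<close>

lemma split_exact:
 assumes L: "left_module R L" and M: "left_module R M" and N: "left_module R N"
  and ex: "short_exact R L i M p N" and a: "add_of R {regular R} N"
 obtains \<sigma> \<rho> where "\<sigma> : mod_hom R N M" "\<rho> : mod_hom R M L"
  "!!x. x : carrier N ==> p (\<sigma> x) = x" "!!x. x : carrier L ==> \<rho> (i x) = x"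
  "!!y. y : carrier M ==> y = i (\<rho> y) +[M] \<sigma> (p y)"
proof -
 interpret L: left_module R L by fact
 interpret M: left_module R M by fact
 interpret N: left_module R N by fact
 have i: "i : mod_hom R L M" "inj_on i (carrier L)" and p: "p : mod_hom R M N" "p ` carrier M = carrier N"
  and ik: "i ` carrier L = {y : carrier M. p y = 0[N]}" using ex by (simp_all add: short_exact_def a_kernel_eq)
 obtain \<sigma> where s: "\<sigma> : mod_hom R N M" "!!x. x : carrier N ==> p (\<sigma> x) = x"
  by (rule projective_lifting[OF N a M N p mod_hom_id]) (rule that)
 let ?I = "M(|carrier := i ` carrier L|)"
 have iI: "i : mod_hom R L ?I" by (rule mod_hom_into_submodule[OF i(1)]) simp
 have bij: "bij_betw i (carrier L) (carrier ?I)" using i(2) by (simp add: bij_betw_def)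
 let ?k = "inv_into (carrier L) i"
 have k: "?k : mod_hom R ?I L" by (rule mod_hom_inverse[OF L iI bij])
 have ki: "?k (i x) = x" if "x : carrier L" for x by (rule inv_into_f_f[OF i(2) that])
 have kc: "i (?k y) = y" if "y : i ` carrier L" for y by (rule f_inv_into_f[OF that])
 let ?d = "%y. y +[M] -[M] \<sigma> (p y)"
 have d: "?d : mod_hom R M M" by (rule mod_hom_plus[OF M mod_hom_id mod_hom_uminus[OF M mod_hom_comp[OF p(1) s(1)]]])
 have dI: "?d y : i ` carrier L" if y: "y : carrier M" for y
 proof -
  have py: "p y : carrier N" and sy: "\<sigma> (p y) : carrier M"
   using mod_hom_closed[OF p(1) y] mod_hom_closed[OF s(1)] by simp_all
  have "p (?d y) = p y +[N] -[N] p (\<sigma> (p y))"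
   using mod_hom_add[OF p(1) y M.M.a_inv_closed[OF sy]] mod_hom_minus[OF M N p(1) sy] by simp
  then have "p (?d y) = 0[N]" unfolding s(2)[OF py] using N.M.r_neg[OF py] by simp
  then show ?thesis unfolding ik using mod_hom_closed[OF d y] by simp
 qed
 have r: "(%y. ?k (?d y)) : mod_hom R M L" by (rule mod_hom_comp[OF mod_hom_into_submodule[OF d dI] k])
 show ?thesis
 proof (rule that[OF s(1) r s(2)])
  fix x assume x: "x : carrier L"
  have ix: "i x : carrier M" "p (i x) = 0[N]" using ik x by blast+
  have "?d (i x) = i x" using ix mod_hom_zero[OF N M s(1)] by simp
  then show "?k (?d (i x)) = x" using ki[OF x] by simp
 next
  fix y assume y: "y : carrier M"
  have sy: "\<sigma> (p y) : carrier M" using mod_hom_closed[OF s(1) mod_hom_closed[OF p(1) y]] .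
  have "i (?k (?d y)) +[M] \<sigma> (p y) = ?d y +[M] \<sigma> (p y)" unfolding kc[OF dI[OF y]] ..
  also have "\<dots> = y" using y sy by (simp add: M.M.a_assoc M.M.l_neg)
  finally show "y = i (?k (?d y)) +[M] \<sigma> (p y)" by (rule sym)
 qed
qed

context assoc_algebra
begin

lemma short_exact_restrict_scalars:
 assumes "short_exact A L i M p N"
 shows "short_exact R (restrict_scalars A L) i (restrict_scalars A M) p (restrict_scalars A N)"
 using assms by (simp add: short_exact_def a_kernel_eq mod_hom_restrict_scalars)

text \<open>The sequence splits over \<open>R\<close>.\<close>

lemma lattice_extension:
 assumes L: "lattice R A L" and M: "left_module A M" and N: "lattice R A N" and ex: "short_exact A L i M p N"
 shows "lattice R A M"
proof -
 note Lm = restrict_left_module[OF lattice_module[OF L]] and Nm = restrict_left_module[OF lattice_module[OF N]]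
  and Mm = restrict_left_module[OF M]
 have a: "add_of R {regular R} (restrict_scalars A N)" "add_of R {regular R} (restrict_scalars A L)"
  using L N by (simp_all add: lattice_def)
 obtain \<sigma> \<rho> where s: "\<sigma> : mod_hom R (restrict_scalars A N) (restrict_scalars A M)"
  and r: "\<rho> : mod_hom R (restrict_scalars A M) (restrict_scalars A L)"
  and e: "!!y. y : carrier (restrict_scalars A M) ==> y = i (\<rho> y) +[restrict_scalars A M] \<sigma> (p y)"
  by (rule split_exact[OF Lm Mm Nm short_exact_restrict_scalars[OF ex] a(1)]) (rule that)
 have i: "i : mod_hom R (restrict_scalars A L) (restrict_scalars A M)"
  and p: "p : mod_hom R (restrict_scalars A M) (restrict_scalars A N)"
  using ex by (simp_all add: short_exact_def mod_hom_restrict_scalars)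
 have "sum_factors R {regular R} (restrict_scalars A M) (restrict_scalars A M)
   (%y. i (\<rho> y) +[restrict_scalars A M] \<sigma> (p y))" by (rule sum_factors_add[OF Mm Mm
     sum_factors_post[OF Mm Lm Mm sum_factors_pre[OF a(2)[unfolded add_of_def] r] i]
     sum_factors_post[OF Mm Nm Mm sum_factors_pre[OF a(1)[unfolded add_of_def] p] s]])
 then have "add_of R {regular R} (restrict_scalars A M)" unfolding add_of_def by (rule sum_factors_cong) (rule e)
 then show ?thesis using M by (simp add: lattice_def)
qed

end

section \<open>The opposite algebra and duality\<close>

lemma opposite_simps [simp]:
 "carrier (opposite A) = carrier A" "0[opposite A] = 0[A]" "1[opposite A] = 1[A]"
 "x +[opposite A] y = x +[A] y" "x **[opposite A] y = y **[A] x" "r *[opposite A] x = r *[A] x"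
 by (simp_all add: opposite_def)

lemma opposite_opposite [simp]: "opposite (opposite A) = A" by (simp add: opposite_def)

context assoc_algebra
begin

lemma opposite_algebra: "assoc_algebra R (opposite A)"
proof -
 have grp: "abelian_group (opposite A)" by (rule abelian_groupI) (auto simp: a_ac intro: r_neg)
 have "ring (opposite A)" by (rule ringI[OF grp])
   (auto intro!: monoidI simp: m_assoc l_distr r_distr)
 moreover have "module R (opposite A)" by (rule moduleI[OF R.cring_axioms grp])
   (simp_all add: smult_l_distr smult_r_distr smult_assoc1)
 ultimately show ?thesis by (simp add: assoc_algebra_def assoc_algebra_axioms_def smult_mult_left smult_mult_right)
qed

lemma dual_simps:
 "f : carrier (dual R A M) \<longleftrightarrow> f : mod_hom R (restrict_scalars A M) (regular R) & f : extensional (carrier M)"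
 "0[dual R A M] = (\<lambda>x\<in>carrier M. 0[R])"
 "f +[dual R A M] g = (\<lambda>x\<in>carrier M. f x +[R] g x)"
 "a *[dual R A M] f = (\<lambda>x\<in>carrier M. f (a *[M] x))" by (simp_all add: dual_def)

lemma dual_hom: "f : carrier (dual R A M) ==> f : mod_hom R (restrict_scalars A M) (regular R)"
 by (simp add: dual_simps)

lemma dual_closed: "[|f : carrier (dual R A M); x : carrier M|] ==> f x : carrier R"
 using mod_hom_closed[OF dual_hom, of f M x] by simp

lemma dual_sc: "[|f : carrier (dual R A M); r : carrier R; x : carrier M|] ==> f (sc A M r x) = r **[R] f x"
 using mod_hom_smult[OF dual_hom, of f M r x] by simp

lemma dual_eqI:
 "[|f : carrier (dual R A M); g : carrier (dual R A M); !!x. x : carrier M ==> f x = g x|] ==> f = g"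
 by (rule extensionalityI[of f "carrier M" g]) (simp_all add: dual_simps)

lemma dual_memI:
 assumes "left_module A M" "f : mod_hom R (restrict_scalars A M) (regular R)"
 shows "restrict f (carrier M) : carrier (dual R A M)"
 using mod_hom_restrict[OF restrict_left_module[OF assms(1)] assms(2)] by (simp add: dual_simps)

lemma dual_left_module:
 assumes M: "left_module A M" shows "left_module (opposite A) (dual R A M)"
proof -
 interpret M: left_module A M by fact
 note MR = restrict_left_module[OF M] and RR = regular_left_module[OF ring_R]
 interpret RR: left_module R "regular R" by fact
 let ?D = "dual R A M"
 have addc: "f +[?D] g : carrier ?D" if "f : carrier ?D" "g : carrier ?D" for f g
  using dual_memI[OF M mod_hom_plus[OF RR dual_hom[OF that(1)] dual_hom[OF that(2)]]] by (simp add: dual_simps(3))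
 have zc: "0[?D] : carrier ?D" using dual_memI[OF M mod_hom_zero_map[OF RR]] by (simp add: dual_simps(2))
 have sc: "a *[?D] f : carrier ?D" if a: "a : carrier A" and f: "f : carrier ?D" for a f
 proof -
  have "(%x. a *[M] x) : mod_hom R (restrict_scalars A M) (restrict_scalars A M)"
   using a by (intro mod_homI) (simp_all add: M.smult_r_distr sc_commute[OF M])
  from dual_memI[OF M mod_hom_comp[OF this dual_hom[OF f]]] show ?thesis by (simp add: dual_simps(4))
 qed
 have grp: "abelian_group ?D"
 proof (rule abelian_groupI)
  fix f g h assume f: "f : carrier ?D" and g: "g : carrier ?D" and h: "h : carrier ?D"
  show "f +[?D] g +[?D] h = f +[?D] (g +[?D] h)"
   unfolding dual_simps by (rule restrict_ext) (simp add: dual_closed[OF f] dual_closed[OF g] dual_closed[OF h] R.a_assoc)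
  show "f +[?D] g = g +[?D] f"
   unfolding dual_simps by (rule restrict_ext) (simp add: dual_closed[OF f] dual_closed[OF g] R.a_comm)
 next
  fix f assume f: "f : carrier ?D"
  show "0[?D] +[?D] f = f" by (rule dual_eqI[OF addc[OF zc f] f]) (simp add: dual_simps(2,3) dual_closed[OF f])
  let ?g = "\<lambda>x\<in>carrier M. -[regular R] f x"
  have "?g : carrier ?D" by (rule dual_memI[OF M mod_hom_uminus[OF RR dual_hom[OF f]]])
  moreover have "?g +[?D] f = 0[?D]" unfolding dual_simps(2,3)
   by (rule restrict_ext) (use RR.M.l_neg dual_closed[OF f] in simp)
  ultimately show "\<exists>g\<in>carrier ?D. g +[?D] f = 0[?D]" by (intro bexI[of _ ?g])
 qed (fact addc zc)+
 show ?thesis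
 proof (rule left_moduleI[OF assoc_algebra.ring_A[OF opposite_algebra] grp])
  fix a b f g assume "a : carrier (opposite A)" "b : carrier (opposite A)"
   and f: "f : carrier ?D" and g: "g : carrier ?D"
  then have a: "a : carrier A" and b: "b : carrier A" by simp_all
  have fa: "f (x +[M] y) = f x +[R] f y" if "x : carrier M" "y : carrier M" for x y
   using mod_hom_add[OF dual_hom[OF f], of x y] that by simp
  show "(a +[opposite A] b) *[?D] f = a *[?D] f +[?D] b *[?D] f"
   unfolding dual_simps by (rule restrict_ext) (simp add: a b M.smult_l_distr fa)
  show "a *[?D] (f +[?D] g) = a *[?D] f +[?D] a *[?D] g" unfolding dual_simps by (rule restrict_ext) (simp add: a)
  show "(a **[opposite A] b) *[?D] f = a *[?D] (b *[?D] f)"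
   unfolding dual_simps by (rule restrict_ext) (simp add: a b M.smult_assoc1)
  show "a *[?D] f : carrier ?D" by (rule sc[OF a f])
 next
  fix f assume f: "f : carrier ?D"
  show "1[opposite A] *[?D] f = f"
   by (rule dual_eqI[OF _ f]) (use sc[OF one_closed f] in "simp_all add: dual_simps(4)")
 qed
qed

lemma dual_sc_apply:
 assumes "f : carrier (dual R A M)" "r : carrier R" "x : carrier M"
 shows "(sc (opposite A) (dual R A M) r f) x = r **[R] f x" using assms by (simp add: dual_simps(4) dual_sc)

lemma dual_eval_hom:
 assumes x: "x : carrier M"
 shows "(%f. f x) : mod_hom R (restrict_scalars (opposite A) (dual R A M)) (regular R)"
 using x by (intro mod_homI) (simp_all add: dual_closed dual_simps(3,4) dual_sc)

end

definition dual_map :: "('m, 'z) partial_object_scheme => ('m => 'n) => ('n => 'r) => 'm => 'r" where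
 "dual_map M f \<phi> = (\<lambda>x\<in>carrier M. \<phi> (f x))"

context assoc_algebra
begin

lemma dual_map_hom:
 assumes M: "left_module A M" and f: "f : mod_hom A M N"
 shows "dual_map M f : mod_hom (opposite A) (dual R A N) (dual R A M)"
proof -
 interpret M: left_module A M by fact
 note fc = mod_hom_closed[OF f]
 show ?thesis
 proof (rule mod_homI)
  fix \<phi> assume p: "\<phi> : carrier (dual R A N)"
  show "dual_map M f \<phi> : carrier (dual R A M)" unfolding dual_map_def
   by (rule dual_memI[OF M mod_hom_comp[OF mod_hom_restrict_scalars[OF f] dual_hom[OF p]]])
  fix a assume "a : carrier (opposite A)"
  then have a: "a : carrier A" by simp
  show "dual_map M f (a *[dual R A N] \<phi>) = a *[dual R A M] dual_map M f \<phi>" unfolding dual_map_def dual_simps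
   by (rule restrict_ext) (simp add: a fc mod_hom_smult[OF f a])
 next
  fix \<phi> \<psi> assume p: "\<phi> : carrier (dual R A N)" "\<psi> : carrier (dual R A N)"
  show "dual_map M f (\<phi> +[dual R A N] \<psi>) = dual_map M f \<phi> +[dual R A M] dual_map M f \<psi>"
   unfolding dual_map_def dual_simps by (rule restrict_ext) (simp add: fc)
 qed
qed

text \<open>A dual basis over \<open>R\<close>, with its coordinate functions taken from the dual module.\<close>

lemma dual_coordinates:
 assumes M: "lattice R A M"
 obtains L where "!!x \<phi>. (x, \<phi>) : set L ==> x : carrier M & \<phi> : carrier (dual R A M)"
  "!!y. y : carrier M ==> y = lsum M (%(x, \<phi>). sc A M (\<phi> y) x) L"
proof -
 note Mm = lattice_module[OF M]
 note MR = restrict_left_module[OF Mm]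
 obtain L where L: "!!x \<phi>. (x, \<phi>) : set L ==> x : carrier (restrict_scalars A M) & \<phi> : mod_hom R (restrict_scalars A M) (regular R)"
  "!!y. y : carrier (restrict_scalars A M) ==>
   y = lsum (restrict_scalars A M) (%(x, \<phi>). \<phi> y *[restrict_scalars A M] x) L"
  by (rule dual_basis[OF MR]) (use M in "simp add: lattice_def", rule that)
 let ?L = "map (%(x, \<phi>). (x, restrict \<phi> (carrier M))) L"
 show ?thesis
 proof (rule that[of ?L])
  fix x \<phi> assume "(x, \<phi>) : set ?L"
  then obtain \<psi> where "(x, \<psi>) : set L" "\<phi> = restrict \<psi> (carrier M)" by auto
  then show "x : carrier M & \<phi> : carrier (dual R A M)" using L(1)[of x \<psi>] dual_memI[OF Mm] by simp
 next
  fix y assume y: "y : carrier M"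
  have "lsum M (%(x, \<phi>). sc A M (\<phi> y) x) ?L = lsum M (%(x, \<phi>). sc A M (\<phi> y) x) L"
   unfolding lsum_map using y by (intro lsum_cong) auto
  also have "\<dots> = y" using L(2)[of y] y by simp
  finally show "y = lsum M (%(x, \<phi>). sc A M (\<phi> y) x) ?L" by (rule sym)
 qed
qed

lemma dual_expand:
 assumes M: "left_module A M" and \<psi>: "\<psi> : carrier (dual R A M)"
  and L: "!!q. q : set L ==> c q : carrier R & x q : carrier M"
 shows "\<psi> (lsum M (%q. sc A M (c q) (x q)) L) = lsum R (%q. c q **[R] \<psi> (x q)) L"
proof -
 have "\<psi> (lsum (restrict_scalars A M) (%q. sc A M (c q) (x q)) L)
   = lsum (regular R) (%q. \<psi> (sc A M (c q) (x q))) L"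
  by (rule lsum_hom[OF restrict_left_module[OF M] regular_left_module[OF ring_R] dual_hom[OF \<psi>]])
   (use L sc_closed[OF M] in simp)
 moreover have "lsum (regular R) f xs = lsum R f xs" for f :: "'k => _" and xs by (induction xs) simp_all
 ultimately have "\<psi> (lsum M (%q. sc A M (c q) (x q)) L) = lsum R (%q. \<psi> (sc A M (c q) (x q))) L" by simp
 also have "\<dots> = lsum R (%q. c q **[R] \<psi> (x q)) L" by (rule lsum_cong) (use L dual_sc[OF \<psi>] in simp)
 finally show ?thesis .
qed

text \<open>The coordinate functions of a dual basis already separate points.\<close>

lemma dual_separates:
 assumes M: "lattice R A M" and x: "x : carrier M" and y: "y : carrier M"
  and e: "!!\<phi>. \<phi> : carrier (dual R A M) ==> \<phi> x = \<phi> y"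
 shows "x = y"
proof -
 obtain L where L: "!!x \<phi>. (x, \<phi>) : set L ==> x : carrier M & \<phi> : carrier (dual R A M)"
  "!!y. y : carrier M ==> y = lsum M (%(x, \<phi>). sc A M (\<phi> y) x) L" by (rule dual_coordinates[OF M]) (rule that)
 have "lsum M (%(z, \<phi>). sc A M (\<phi> x) z) L = lsum M (%(z, \<phi>). sc A M (\<phi> y) z) L"
 proof (rule lsum_cong)
  fix q assume q: "q : set L"
  obtain z \<phi> where [simp]: "q = (z, \<phi>)" by (cases q)
  show "(case q of (z, \<phi>) => sc A M (\<phi> x) z) = (case q of (z, \<phi>) => sc A M (\<phi> y) z)"
   using e[of \<phi>] L(1)[of z \<phi>] q by simp
 qed
 then show ?thesis unfolding L(2)[OF x, symmetric] L(2)[OF y, symmetric] .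
qed

lemma dual_lsum_apply:
 assumes M: "left_module A M" and f: "!!q. q : set L ==> f q : carrier (dual R A M)" and x: "x : carrier M"
 shows "(lsum (dual R A M) f L) x = lsum R (%q. f q x) L" using f
proof (induction L)
 case Nil
 show ?case using x by (simp add: dual_simps(2))
next
 case (Cons q L)
 then show ?case using x by (simp add: dual_simps(3))
qed

lemma dual_basis_expansion:
 assumes M: "lattice R A M"
  and L: "!!x \<phi>. (x, \<phi>) : set L ==> x : carrier M & \<phi> : carrier (dual R A M)"
  "!!y. y : carrier M ==> y = lsum M (%(x, \<phi>). sc A M (\<phi> y) x) L"
  and \<psi>: "\<psi> : carrier (dual R A M)"
 shows "\<psi> = lsum (dual R A M) (%(x, \<phi>). sc (opposite A) (dual R A M) (\<psi> x) \<phi>) L"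
proof -
 note Mm = lattice_module[OF M]
 interpret B: assoc_algebra R "opposite A" by (rule opposite_algebra)
 interpret D: left_module "opposite A" "dual R A M" by (rule dual_left_module[OF Mm])
 have c: "(case q of (x, \<phi>) => sc (opposite A) (dual R A M) (\<psi> x) \<phi>) : carrier (dual R A M)" if q: "q : set L" for q
 proof -
  obtain x \<phi> where [simp]: "q = (x, \<phi>)" by (cases q)
  have "x : carrier M" "\<phi> : carrier (dual R A M)" using L(1) q by simp_all
  then show ?thesis using B.sc_closed[OF D.left_module_axioms dual_closed[OF \<psi>]] by simp
 qed
 show ?thesis
 proof (rule dual_eqI[OF \<psi>])
  show "lsum (dual R A M) (%(x, \<phi>). sc (opposite A) (dual R A M) (\<psi> x) \<phi>) L : carrier (dual R A M)"
   by (rule D.M.lsum_closed) (rule c)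
  fix y assume y: "y : carrier M"
  have "\<psi> y = \<psi> (lsum M (%(x, \<phi>). sc A M (\<phi> y) x) L)" by (rule arg_cong[OF L(2)[OF y]])
  also have "\<dots> = \<psi> (lsum M (%q. sc A M (snd q y) (fst q)) L)" by (simp add: case_prod_unfold)
  also have "\<dots> = lsum R (%q. snd q y **[R] \<psi> (fst q)) L"
  proof (rule dual_expand[OF Mm \<psi>])
   fix q assume "q : set L"
   then show "snd q y : carrier R & fst q : carrier M"
    using L(1)[of "fst q" "snd q"] dual_closed[of "snd q" M y] y by simp
  qed
  also have "\<dots> = lsum R (%q. (case q of (x, \<phi>) => sc (opposite A) (dual R A M) (\<psi> x) \<phi>) y) L"
  proof (rule lsum_cong)
   fix q assume q: "q : set L"
   obtain x \<phi> where [simp]: "q = (x, \<phi>)" by (cases q)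
   have c: "x : carrier M" "\<phi> : carrier (dual R A M)" using L(1) q by simp_all
   show "snd q y **[R] \<psi> (fst q) = (case q of (x, \<phi>) => sc (opposite A) (dual R A M) (\<psi> x) \<phi>) y"
    using dual_sc_apply[OF c(2) dual_closed[OF \<psi> c(1)] y] R.m_comm[OF dual_closed[OF c(2) y] dual_closed[OF \<psi> c(1)]]
    by simp
  qed
  also have "\<dots> = (lsum (dual R A M) (%(x, \<phi>). sc (opposite A) (dual R A M) (\<psi> x) \<phi>) L) y"
   by (rule dual_lsum_apply[OF Mm c y, symmetric])
  finally show "\<psi> y = (lsum (dual R A M) (%(x, \<phi>). sc (opposite A) (dual R A M) (\<psi> x) \<phi>) L) y" .
 qed
qed

text \<open>The coordinate functions \<open>\<phi>\<close> and the evaluations at the \<open>x\<close> form a dual basis of the dual.\<close>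

lemma dual_lattice:
 fixes M :: "('a, 'm, 'z) module_scheme"
 assumes M: "lattice R A M" shows "lattice R (opposite A) (dual R A M)"
proof -
 note Mm = lattice_module[OF M]
 interpret B: assoc_algebra R "opposite A" by (rule opposite_algebra)
 note D = dual_left_module[OF Mm]
 obtain L where L: "!!x \<phi>. (x, \<phi>) : set L ==> x : carrier M & \<phi> : carrier (dual R A M)"
  "!!y. y : carrier M ==> y = lsum M (%(x, \<phi>). sc A M (\<phi> y) x) L" by (rule dual_coordinates[OF M]) (rule that)
 have "add_of R {regular R} (restrict_scalars (opposite A) (dual R A M))"
 proof (rule add_of_regularI[OF B.restrict_left_module[OF D], of "map (%(x, \<phi>). (\<phi>, %f. f x)) L"])
  fix \<phi> and e :: "('m => 'r) => 'r"
  assume "(\<phi>, e) : set (map (%(x, \<phi>). (\<phi>, %f. f x)) L)"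
  then obtain x where "(x, \<phi>) : set L" "e = (%f. f x)" by auto
  then show "\<phi> : carrier (restrict_scalars (opposite A) (dual R A M)) \<and>
    e : mod_hom R (restrict_scalars (opposite A) (dual R A M)) (regular R)"
   using L(1)[of x \<phi>] dual_eval_hom[of x M] by simp
 next
  fix \<psi> assume "\<psi> : carrier (restrict_scalars (opposite A) (dual R A M))"
  then have "\<psi> : carrier (dual R A M)" by simp
  from dual_basis_expansion[OF M L this]
  show "\<psi> = lsum (restrict_scalars (opposite A) (dual R A M))
   (%(\<phi>, e). e \<psi> *[restrict_scalars (opposite A) (dual R A M)] \<phi>) (map (%(x, \<phi>). (\<phi>, %f. f x)) L)"
   by (simp add: lsum_map case_prod_unfold)
 qed
 then show ?thesis using D by (simp add: lattice_def)
qed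

lemma dual_eval_module_hom:
 assumes M: "left_module A M"
 shows "(%x. \<lambda>\<phi>\<in>carrier (dual R A M). \<phi> x) : mod_hom A M (dual R (opposite A) (dual R A M))"
proof -
 interpret B: assoc_algebra R "opposite A" by (rule opposite_algebra)
 let ?D = "dual R A M"
 note D = dual_left_module[OF M]
 let ?e = "%x. \<lambda>\<phi>\<in>carrier ?D. \<phi> x"
 have ec: "?e x : carrier (dual R (opposite A) ?D)" if "x : carrier M" for x
  by (rule B.dual_memI[OF D dual_eval_hom[OF that]])
 show ?thesis
 proof (rule mod_homI[OF ec])
  fix x y assume xy: "x : carrier M" "y : carrier M"
  show "?e (x +[M] y) = ?e x +[dual R (opposite A) ?D] ?e y" unfolding B.dual_simps(3)
  proof (rule restrict_ext)
   fix \<phi> assume p: "\<phi> : carrier ?D"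
   show "\<phi> (x +[M] y) = ?e x \<phi> +[R] ?e y \<phi>" using mod_hom_add[OF dual_hom[OF p], of x y] xy p by simp
  qed
 next
  fix a x assume a: "a : carrier A" and x: "x : carrier M"
  show "?e (a *[M] x) = a *[dual R (opposite A) ?D] ?e x" unfolding B.dual_simps(4)
  proof (rule restrict_ext)
   fix \<phi> assume p: "\<phi> : carrier ?D"
   have "a *[?D] \<phi> : carrier ?D" using left_module.smult_closed[OF D, of a \<phi>] a p by simp
   then show "\<phi> (a *[M] x) = ?e x (a *[?D] \<phi>)" using x by (simp add: dual_simps(4))
  qed
 qed
qed

text \<open>A functional \<open>\<Phi>\<close> on the dual is evaluation at \<open>\<Sum> \<Phi>(\<phi>\<^sub>j) x\<^sub>j\<close> for a dual basis \<open>(x\<^sub>j, \<phi>\<^sub>j)\<close>.\<close>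

lemma dual_dual_bij:
 assumes M: "lattice R A M"
 shows "bij_betw (%x. \<lambda>\<phi>\<in>carrier (dual R A M). \<phi> x) (carrier M) (carrier (dual R (opposite A) (dual R A M)))"
proof -
 note Mm = lattice_module[OF M]
 interpret M: left_module A M by (rule Mm)
 interpret B: assoc_algebra R "opposite A" by (rule opposite_algebra)
 let ?D = "dual R A M"
 note D = dual_left_module[OF Mm]
 let ?e = "%x. \<lambda>\<phi>\<in>carrier ?D. \<phi> x"
 note ec = mod_hom_closed[OF dual_eval_module_hom[OF Mm]]
 show ?thesis
 proof (rule bij_betw_imageI)
  show "inj_on ?e (carrier M)"
  proof (rule inj_onI)
   fix x y assume xy: "x : carrier M" "y : carrier M" "?e x = ?e y"
   show "x = y"
   proof (rule dual_separates[OF M xy(1,2)])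
    fix \<phi> assume "\<phi> : carrier ?D"
    then show "\<phi> x = \<phi> y" using fun_cong[OF xy(3), of \<phi>] by simp
   qed
  qed
  show "?e ` carrier M = carrier (dual R (opposite A) ?D)"
  proof
   show "?e ` carrier M <= carrier (dual R (opposite A) ?D)" by (rule image_subsetI) (rule ec)
   show "carrier (dual R (opposite A) ?D) <= ?e ` carrier M"
   proof
    fix \<Phi> assume P: "\<Phi> : carrier (dual R (opposite A) ?D)"
    obtain L where L: "!!x \<phi>. (x, \<phi>) : set L ==> x : carrier M & \<phi> : carrier ?D"
     "!!y. y : carrier M ==> y = lsum M (%(x, \<phi>). sc A M (\<phi> y) x) L" by (rule dual_coordinates[OF M]) (rule that)
    let ?x = "lsum M (%q. sc A M (\<Phi> (snd q)) (fst q)) L"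
    have Lc: "\<Phi> (snd q) : carrier R & fst q : carrier M" if "q : set L" for q
     using L(1)[of "fst q" "snd q"] that B.dual_closed[OF P, of "snd q"] by simp
    have x: "?x : carrier M" by (rule M.M.lsum_closed) (use Lc sc_closed[OF Mm] in simp)
    have "\<Phi> = ?e ?x"
    proof (rule B.dual_eqI[OF P ec[OF x]])
     fix \<psi> assume p: "\<psi> : carrier ?D"
     have "\<Phi> \<psi> = \<Phi> (lsum ?D (%(x, \<phi>). sc (opposite A) ?D (\<psi> x) \<phi>) L)"
      by (rule arg_cong[OF dual_basis_expansion[OF M L p]])
     also have "\<dots> = \<Phi> (lsum ?D (%q. sc (opposite A) ?D (\<psi> (fst q)) (snd q)) L)" by (simp only: case_prod_unfold)
     also have "\<dots> = lsum R (%q. \<psi> (fst q) **[R] \<Phi> (snd q)) L"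
     proof (rule B.dual_expand[OF D P])
      fix q assume "q : set L"
      then show "\<psi> (fst q) : carrier R & snd q : carrier ?D"
       using L(1)[of "fst q" "snd q"] dual_closed[OF p, of "fst q"] by simp
     qed
     also have "\<dots> = lsum R (%q. \<Phi> (snd q) **[R] \<psi> (fst q)) L"
      by (rule lsum_cong) (use Lc dual_closed[OF p] R.m_comm in simp)
     also have "\<dots> = \<psi> ?x" by (rule dual_expand[OF Mm p Lc, symmetric])
     finally show "\<Phi> \<psi> = ?e ?x \<psi>" using p by simp
    qed
    then show "\<Phi> : ?e ` carrier M" using x by (rule image_eqI)
   qed
  qed
 qed
qed

lemma dual_dual_iso:
 assumes M: "lattice R A M"
 shows "mod_iso A M (dual R (opposite A) (dual R A M))" unfolding mod_iso_def
proof (rule bexI)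
 show "bij_betw (%x. \<lambda>\<phi>\<in>carrier (dual R A M). \<phi> x) (carrier M) (carrier (dual R (opposite A) (dual R A M)))"
  by (rule dual_dual_bij[OF M])
qed (rule dual_eval_module_hom[OF lattice_module[OF M]])

text \<open>A homomorphism \<open>g : D N \<rightarrow> D M\<close> is the transpose of \<open>M \<rightarrow> D D M \<rightarrow> D D N = N\<close>.\<close>

lemma dual_hom_is_transpose:
 assumes M: "left_module A M" and N: "lattice R A N"
  and g: "g : mod_hom (opposite A) (dual R A N) (dual R A M)"
 obtains h where "h : mod_hom A M N"
  "!!\<phi> x. [|\<phi> : carrier (dual R A N); x : carrier M|] ==> g \<phi> x = \<phi> (h x)"
proof -
 note Nm = lattice_module[OF N]
 interpret B: assoc_algebra R "opposite A" by (rule opposite_algebra)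
 let ?DN = "dual R A N" and ?DM = "dual R A M"
 let ?eN = "%x. \<lambda>\<phi>\<in>carrier ?DN. \<phi> x" and ?eM = "%x. \<lambda>\<phi>\<in>carrier ?DM. \<phi> x"
 have gt: "dual_map ?DN g : mod_hom A (dual R (opposite A) ?DM) (dual R (opposite A) ?DN)"
  using B.dual_map_hom[OF dual_left_module[OF Nm] g] by simp
 note gM = mod_hom_comp[OF dual_eval_module_hom[OF M] gt]
 note bij = dual_dual_bij[OF N]
 let ?h = "%x. inv_into (carrier N) ?eN (dual_map ?DN g (?eM x))"
 have h: "?h : mod_hom A M N" by (rule mod_hom_comp[OF gM mod_hom_inverse[OF Nm dual_eval_module_hom[OF Nm] bij]])
 show ?thesis
 proof (rule that[OF h])
  fix \<phi> x assume p: "\<phi> : carrier ?DN" and x: "x : carrier M"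
  have "?eN (?h x) = dual_map ?DN g (?eM x)"
   by (rule f_inv_into_f) (use mod_hom_closed[OF gM x] bij in "simp only: bij_betw_def")
  from fun_cong[OF this, of \<phi>] show "g \<phi> x = \<phi> (?h x)" using p mod_hom_closed[OF g p] by (simp add: dual_map_def)
 qed
qed

lemma dual_hom_nonzero:
 assumes M: "left_module A M" and N: "lattice R A N"
  and "hom_nonzero (opposite A) (dual R A N) (dual R A M)"
 shows "hom_nonzero A M N"
proof -
 obtain g \<phi> where g: "g : mod_hom (opposite A) (dual R A N) (dual R A M)" "\<phi> : carrier (dual R A N)"
  "g \<phi> \<noteq> 0[dual R A M]" using assms(3) unfolding hom_nonzero_def by blast
 obtain h where h: "h : mod_hom A M N"
  "!!\<phi> x. [|\<phi> : carrier (dual R A N); x : carrier M|] ==> g \<phi> x = \<phi> (h x)"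
  by (rule dual_hom_is_transpose[OF M N g(1)]) (rule that)
 have "\<exists>x\<in>carrier M. h x \<noteq> 0[N]"
 proof (rule ccontr)
  assume "\<not> (\<exists>x\<in>carrier M. h x \<noteq> 0[N])"
  then have z: "h x = 0[N]" if "x : carrier M" for x using that by blast
  have "\<phi> 0[N] = 0[R]"
   using mod_hom_zero[OF restrict_left_module[OF lattice_module[OF N]] regular_left_module[OF ring_R] dual_hom[OF g(2)]]
   by simp
  then have "g \<phi> = 0[dual R A M]" by (intro dual_eqI[of "g \<phi>" M] mod_hom_closed[OF g(1,2)] abelian_groupE(2)
     left_module_group[OF dual_left_module[OF M]]) (simp add: h(2)[OF g(2)] z dual_simps(2))
  then show False using g(3) by simp
 qed
 then show ?thesis unfolding hom_nonzero_def using h(1) by blast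
qed

text \<open>Endomorphisms of the dual are transposes of endomorphisms, hence transposes of scalars.\<close>

lemma dual_scalar_end:
 assumes M: "lattice R A M" and se: "scalar_end R A M"
 shows "scalar_end R (opposite A) (dual R A M)" unfolding scalar_end_def
proof (intro conjI ballI impI)
 note Mm = lattice_module[OF M]
 interpret B: assoc_algebra R "opposite A" by (rule opposite_algebra)
 fix g assume g: "g : mod_hom (opposite A) (dual R A M) (dual R A M)"
 obtain h where h: "h : mod_hom A M M"
  "!!\<phi> x. [|\<phi> : carrier (dual R A M); x : carrier M|] ==> g \<phi> x = \<phi> (h x)"
  by (rule dual_hom_is_transpose[OF Mm M g]) (rule that)
 obtain r where r: "r : carrier R" "!!x. x : carrier M ==> h x = sc A M r x"
  by (rule scalar_end_scalar[OF se h(1)]) (rule that)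
 have "g \<phi> = sc (opposite A) (dual R A M) r \<phi>" if p: "\<phi> : carrier (dual R A M)" for \<phi>
 proof (rule dual_eqI[OF mod_hom_closed[OF g p] B.sc_closed[OF dual_left_module[OF Mm] r(1) p]])
  fix x assume x: "x : carrier M"
  show "g \<phi> x = sc (opposite A) (dual R A M) r \<phi> x"
   unfolding h(2)[OF p x] r(2)[OF x] dual_sc[OF p r(1) x] dual_sc_apply[OF p r(1) x] ..
 qed
 then show "\<exists>r\<in>carrier R. \<forall>\<phi>\<in>carrier (dual R A M). g \<phi> = sc (opposite A) (dual R A M) r \<phi>" using r(1) by blast
next
 note Mm = lattice_module[OF M]
 interpret M: left_module A M by (rule Mm)
 fix r assume r: "r : carrier R" and z: "\<forall>\<phi>\<in>carrier (dual R A M). sc (opposite A) (dual R A M) r \<phi> = 0[dual R A M]"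
 have "sc A M r x = 0[M]" if x: "x : carrier M" for x
 proof (rule dual_separates[OF M sc_closed[OF Mm r x] M.M.zero_closed])
  fix \<phi> assume p: "\<phi> : carrier (dual R A M)"
  have "\<phi> (sc A M r x) = (sc (opposite A) (dual R A M) r \<phi>) x"
   unfolding dual_sc[OF p r x] dual_sc_apply[OF p r x] ..
  also have "\<dots> = 0[R]" using z p x by (simp add: dual_simps(2))
  also have "0[R] = \<phi> 0[M]"
   using mod_hom_zero[OF restrict_left_module[OF Mm] regular_left_module[OF ring_R] dual_hom[OF p]] by simp
  finally show "\<phi> (sc A M r x) = \<phi> 0[M]" .
 qed
 then show "r = 0[R]" using se r unfolding scalar_end_def by simp
qed

lemma dual_add_of:
 assumes X: "left_module A X" and Ms: "!!M. M : Ms ==> left_module A M" and a: "add_of A Ms X"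
 shows "add_of (opposite A) (dual R A ` Ms) (dual R A X)"
proof -
 have "sum_factors (opposite A) (dual R A ` Ms) (dual R A X) (dual R A X) (dual_map X h)"
  if "sum_factors A Ms X X h" for h using that
 proof induction
  case (zero h)
  show ?case
  proof (rule sum_factors.zero)
   fix \<phi> assume p: "\<phi> : carrier (dual R A X)"
   have "\<phi> 0[X] = 0[R]"
    using mod_hom_zero[OF restrict_left_module[OF X] regular_left_module[OF ring_R] dual_hom[OF p]] by simp
   then show "dual_map X h \<phi> = 0[dual R A X]"
    unfolding dual_map_def dual_simps(2) by (intro restrict_ext) (simp add: zero)
  qed
 next
  case (step g M t s h)
  note M = Ms[OF step(2)]
  show ?case
  proof (rule sum_factors.step[OF step.IH imageI[OF step(2)] dual_map_hom[OF M step(4)] dual_map_hom[OF X step(3)]])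
   fix \<phi> assume p: "\<phi> : carrier (dual R A X)"
   have pa: "\<phi> (u +[X] v) = \<phi> u +[R] \<phi> v" if "u : carrier X" "v : carrier X" for u v
    using mod_hom_add[OF dual_hom[OF p], of u v] that by simp
   show "dual_map X h \<phi> = dual_map X t (dual_map M s \<phi>) +[dual R A X] dual_map X g \<phi>"
    unfolding dual_map_def dual_simps(3) by (rule restrict_ext)
     (simp add: step(5) pa mod_hom_closed[OF step(3)] mod_hom_closed[OF mod_hom_comp[OF step(3,4)]]
      mod_hom_closed[OF sum_factors_hom[OF X X step(1)]])
  qed
 qed
 from this[OF a[unfolded add_of_def]] show ?thesis unfolding add_of_def
  by (rule sum_factors_cong) (simp add: dual_map_def dual_simps(1) extensional_restrict)
qed

text \<open>Functionals on \<open>L\<close> extend to \<open>M\<close> because the sequence splits over \<open>R\<close>: this is where \<open>N\<close> has to be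
 projective over \<open>R\<close>.\<close>

lemma dual_short_exact:
 assumes L: "left_module A L" and M: "left_module A M" and N: "lattice R A N" and ex: "short_exact A L i M p N"
 shows "short_exact (opposite A) (dual R A N) (dual_map M p) (dual R A M) (dual_map L i) (dual R A L)"
proof -
 note Nm = lattice_module[OF N]
 note LR = restrict_left_module[OF L] and MR = restrict_left_module[OF M] and NR = restrict_left_module[OF Nm]
  and RR = regular_left_module[OF ring_R]
 have i: "i : mod_hom A L M" and p: "p : mod_hom A M N" "p ` carrier M = carrier N"
  and ik: "i ` carrier L = {y : carrier M. p y = 0[N]}" using ex by (simp_all add: short_exact_def a_kernel_eq)
 note ic = mod_hom_closed[OF i] and pc = mod_hom_closed[OF p(1)]
 have aN: "add_of R {regular R} (restrict_scalars A N)" using N by (simp add: lattice_def)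
 obtain \<sigma> \<rho> where r: "\<rho> : mod_hom R (restrict_scalars A M) (restrict_scalars A L)"
  and ri: "!!x. x : carrier (restrict_scalars A L) ==> \<rho> (i x) = x"
  by (rule split_exact[OF LR MR NR short_exact_restrict_scalars[OF ex] aN]) (rule that)
 show ?thesis unfolding short_exact_def
 proof (intro conjI)
  show "dual_map M p : mod_hom (opposite A) (dual R A N) (dual R A M)" by (rule dual_map_hom[OF M p(1)])
  show "dual_map L i : mod_hom (opposite A) (dual R A M) (dual R A L)" by (rule dual_map_hom[OF L i])
  show "inj_on (dual_map M p) (carrier (dual R A N))"
  proof (rule inj_onI)
   fix \<phi> \<psi> assume c: "\<phi> : carrier (dual R A N)" "\<psi> : carrier (dual R A N)" and e: "dual_map M p \<phi> = dual_map M p \<psi>"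
   show "\<phi> = \<psi>"
   proof (rule dual_eqI[OF c])
    fix y assume "y : carrier N"
    then obtain x where x: "x : carrier M" "y = p x" unfolding p(2)[symmetric] by blast
    show "\<phi> y = \<psi> y" using fun_cong[OF e, of x] x by (simp add: dual_map_def)
   qed
  qed
  show "dual_map M p ` carrier (dual R A N) = a_kernel (dual R A M) (dual R A L) (dual_map L i)"
  proof
   show "dual_map M p ` carrier (dual R A N) <= a_kernel (dual R A M) (dual R A L) (dual_map L i)"
   proof (rule image_subsetI)
    fix \<phi> assume c: "\<phi> : carrier (dual R A N)"
    have z: "\<phi> 0[N] = 0[R]" using mod_hom_zero[OF NR RR dual_hom[OF c]] by simp
    have pi: "p (i x) = 0[N]" if "x : carrier L" for x using ik that by blast
    have "dual_map L i (dual_map M p \<phi>) = 0[dual R A L]"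
     unfolding dual_map_def dual_simps(2) by (rule restrict_ext) (simp add: ic pi z)
    then show "dual_map M p \<phi> : a_kernel (dual R A M) (dual R A L) (dual_map L i)"
     unfolding a_kernel_eq using mod_hom_closed[OF dual_map_hom[OF M p(1)] c] by simp
   qed
   show "a_kernel (dual R A M) (dual R A L) (dual_map L i) <= dual_map M p ` carrier (dual R A N)"
   proof
    fix \<psi> assume "\<psi> : a_kernel (dual R A M) (dual R A L) (dual_map L i)"
    then have c: "\<psi> : carrier (dual R A M)" and e: "dual_map L i \<psi> = 0[dual R A L]"
     unfolding a_kernel_eq by simp_all
    have k: "\<psi> y = 0[R]" if "y : carrier M" "p y = 0[N]" for y
    proof -
     have "y : i ` carrier L" unfolding ik using that by simp
     then obtain x where "x : carrier L" "y = i x" by blast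
     then show ?thesis using fun_cong[OF e, of x] by (simp add: dual_map_def dual_simps(2))
    qed
    obtain \<chi> where x: "\<chi> : mod_hom R (restrict_scalars A N) (regular R)"
     "!!y. y : carrier (restrict_scalars A M) ==> \<chi> (p y) = \<psi> y"
     by (rule mod_hom_factor[OF MR NR RR mod_hom_restrict_scalars[OF p(1)] _ dual_hom[OF c]])
      (simp add: p(2), simp add: k, rule that)
    have "\<psi> = dual_map M p (restrict \<chi> (carrier N))"
     by (rule dual_eqI[OF c mod_hom_closed[OF dual_map_hom[OF M p(1)] dual_memI[OF Nm x(1)]]])
      (use x(2) pc in "simp add: dual_map_def")
    then show "\<psi> : dual_map M p ` carrier (dual R A N)" using dual_memI[OF Nm x(1)] by (rule image_eqI)
   qed
  qed
  show "dual_map L i ` carrier (dual R A M) = carrier (dual R A L)"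
  proof
   show "dual_map L i ` carrier (dual R A M) <= carrier (dual R A L)"
    by (rule image_subsetI) (rule mod_hom_closed[OF dual_map_hom[OF L i]])
   show "carrier (dual R A L) <= dual_map L i ` carrier (dual R A M)"
   proof
    fix \<phi> assume c: "\<phi> : carrier (dual R A L)"
    let ?\<psi> = "restrict (%y. \<phi> (\<rho> y)) (carrier M)"
    have m: "?\<psi> : carrier (dual R A M)" by (rule dual_memI[OF M mod_hom_comp[OF r dual_hom[OF c]]])
    have "\<phi> = dual_map L i ?\<psi>" by (rule dual_eqI[OF c mod_hom_closed[OF dual_map_hom[OF L i] m]])
      (use ri ic in "simp add: dual_map_def")
    then show "\<phi> : dual_map L i ` carrier (dual R A M)" using m by (rule image_eqI)
   qed
  qed
 qed
qed

text \<open>Dualizing reverses a filtration: the dual of the top layer becomes the bottom layer.\<close>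

lemma dual_Filt:
 assumes M: "left_module A M" and Ms: "!!X. X : Ms ==> lattice R A X" and f: "Filt A Ms M F"
 shows "lattice R A (M(|carrier := F|)) \<and>
  Filt (opposite A) (dual R A ` Ms) (dual R A (M(|carrier := F|))) (carrier (dual R A (M(|carrier := F|))))" using f
proof induction
 case zero
 let ?Z = "M(|carrier := {0[M]}|)"
 have Z: "left_module A ?Z" by (rule submodule_module[OF M zero_submodule[OF M]])
 have "add_of R {regular R} (restrict_scalars A ?Z)" unfolding add_of_def by (rule sum_factors.zero) simp
 then have lat: "lattice R A ?Z" using Z by (simp add: lattice_def)
 note D = dual_left_module[OF Z]
 have zD: "0[dual R A ?Z] : carrier (dual R A ?Z)" by (rule submodule_zero[OF carrier_submodule[OF D]])
 have "\<phi> = 0[dual R A ?Z]" if p: "\<phi> : carrier (dual R A ?Z)" for \<phi> by (rule dual_eqI[OF p zD])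
   (use mod_hom_zero[OF restrict_left_module[OF Z] regular_left_module[OF ring_R] dual_hom[OF p]] in "simp add: dual_simps(2)")
 then have "carrier (dual R A ?Z) = {0[dual R A ?Z]}" using zD by blast
 then show ?case using lat Filt.zero[of "opposite A" "dual R A ` Ms" "dual R A ?Z"] by simp
next
 case (step F W X)
 let ?F = "M(|carrier := F|)" and ?W = "M(|carrier := W|)"
 have F: "submodule F A M" by (rule Filt_submodule[OF step(1) M])
 have Fm: "left_module A ?F" and Wm: "left_module A ?W"
  by (rule submodule_module[OF M F], rule submodule_module[OF M step(2)])
 have FW: "submodule F A ?W" by (rule submodule_of_submodule[OF M step(2) F step(3)])
 let ?Q = "quotient_module ?W F"
 have Q: "left_module A ?Q" by (rule quotient_left_module[OF Wm FW])
 have Ql: "lattice R A ?Q" by (rule lattice_add_of[OF Q _ step(5)]) (use Ms[OF step(4)] in simp)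
 have ex: "short_exact A ?F (%x. x) ?W (%x. F +>\<^bsub>?W\<^esub> x) ?Q" using short_exact_quotient[OF Wm FW] by simp
 have Wl: "lattice R A ?W" by (rule lattice_extension[OF conjunct1[OF step.IH] Wm Ql ex])
 have "add_of (opposite A) (dual R A ` {X}) (dual R A ?Q)"
  by (rule dual_add_of[OF Q _ step(5)]) (use lattice_module[OF Ms[OF step(4)]] in simp)
 then have a: "add_of (opposite A) {dual R A X} (dual R A ?Q)" by simp
 have "Filt (opposite A) (dual R A ` Ms) (dual R A ?W) (carrier (dual R A ?W))"
  by (rule Filt_extension[OF dual_left_module[OF Q] dual_left_module[OF Wm] dual_left_module[OF Fm]
     dual_short_exact[OF Fm Wm Ql ex] imageI[OF step(4)] a conjunct2[OF step.IH]])
 with Wl show ?case ..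
qed

end

lemma lsum_carrier_update [simp]: "lsum (M(|carrier := W|)) f xs = lsum M f xs" by (induction xs) simp_all

lemma hom_nonzeroI: "[|f : mod_hom A M N; x : carrier M; f x \<noteq> 0[N]|] ==> hom_nonzero A M N"
 unfolding hom_nonzero_def by (rule bexI[of _ f], rule bexI[of _ x])

lemma Filt_mono: "[|Filt A Ms M F; Ms <= Ns|] ==> Filt A Ns M F"
proof (induction rule: Filt.induct)
 case zero
 show ?case by (rule Filt.zero)
next
 case (step F W X)
 have "X : Ns" using step(4) step.prems by blast
 then show ?case by (rule Filt.step[OF step.IH[OF step.prems] step(2,3) _ step(5)])
qed

section \<open>Traces\<close>

text \<open>The trace of a class of modules in \<open>M\<close>: the submodule generated by all images of
 homomorphisms into \<open>M\<close>.\<close>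

inductive_set trace ::
 "('a, 'x) ring_scheme => ('a, 'p, 'w) module_scheme set => ('a, 'm, 'y) module_scheme => 'm set"
 for A Ps M where
 zero: "0[M] : trace A Ps M"
| step: "[|Q : Ps; g : mod_hom A Q M; x : carrier Q; y : trace A Ps M|] ==> g x +[M] y : trace A Ps M"

lemma trace_mono: "[|y : trace A Ps M; Ps <= Qs|] ==> y : trace A Qs M"
proof (induction rule: trace.induct)
 case zero
 show ?case by (rule trace.zero)
next
 case (step Q g x y)
 have "Q : Qs" using step(1) step.prems by blast
 then show ?case using step(2,3) step.IH[OF step.prems] by (rule trace.step)
qed

context
 fixes A :: "('a, 'x) ring_scheme" and Ps :: "('a, 'p, 'w) module_scheme set"
 assumes Ps: "\<forall>Q\<in>Ps. left_module A Q"
begin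

lemma trace_into:
 assumes M: "left_module A M" and "Q : Ps" "g : mod_hom A Q M" "x : carrier Q"
 shows "g x : trace A Ps M"
proof -
 interpret M: left_module A M by fact
 show ?thesis using trace.step[OF assms(2-4) trace.zero] mod_hom_closed[OF assms(3,4)] by simp
qed

lemma trace_closed: "[|left_module A M; y : trace A Ps M|] ==> y : carrier M"
proof -
 assume M: "left_module A M" and y: "y : trace A Ps M"
 interpret M: left_module A M by fact
 show ?thesis using y by induction (simp_all add: mod_hom_closed)
qed

lemma trace_submodule:
 assumes M: "left_module A M" shows "submodule (trace A Ps M) A M"
proof -
 interpret M: left_module A M by fact
 note cl = trace_closed[OF M]
 show ?thesis
 proof (rule submodule_intro[OF M subsetI[OF cl] trace.zero])
  fix x y assume x: "x : trace A Ps M" and y: "y : trace A Ps M"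
  from x show "x +[M] y : trace A Ps M"
  proof induction
   case zero
   show ?case using y cl[OF y] by simp
  next
   case (step Q g u z)
   have "(g u +[M] z) +[M] y = g u +[M] (z +[M] y)"
    by (rule M.M.a_assoc[OF mod_hom_closed[OF step(2,3)] cl[OF step(4)] cl[OF y]])
   then show ?case using trace.step[OF step(1-3) step.IH] by simp
  qed
 next
  fix a x assume a: "a : carrier A" and x: "x : trace A Ps M"
  from x show "a *[M] x : trace A Ps M"
  proof induction
   case zero
   show ?case using trace.zero[of M A Ps] a by simp
  next
   case (step Q g u z)
   have u: "a *[Q] u : carrier Q" by (rule left_module.smult_closed[OF bspec[OF Ps step(1)] a step(3)])
   have "a *[M] (g u +[M] z) = g (a *[Q] u) +[M] a *[M] z"
    using M.smult_r_distr[OF a mod_hom_closed[OF step(2,3)] cl[OF step(4)]] mod_hom_smult[OF step(2) a step(3)] by simp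
   then show ?case using trace.step[OF step(1,2) u step.IH] by simp
  qed
 qed
qed

lemma trace_hom:
 assumes M: "left_module A M" and N: "left_module A N" and h: "h : mod_hom A M N" and y: "y : trace A Ps M"
 shows "h y : trace A Ps N" using y
proof induction
 case zero
 show ?case using trace.zero[of N A Ps] mod_hom_zero[OF M N h] by simp
next
 case (step Q g x y)
 have "h (g x +[M] y) = h (g x) +[N] h y"
  by (rule mod_hom_add[OF h mod_hom_closed[OF step(2,3)] trace_closed[OF M step(4)]])
 then show ?case using trace.step[OF step(1) mod_hom_comp[OF step(2) h] step(3) step.IH] by simp
qed

lemma trace_eq_zero:
 assumes N: "left_module A N" and z: "!!Q. Q : Ps ==> \<not> hom_nonzero A Q N" and y: "y : trace A Ps N"
 shows "y = 0[N]"
proof -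
 interpret N: left_module A N by fact
 show ?thesis using y
 proof induction
  case (step Q g x y)
  have "g x = 0[N]" using z[OF step(1)] step(2,3) unfolding hom_nonzero_def by blast
  then show ?case using step.IH by simp
 qed simp
qed

lemma trace_submodule_incl:
 assumes M: "left_module A M" and F: "submodule F A M" and y: "y : trace A Ps (M(|carrier := F|))"
 shows "y : trace A Ps M"
 using trace_hom[OF submodule_module[OF M F] M mod_hom_from_submodule[OF mod_hom_id submodule_subset[OF F]] y] .

lemma trace_submodule_mono:
 assumes M: "left_module A M" and F: "submodule F A M" and W: "submodule W A M" and FW: "F <= W"
  and y: "y : trace A Ps (M(|carrier := F|))"
 shows "y : trace A Ps (M(|carrier := W|))"
 using trace_submodule_incl[OF submodule_module[OF M W] submodule_of_submodule[OF M W F FW]] y by simp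

lemma trace_in_trace:
 assumes M: "left_module A M" and y: "y : trace A Ps M" and W: "submodule W A M" "trace A Ps M <= W"
 shows "y : trace A Ps (M(|carrier := W|))" using y
proof induction
 case zero
 show ?case using trace.zero[of "M(|carrier := W|)" A Ps] by simp
next
 case (step Q g x y)
 have "g : mod_hom A Q (M(|carrier := W|))"
  by (rule mod_hom_into_submodule[OF step(2)]) (use trace_into[OF M step(1,2)] W(2) in blast)
 from trace.step[OF step(1) this step(3) step.IH] show ?case by simp
qed

end

section \<open>Standard modules: a filtration by traces\<close>

text \<open>The data of a split quasi-hereditary structure, with a numbering \<open>e\<close> of the poset that puts
 larger elements first.\<close>

locale standard_modules = assoc_algebra R A
 for R :: "('r, 'x) ring_scheme" (structure) and A :: "('r, 'a, 'y) module_scheme" (structure) +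
 fixes \<Lambda> :: "'l::order set" and D :: "'l => ('a, 'm, 'z) module_scheme"
  and P :: "'l => ('a, 'p, 'w) module_scheme" and p :: "'l => 'p => 'm" and e :: "'l => nat"
 assumes e_less: "[|\<alpha> : \<Lambda>; \<beta> : \<Lambda>; \<alpha> < \<beta>|] ==> e \<beta> < e \<alpha>" and e_inj: "inj_on e \<Lambda>"
  and D_lattice: "\<alpha> : \<Lambda> ==> lattice R A (D \<alpha>)" and D_end: "\<alpha> : \<Lambda> ==> scalar_end R A (D \<alpha>)"
  and D_hom: "[|\<alpha> : \<Lambda>; \<beta> : \<Lambda>; hom_nonzero A (D \<alpha>) (D \<beta>)|] ==> \<alpha> \<le> \<beta>"
  and P_mod: "\<alpha> : \<Lambda> ==> left_module A (P \<alpha>)" and P_proj: "\<alpha> : \<Lambda> ==> add_of A {regular A} (P \<alpha>)"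
  and p_hom: "\<alpha> : \<Lambda> ==> p \<alpha> : mod_hom A (P \<alpha>) (D \<alpha>)"
  and p_surj: "\<alpha> : \<Lambda> ==> p \<alpha> ` carrier (P \<alpha>) = carrier (D \<alpha>)"
  and K_filt: "\<alpha> : \<Lambda> ==> Filt A (D ` {\<mu> : \<Lambda>. \<alpha> < \<mu>}) (P \<alpha>) (a_kernel (P \<alpha>) (D \<alpha>) (p \<alpha>))"
  and P_gen: "add_of A (P ` \<Lambda>) (regular A)"
begin

abbreviation tr :: "nat => ('a, 'n, 'v) module_scheme => 'n set" where
 "tr k M \<equiv> trace A (P ` {\<mu> : \<Lambda>. e \<mu> < k}) M"

lemma D_mod: "\<alpha> : \<Lambda> ==> left_module A (D \<alpha>)" by (rule lattice_module[OF D_lattice])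

lemma tr_Ps: "\<forall>Q \<in> P ` {\<mu> : \<Lambda>. e \<mu> < k}. left_module A Q" using P_mod by blast

lemmas tr_closed = trace_closed[where A = A and Ps = "P ` {\<mu> : \<Lambda>. e \<mu> < k}", OF tr_Ps]
 and tr_submodule = trace_submodule[where A = A and Ps = "P ` {\<mu> : \<Lambda>. e \<mu> < k}", OF tr_Ps]
 and tr_hom = trace_hom[where A = A and Ps = "P ` {\<mu> : \<Lambda>. e \<mu> < k}", OF tr_Ps]
 and tr_incl = trace_submodule_incl[where A = A and Ps = "P ` {\<mu> : \<Lambda>. e \<mu> < k}", OF tr_Ps]
 and tr_sub_mono = trace_submodule_mono[where A = A and Ps = "P ` {\<mu> : \<Lambda>. e \<mu> < k}", OF tr_Ps]
 and tr_in_tr = trace_in_trace[where A = A and Ps = "P ` {\<mu> : \<Lambda>. e \<mu> < k}", OF tr_Ps]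
 for k

lemma tr_into: "[|left_module A M; \<mu> : \<Lambda>; e \<mu> < k; g : mod_hom A (P \<mu>) M; x : carrier (P \<mu>)|] ==> g x : tr k M"
 by (rule trace_into[OF tr_Ps, where Q = "P \<mu>"]) simp_all

lemma tr_mono: "[|y : tr k M; k \<le> l|] ==> y : tr l M" by (erule trace_mono) auto

lemma P_lift:
 assumes "\<mu> : \<Lambda>" "left_module A M" "left_module A N" "q : mod_hom A M N" "q ` carrier M = carrier N"
  "h : mod_hom A (P \<mu>) N"
 obtains g where "g : mod_hom A (P \<mu>) M" "!!x. x : carrier (P \<mu>) ==> q (g x) = h x"
 by (rule projective_lifting[OF P_mod[OF assms(1)] P_proj[OF assms(1)] assms(2-6)]) (rule that)

definition lifts :: "'l => (('p => 'n) \<times> ('k => 'm)) list => 'k => (('p => 'n) \<times> ('k => 'm) => 'p) => bool" where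
 "lifts \<nu> L y q \<longleftrightarrow> (\<forall>s\<in>set L. q s : carrier (P \<nu>) & p \<nu> (q s) = snd s y)"

definition comb :: "('a, 'n, 'v) module_scheme => (('p => 'n) \<times> ('k => 'm)) list => (('p => 'n) \<times> ('k => 'm) => 'p) => 'n" where
 "comb M L q = lsum M (%s. fst s (q s)) L"

lemma lifts_exist:
 assumes "\<nu> : \<Lambda>" "!!s. s : set L ==> snd s y : carrier (D \<nu>)"
 obtains q where "lifts \<nu> L y q"
proof (rule that)
 show "lifts \<nu> L y (%s. inv_into (carrier (P \<nu>)) (p \<nu>) (snd s y))" unfolding lifts_def
 proof (intro ballI conjI)
  fix s assume "s : set L"
  then have s: "snd s y : p \<nu> ` carrier (P \<nu>)" using assms(2) p_surj[OF assms(1)] by simp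
  show "inv_into (carrier (P \<nu>)) (p \<nu>) (snd s y) : carrier (P \<nu>)" by (rule inv_into_into[OF s])
  show "p \<nu> (inv_into (carrier (P \<nu>)) (p \<nu>) (snd s y)) = snd s y" by (rule f_inv_into_f[OF s])
 qed
qed

lemma comb_add:
 assumes M: "left_module A M" and \<nu>: "\<nu> : \<Lambda>"
  and L: "!!s. s : set L ==> fst s : mod_hom A (P \<nu>) M"
  and q: "!!s. s : set L ==> q s : carrier (P \<nu>)" and q': "!!s. s : set L ==> q' s : carrier (P \<nu>)"
 shows "comb M L (%s. q s +[P \<nu>] q' s) = comb M L q +[M] comb M L q'"
proof -
 interpret M: left_module A M by fact
 have "comb M L (%s. q s +[P \<nu>] q' s) = lsum M (%s. fst s (q s) +[M] fst s (q' s)) L"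
  unfolding comb_def by (rule lsum_cong) (use mod_hom_add[OF L q q'] in simp)
 also have "\<dots> = comb M L q +[M] comb M L q'"
  unfolding comb_def by (rule M.M.lsum_add) (use mod_hom_closed[OF L q] mod_hom_closed[OF L q'] in simp_all)
 finally show ?thesis .
qed

lemma comb_closed:
 assumes M: "left_module A M" and L: "!!s. s : set L ==> fst s : mod_hom A (P \<nu>) M"
  and q: "!!s. s : set L ==> q s : carrier (P \<nu>)"
 shows "comb M L q : carrier M"
proof -
 interpret M: left_module A M by fact
 show ?thesis unfolding comb_def by (rule M.M.lsum_closed) (use mod_hom_closed[OF L q] in simp)
qed

lemma comb_smult:
 assumes M: "left_module A M" and a: "a : carrier A"
  and L: "!!s. s : set L ==> fst s : mod_hom A (P \<nu>) M"
  and q: "!!s. s : set L ==> q s : carrier (P \<nu>)"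
 shows "comb M L (%s. a *[P \<nu>] q s) = a *[M] comb M L q"
proof -
 interpret M: left_module A M by fact
 have "comb M L (%s. a *[P \<nu>] q s) = lsum M (%s. a *[M] fst s (q s)) L"
  unfolding comb_def by (rule lsum_cong) (use mod_hom_smult[OF L a q] in simp)
 also have "\<dots> = a *[M] comb M L q"
  unfolding comb_def by (rule M.lsum_smult[OF a, symmetric]) (use mod_hom_closed[OF L q] in simp)
 finally show ?thesis .
qed

lemma comb_tr:
 assumes M: "left_module A M" and \<nu>: "\<nu> : \<Lambda>" "e \<nu> < k"
  and L: "!!s. s : set L ==> fst s : mod_hom A (P \<nu>) M"
  and q: "!!s. s : set L ==> q s : carrier (P \<nu>)"
 shows "comb M L q : tr k M" unfolding comb_def
 by (rule lsum_in_submodule[OF tr_submodule[OF M]]) (use tr_into[OF M \<nu> L q] in simp)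

lemma comb_carrier_update [simp]: "comb (M(|carrier := W|)) L q = comb M L q" by (simp add: comb_def)

text \<open>A layer \<open>W/F\<close> in the additive closure of \<open>D \<nu>\<close>, without quotients: maps \<open>\<sigma> : P \<nu> \<rightarrow> W\<close> and
 \<open>\<tau> : W \<rightarrow> D \<nu>\<close> such that modulo \<open>F\<close> each \<open>y\<close> is the sum of the \<open>\<sigma>\<close> applied to lifts of the
 \<open>\<tau> y\<close>.\<close>

definition layer where
 "layer \<nu> M W F L \<longleftrightarrow>
  (\<forall>s\<in>set L. fst s : mod_hom A (P \<nu>) (M(|carrier := W|)) & snd s : mod_hom A (M(|carrier := W|)) (D \<nu>)) \<and>
  (\<forall>y\<in>W. \<forall>q. lifts \<nu> L y q \<longrightarrow> (\<exists>z\<in>F. y = comb M L q +[M] z))"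

text \<open>Maps \<open>D \<nu> \<rightarrow> W/F\<close> lift to \<open>P \<nu> \<rightarrow> W\<close> because \<open>P \<nu>\<close> is projective.\<close>

lemma layer_exists:
 assumes M: "left_module A M" and \<nu>: "\<nu> : \<Lambda>" and W: "submodule W A M" and F: "submodule F A M" and FW: "F <= W"
  and a: "add_of A {D \<nu>} (quotient_module (M(|carrier := W|)) F)"
 obtains L where "layer \<nu> M W F L"
proof -
 let ?W = "M(|carrier := W|)" let ?Q = "quotient_module ?W F"
 interpret M: left_module A M by fact
 have Wm: "left_module A ?W" by (rule submodule_module[OF M W])
 have FW': "submodule F A ?W" by (rule submodule_of_submodule[OF M W F FW])
 interpret W: left_module A ?W by fact
 have Q: "left_module A ?Q" by (rule quotient_left_module[OF Wm FW'])
 let ?c = "%y. F +>\<^bsub>?W\<^esub> y"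
 note c = quotient_proj[OF Wm FW'] and cs = quotient_carrier[OF Wm FW', symmetric]
 obtain L where L: "!!t s. (t, s) : set L ==> t : mod_hom A ?Q (D \<nu>) & s : mod_hom A (D \<nu>) ?Q"
  "!!x. x : carrier ?Q ==> x = lsum ?Q (%(t, s). s (t x)) L"
  by (rule sum_factors_list[OF a[unfolded add_of_def]]) (rule that)
 define sg where "sg s = (SOME g. g : mod_hom A (P \<nu>) ?W & (\<forall>x\<in>carrier (P \<nu>). ?c (g x) = s (p \<nu> x)))" for s
 have sg: "sg s : mod_hom A (P \<nu>) ?W & (\<forall>x\<in>carrier (P \<nu>). ?c (sg s x) = s (p \<nu> x))"
  if sh: "s : mod_hom A (D \<nu>) ?Q" for s
 proof -
  obtain g where "g : mod_hom A (P \<nu>) ?W" "!!x. x : carrier (P \<nu>) ==> ?c (g x) = s (p \<nu> x)"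
   by (rule P_lift[OF \<nu> Wm Q c cs mod_hom_comp[OF p_hom[OF \<nu>] sh]]) (rule that)
  then have "\<exists>g. g : mod_hom A (P \<nu>) ?W & (\<forall>x\<in>carrier (P \<nu>). ?c (g x) = s (p \<nu> x))"
   by (intro exI[of _ g] conjI ballI)
  then show ?thesis unfolding sg_def by (rule someI_ex)
 qed
 let ?f = "%ts. (sg (snd ts), %y. fst ts (?c y))"
 let ?L = "map ?f L"
 have Lc: "fst ts : mod_hom A ?Q (D \<nu>)" "snd ts : mod_hom A (D \<nu>) ?Q" if "ts : set L" for ts
  using L(1)[of "fst ts" "snd ts"] that by simp_all
 have hs: "fst s : mod_hom A (P \<nu>) ?W & snd s : mod_hom A ?W (D \<nu>)" if s: "s : set ?L" for s
 proof -
  obtain ts where ts: "ts : set L" "s = ?f ts" using s by auto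
  show ?thesis unfolding ts(2) using sg[OF Lc(2)[OF ts(1)]] mod_hom_comp[OF c Lc(1)[OF ts(1)]] by simp
 qed
 have "layer \<nu> M W F ?L" unfolding layer_def
 proof (intro conjI ballI allI impI)
  fix y q assume y: "y : W" and q: "lifts \<nu> ?L y q"
  have yW: "y : carrier ?W" using y by simp
  have qc: "q (?f ts) : carrier (P \<nu>)" "p \<nu> (q (?f ts)) = fst ts (?c y)" if "ts : set L" for ts
   using q that unfolding lifts_def by auto
  have qs: "q s : carrier (P \<nu>)" if "s : set ?L" for s by (rule conjunct1[OF bspec[OF q[unfolded lifts_def] that]])
  have cW: "comb ?W ?L q : carrier ?W" by (rule comb_closed[OF Wm conjunct1[OF hs] qs])
  have "?c (comb ?W ?L q) = lsum ?Q (%s. ?c (fst s (q s))) ?L" unfolding comb_def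
   by (rule lsum_hom[OF Wm Q c]) (rule mod_hom_closed[OF conjunct1[OF hs] qs])
  also have "\<dots> = lsum ?Q (%ts. ?c (sg (snd ts) (q (?f ts)))) L" by (simp add: lsum_map)
  also have "\<dots> = lsum ?Q (%(t, s). s (t (?c y))) L"
  proof (rule lsum_cong)
   fix ts assume ts: "ts : set L"
   show "?c (sg (snd ts) (q (?f ts))) = (case ts of (t, s) => s (t (?c y)))"
    using conjunct2[OF sg[OF Lc(2)[OF ts]]] qc[OF ts] by (simp add: case_prod_unfold)
  qed
  also have "\<dots> = ?c y" by (rule L(2)[OF mod_hom_closed[OF c yW], symmetric])
  finally have "?c y = ?c (comb ?W ?L q)" by (rule sym)
  then have d: "y -[?W] comb ?W ?L q : F" using quotient_eq_iff[OF Wm FW' yW cW] by simp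
  have "y = comb ?W ?L q +[?W] (y +[?W] -[?W] comb ?W ?L q)" by (rule W.M.add_sub_cancel(2)[OF cW yW, symmetric])
  then show "\<exists>z\<in>F. y = comb M ?L q +[M] z"
   using d by (intro bexI[of _ "y +[?W] -[?W] comb ?W ?L q"]) (simp_all add: a_minus_def)
 qed (use hs in auto)
 then show ?thesis by (rule that)
qed

lemma layerD:
 assumes "layer \<nu> M W F L" "s : set L"
 shows "fst s : mod_hom A (P \<nu>) (M(|carrier := W|))" "snd s : mod_hom A (M(|carrier := W|)) (D \<nu>)"
 using assms unfolding layer_def by simp_all

lemma layer_decomp:
 assumes "layer \<nu> M W F L" "y : W" "lifts \<nu> L y q"
 obtains z where "z : F" "y = comb M L q +[M] z" using assms unfolding layer_def by blast

lemma layer_lifts: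
 assumes "layer \<nu> M W F L" "\<nu> : \<Lambda>" "y : W"
 obtains q where "lifts \<nu> L y q"
 by (rule lifts_exist[OF assms(2), of L y]) (use mod_hom_closed[OF layerD(2)[OF assms(1)]] assms(3) in simp, rule that)

text \<open>By induction along the numbering: a nonzero map \<open>P \<mu> \<rightarrow> D \<kappa>\<close> is nonzero on a layer of the kernel, so
 that some \<open>\<nu> > \<mu>\<close> has a nonzero map \<open>P \<nu> \<rightarrow> D \<kappa>\<close>, or it induces a map \<open>D \<mu> \<rightarrow> D \<kappa>\<close>.\<close>

lemma hom_P_D: "[|\<mu> : \<Lambda>; \<kappa> : \<Lambda>; hom_nonzero A (P \<mu>) (D \<kappa>)|] ==> \<mu> \<le> \<kappa>"
proof (induction "e \<mu>" arbitrary: \<mu> rule: less_induct)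
 case less
 note \<mu> = less.prems(1) and \<kappa> = less.prems(2)
 note Pm = P_mod[OF \<mu>] and Dm = D_mod[OF \<kappa>]
 interpret Dl: left_module A "D \<kappa>" by (rule Dm)
 obtain h x where h: "h : mod_hom A (P \<mu>) (D \<kappa>)" and x: "x : carrier (P \<mu>)" "h x \<noteq> 0[D \<kappa>]"
  using less.prems(3) unfolding hom_nonzero_def by blast
 have key: "(\<forall>y\<in>F. h y = 0[D \<kappa>]) \<or> \<mu> \<le> \<kappa>" if "Filt A (D ` {\<nu> : \<Lambda>. \<mu> < \<nu>}) (P \<mu>) F" for F using that
 proof induction
  case zero
  show ?case using mod_hom_zero[OF Pm Dm h] by simp
 next
  case (step F W X)
  show ?case
  proof (rule disjCI)
   assume nle: "\<not> \<mu> \<le> \<kappa>"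
   then have hF: "h z = 0[D \<kappa>]" if "z : F" for z using step.IH that by blast
   obtain \<nu> where \<nu>: "\<nu> : \<Lambda>" "\<mu> < \<nu>" "X = D \<nu>" using step(4) by blast
   have F: "submodule F A (P \<mu>)" by (rule Filt_submodule[OF step(1) Pm])
   obtain L where L: "layer \<nu> (P \<mu>) W F L"
    by (rule layer_exists[OF Pm \<nu>(1) step(2) F step(3) step(5)[unfolded \<nu>(3)]]) (rule that)
   have Lm: "fst s : mod_hom A (P \<nu>) (P \<mu>)" if "s : set L" for s
    by (rule mod_hom_out_of_submodule[OF layerD(1)[OF L that] submodule_subset[OF step(2)]])
   have z: "h (fst s u) = 0[D \<kappa>]" if s: "s : set L" and u: "u : carrier (P \<nu>)" for s u
   proof (rule ccontr)
    assume "h (fst s u) \<noteq> 0[D \<kappa>]"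
    then have "hom_nonzero A (P \<nu>) (D \<kappa>)" by (rule hom_nonzeroI[OF mod_hom_comp[OF Lm[OF s] h] u])
    then have "\<nu> \<le> \<kappa>" by (rule less.hyps[OF e_less[OF \<mu> \<nu>(1,2)] \<nu>(1) \<kappa>])
    then show False using nle \<nu>(2) by simp
   qed
   show "\<forall>y\<in>W. h y = 0[D \<kappa>]"
   proof
    fix y assume y: "y : W"
    obtain q where q: "lifts \<nu> L y q" by (rule layer_lifts[OF L \<nu>(1) y]) (rule that)
    obtain z where zF: "z : F" "y = comb (P \<mu>) L q +[P \<mu>] z" by (rule layer_decomp[OF L y q]) (rule that)
    have qc: "q s : carrier (P \<nu>)" if "s : set L" for s using q that by (simp add: lifts_def)
    have "h (comb (P \<mu>) L q) = lsum (D \<kappa>) (%s. h (fst s (q s))) L"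
     unfolding comb_def by (rule lsum_hom[OF Pm Dm h]) (rule mod_hom_closed[OF Lm qc])
    also have "\<dots> = 0[D \<kappa>]" by (rule Dl.M.lsum_zero) (rule z[OF _ qc])
    finally have hc: "h (comb (P \<mu>) L q) = 0[D \<kappa>]" .
    have "h y = h (comb (P \<mu>) L q) +[D \<kappa>] h z" unfolding zF(2)
     by (rule mod_hom_add[OF h comb_closed[OF Pm Lm qc]]) (use zF(1) submodule_subset[OF F] in auto)
    then show "h y = 0[D \<kappa>]" using hc hF[OF zF(1)] by simp
   qed
  qed
 qed
 show "\<mu> \<le> \<kappa>"
 proof (rule ccontr)
  assume nle: "\<not> \<mu> \<le> \<kappa>"
  have k: "h y = 0[D \<kappa>]" if "y : carrier (P \<mu>)" "p \<mu> y = 0[D \<mu>]" for y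
   using key[OF K_filt[OF \<mu>]] nle that unfolding a_kernel_eq by simp
  obtain g where g: "g : mod_hom A (D \<mu>) (D \<kappa>)" "!!y. y : carrier (P \<mu>) ==> g (p \<mu> y) = h y"
   by (rule mod_hom_factor[OF Pm D_mod[OF \<mu>] Dm p_hom[OF \<mu>] p_surj[OF \<mu>] h k]) (simp, simp, rule that)
  have "hom_nonzero A (D \<mu>) (D \<kappa>)"
   by (rule hom_nonzeroI[OF g(1) mod_hom_closed[OF p_hom[OF \<mu>] x(1)]]) (simp add: g(2)[OF x(1)] x(2))
  then show False using D_hom[OF \<mu> \<kappa>] nle by simp
 qed
qed

lemma hom_P_D_zero:
 assumes "\<mu> : \<Lambda>" "\<kappa> : \<Lambda>" "e \<mu> < e \<kappa>" "h : mod_hom A (P \<mu>) (D \<kappa>)" "x : carrier (P \<mu>)"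
 shows "h x = 0[D \<kappa>]"
proof (rule ccontr)
 assume "h x \<noteq> 0[D \<kappa>]"
 then have "hom_nonzero A (P \<mu>) (D \<kappa>)" by (rule hom_nonzeroI[OF assms(4,5)])
 then have "\<mu> \<le> \<kappa>" by (rule hom_P_D[OF assms(1,2)])
 then have "\<mu> = \<kappa> \<or> \<mu> < \<kappa>" by (simp add: order_le_less disj_commute)
 then show False using e_less[OF assms(1,2)] assms(3) by auto
qed

text \<open>The projectives \<open>P \<mu>\<close> numbered before \<open>\<kappa>\<close> do not satisfy \<open>\<mu> \<le> \<kappa>\<close>.\<close>

lemma tr_D_zero:
 assumes \<kappa>: "\<kappa> : \<Lambda>" and k: "k \<le> e \<kappa>" and y: "y : tr k (D \<kappa>)"
 shows "y = 0[D \<kappa>]"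
proof (rule trace_eq_zero[OF tr_Ps D_mod[OF \<kappa>] _ y])
 fix Q assume "Q : P ` {\<mu> : \<Lambda>. e \<mu> < k}"
 then obtain \<mu> where \<mu>: "\<mu> : \<Lambda>" "e \<mu> < e \<kappa>" "Q = P \<mu>" using k by auto
 show "\<not> hom_nonzero A Q (D \<kappa>)" unfolding hom_nonzero_def \<mu>(3) using hom_P_D_zero[OF \<mu>(1) \<kappa> \<mu>(2)] by blast
qed

abbreviation K :: "'l => 'p set" where
 "K \<alpha> \<equiv> a_kernel (P \<alpha>) (D \<alpha>) (p \<alpha>)"

text \<open>The layers of the kernel have types above \<open>\<kappa>\<close>, so lifts to the \<open>P \<nu>\<close> show that the kernel is
 contained in the trace.  Conversely the trace maps into the trace of \<open>D \<kappa>\<close>, which is zero.\<close>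

lemma K_eq_tr:
 assumes \<kappa>: "\<kappa> : \<Lambda>" shows "K \<kappa> = tr (e \<kappa>) (P \<kappa>)"
proof
 note Pm = P_mod[OF \<kappa>] and Dm = D_mod[OF \<kappa>]
 have "F <= tr (e \<kappa>) (P \<kappa>)" if "Filt A (D ` {\<nu> : \<Lambda>. \<kappa> < \<nu>}) (P \<kappa>) F" for F using that
 proof induction
  case zero
  show ?case using trace.zero by simp
 next
  case (step F W X)
  obtain \<nu> where \<nu>: "\<nu> : \<Lambda>" "\<kappa> < \<nu>" "X = D \<nu>" using step(4) by blast
  have F: "submodule F A (P \<kappa>)" by (rule Filt_submodule[OF step(1) Pm])
  obtain L where L: "layer \<nu> (P \<kappa>) W F L"
   by (rule layer_exists[OF Pm \<nu>(1) step(2) F step(3) step(5)[unfolded \<nu>(3)]]) (rule that)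
  have Lm: "fst s : mod_hom A (P \<nu>) (P \<kappa>)" if "s : set L" for s
   by (rule mod_hom_out_of_submodule[OF layerD(1)[OF L that] submodule_subset[OF step(2)]])
  show ?case
  proof
   fix y assume y: "y : W"
   obtain q where q: "lifts \<nu> L y q" by (rule layer_lifts[OF L \<nu>(1) y]) (rule that)
   obtain z where zF: "z : F" "y = comb (P \<kappa>) L q +[P \<kappa>] z" by (rule layer_decomp[OF L y q]) (rule that)
   have qc: "q s : carrier (P \<nu>)" if "s : set L" for s using q that by (simp add: lifts_def)
   have "comb (P \<kappa>) L q : tr (e \<kappa>) (P \<kappa>)" by (rule comb_tr[OF Pm \<nu>(1) e_less[OF \<kappa> \<nu>(1,2)] Lm qc])
   then show "y : tr (e \<kappa>) (P \<kappa>)"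
    unfolding zF(2) using zF(1) step.IH by (intro submodule_add[OF tr_submodule[OF Pm]]) auto
  qed
 qed
 from this[OF K_filt[OF \<kappa>]] show "K \<kappa> <= tr (e \<kappa>) (P \<kappa>)" .
 show "tr (e \<kappa>) (P \<kappa>) <= K \<kappa>"
 proof
  fix y assume y: "y : tr (e \<kappa>) (P \<kappa>)"
  have "p \<kappa> y = 0[D \<kappa>]" by (rule tr_D_zero[OF \<kappa> order_refl tr_hom[OF Pm Dm p_hom[OF \<kappa>] y]])
  then show "y : K \<kappa>" unfolding a_kernel_eq using tr_closed[OF Pm y] by simp
 qed
qed

end

section \<open>Traces in filtered modules\<close>

lemma submodule_trans:
 assumes "left_module A M" "submodule F A M" "submodule X A (M(|carrier := F|))"
 shows "submodule X A M" by (rule submodule_intro[OF assms(1)])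
  (use submodule_subset[OF assms(2)] submodule_subset[OF assms(3)] submodule_zero[OF assms(3)]
   submodule_add[OF assms(3)] submodule_smult[OF assms(3)] in auto)

context standard_modules
begin

lemma layer_carrier_update [simp]: "layer \<nu> (M(|carrier := F|)) X Y L \<longleftrightarrow> layer \<nu> M X Y L" by (simp add: layer_def)

lemma comb_cong: "(!!s. s : set L ==> q s = q' s) ==> comb M L q = comb M L q'"
 unfolding comb_def by (rule lsum_cong) simp

context
 fixes M :: "('a, 'n, 'v) module_scheme" and \<nu> W F L
 assumes M: "left_module A M" and nu: "\<nu> : \<Lambda>" and W: "submodule W A M" and F: "submodule F A M"
  and FW: "F <= W" and L: "layer \<nu> M W F L"
begin

lemma layer_Wm: "left_module A (M(|carrier := W|))" and layer_Fm: "left_module A (M(|carrier := F|))"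
 by (rule submodule_module[OF M W], rule submodule_module[OF M F])

lemma layer_fst: "s : set L ==> fst s : mod_hom A (P \<nu>) M"
 by (rule mod_hom_out_of_submodule[OF layerD(1)[OF L] submodule_subset[OF W]])

lemma lifts_closed: "[|lifts \<nu> K' y q; s : set K'|] ==> q s : carrier (P \<nu>)" by (simp add: lifts_def)

text \<open>A map from \<open>P \<mu>\<close> with \<open>e \<mu> < e \<nu>\<close> cannot reach a layer of type \<open>\<nu>\<close>.\<close>

lemma layer_tr_low:
 assumes k: "k \<le> e \<nu>" and y: "y : tr k (M(|carrier := W|))"
 shows "y : tr k (M(|carrier := F|))" using y
proof induction
 case zero
 show ?case using trace.zero[of "M(|carrier := F|)"] by simp
next
 case (step Q g x y)
 interpret M: left_module A M by (rule M)
 interpret Pn: left_module A "P \<nu>" by (rule P_mod[OF nu])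
 obtain \<mu> where mu: "\<mu> : \<Lambda>" "e \<mu> < k" "Q = P \<mu>" using step(1) by blast
 have "g u : F" if u: "u : carrier Q" for u
 proof -
  have gW: "g u : W" using mod_hom_closed[OF step(2) u] by simp
  have z: "snd s (g u) = 0[D \<nu>]" if s: "s : set L" for s
   by (rule hom_P_D_zero[OF mu(1) nu _ mod_hom_comp[OF step(2)[unfolded mu(3)] layerD(2)[OF L s]]])
    (use mu k u in simp_all)
  have l: "lifts \<nu> L (g u) (%_. 0[P \<nu>])"
   unfolding lifts_def using z mod_hom_zero[OF P_mod[OF nu] D_mod[OF nu] p_hom[OF nu]] by simp
  obtain w where w: "w : F" "g u = comb M L (%_. 0[P \<nu>]) +[M] w" by (rule layer_decomp[OF L gW l]) (rule that)
  have "comb M L (%_. 0[P \<nu>]) = 0[M]"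
   unfolding comb_def by (rule M.M.lsum_zero) (rule mod_hom_zero[OF P_mod[OF nu] M layer_fst])
  then have "g u = w" using w submodule_subset[OF F] by auto
  then show ?thesis using w(1) by simp
 qed
 then have "g : mod_hom A Q (M(|carrier := F|))"
  using mod_hom_into_submodule[OF mod_hom_out_of_submodule[OF step(2) submodule_subset[OF W]]] by simp
 from trace.step[OF step(1) this step(3) step.IH] show ?case by simp
qed

lemma layer_tr_decomp:
 assumes y: "y : tr k (M(|carrier := W|))"
 shows "\<exists>q. lifts \<nu> L y q & (\<exists>z\<in>tr k (M(|carrier := F|)). y = comb M L q +[M] z)" using y
proof induction
 interpret M: left_module A M by (rule M)
 interpret Pn: left_module A "P \<nu>" by (rule P_mod[OF nu])
 note Pm = P_mod[OF nu] and Dm = D_mod[OF nu]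
 {
  case zero
  have "lifts \<nu> L 0[M(|carrier := W|)] (%_. 0[P \<nu>])"
   unfolding lifts_def using mod_hom_zero[OF Pm Dm p_hom[OF nu]] mod_hom_zero[OF layer_Wm Dm layerD(2)[OF L]] by simp
  moreover have "comb M L (%_. 0[P \<nu>]) = 0[M]"
   unfolding comb_def by (rule M.M.lsum_zero) (rule mod_hom_zero[OF Pm M layer_fst])
  moreover have "0[M] : tr k (M(|carrier := F|))" using trace.zero[of "M(|carrier := F|)"] by simp
  ultimately show ?case by (intro exI[of _ "%_. 0[P \<nu>]"] conjI bexI[of _ "0[M]"]) simp_all
 next
  case (step Q g x y)
  obtain \<mu> where mu: "\<mu> : \<Lambda>" "e \<mu> < k" "Q = P \<mu>" using step(1) by blast
  obtain q' z' where q': "lifts \<nu> L y q'" and z': "z' : tr k (M(|carrier := F|))" "y = comb M L q' +[M] z'"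
   using step.IH by blast
  note Qm = P_mod[OF mu(1), folded mu(3)]
  define gs where "gs s = (SOME f. f : mod_hom A Q (P \<nu>) & (\<forall>u\<in>carrier Q. p \<nu> (f u) = snd s (g u)))" for s :: "('p => 'n) \<times> ('n => 'm)"
  have gs: "gs s : mod_hom A Q (P \<nu>) & (\<forall>u\<in>carrier Q. p \<nu> (gs s u) = snd s (g u))" if s: "s : set L" for s
  proof -
   obtain f where f: "f : mod_hom A (P \<mu>) (P \<nu>)" "!!u. u : carrier (P \<mu>) ==> p \<nu> (f u) = snd s (g u)"
    by (rule P_lift[OF mu(1) Pm Dm p_hom[OF nu] p_surj[OF nu] mod_hom_comp[OF step(2)[unfolded mu(3)] layerD(2)[OF L s]]]) (rule that)
   then have "\<exists>f. f : mod_hom A Q (P \<nu>) & (\<forall>u\<in>carrier Q. p \<nu> (f u) = snd s (g u))"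
    unfolding mu(3) by (intro exI[of _ f] conjI ballI)
   then show ?thesis unfolding gs_def by (rule someI_ex)
  qed
  note gsh = conjunct1[OF gs]
  have gsc: "gs s u : carrier (P \<nu>)" if "s : set L" "u : carrier Q" for s u
   by (rule mod_hom_closed[OF gsh[OF that(1)] that(2)])
  have gl: "lifts \<nu> L (g u) (%s. gs s u)" if u: "u : carrier Q" for u
   unfolding lifts_def using gsc u conjunct2[OF gs] by simp
  note gM = mod_hom_out_of_submodule[OF step(2) submodule_subset[OF W]]
  have ch: "(%u. comb M L (%s. gs s u)) : mod_hom A Q M"
   unfolding comb_def by (rule mod_hom_lsum[OF M]) (rule mod_hom_comp[OF gsh layer_fst])
  let ?G = "%u. g u +[M] -[M] comb M L (%s. gs s u)"
  have GM: "?G : mod_hom A Q M" by (rule mod_hom_plus[OF M gM mod_hom_uminus[OF M ch]])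
  have GF: "?G u : F" if u: "u : carrier Q" for u
  proof -
   have gW: "g u : W" using mod_hom_closed[OF step(2) u] by simp
   obtain w where w: "w : F" "g u = comb M L (%s. gs s u) +[M] w" by (rule layer_decomp[OF L gW gl[OF u]]) (rule that)
   have "?G u = w" unfolding w(2)
    by (rule M.M.add_sub_cancel(1)[OF mod_hom_closed[OF ch u]]) (use w(1) submodule_subset[OF F] in blast)
   then show ?thesis using w(1) by simp
  qed
  have Gx: "?G x : tr k (M(|carrier := F|))"
   by (rule tr_into[OF layer_Fm mu(1,2)]) (use mod_hom_into_submodule[OF GM GF] step(3) mu(3) in simp_all)
  let ?q = "%s. gs s x +[P \<nu>] q' s"
  have qc': "q' s : carrier (P \<nu>)" if "s : set L" for s by (rule lifts_closed[OF q' that])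
  have yW: "y : carrier (M(|carrier := W|))" by (rule tr_closed[OF layer_Wm step(4)])
  have lq: "lifts \<nu> L (g x +[M(|carrier := W|)] y) ?q" unfolding lifts_def
  proof (intro ballI conjI)
   fix s assume s: "s : set L"
   show "?q s : carrier (P \<nu>)" using gsc[OF s step(3)] qc'[OF s] by simp
   have "p \<nu> (?q s) = p \<nu> (gs s x) +[D \<nu>] p \<nu> (q' s)"
    by (rule mod_hom_add[OF p_hom[OF nu] gsc[OF s step(3)] qc'[OF s]])
   also have "\<dots> = snd s (g x) +[D \<nu>] snd s y" using conjunct2[OF gs[OF s]] step(3) q' s by (simp add: lifts_def)
   also have "\<dots> = snd s (g x +[M(|carrier := W|)] y)"
    by (rule mod_hom_add[OF layerD(2)[OF L s] mod_hom_closed[OF step(2,3)] yW, symmetric])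
   finally show "p \<nu> (?q s) = snd s (g x +[M(|carrier := W|)] y)" .
  qed
  have c1: "comb M L (%s. gs s x) : carrier M" by (rule mod_hom_closed[OF ch step(3)])
  have c2: "comb M L q' : carrier M" by (rule comb_closed[OF M layer_fst qc'])
  have z'M: "z' : carrier M" using tr_closed[OF layer_Fm z'(1)] submodule_subset[OF F] by auto
  have gx: "g x = comb M L (%s. gs s x) +[M] ?G x"
   by (rule M.M.add_sub_cancel(2)[OF c1 mod_hom_closed[OF gM step(3)], symmetric])
  have "g x +[M] y = (comb M L (%s. gs s x) +[M] ?G x) +[M] (comb M L q' +[M] z')" using gx z'(2) by simp
  also have "\<dots> = (comb M L (%s. gs s x) +[M] comb M L q') +[M] (?G x +[M] z')"
   using c1 c2 z'M mod_hom_closed[OF GM step(3)] by (simp only: M.M.a_ac M.M.a_closed)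
  also have "comb M L (%s. gs s x) +[M] comb M L q' = comb M L ?q"
   by (rule comb_add[OF M nu layer_fst gsc[OF _ step(3)] qc', symmetric])
  finally have eq: "g x +[M] y = comb M L ?q +[M] (?G x +[M] z')" .
  have "?G x +[M] z' : tr k (M(|carrier := F|))" using submodule_add[OF tr_submodule[OF layer_Fm] Gx z'(1)] by simp
  then show ?case using lq eq by (intro exI[of _ ?q] conjI bexI[of _ "?G x +[M] z'"]) simp_all
 }
qed

text \<open>Two choices of lifts differ by elements of the kernels, whose images are of lower index.\<close>

lemma lifts_change:
 assumes q: "lifts \<nu> L y q" and q': "lifts \<nu> L y q'"
 obtains d where "d : tr (e \<nu>) (M(|carrier := F|))" "comb M L q' = comb M L q +[M] d"
proof -
 interpret M: left_module A M by (rule M)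
 interpret Pn: left_module A "P \<nu>" by (rule P_mod[OF nu])
 interpret Dn: left_module A "D \<nu>" by (rule D_mod[OF nu])
 note Pm = P_mod[OF nu] and Dm = D_mod[OF nu]
 note qc = lifts_closed[OF q] and qc' = lifts_closed[OF q']
 let ?d = "%s. q' s +[P \<nu>] -[P \<nu>] q s"
 have dc: "?d s : carrier (P \<nu>)" if "s : set L" for s using qc[OF that] qc'[OF that] by simp
 have dK: "?d s : tr (e \<nu>) (P \<nu>)" if s: "s : set L" for s
 proof -
  have e: "p \<nu> (q' s) = p \<nu> (q s)" using q q' s by (simp add: lifts_def)
  have "p \<nu> (?d s) = p \<nu> (q' s) +[D \<nu>] -[D \<nu>] p \<nu> (q s)"
   using mod_hom_add[OF p_hom[OF nu] qc'[OF s] Pn.M.a_inv_closed[OF qc[OF s]]]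
    mod_hom_minus[OF Pm Dm p_hom[OF nu] qc[OF s]] by simp
  also have "\<dots> = 0[D \<nu>]" unfolding e by (rule Dn.M.r_neg[OF mod_hom_closed[OF p_hom[OF nu] qc[OF s]]])
  finally show ?thesis unfolding K_eq_tr[OF nu, symmetric] a_kernel_eq using dc[OF s] by simp
 qed
 have "comb (M(|carrier := W|)) L ?d : tr (e \<nu>) (M(|carrier := W|))" unfolding comb_def
  by (rule lsum_in_submodule[OF tr_submodule[OF layer_Wm]]) (rule tr_hom[OF Pm layer_Wm layerD(1)[OF L] dK])
 then have "comb M L ?d : tr (e \<nu>) (M(|carrier := F|))" using layer_tr_low[OF order_refl] by simp
 moreover have "comb M L q' = comb M L q +[M] comb M L ?d"
 proof -
  have "comb M L q' = comb M L (%s. q s +[P \<nu>] ?d s)"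
   by (rule comb_cong) (use Pn.M.add_sub_cancel(2)[OF qc qc'] in simp)
  also have "\<dots> = comb M L q +[M] comb M L ?d" by (rule comb_add[OF M nu layer_fst qc dc])
  finally show ?thesis .
 qed
 ultimately show ?thesis by (rule that)
qed

lemma layer_tr_lifts:
 assumes k: "e \<nu> < k" and y: "y : tr k (M(|carrier := W|))" and q: "lifts \<nu> L y q"
 obtains z where "z : tr k (M(|carrier := F|))" "y = comb M L q +[M] z"
proof -
 interpret M: left_module A M by (rule M)
 obtain q' z where q': "lifts \<nu> L y q'" and z: "z : tr k (M(|carrier := F|))" "y = comb M L q' +[M] z"
  using layer_tr_decomp[OF y] by blast
 obtain d where d: "d : tr (e \<nu>) (M(|carrier := F|))" "comb M L q' = comb M L q +[M] d"
  by (rule lifts_change[OF q q']) (rule that)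
 have d': "d : tr k (M(|carrier := F|))" by (rule tr_mono[OF d(1)]) (use k in simp)
 have c: "comb M L q : carrier M" "d : carrier M" "z : carrier M"
  using comb_closed[OF M layer_fst lifts_closed[OF q]] tr_closed[OF layer_Fm d'] tr_closed[OF layer_Fm z(1)]
   submodule_subset[OF F] by auto
 have "y = comb M L q +[M] (d +[M] z)" unfolding z(2) d(2) by (rule M.M.a_assoc[OF c])
 moreover have "d +[M] z : tr k (M(|carrier := F|))"
  using submodule_add[OF tr_submodule[OF layer_Fm] d' z(1)] by simp
 ultimately show ?thesis by (intro that[of "d +[M] z"])
qed

text \<open>Traces refine: if the layer \<open>tr (e \<kappa> + 1)/tr (e \<kappa>)\<close> of \<open>F\<close> is in the additive closure of
 \<open>D \<kappa>\<close>, so is that of \<open>W\<close>.  The maps to \<open>D \<kappa>\<close> extend from \<open>F\<close> to \<open>W\<close> by subtracting lifts of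
 the \<open>\<nu>\<close>-component; this is well defined because the ambiguity has index below \<open>e \<nu>\<close>.\<close>

lemma trace_layer_step:
 assumes ka: "\<kappa> : \<Lambda>"
  and La: "layer \<kappa> M (tr (Suc (e \<kappa>)) (M(|carrier := F|))) (tr (e \<kappa>) (M(|carrier := F|))) La"
 shows "\<exists>L'. layer \<kappa> M (tr (Suc (e \<kappa>)) (M(|carrier := W|))) (tr (e \<kappa>) (M(|carrier := W|))) L'"
proof (cases "e \<kappa> < e \<nu>")
 case True
 have "tr k (M(|carrier := W|)) = tr k (M(|carrier := F|))" if "k \<le> e \<nu>" for k
  using layer_tr_low[OF that] tr_sub_mono[OF M F W FW] by blast
 then show ?thesis using La True by (intro exI[of _ La]) simp
next
 case False
 then have nk: "e \<nu> < Suc (e \<kappa>)" by simp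
 let ?F1 = "tr (Suc (e \<kappa>)) (M(|carrier := F|))" and ?F0 = "tr (e \<kappa>) (M(|carrier := F|))"
 let ?W1 = "tr (Suc (e \<kappa>)) (M(|carrier := W|))" and ?W0 = "tr (e \<kappa>) (M(|carrier := W|))"
 interpret M: left_module A M by (rule M)
 interpret Dk: left_module A "D \<kappa>" by (rule D_mod[OF ka])
 have F1: "submodule ?F1 A M" and F0: "submodule ?F0 A M"
  by (rule submodule_trans[OF M F tr_submodule[OF layer_Fm]])+
 have W1: "submodule ?W1 A M" and W0: "submodule ?W0 A M"
  by (rule submodule_trans[OF M W tr_submodule[OF layer_Wm]])+
 have F1W1: "?F1 <= ?W1" and F0W0: "?F0 <= ?W0" using tr_sub_mono[OF M F W FW] by blast+
 have F0F1: "?F0 <= ?F1" using tr_mono[of _ "e \<kappa>" _ "Suc (e \<kappa>)"] by auto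
 have F1M: "z : carrier M" if "z : ?F1" for z using submodule_subset[OF F1] that by blast
 have F0M: "z : carrier M" if "z : ?F0" for z using submodule_subset[OF F0] that by blast
 have W1W: "?W1 <= W" using tr_closed[OF layer_Wm] by auto
 have b0: "b z = 0[D \<kappa>]" if b: "b : mod_hom A (M(|carrier := ?F1|)) (D \<kappa>)" and z: "z : ?F0" for b z
 proof -
  have "z : tr (e \<kappa>) ((M(|carrier := F|))(|carrier := ?F1|))"
   by (rule tr_in_tr[OF layer_Fm z tr_submodule[OF layer_Fm] F0F1])
  then have "z : tr (e \<kappa>) (M(|carrier := ?F1|))" by simp
  from tr_hom[OF submodule_module[OF M F1] D_mod[OF ka] b this]
  show ?thesis by (rule tr_D_zero[OF ka order_refl])
 qed
 \<comment> \<open>\<open>z\<close> is what remains of \<open>y\<close> after subtracting lifts of its component of type \<open>\<nu>\<close>; it is not unique.\<close>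
 define dec where "dec y z \<longleftrightarrow> (\<exists>q. lifts \<nu> L y q & z : ?F1 & y = comb M L q +[M] z)" for y z
 have dec_ex: "\<exists>z. dec y z" if "y : ?W1" for y using layer_tr_decomp[OF that] unfolding dec_def by blast
 have dec_uniq: "b z = b z'" if b: "b : mod_hom A (M(|carrier := ?F1|)) (D \<kappa>)" and z: "dec y z" and z': "dec y z'" for b y z z'
 proof -
  obtain q where q: "lifts \<nu> L y q" "z : ?F1" "y = comb M L q +[M] z" using z unfolding dec_def by blast
  obtain q' where q': "lifts \<nu> L y q'" "z' : ?F1" "y = comb M L q' +[M] z'" using z' unfolding dec_def by blast
  obtain d where d: "d : tr (e \<nu>) (M(|carrier := F|))" "comb M L q' = comb M L q +[M] d"
   by (rule lifts_change[OF q(1) q'(1)]) (rule that)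
  have d0: "d : ?F0" by (rule tr_mono[OF d(1)]) (use nk in simp)
  have c: "comb M L q : carrier M" by (rule comb_closed[OF M layer_fst lifts_closed[OF q(1)]])
  have eq: "comb M L q +[M] z = comb M L q +[M] (d +[M] z')"
   using q(3) q'(3) d(2) M.M.a_assoc[OF c F0M[OF d0] F1M[OF q'(2)]] by simp
  have "z = d +[M] z'" by (rule M.M.add.l_cancel[OF eq F1M[OF q(2)] M.M.a_closed[OF F0M[OF d0] F1M[OF q'(2)]] c])
  then have "b z = b d +[D \<kappa>] b z'" using mod_hom_add[OF b, of d z'] F0F1 d0 q'(2) by auto
  then show ?thesis using b0[OF b d0] mod_hom_closed[OF b, of z'] q'(2) by simp
 qed
 have dec_add: "dec (y +[M] y') (z +[M] z')" if y: "y : ?W1" "dec y z" and y': "y' : ?W1" "dec y' z'" for y y' z z'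
 proof -
  obtain q where q: "lifts \<nu> L y q" "z : ?F1" "y = comb M L q +[M] z" using y(2) unfolding dec_def by blast
  obtain q' where q': "lifts \<nu> L y' q'" "z' : ?F1" "y' = comb M L q' +[M] z'" using y'(2) unfolding dec_def by blast
  note qc = lifts_closed[OF q(1)] and qc' = lifts_closed[OF q'(1)]
  have l: "lifts \<nu> L (y +[M] y') (%s. q s +[P \<nu>] q' s)" unfolding lifts_def
  proof (intro ballI conjI)
   fix s assume s: "s : set L"
   interpret Pn: left_module A "P \<nu>" by (rule P_mod[OF nu])
   show "q s +[P \<nu>] q' s : carrier (P \<nu>)" using qc[OF s] qc'[OF s] by simp
   show "p \<nu> (q s +[P \<nu>] q' s) = snd s (y +[M] y')"
    using mod_hom_add[OF p_hom[OF nu] qc[OF s] qc'[OF s]] mod_hom_add[OF layerD(2)[OF L s], of y y']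
     subsetD[OF W1W y(1)] subsetD[OF W1W y'(1)] q(1) q'(1) s by (simp add: lifts_def)
  qed
  have ca: "comb M L (%s. q s +[P \<nu>] q' s) = comb M L q +[M] comb M L q'"
   by (rule comb_add[OF M nu layer_fst qc qc'])
  have cc: "comb M L q : carrier M" by (rule comb_closed[OF M layer_fst qc])
  have cc': "comb M L q' : carrier M" by (rule comb_closed[OF M layer_fst qc'])
  have "y +[M] y' = comb M L (%s. q s +[P \<nu>] q' s) +[M] (z +[M] z')"
   unfolding ca q(3) q'(3) using cc cc' F1M[OF q(2)] F1M[OF q'(2)] by (simp add: M.M.a_ac)
  then show ?thesis unfolding dec_def using l submodule_add[OF F1 q(2) q'(2)] by (intro exI conjI)
 qed
 have dec_smult: "dec (a *[M] y) (a *[M] z)" if a: "a : carrier A" and y: "y : ?W1" "dec y z" for a y z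
 proof -
  obtain q where q: "lifts \<nu> L y q" "z : ?F1" "y = comb M L q +[M] z" using y(2) unfolding dec_def by blast
  note qc = lifts_closed[OF q(1)]
  have l: "lifts \<nu> L (a *[M] y) (%s. a *[P \<nu>] q s)" unfolding lifts_def
  proof (intro ballI conjI)
   fix s assume s: "s : set L"
   interpret Pn: left_module A "P \<nu>" by (rule P_mod[OF nu])
   show "a *[P \<nu>] q s : carrier (P \<nu>)" using qc[OF s] a by simp
   show "p \<nu> (a *[P \<nu>] q s) = snd s (a *[M] y)"
    using mod_hom_smult[OF p_hom[OF nu] a qc[OF s]] mod_hom_smult[OF layerD(2)[OF L s] a, of y]
     subsetD[OF W1W y(1)] q(1) s by (simp add: lifts_def)
  qed
  have ca: "comb M L (%s. a *[P \<nu>] q s) = a *[M] comb M L q" by (rule comb_smult[OF M a layer_fst qc])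
  have cc: "comb M L q : carrier M" by (rule comb_closed[OF M layer_fst qc])
  have "a *[M] y = comb M L (%s. a *[P \<nu>] q s) +[M] a *[M] z"
   unfolding ca q(3) by (rule M.smult_r_distr[OF a cc F1M[OF q(2)]])
  then show ?thesis unfolding dec_def using l submodule_smult[OF F1 a q(2)] by (intro exI conjI)
 qed
 \<comment> \<open>The extension of \<open>b\<close> to the trace of \<open>W\<close>: maps to \<open>D \<kappa>\<close> do not see the choice of the remainder.\<close>
 define ext where "ext b y = b (SOME z. dec y z)" for b :: "'n => 'm" and y
 have ext_eq: "ext b y = b z" if "b : mod_hom A (M(|carrier := ?F1|)) (D \<kappa>)" "dec y z" for b y z
  unfolding ext_def by (rule dec_uniq[OF that(1) someI that(2)]) (rule that(2))
 have decF: "z : ?F1" if "dec y z" for y z using that unfolding dec_def by blast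
 have ext_hom: "ext b : mod_hom A (M(|carrier := ?W1|)) (D \<kappa>)" if b: "b : mod_hom A (M(|carrier := ?F1|)) (D \<kappa>)" for b
 proof (rule mod_homI)
  fix y assume "y : carrier (M(|carrier := ?W1|))"
  then have y: "y : ?W1" by simp
  obtain z where z: "dec y z" using dec_ex[OF y] by blast
  have zc: "z : carrier (M(|carrier := ?F1|))" using decF[OF z] by simp
  show "ext b y : carrier (D \<kappa>)" unfolding ext_eq[OF b z] by (rule mod_hom_closed[OF b zc])
  {
   fix y' assume "y' : carrier (M(|carrier := ?W1|))"
   then have y': "y' : ?W1" by simp
   obtain z' where z': "dec y' z'" using dec_ex[OF y'] by blast
   have zc': "z' : carrier (M(|carrier := ?F1|))" using decF[OF z'] by simp
   show "ext b (y +[M(|carrier := ?W1|)] y') = ext b y +[D \<kappa>] ext b y'"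
    using ext_eq[OF b dec_add[OF y z y' z']] ext_eq[OF b z] ext_eq[OF b z'] mod_hom_add[OF b zc zc'] by simp
  next
   fix a assume a: "a : carrier A"
   show "ext b (a *[M(|carrier := ?W1|)] y) = a *[D \<kappa>] ext b y"
    using ext_eq[OF b dec_smult[OF a y z]] ext_eq[OF b z] mod_hom_smult[OF b a zc] by simp
  }
 qed
 \<comment> \<open>For \<open>\<nu> = \<kappa>\<close> the new layer contributes its own maps.  Otherwise \<open>\<nu>\<close> is numbered before \<open>\<kappa>\<close>, and the
  component of type \<open>\<nu>\<close> already lies in the smaller trace.\<close>
 let ?f = "%s. (fst s, ext (snd s))"
 let ?T = "if \<nu> = \<kappa> then L else []"
 let ?L = "map ?f La @ ?T"
 have hs: "fst s : mod_hom A (P \<kappa>) (M(|carrier := ?W1|)) & snd s : mod_hom A (M(|carrier := ?W1|)) (D \<kappa>)"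
  if s: "s : set ?L" for s
 proof -
  consider s' where "s' : set La" "s = ?f s'" | "\<nu> = \<kappa>" "s : set L" using s by (auto split: if_splits)
  then show ?thesis
  proof cases
   case 1
   have "fst s' : mod_hom A (P \<kappa>) (M(|carrier := ?W1|))"
    using mod_hom_into_submodule[OF mod_hom_out_of_submodule[OF layerD(1)[OF La 1(1)] submodule_subset[OF F1]], of ?W1]
     mod_hom_closed[OF layerD(1)[OF La 1(1)]] F1W1 by auto
   then show ?thesis using ext_hom[OF layerD(2)[OF La 1(1)]] unfolding 1(2) by simp
  next
   case 2
   have "fst s x : ?W1" if "x : carrier (P \<kappa>)" for x
    by (rule tr_into[OF layer_Wm ka _ layerD(1)[OF L 2(2), unfolded 2(1)] that]) simp
   then have "fst s : mod_hom A (P \<kappa>) ((M(|carrier := W|))(|carrier := ?W1|))"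
    using mod_hom_into_submodule[OF layerD(1)[OF L 2(2), unfolded 2(1)]] by blast
   moreover have "snd s : mod_hom A ((M(|carrier := W|))(|carrier := ?W1|)) (D \<kappa>)"
    by (rule mod_hom_from_submodule[OF layerD(2)[OF L 2(2), unfolded 2(1)]]) (use W1W in simp)
   ultimately show ?thesis by simp
  qed
 qed
 have "layer \<kappa> M ?W1 ?W0 ?L" unfolding layer_def
 proof (intro conjI ballI allI impI)
  fix y q assume y: "y : ?W1" and q: "lifts \<kappa> ?L y q"
  have qc: "q s : carrier (P \<kappa>)" "p \<kappa> (q s) = snd s y" if "s : set ?L" for s
   using bspec[OF q[unfolded lifts_def] that] by simp_all
  have qa: "q (?f s) : carrier (P \<kappa>)" "p \<kappa> (q (?f s)) = ext (snd s) y" if "s : set La" for s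
   using qc[of "?f s"] that by simp_all
  let ?qa = "%s. q (?f s)"
  have split: "comb M ?L q = comb M La ?qa +[M] comb M ?T q"
  proof -
   have a: "fst s (q s) : carrier M" if "s : set ?L" for s
    using mod_hom_closed[OF conjunct1[OF hs[OF that]] qc(1)[OF that]] submodule_subset[OF W1] by auto
   have "comb M ?L q = lsum M (%s. fst s (q s)) (map ?f La) +[M] lsum M (%s. fst s (q s)) ?T"
    unfolding comb_def by (rule M.M.lsum_append) (rule a, simp)+
   then show ?thesis by (simp add: comb_def lsum_map)
  qed
  have LaM: "fst s : mod_hom A (P \<kappa>) M" if "s : set La" for s
   by (rule mod_hom_out_of_submodule[OF layerD(1)[OF La that] submodule_subset[OF F1]])
  have cM: "comb M La ?qa : carrier M" by (rule comb_closed[OF M LaM qa(1)])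
  have rest: "\<exists>z0\<in>?F0. z = comb M La ?qa +[M] z0" if d: "dec y z" for z
  proof -
   have "lifts \<kappa> La z ?qa" unfolding lifts_def using qa ext_eq[OF layerD(2)[OF La] d] by simp
   from layer_decomp[OF La decF[OF d] this] show ?thesis by blast
  qed
  show "\<exists>z\<in>?W0. y = comb M ?L q +[M] z"
  proof (cases "\<nu> = \<kappa>")
   case True
   have lq: "lifts \<nu> L y q" unfolding lifts_def using qc True by simp
   obtain z where z: "z : ?F1" "y = comb M L q +[M] z" by (rule layer_tr_lifts[OF nk y lq]) (rule that)
   have "dec y z" unfolding dec_def using lq z by blast
   then obtain z0 where z0: "z0 : ?F0" "z = comb M La ?qa +[M] z0" using rest by blast
   have c: "comb M L q : carrier M" by (rule comb_closed[OF M layer_fst lifts_closed[OF lq]])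
   have "y = comb M ?L q +[M] z0" unfolding split z(2) z0(2) using True c cM F0M[OF z0(1)] by (simp add: M.M.a_ac)
   then show ?thesis using z0(1) F0W0 by blast
  next
   case False
   then have nuk: "e \<nu> < e \<kappa>" using nk inj_onD[OF e_inj _ nu ka] by (metis less_antisym)
   obtain q1 z where q1: "lifts \<nu> L y q1" and z: "z : ?F1" "y = comb M L q1 +[M] z"
    using layer_tr_decomp[OF y] by blast
   have "dec y z" unfolding dec_def using q1 z by blast
   then obtain z0 where z0: "z0 : ?F0" "z = comb M La ?qa +[M] z0" using rest by blast
   have c: "comb M L q1 : carrier M" by (rule comb_closed[OF M layer_fst lifts_closed[OF q1]])
   have "comb (M(|carrier := W|)) L q1 : ?W0"
    by (rule comb_tr[OF layer_Wm nu nuk layerD(1)[OF L] lifts_closed[OF q1]])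
   then have c0: "comb M L q1 : ?W0" by simp
   have "y = comb M ?L q +[M] (comb M L q1 +[M] z0)"
    unfolding split z(2) z0(2) using False c cM F0M[OF z0(1)] by (simp add: comb_def M.M.a_ac)
   moreover have "comb M L q1 +[M] z0 : ?W0" using submodule_add[OF W0 c0] z0(1) F0W0 by blast
   ultimately show ?thesis by (rule bexI)
  qed
 qed (use hs in auto)
 then show ?thesis by (rule exI)
qed

end

lemma Filt_trace_layer:
 assumes M: "left_module A M" and ka: "\<kappa> : \<Lambda>" and f: "Filt A (D ` \<Lambda>) M W"
 shows "\<exists>L. layer \<kappa> M (tr (Suc (e \<kappa>)) (M(|carrier := W|))) (tr (e \<kappa>) (M(|carrier := W|))) L" using f
proof induction
 case zero
 let ?Z = "M(|carrier := {0[M]}|)"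
 interpret M: left_module A M by fact
 have Z: "left_module A ?Z" by (rule submodule_module[OF M zero_submodule[OF M]])
 have z: "0[M] : tr k ?Z" for k using trace.zero[of ?Z] by simp
 have "y = 0[M]" if "y : tr k ?Z" for k y using tr_closed[OF Z that] by simp
 then have "layer \<kappa> M (tr (Suc (e \<kappa>)) ?Z) (tr (e \<kappa>) ?Z) []"
  unfolding layer_def comb_def using z by (auto intro!: bexI[of _ "0[M]"])
 then show ?case by (rule exI)
next
 case (step F W X)
 obtain \<nu> where nu: "\<nu> : \<Lambda>" "X = D \<nu>" using step(4) by blast
 have F: "submodule F A M" by (rule Filt_submodule[OF step(1) M])
 obtain L where L: "layer \<nu> M W F L"
  by (rule layer_exists[OF M nu(1) step(2) F step(3) step(5)[unfolded nu(2)]]) (rule that)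
 obtain La where La: "layer \<kappa> M (tr (Suc (e \<kappa>)) (M(|carrier := F|))) (tr (e \<kappa>) (M(|carrier := F|))) La"
  using step.IH by blast
 show ?case by (rule trace_layer_step[OF M nu(1) step(2) F step(3) L ka La])
qed

lemma P_filt:
 assumes al: "\<alpha> : \<Lambda>"
 shows "Filt A (D ` {\<mu> : \<Lambda>. \<alpha> \<le> \<mu>}) (P \<alpha>) (carrier (P \<alpha>))"
proof (rule Filt.step[OF Filt_mono[OF K_filt[OF al]] carrier_submodule[OF P_mod[OF al]]])
 note Pm = P_mod[OF al] and Dm = D_mod[OF al]
 have K: "submodule (K \<alpha>) A (P \<alpha>)" by (rule kernel_submodule[OF Pm Dm p_hom[OF al]])
 show "D ` {\<mu> : \<Lambda>. \<alpha> < \<mu>} <= D ` {\<mu> : \<Lambda>. \<alpha> \<le> \<mu>}" by (auto simp: order_less_imp_le)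
 show "K \<alpha> <= carrier (P \<alpha>)" by (rule submodule_subset[OF K])
 show "D \<alpha> : D ` {\<mu> : \<Lambda>. \<alpha> \<le> \<mu>}" using al by simp
 have "mod_iso A (quotient_module (P \<alpha>) (K \<alpha>)) (D \<alpha>)"
  by (rule quotient_iso[OF Pm Dm p_hom[OF al] p_surj[OF al] K]) (simp add: a_kernel_eq)
 from add_of_iso[OF quotient_left_module[OF Pm K] Dm this add_of_self[OF Dm]]
 show "add_of A {D \<alpha>} (quotient_module (P \<alpha>(|carrier := carrier (P \<alpha>)|)) (K \<alpha>))" by simp
qed

lemma P_trace_layer:
 assumes al: "\<alpha> : \<Lambda>" and ka: "\<kappa> : \<Lambda>"
 obtains L where "layer \<kappa> (P \<alpha>) (tr (Suc (e \<kappa>)) (P \<alpha>)) (tr (e \<kappa>) (P \<alpha>)) L"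
proof -
 have "Filt A (D ` \<Lambda>) (P \<alpha>) (carrier (P \<alpha>))" by (rule Filt_mono[OF P_filt[OF al]]) blast
 from Filt_trace_layer[OF P_mod[OF al] ka this] show ?thesis using that by auto
qed

text \<open>If \<open>\<alpha> \<le> \<beta>\<close> fails, no layer of \<open>P \<alpha>\<close> has type \<open>\<beta>\<close>, so homomorphisms \<open>P \<beta> \<rightarrow> P \<alpha>\<close> already
 land in the trace of the earlier projectives.\<close>

lemma hom_P_into_tr:
 assumes al: "\<alpha> : \<Lambda>" and be: "\<beta> : \<Lambda>" and n: "\<not> \<alpha> \<le> \<beta>"
  and g: "g : mod_hom A (P \<beta>) (P \<alpha>)" and x: "x : carrier (P \<beta>)"
 shows "g x : tr (e \<beta>) (P \<alpha>)"
proof -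
 note Pm = P_mod[OF al]
 interpret Pa: left_module A "P \<alpha>" by (rule Pm)
 have "tr (Suc (e \<beta>)) ((P \<alpha>)(|carrier := W|)) <= tr (e \<beta>) ((P \<alpha>)(|carrier := W|))"
  if "Filt A (D ` {\<mu> : \<Lambda>. \<alpha> \<le> \<mu>}) (P \<alpha>) W" for W using that
 proof induction
  case zero
  let ?Z = "(P \<alpha>)(|carrier := {0[P \<alpha>]}|)"
  have Z: "left_module A ?Z" by (rule submodule_module[OF Pm zero_submodule[OF Pm]])
  show ?case
  proof
   fix y assume "y : tr (Suc (e \<beta>)) ?Z"
   then have "y = 0[?Z]" using tr_closed[OF Z] by simp
   then show "y : tr (e \<beta>) ?Z" using trace.zero[of ?Z] by simp
  qed
 next
  case (step F W X)
  obtain \<nu> where nu: "\<nu> : \<Lambda>" "\<alpha> \<le> \<nu>" "X = D \<nu>" using step(4) by blast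
  have F: "submodule F A (P \<alpha>)" by (rule Filt_submodule[OF step(1) Pm])
  obtain L where L: "layer \<nu> (P \<alpha>) W F L"
   by (rule layer_exists[OF Pm nu(1) step(2) F step(3) step(5)[unfolded nu(3)]]) (rule that)
  let ?W = "(P \<alpha>)(|carrier := W|)" and ?F = "(P \<alpha>)(|carrier := F|)"
  have Wm: "left_module A ?W" by (rule submodule_module[OF Pm step(2)])
  have FW: "tr (e \<beta>) ?F <= tr (e \<beta>) ?W" using tr_sub_mono[OF Pm F step(2,3)] by blast
  have ne: "e \<nu> \<noteq> e \<beta>" using inj_onD[OF e_inj _ nu(1) be] nu(2) n by blast
  show ?case
  proof
   fix y assume y: "y : tr (Suc (e \<beta>)) ?W"
   show "y : tr (e \<beta>) ?W"
   proof (cases "e \<nu> < e \<beta>")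
    case True
    obtain q z where q: "lifts \<nu> L y q" and z: "z : tr (Suc (e \<beta>)) ?F" "y = comb (P \<alpha>) L q +[P \<alpha>] z"
     using layer_tr_decomp[OF Pm nu(1) step(2) F step(3) L y] by blast
    have "comb ?W L q : tr (e \<beta>) ?W"
     by (rule comb_tr[OF Wm nu(1) True layerD(1)[OF L]]) (use q in "simp_all add: lifts_def")
    moreover have "z : tr (e \<beta>) ?W" using z(1) step.IH FW by blast
    ultimately have "comb ?W L q +[?W] z : tr (e \<beta>) ?W" by (rule submodule_add[OF tr_submodule[OF Wm]])
    then show ?thesis unfolding z(2) by simp
   next
    case False
    then have "Suc (e \<beta>) \<le> e \<nu>" using ne by simp
    from layer_tr_low[OF Pm nu(1) step(2) F step(3) L this y] show ?thesis using step.IH FW by blast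
   qed
  qed
 qed
 from this[OF P_filt[OF al]] have "tr (Suc (e \<beta>)) (P \<alpha>) <= tr (e \<beta>) (P \<alpha>)" by simp
 moreover have "g x : tr (Suc (e \<beta>)) (P \<alpha>)" by (rule tr_into[OF Pm be _ g x]) simp
 ultimately show ?thesis by blast
qed

end

section \<open>The trace filtration of the algebra\<close>

lemma lsum_regular [simp]: "lsum (regular A) f xs = lsum A f xs" by (induction xs) simp_all

lemma regular_minus [simp]: "-[regular A] x = -[A] x" by (simp add: a_inv_def m_inv_def regular_def)

lemma lsum_opposite [simp]: "lsum (opposite A) f xs = lsum A f xs" by (induction xs) simp_all

lemma (in abelian_monoid) lsum_product:
 assumes "!!x y. [|x : set xs; y : set ys|] ==> f (x, y) : carrier G"
 shows "lsum G f (List.product xs ys) = lsum G (%x. lsum G (%y. f (x, y)) ys) xs" using assms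
proof (induction xs)
 case (Cons x xs)
 have "lsum G f (List.product (x # xs) ys) = lsum G f (map (Pair x) ys) \<oplus> lsum G f (List.product xs ys)"
  unfolding product.simps(2) by (rule lsum_append) (use Cons.prems in auto)
 then show ?case using Cons by (simp add: lsum_map)
qed simp

context standard_modules
begin

lemma reg: "left_module A (regular A)" by (rule regular_left_module[OF ring_A])

abbreviation T :: "nat => 'a set" where
 "T k \<equiv> tr k (regular A)"

lemma T_closed: "t : T k ==> t : carrier A" using tr_closed[OF reg] by simp

lemma right_mult_hom: "c : carrier A ==> (%x. x **[A] c) : mod_hom A (regular A) (regular A)"
 using mod_hom_from_regular[OF reg, of c] by simp

lemma T_right_ideal: "[|t : T k; c : carrier A|] ==> t **[A] c : T k" using tr_hom[OF reg reg right_mult_hom] by simp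

text \<open>Layers pass to modules in the additive closure of the \<open>P \<alpha>\<close>, by induction on the number of
 projectives needed.\<close>

lemma add_trace_layer:
 assumes X: "left_module A X" and ka: "\<kappa> : \<Lambda>" and f: "sum_factors A (P ` \<Lambda>) X X h"
 shows "\<exists>L. (\<forall>s\<in>set L. fst s : mod_hom A (P \<kappa>) (X(|carrier := tr (Suc (e \<kappa>)) X|))
   & snd s : mod_hom A (X(|carrier := tr (Suc (e \<kappa>)) X|)) (D \<kappa>)) \<and>
  (\<forall>y\<in>tr (Suc (e \<kappa>)) X. \<forall>q. lifts \<kappa> L y q \<longrightarrow> (\<exists>z\<in>tr (e \<kappa>) X. h y = comb X L q +[X] z))" using f
proof induction
 case (zero h)
 interpret X: left_module A X by fact
 have "h y = 0[X]" if "y : tr (Suc (e \<kappa>)) X" for y by (rule zero[OF tr_closed[OF X that]])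
 then show ?case by (intro exI[of _ "[]"]) (auto simp: comb_def intro!: bexI[of _ "0[X]"] trace.zero)
next
 case (step g M t s h)
 let ?T1 = "tr (Suc (e \<kappa>))" and ?T0 = "tr (e \<kappa>)"
 interpret X: left_module A X by fact
 obtain \<alpha> where al: "\<alpha> : \<Lambda>" "M = P \<alpha>" using step(2) by blast
 note t = step(3)[unfolded al(2)] and s = step(4)[unfolded al(2)] and Pm = P_mod[OF al(1)]
 interpret Pa: left_module A "P \<alpha>" by (rule Pm)
 obtain La where La: "layer \<kappa> (P \<alpha>) (?T1 (P \<alpha>)) (?T0 (P \<alpha>)) La" by (rule P_trace_layer[OF al(1) ka]) (rule that)
 obtain Lg where Lg: "!!r. r : set Lg ==> fst r : mod_hom A (P \<kappa>) (X(|carrier := ?T1 X|))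
   & snd r : mod_hom A (X(|carrier := ?T1 X|)) (D \<kappa>)"
  "!!y q. [|y : ?T1 X; lifts \<kappa> Lg y q|] ==> \<exists>z\<in>?T0 X. g y = comb X Lg q +[X] z" using step.IH by blast
 let ?f = "%r. ((%u. s (fst r u)), (%y. snd r (t y)))"
 let ?L = "map ?f La @ Lg"
 have ts: "t : mod_hom A (X(|carrier := ?T1 X|)) ((P \<alpha>)(|carrier := ?T1 (P \<alpha>)|))"
 proof (rule mod_hom_into_submodule[OF mod_hom_from_submodule[OF t submodule_subset[OF tr_submodule[OF X]]]])
  fix y assume "y : carrier (X(|carrier := ?T1 X|))"
  then show "t y : ?T1 (P \<alpha>)" using tr_hom[OF X Pm t] by simp
 qed
 have LaP: "fst r : mod_hom A (P \<kappa>) (P \<alpha>)" if "r : set La" for r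
  by (rule mod_hom_out_of_submodule[OF layerD(1)[OF La that] submodule_subset[OF tr_submodule[OF Pm]]])
 have LaX: "(%u. s (fst r u)) : mod_hom A (P \<kappa>) X" if "r : set La" for r by (rule mod_hom_comp[OF LaP[OF that] s])
 have LgX: "fst r : mod_hom A (P \<kappa>) X" if "r : set Lg" for r
  by (rule mod_hom_out_of_submodule[OF conjunct1[OF Lg(1)[OF that]] submodule_subset[OF tr_submodule[OF X]]])
 show ?case
 proof (intro exI[of _ ?L] conjI ballI allI impI)
  fix r assume r: "r : set ?L"
  then consider r' where "r' : set La" "r = ?f r'" | "r : set Lg" by auto
  then show "fst r : mod_hom A (P \<kappa>) (X(|carrier := ?T1 X|))"
  proof cases
   case 1
   have "s (fst r' u) : ?T1 X" if u: "u : carrier (P \<kappa>)" for u by (rule tr_into[OF X ka _ LaX[OF 1(1)] u]) simp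
   then show ?thesis unfolding 1(2) using mod_hom_into_submodule[OF LaX[OF 1(1)]] by simp
  next
   case 2
   then show ?thesis using Lg(1) by blast
  qed
 next
  fix r assume r: "r : set ?L"
  then consider r' where "r' : set La" "r = ?f r'" | "r : set Lg" by auto
  then show "snd r : mod_hom A (X(|carrier := ?T1 X|)) (D \<kappa>)"
  proof cases
   case 1
   show ?thesis unfolding 1(2) using mod_hom_comp[OF ts layerD(2)[OF La 1(1)]] by simp
  next
   case 2
   then show ?thesis using Lg(1) by blast
  qed
 next
  fix y q assume y: "y : ?T1 X" and q: "lifts \<kappa> ?L y q"
  have qc: "q r : carrier (P \<kappa>)" "p \<kappa> (q r) = snd r y" if "r : set ?L" for r
   using bspec[OF q[unfolded lifts_def] that] by simp_all
  let ?qa = "%r. q (?f r)"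
  have qa: "?qa r : carrier (P \<kappa>)" "p \<kappa> (?qa r) = snd r (t y)" if "r : set La" for r
   using qc[of "?f r"] that by simp_all
  have qg: "q r : carrier (P \<kappa>)" "p \<kappa> (q r) = snd r y" if "r : set Lg" for r using qc[of r] that by simp_all
  have "lifts \<kappa> La (t y) ?qa" unfolding lifts_def using qa by blast
  then obtain z where z: "z : ?T0 (P \<alpha>)" "t y = comb (P \<alpha>) La ?qa +[P \<alpha>] z"
   by (rule layer_decomp[OF La tr_hom[OF X Pm t y]]) (rule that)
  have "lifts \<kappa> Lg y q" unfolding lifts_def using qg by blast
  then obtain z' where z': "z' : ?T0 X" "g y = comb X Lg q +[X] z'" using Lg(2)[OF y] by blast
  have ca: "comb (P \<alpha>) La ?qa : carrier (P \<alpha>)" by (rule comb_closed[OF Pm LaP qa(1)])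
  have "s (comb (P \<alpha>) La ?qa) = lsum X (%r. s (fst r (?qa r))) La"
   unfolding comb_def by (rule lsum_hom[OF Pm X s]) (rule mod_hom_closed[OF LaP qa(1)])
  then have st: "s (t y) = lsum X (%r. s (fst r (?qa r))) La +[X] s z"
   unfolding z(2) using mod_hom_add[OF s ca tr_closed[OF Pm z(1)]] by simp
  have l1: "lsum X (%r. s (fst r (?qa r))) La : carrier X"
   by (rule X.M.lsum_closed) (rule mod_hom_closed[OF LaX qa(1)])
  have l2: "comb X Lg q : carrier X" by (rule comb_closed[OF X LgX qg(1)])
  have "comb X ?L q = lsum X (%r. fst r (q r)) (map ?f La) +[X] lsum X (%r. fst r (q r)) Lg" unfolding comb_def
   by (rule X.M.lsum_append) (use mod_hom_closed[OF LaX qa(1)] mod_hom_closed[OF LgX qg(1)] in auto)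
  then have c: "comb X ?L q = lsum X (%r. s (fst r (?qa r))) La +[X] comb X Lg q" by (simp add: lsum_map comb_def)
  have sz: "s z : ?T0 X" by (rule tr_hom[OF Pm X s z(1)])
  have "h y = s (t y) +[X] g y" by (rule step(5)[OF tr_closed[OF X y]])
  also have "\<dots> = comb X ?L q +[X] (s z +[X] z')"
   unfolding st z'(2) c using l1 l2 tr_closed[OF X sz] tr_closed[OF X z'(1)] by (simp add: X.M.a_ac)
  finally show "\<exists>z\<in>?T0 X. h y = comb X ?L q +[X] z"
   using submodule_add[OF tr_submodule[OF X] sz z'(1)] by (intro bexI)
 qed
qed

lemma regular_trace_layer:
 assumes ka: "\<kappa> : \<Lambda>"
 obtains L where "layer \<kappa> (regular A) (T (Suc (e \<kappa>))) (T (e \<kappa>)) L"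
 using add_trace_layer[OF reg ka P_gen[unfolded add_of_def]] that unfolding layer_def by blast

text \<open>The layers of \<open>A\<close> are separated by homomorphisms to the standard module.\<close>

lemma layer_separates:
 assumes ka: "\<kappa> : \<Lambda>" and w: "w : T (Suc (e \<kappa>))"
  and z: "!!b. b : mod_hom A ((regular A)(|carrier := T (Suc (e \<kappa>))|)) (D \<kappa>) ==> b w = 0[D \<kappa>]"
 shows "w : T (e \<kappa>)"
proof -
 interpret Rg: left_module A "regular A" by (rule reg)
 interpret Pk: left_module A "P \<kappa>" by (rule P_mod[OF ka])
 obtain L where L: "layer \<kappa> (regular A) (T (Suc (e \<kappa>))) (T (e \<kappa>)) L" by (rule regular_trace_layer[OF ka]) (rule that)
 have l: "lifts \<kappa> L w (%_. 0[P \<kappa>])"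
  unfolding lifts_def using z[OF layerD(2)[OF L]] mod_hom_zero[OF P_mod[OF ka] D_mod[OF ka] p_hom[OF ka]] by simp
 obtain v where v: "v : T (e \<kappa>)" "w = comb (regular A) L (%_. 0[P \<kappa>]) +[regular A] v"
  by (rule layer_decomp[OF L w l]) (rule that)
 have "comb (regular A) L (%_. 0[P \<kappa>]) = 0[regular A]" unfolding comb_def by (rule Rg.M.lsum_zero)
   (rule mod_hom_zero[OF P_mod[OF ka] reg mod_hom_out_of_submodule[OF layerD(1)[OF L] submodule_subset[OF tr_submodule[OF reg]]]])
 then have "w = v" using v T_closed[OF v(1)] Rg.M.l_zero[of v] by simp
 then show ?thesis using v(1) by simp
qed

lemma layer_separates_diff:
 assumes ka: "\<kappa> : \<Lambda>" and u: "u : T (Suc (e \<kappa>))" and v: "v : T (Suc (e \<kappa>))"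
  and eq: "!!b. b : mod_hom A ((regular A)(|carrier := T (Suc (e \<kappa>))|)) (D \<kappa>) ==> b u = b v"
 shows "u -[A] v : T (e \<kappa>)"
proof (rule layer_separates[OF ka])
 interpret Dk: left_module A "D \<kappa>" by (rule D_mod[OF ka])
 show m: "u -[A] v : T (Suc (e \<kappa>))"
  using submodule_add[OF tr_submodule[OF reg] u submodule_minus[OF reg tr_submodule[OF reg] v]]
  by (simp add: a_minus_def)
 fix b assume b: "b : mod_hom A ((regular A)(|carrier := T (Suc (e \<kappa>))|)) (D \<kappa>)"
 have "u = (u -[A] v) +[A] v" using T_closed[OF u] T_closed[OF v] by (simp add: a_minus_def a_assoc l_neg)
 then have "b (u -[A] v) +[D \<kappa>] b v = b v" using mod_hom_add[OF b, of "u -[A] v" v] m v eq[OF b] by simp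
 then show "b (u -[A] v) = 0[D \<kappa>]" using mod_hom_closed[OF b, of "u -[A] v"] mod_hom_closed[OF b, of v] m v
  by (simp add: Dk.M.add.l_cancel_one)
qed

text \<open>The kernel of \<open>p \<kappa>\<close> is a trace that vanishes in "D \<kappa>", so \<open>h\<close> factors through an endomorphism of
 \<open>D \<kappa>\<close>.\<close>

lemma hom_P_D_scalar:
 assumes ka: "\<kappa> : \<Lambda>" and h: "h : mod_hom A (P \<kappa>) (D \<kappa>)"
 obtains r where "r : carrier R" "!!y. y : carrier (P \<kappa>) ==> h y = sc A (D \<kappa>) r (p \<kappa> y)"
proof -
 note Pm = P_mod[OF ka] and Dm = D_mod[OF ka]
 have k: "h y = 0[D \<kappa>]" if y: "y : carrier (P \<kappa>)" "p \<kappa> y = 0[D \<kappa>]" for y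
 proof (rule tr_D_zero[OF ka order_refl tr_hom[OF Pm Dm h]])
  show "y : tr (e \<kappa>) (P \<kappa>)" using y K_eq_tr[OF ka] unfolding a_kernel_eq by blast
 qed
 obtain g where g: "g : mod_hom A (D \<kappa>) (D \<kappa>)" "!!y. y : carrier (P \<kappa>) ==> g (p \<kappa> y) = h y"
  by (rule mod_hom_factor[OF Pm Dm Dm p_hom[OF ka] p_surj[OF ka] h k]) (assumption, assumption, rule that)
 obtain r where r: "r : carrier R" "!!x. x : carrier (D \<kappa>) ==> g x = sc A (D \<kappa>) r x"
  by (rule scalar_end_scalar[OF D_end[OF ka] g(1)]) (rule that)
 show ?thesis by (rule that[OF r(1)]) (simp add: g(2)[symmetric] r(2) mod_hom_closed[OF p_hom[OF ka]])
qed

text \<open>Since \<open>Hom (T (Suc (e \<kappa>)), D \<kappa>)\<close> sees a layer of \<open>A\<close> faithfully, a map \<open>P \<kappa> \<rightarrow> A\<close> is determined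
 modulo the previous layer by its composites with these \<open>b\<close>.  The map \<open>E L t \<xi>\<close> realises the prescription
 \<open>b \<mapsto> \<xi> (b t) \<cdot> p \<kappa>\<close>, where \<open>\<xi>\<close> is an \<open>R\<close>-linear form on \<open>D \<kappa>\<close>; this makes \<open>T (Suc (e \<kappa>)) / T (e \<kappa>)\<close>
 behave like \<open>D \<kappa> \<otimes>\<^sub>R Q \<kappa>\<close>.\<close>

definition E :: "(('p => 'a) \<times> ('a => 'm)) list => 'a => ('m => 'r) => 'p => 'a" where
 "E L t \<xi> y = lsum A (%s. \<xi> (snd s t) *[A] fst s y) L"

lemma T_scalar: "[|r : carrier R; t : T k|] ==> r *[A] t : T k"
 using submodule_smult[OF tr_submodule[OF reg], of "r *[A] 1[A]" t k] scalar_mult_left[OF _ T_closed] by simp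

context
 fixes \<kappa> L
 assumes ka: "\<kappa> : \<Lambda>" and L: "layer \<kappa> (regular A) (T (Suc (e \<kappa>))) (T (e \<kappa>)) L"
begin

abbreviation (input) "TW \<equiv> (regular A)(|carrier := T (Suc (e \<kappa>))|)"

lemma TW: "left_module A TW" by (rule submodule_module[OF reg tr_submodule[OF reg]])

lemma L_fst: "s : set L ==> fst s : mod_hom A (P \<kappa>) (regular A)"
 by (rule mod_hom_out_of_submodule[OF layerD(1)[OF L] submodule_subset[OF tr_submodule[OF reg]]])

lemma L_fst_T: "[|s : set L; y : carrier (P \<kappa>)|] ==> fst s y : T (Suc (e \<kappa>))"
 using mod_hom_closed[OF layerD(1)[OF L]] by simp

lemma L_snd: "[|s : set L; t : T (Suc (e \<kappa>))|] ==> snd s t : carrier (D \<kappa>)"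
 using mod_hom_closed[OF layerD(2)[OF L]] by simp

lemma E_closed:
 assumes "\<xi> : carrier (dual R A (D \<kappa>))" "t : T (Suc (e \<kappa>))" "y : carrier (P \<kappa>)"
 shows "E L t \<xi> y : T (Suc (e \<kappa>))"
proof -
 have "lsum (regular A) (%s. \<xi> (snd s t) *[A] fst s y) L : T (Suc (e \<kappa>))"
  by (rule lsum_in_submodule[OF tr_submodule[OF reg]])
   (rule T_scalar[OF dual_closed[OF assms(1) L_snd[OF _ assms(2)]] L_fst_T[OF _ assms(3)]])
 then show ?thesis unfolding E_def by simp
qed

lemma E_hom:
 assumes "\<xi> : carrier (dual R A (D \<kappa>))" "t : T (Suc (e \<kappa>))"
 shows "E L t \<xi> : mod_hom A (P \<kappa>) (regular A)"
proof -
 have "(%y. lsum (regular A) (%s. sc A (regular A) (\<xi> (snd s t)) (fst s y)) L) : mod_hom A (P \<kappa>) (regular A)"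
  by (rule mod_hom_lsum[OF reg])
   (rule mod_hom_comp[OF L_fst mod_hom_scalar[OF reg dual_closed[OF assms(1) L_snd[OF _ assms(2)]]]])
 then show ?thesis
 proof (rule mod_hom_cong[OF P_mod[OF ka]])
  fix y assume y: "y : carrier (P \<kappa>)"
  have "lsum A (%s. \<xi> (snd s t) *[A] fst s y) L = lsum A (%s. sc A (regular A) (\<xi> (snd s t)) (fst s y)) L"
   by (rule lsum_cong)
    (simp add: scalar_mult_left[OF dual_closed[OF assms(1) L_snd[OF _ assms(2)]] T_closed[OF L_fst_T[OF _ y]]])
  then show "E L t \<xi> y = lsum (regular A) (%s. sc A (regular A) (\<xi> (snd s t)) (fst s y)) L" unfolding E_def by simp
 qed
qed

lemma hom_T_zero:
 assumes b: "b : mod_hom A TW (D \<kappa>)" and t: "t : T (e \<kappa>)"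
 shows "b t = 0[D \<kappa>]"
proof (rule tr_D_zero[OF ka order_refl tr_hom[OF TW D_mod[OF ka] b]])
 show "t : tr (e \<kappa>) TW"
  by (rule tr_in_tr[OF reg t tr_submodule[OF reg]]) (use tr_mono[of _ "e \<kappa>" "regular A" "Suc (e \<kappa>)"] in auto)
qed

lemma hom_T_scalar:
 assumes b: "b : mod_hom A TW (D \<kappa>)" and r: "r : carrier R" and t: "t : T (Suc (e \<kappa>))"
 shows "b (r *[A] t) = sc A (D \<kappa>) r (b t)"
 using mod_hom_smult[OF b one_scalar_closed[OF r], of t] t scalar_mult_left[OF r T_closed[OF t]] by simp

text \<open>All homomorphisms from the layer to \<open>D \<kappa>\<close> are \<open>R\<close>-combinations of those in "L", with the
 coefficients by which \<open>b\<close> acts on the maps \<open>P \<kappa> \<rightarrow> A\<close> in "L".\<close>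

lemma hom_T_expand:
 assumes b: "b : mod_hom A TW (D \<kappa>)"
 obtains c where "!!s. s : set L ==> c s : carrier R"
  "!!s y. [|s : set L; y : carrier (P \<kappa>)|] ==> b (fst s y) = sc A (D \<kappa>) (c s) (p \<kappa> y)"
  "!!t. t : T (Suc (e \<kappa>)) ==> b t = lsum (D \<kappa>) (%s. sc A (D \<kappa>) (c s) (snd s t)) L"
proof -
 interpret Dk: left_module A "D \<kappa>" by (rule D_mod[OF ka])
 define c where "c s = (SOME r. r : carrier R & (\<forall>y\<in>carrier (P \<kappa>). b (fst s y) = sc A (D \<kappa>) r (p \<kappa> y)))" for s :: "('p => 'a) \<times> ('a => 'm)"
 have c: "c s : carrier R & (\<forall>y\<in>carrier (P \<kappa>). b (fst s y) = sc A (D \<kappa>) (c s) (p \<kappa> y))" if s: "s : set L" for s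
 proof -
  obtain r where "r : carrier R" "!!y. y : carrier (P \<kappa>) ==> b (fst s y) = sc A (D \<kappa>) r (p \<kappa> y)"
   by (rule hom_P_D_scalar[OF ka mod_hom_comp[OF layerD(1)[OF L s] b]]) (rule that)
  then have "\<exists>r. r : carrier R & (\<forall>y\<in>carrier (P \<kappa>). b (fst s y) = sc A (D \<kappa>) r (p \<kappa> y))"
   by (intro exI[of _ r] conjI ballI)
  then show ?thesis unfolding c_def by (rule someI_ex)
 qed
 show ?thesis
 proof (rule that[of c])
  show "c s : carrier R" if "s : set L" for s using c[OF that] by blast
  show "b (fst s y) = sc A (D \<kappa>) (c s) (p \<kappa> y)" if "s : set L" "y : carrier (P \<kappa>)" for s y
   using c[OF that(1)] that(2) by blast
  fix t assume t: "t : T (Suc (e \<kappa>))"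
  obtain q where q: "lifts \<kappa> L t q" by (rule layer_lifts[OF L ka t]) (rule that)
  have qc: "q s : carrier (P \<kappa>)" "p \<kappa> (q s) = snd s t" if "s : set L" for s
   using bspec[OF q[unfolded lifts_def] that] by simp_all
  obtain z where z: "z : T (e \<kappa>)" "t = comb (regular A) L q +[regular A] z"
   by (rule layer_decomp[OF L t q]) (rule that)
  have z1: "z : T (Suc (e \<kappa>))" by (rule tr_mono[OF z(1)]) simp
  have cc: "comb TW L q : carrier TW" by (rule comb_closed[OF TW layerD(1)[OF L] qc(1)])
  have "b (comb TW L q) = lsum (D \<kappa>) (%s. b (fst s (q s))) L"
   unfolding comb_def by (rule lsum_hom[OF TW D_mod[OF ka] b]) (rule mod_hom_closed[OF layerD(1)[OF L] qc(1)])
  also have "\<dots> = lsum (D \<kappa>) (%s. sc A (D \<kappa>) (c s) (snd s t)) L" by (rule lsum_cong) (use c qc in simp)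
  finally have bc: "b (comb (regular A) L q) = lsum (D \<kappa>) (%s. sc A (D \<kappa>) (c s) (snd s t)) L" by simp
  have "lsum (D \<kappa>) (%s. sc A (D \<kappa>) (c s) (snd s t)) L : carrier (D \<kappa>)"
   by (rule Dk.M.lsum_closed) (use c L_snd[OF _ t] in simp)
  moreover have "b t = b (comb (regular A) L q) +[D \<kappa>] b z" using mod_hom_add[OF b cc, of z] z1 z(2) by simp
  ultimately show "b t = lsum (D \<kappa>) (%s. sc A (D \<kappa>) (c s) (snd s t)) L" using bc hom_T_zero[OF b z(1)] by simp
 qed
qed

text \<open>Both sides are expanded in the maps of \<open>L\<close>; the coefficients of \<open>b\<close> and of \<open>E\<close> then change places,
 which uses that \<open>R\<close> is commutative.\<close>

lemma hom_E:
 assumes b: "b : mod_hom A TW (D \<kappa>)" and xi: "\<xi> : carrier (dual R A (D \<kappa>))" and t: "t : T (Suc (e \<kappa>))"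
  and y: "y : carrier (P \<kappa>)"
 shows "b (E L t \<xi> y) = sc A (D \<kappa>) (\<xi> (b t)) (p \<kappa> y)"
proof -
 note Dm = D_mod[OF ka]
 interpret Dk: left_module A "D \<kappa>" by (rule Dm)
 interpret DR: left_module R "restrict_scalars A (D \<kappa>)" by (rule restrict_left_module[OF Dm])
 obtain c where c: "!!s. s : set L ==> c s : carrier R"
  "!!s y. [|s : set L; y : carrier (P \<kappa>)|] ==> b (fst s y) = sc A (D \<kappa>) (c s) (p \<kappa> y)"
  "!!t. t : T (Suc (e \<kappa>)) ==> b t = lsum (D \<kappa>) (%s. sc A (D \<kappa>) (c s) (snd s t)) L"
  by (rule hom_T_expand[OF b]) (rule that)
 have py: "p \<kappa> y : carrier (D \<kappa>)" by (rule mod_hom_closed[OF p_hom[OF ka] y])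
 have xs: "\<xi> (snd s t) : carrier R" if "s : set L" for s by (rule dual_closed[OF xi L_snd[OF that t]])
 have "b (lsum TW (%s. \<xi> (snd s t) *[A] fst s y) L) = lsum (D \<kappa>) (%s. b (\<xi> (snd s t) *[A] fst s y)) L"
  by (rule lsum_hom[OF TW Dm b]) (simp add: T_scalar[OF xs L_fst_T[OF _ y]])
 then have "b (E L t \<xi> y) = lsum (D \<kappa>) (%s. b (\<xi> (snd s t) *[A] fst s y)) L" by (simp add: E_def)
 also have "\<dots> = lsum (D \<kappa>) (%s. sc A (D \<kappa>) (c s **[R] \<xi> (snd s t)) (p \<kappa> y)) L"
 proof (rule lsum_cong)
  fix s assume s: "s : set L"
  have "b (\<xi> (snd s t) *[A] fst s y) = sc A (D \<kappa>) (\<xi> (snd s t)) (sc A (D \<kappa>) (c s) (p \<kappa> y))"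
   using hom_T_scalar[OF b xs[OF s] L_fst_T[OF s y]] c(2)[OF s y] by simp
  also have "\<dots> = sc A (D \<kappa>) (\<xi> (snd s t) **[R] c s) (p \<kappa> y)"
   using DR.smult_assoc1[OF xs[OF s] c(1)[OF s], of "p \<kappa> y"] py by simp
  also have "\<xi> (snd s t) **[R] c s = c s **[R] \<xi> (snd s t)" by (rule R.m_comm[OF xs[OF s] c(1)[OF s]])
  finally show "b (\<xi> (snd s t) *[A] fst s y) = sc A (D \<kappa>) (c s **[R] \<xi> (snd s t)) (p \<kappa> y)" .
 qed
 also have "\<dots> = sc A (D \<kappa>) (lsum R (%s. c s **[R] \<xi> (snd s t)) L) (p \<kappa> y)"
  using DR.lsum_smult_left[of "p \<kappa> y" L "%s. c s **[R] \<xi> (snd s t)"] py c(1) xs by simp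
 also have "lsum R (%s. c s **[R] \<xi> (snd s t)) L = \<xi> (b t)"
  unfolding c(3)[OF t] by (rule dual_expand[OF Dm xi, symmetric]) (use c(1) L_snd[OF _ t] in simp)
 finally show ?thesis .
qed

lemma E_add:
 assumes xi: "\<xi> : carrier (dual R A (D \<kappa>))" and t: "t : T (Suc (e \<kappa>))" "t' : T (Suc (e \<kappa>))"
  and y: "y : carrier (P \<kappa>)"
 shows "E L (t +[A] t') \<xi> y = E L t \<xi> y +[A] E L t' \<xi> y"
proof -
 interpret RA: left_module R A by (rule self_left_module)
 have c: "\<xi> (snd s t) *[A] fst s y : carrier A" "\<xi> (snd s t') *[A] fst s y : carrier A" if "s : set L" for s
  using dual_closed[OF xi L_snd[OF that t(1)]] dual_closed[OF xi L_snd[OF that t(2)]] T_closed[OF L_fst_T[OF that y]]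
  by simp_all
 have "E L (t +[A] t') \<xi> y = lsum A (%s. \<xi> (snd s t) *[A] fst s y +[A] \<xi> (snd s t') *[A] fst s y) L" unfolding E_def
 proof (rule lsum_cong)
  fix s assume s: "s : set L"
  have "snd s (t +[A] t') = snd s t +[D \<kappa>] snd s t'" using mod_hom_add[OF layerD(2)[OF L s], of t t'] t by simp
  then have "\<xi> (snd s (t +[A] t')) = \<xi> (snd s t) +[R] \<xi> (snd s t')"
   using mod_hom_add[OF dual_hom[OF xi], of "snd s t" "snd s t'"] L_snd[OF s t(1)] L_snd[OF s t(2)] by simp
  then show "\<xi> (snd s (t +[A] t')) *[A] fst s y = \<xi> (snd s t) *[A] fst s y +[A] \<xi> (snd s t') *[A] fst s y"
   using RA.smult_l_distr dual_closed[OF xi L_snd[OF s t(1)]] dual_closed[OF xi L_snd[OF s t(2)]] T_closed[OF L_fst_T[OF s y]]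
   by simp
 qed
 also have "\<dots> = E L t \<xi> y +[A] E L t' \<xi> y"
  unfolding E_def by (rule abelian_monoid.lsum_add[OF abelian_group.axioms(1)[OF left_module_group[OF self_left_module]]]) (fact c)+
 finally show ?thesis .
qed

text \<open>Composing \<open>b\<close> with a right multiplication gives another test map, and test maps determine the values
 modulo the previous layer.\<close>

lemma E_right_linear:
 assumes xi: "\<xi> : carrier (dual R A (D \<kappa>))" and t: "t : T (Suc (e \<kappa>))" and c: "c : carrier A"
  and y: "y : carrier (P \<kappa>)"
 shows "E L (t **[A] c) \<xi> y -[A] (E L t \<xi> y) **[A] c : T (e \<kappa>)"
proof (rule layer_separates_diff[OF ka])
 note tc = T_right_ideal[OF t c]
 show "E L (t **[A] c) \<xi> y : T (Suc (e \<kappa>))" by (rule E_closed[OF xi tc y])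
 show "(E L t \<xi> y) **[A] c : T (Suc (e \<kappa>))" by (rule T_right_ideal[OF E_closed[OF xi t y] c])
 fix b assume b: "b : mod_hom A TW (D \<kappa>)"
 have "(%x. x **[A] c) : mod_hom A TW TW"
 proof (rule mod_hom_into_submodule[OF mod_hom_from_submodule[OF right_mult_hom[OF c] submodule_subset[OF tr_submodule[OF reg]]]])
  fix x assume "x : carrier TW"
  then show "x **[A] c : T (Suc (e \<kappa>))" using T_right_ideal[OF _ c] by simp
 qed
 from hom_E[OF mod_hom_comp[OF this b] xi t y]
 show "b (E L (t **[A] c) \<xi> y) = b ((E L t \<xi> y) **[A] c)" using hom_E[OF b xi tc y] by simp
qed

lemma E_zero:
 assumes xi: "\<xi> : carrier (dual R A (D \<kappa>))" and t: "t : T (e \<kappa>)" and y: "y : carrier (P \<kappa>)"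
 shows "E L t \<xi> y = 0[A]"
proof -
 interpret RA: left_module R A by (rule self_left_module)
 have x0: "\<xi> 0[D \<kappa>] = 0[R]"
  using mod_hom_zero[OF restrict_left_module[OF D_mod[OF ka]] regular_left_module[OF ring_R] dual_hom[OF xi]] by simp
 show ?thesis unfolding E_def
  by (rule abelian_monoid.lsum_zero[OF abelian_group.axioms(1)[OF left_module_group[OF self_left_module]]]) (simp add: hom_T_zero[OF layerD(2)[OF L] t] x0 T_closed[OF L_fst_T[OF _ y]])
qed

end

end

section \<open>Homomorphisms into the algebra as right modules\<close>

context standard_modules
begin

abbreviation B :: "('r, 'a, 'y) module_scheme" where
 "B \<equiv> opposite A"

abbreviation H :: "'l => ('a, 'p => 'a) module" where
 "H \<alpha> \<equiv> hom_module (%b x. x **[A] b) A (P \<alpha>) (regular A)"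

lemma ring_B: "ring B" by (rule assoc_algebra.ring_A[OF opposite_algebra])

lemma regB: "left_module B (regular B)" by (rule regular_left_module[OF ring_B])

lemma H_mod: assumes al: "\<alpha> : \<Lambda>" shows "left_module B (H \<alpha>)"
 by (rule hom_module_left_module[OF P_mod[OF al] reg ring_B]) (simp_all add: l_distr r_distr m_assoc)

lemma H_hom: "f : carrier (H \<alpha>) ==> f : mod_hom A (P \<alpha>) (regular A)" by (simp add: hom_module_simps)

lemma H_val: "[|f : carrier (H \<alpha>); x : carrier (P \<alpha>)|] ==> f x : carrier A" using mod_hom_closed[OF H_hom] by simp

lemma H_restrict: "[|\<alpha> : \<Lambda>; f : mod_hom A (P \<alpha>) (regular A)|] ==> restrict f (carrier (P \<alpha>)) : carrier (H \<alpha>)"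
 by (rule hom_module_restrict[OF P_mod])

lemma H_eval: "x : carrier (P \<alpha>) ==> (%f. f x) : mod_hom B (H \<alpha>) (regular B)"
 by (rule mod_homI) (simp_all add: H_val hom_module_simps(3,4))

lemma H_lsum_apply:
 assumes al: "\<alpha> : \<Lambda>" and F: "!!s. s : set xs ==> F s : carrier (H \<alpha>)" and x: "x : carrier (P \<alpha>)"
 shows "(lsum (H \<alpha>) F xs) x = lsum A (%s. F s x) xs" using lsum_hom[OF H_mod[OF al] regB H_eval[OF x] F] by simp

lemma H_sc_apply:
 assumes "f : carrier (H \<alpha>)" "r : carrier R" "x : carrier (P \<alpha>)"
 shows "(sc B (H \<alpha>) r f) x = r *[A] f x"
 using assms scalar_mult_right[OF assms(2) H_val[OF assms(1,3)]] by (simp add: hom_module_simps(4))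

text \<open>The maps \<open>P \<alpha> \<rightarrow> A\<close> with image in the ideal \<open>T k\<close>; the filtration of \<open>H \<alpha>\<close> by these submodules has
 layers \<open>Hom (P \<alpha>, T (Suc k) / T k)\<close>.\<close>

definition HF :: "nat => 'l => ('p => 'a) set" where
 "HF k \<alpha> = {f : carrier (H \<alpha>). \<forall>x\<in>carrier (P \<alpha>). f x : T k}"

lemma T_zero: "0[A] : T k" using trace.zero[of "regular A"] by simp

lemma T_add: "[|x : T k; y : T k|] ==> x +[A] y : T k" using submodule_add[OF tr_submodule[OF reg]] by simp

lemma HF_sub: assumes al: "\<alpha> : \<Lambda>" shows "submodule (HF k \<alpha>) B (H \<alpha>)"
proof (rule submodule_intro[OF H_mod[OF al]])
 interpret Ha: left_module B "H \<alpha>" by (rule H_mod[OF al])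
 show "HF k \<alpha> <= carrier (H \<alpha>)" unfolding HF_def by blast
 show "0[H \<alpha>] : HF k \<alpha>" unfolding HF_def using Ha.M.zero_closed T_zero by (simp add: hom_module_simps(2))
 fix f g assume f: "f : HF k \<alpha>" and g: "g : HF k \<alpha>"
 then show "f +[H \<alpha>] g : HF k \<alpha>"
  unfolding HF_def using Ha.M.a_closed[of f g] T_add by (simp add: hom_module_simps(3))
next
 interpret Ha: left_module B "H \<alpha>" by (rule H_mod[OF al])
 fix a f assume "a : carrier B" "f : HF k \<alpha>"
 then show "a *[H \<alpha>] f : HF k \<alpha>"
  unfolding HF_def using Ha.smult_closed[of a f] T_right_ideal by (simp add: hom_module_simps(4))
qed

lemma HF_mono: "k \<le> l ==> HF k \<alpha> <= HF l \<alpha>"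
proof
 fix f assume kl: "k \<le> l" and f: "f : HF k \<alpha>"
 have "f x : T l" if "x : carrier (P \<alpha>)" for x by (rule tr_mono[OF _ kl]) (use f that in "simp add: HF_def")
 then show "f : HF l \<alpha>" using f by (simp add: HF_def)
qed

lemma HF_all: "[|\<alpha> : \<Lambda>; f : carrier (H \<alpha>)|] ==> f : HF (Suc (e \<alpha>)) \<alpha>"
 unfolding HF_def using tr_into[OF reg _ _ H_hom] by simp

lemma HF_val: "[|f : HF k \<alpha>; x : carrier (P \<alpha>)|] ==> f x : T k" unfolding HF_def by blast

lemma HF_H: "f : HF k \<alpha> ==> f : carrier (H \<alpha>)" unfolding HF_def by blast

lemma H_diff_iff:
 assumes al: "\<alpha> : \<Lambda>" and f: "f : carrier (H \<alpha>)" and g: "g : carrier (H \<alpha>)"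
 shows "f -[H \<alpha>] g : HF k \<alpha> \<longleftrightarrow> (\<forall>x\<in>carrier (P \<alpha>). f x -[A] g x : T k)"
proof -
 interpret Ha: left_module B "H \<alpha>" by (rule H_mod[OF al])
 have ng: "-[H \<alpha>] g : carrier (H \<alpha>)" using g by simp
 have m: "-[regular B] y = -[A] y" for y by (simp add: a_inv_def m_inv_def)
 have "(f -[H \<alpha>] g) x = f x -[A] g x" if x: "x : carrier (P \<alpha>)" for x
  using mod_hom_add[OF H_eval[OF x] f ng] mod_hom_minus[OF H_mod[OF al] regB H_eval[OF x] g] m[of "g x"]
  by (simp add: a_minus_def)
 moreover have "f -[H \<alpha>] g : carrier (H \<alpha>)" using f g by simp
 ultimately show ?thesis unfolding HF_def by simp
qed

text \<open>Precomposition with \<open>g : P \<beta> \<rightarrow> P \<alpha>\<close>.\<close>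

definition pc :: "('p => 'p) => 'l => ('p => 'a) => 'p => 'a" where
 "pc g \<beta> f = (\<lambda>y\<in>carrier (P \<beta>). f (g y))"

lemma pc_closed:
 assumes be: "\<beta> : \<Lambda>" and g: "g : mod_hom A (P \<beta>) (P \<alpha>)" and f: "f : mod_hom A (P \<alpha>) (regular A)"
 shows "pc g \<beta> f : carrier (H \<beta>)" unfolding pc_def by (rule H_restrict[OF be mod_hom_comp[OF g f]])

lemma pc_hom:
 assumes be: "\<beta> : \<Lambda>" and g: "g : mod_hom A (P \<beta>) (P \<alpha>)"
 shows "pc g \<beta> : mod_hom B (H \<alpha>) (H \<beta>)"
proof (rule mod_homI)
 fix f assume f: "f : carrier (H \<alpha>)"
 show "pc g \<beta> f : carrier (H \<beta>)" by (rule pc_closed[OF be g H_hom[OF f]])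
 show "pc g \<beta> (f +[H \<alpha>] f') = pc g \<beta> f +[H \<beta>] pc g \<beta> f'" for f'
  unfolding pc_def hom_module_simps(3) by (rule restrict_ext) (simp add: mod_hom_closed[OF g])
 show "pc g \<beta> (b *[H \<alpha>] f) = b *[H \<beta>] pc g \<beta> f" for b
  unfolding pc_def hom_module_simps(4) by (rule restrict_ext) (simp add: mod_hom_closed[OF g])
qed

lemma pc_HF:
 assumes be: "\<beta> : \<Lambda>" and g: "g : mod_hom A (P \<beta>) (P \<alpha>)" and f: "f : HF k \<alpha>"
 shows "pc g \<beta> f : HF k \<beta>"
 unfolding HF_def using pc_closed[OF be g H_hom[OF HF_H[OF f]]] HF_val[OF f mod_hom_closed[OF g]]
 by (simp add: pc_def)

text \<open>A dual basis of \<open>P \<alpha>\<close> expands \<open>Hom (P \<alpha>, A)\<close> as a right module.\<close>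

lemma H_expand:
 assumes al: "\<alpha> : \<Lambda>"
  and Lx: "!!x \<phi>. (x, \<phi>) : set Lx ==> x : carrier (P \<alpha>) & \<phi> : mod_hom A (P \<alpha>) (regular A)"
   "!!y. y : carrier (P \<alpha>) ==> y = lsum (P \<alpha>) (%(x, \<phi>). \<phi> y *[P \<alpha>] x) Lx"
  and f: "f : carrier (H \<alpha>)"
 shows "f = lsum (H \<alpha>) (%(x, \<phi>). f x *[H \<alpha>] restrict \<phi> (carrier (P \<alpha>))) Lx"
proof (rule hom_module_eqI[OF f])
 interpret Ha: left_module B "H \<alpha>" by (rule H_mod[OF al])
 interpret Pa: left_module A "P \<alpha>" by (rule P_mod[OF al])
 have Lc: "fst s : carrier (P \<alpha>)" "snd s : mod_hom A (P \<alpha>) (regular A)" if "s : set Lx" for s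
  using Lx(1)[of "fst s" "snd s"] that by simp_all
 have c: "f (fst s) *[H \<alpha>] restrict (snd s) (carrier (P \<alpha>)) : carrier (H \<alpha>)" if "s : set Lx" for s
  using Ha.smult_closed[OF _ H_restrict[OF al Lc(2)[OF that]], of "f (fst s)"] H_val[OF f Lc(1)[OF that]] by simp
 show "lsum (H \<alpha>) (%(x, \<phi>). f x *[H \<alpha>] restrict \<phi> (carrier (P \<alpha>))) Lx : carrier (H \<alpha>)"
  by (rule Ha.M.lsum_closed) (use c in "simp add: case_prod_unfold")
 fix y assume y: "y : carrier (P \<alpha>)"
 have "f y = f (lsum (P \<alpha>) (%(x, \<phi>). \<phi> y *[P \<alpha>] x) Lx)" using Lx(2)[OF y] by simp
 also have "\<dots> = lsum (regular A) (%s. f (case s of (x, \<phi>) => \<phi> y *[P \<alpha>] x)) Lx"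
  by (rule lsum_hom[OF P_mod[OF al] reg H_hom[OF f]])
   (use mod_hom_closed[OF Lc(2) y] Lc(1) in "simp add: case_prod_unfold")
 also have "\<dots> = lsum A (%s. (case s of (x, \<phi>) => f x *[H \<alpha>] restrict \<phi> (carrier (P \<alpha>))) y) Lx" unfolding lsum_regular
 proof (rule lsum_cong)
  fix s assume s: "s : set Lx"
  show "f (case s of (x, \<phi>) => \<phi> y *[P \<alpha>] x) = (case s of (x, \<phi>) => f x *[H \<alpha>] restrict \<phi> (carrier (P \<alpha>))) y"
   using mod_hom_smult[OF H_hom[OF f] _ Lc(1)[OF s], of "snd s y"] mod_hom_closed[OF Lc(2)[OF s] y] y
   by (simp add: case_prod_unfold hom_module_simps(4))
 qed
 also have "\<dots> = (lsum (H \<alpha>) (%(x, \<phi>). f x *[H \<alpha>] restrict \<phi> (carrier (P \<alpha>))) Lx) y"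
  by (rule H_lsum_apply[OF al _ y, symmetric]) (use c in "simp add: case_prod_unfold")
 finally show "f y = (lsum (H \<alpha>) (%(x, \<phi>). f x *[H \<alpha>] restrict \<phi> (carrier (P \<alpha>))) Lx) y" .
qed

lemma P_dual_basis:
 assumes al: "\<alpha> : \<Lambda>"
 obtains Lx where "!!x \<phi>. (x, \<phi>) : set Lx ==> x : carrier (P \<alpha>) & \<phi> : mod_hom A (P \<alpha>) (regular A)"
  "!!y. y : carrier (P \<alpha>) ==> y = lsum (P \<alpha>) (%(x, \<phi>). \<phi> y *[P \<alpha>] x) Lx"
 by (rule dual_basis[OF P_mod[OF al] P_proj[OF al]]) (rule that)

lemma H_proj:
 assumes al: "\<alpha> : \<Lambda>" shows "add_of B {regular B} (H \<alpha>)"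
proof -
 obtain Lx where Lx: "!!x \<phi>. (x, \<phi>) : set Lx ==> x : carrier (P \<alpha>) & \<phi> : mod_hom A (P \<alpha>) (regular A)"
  "!!y. y : carrier (P \<alpha>) ==> y = lsum (P \<alpha>) (%(x, \<phi>). \<phi> y *[P \<alpha>] x) Lx" by (rule P_dual_basis[OF al]) (rule that)
 let ?f = "%(x, \<phi>). (restrict \<phi> (carrier (P \<alpha>)) :: 'p => 'a, %f :: 'p => 'a. f x)"
 show ?thesis
 proof (rule add_of_regularI[OF H_mod[OF al], of "map ?f Lx"])
  fix u \<psi> assume "(u, \<psi>) : set (map ?f Lx)"
  then obtain x \<phi> where s: "(x, \<phi>) : set Lx" "u = restrict \<phi> (carrier (P \<alpha>))" "\<psi> = (%f. f x)" by auto
  show "u : carrier (H \<alpha>) & \<psi> : mod_hom B (H \<alpha>) (regular B)"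
   unfolding s(2,3) using H_restrict[OF al conjunct2[OF Lx(1)[OF s(1)]]] H_eval[OF conjunct1[OF Lx(1)[OF s(1)]]] by blast
 next
  fix f assume f: "f : carrier (H \<alpha>)"
  show "f = lsum (H \<alpha>) (%(u, \<psi>). \<psi> f *[H \<alpha>] u) (map ?f Lx)"
   using H_expand[OF al Lx f] by (simp add: lsum_map case_prod_unfold)
 qed
qed

text \<open>Transposing a factorisation of \<open>id\<^sub>A\<close> through the \<open>P \<alpha>\<close>.\<close>

lemma regular_in_add_H: "add_of B (H ` \<Lambda>) (regular B)"
proof -
 have "sum_factors B (H ` \<Lambda>) (regular B) (regular B) (%c. h 1[A] **[A] c)"
  if "sum_factors A (P ` \<Lambda>) (regular A) (regular A) h" for h using that
 proof induction
  case (zero h)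
  have "h 1[A] = 0[A]" using zero by simp
  then show ?case by (intro sum_factors.zero) simp
 next
  case (step g M t s h)
  obtain \<alpha> where al: "\<alpha> : \<Lambda>" "M = P \<alpha>" using step(2) by blast
  note t = step(3)[unfolded al(2)] and s = step(4)[unfolded al(2)]
  interpret Ha: left_module B "H \<alpha>" by (rule H_mod[OF al(1)])
  have t1: "t 1[A] : carrier (P \<alpha>)" using mod_hom_closed[OF t] by simp
  have g: "g 1[A] : carrier A" using mod_hom_closed[OF sum_factors_hom[OF reg reg step(1)]] by simp
  have s1: "s (t 1[A]) : carrier A" using mod_hom_closed[OF s t1] by simp
  show ?case
  proof (rule sum_factors.step[OF step.IH])
   show "H \<alpha> : H ` \<Lambda>" using al(1) by blast
   show "(%c. c *[H \<alpha>] restrict s (carrier (P \<alpha>))) : mod_hom B (regular B) (H \<alpha>)"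
    by (rule mod_hom_from_regular[OF H_mod[OF al(1)] H_restrict[OF al(1) s]])
   show "(%f. f (t 1[A])) : mod_hom B (H \<alpha>) (regular B)" by (rule H_eval[OF t1])
   fix c assume "c : carrier (regular B)"
   then have c: "c : carrier A" by simp
   show "h 1[A] **[A] c = (c *[H \<alpha>] restrict s (carrier (P \<alpha>))) (t 1[A]) +[regular B] g 1[A] **[A] c"
    using t1 step(5)[of "1[A]"] l_distr[OF s1 g c] by (simp add: hom_module_simps(4))
  qed
 qed
 from sum_factors_cong[OF this[OF P_gen[unfolded add_of_def]], of "%x. x"] show ?thesis unfolding add_of_def by simp
qed

section \<open>Standard modules over the opposite algebra\<close>

definition Q :: "'l => ('a, ('p => 'a) set) module" where
 "Q \<kappa> = quotient_module (H \<kappa>) (HF (e \<kappa>) \<kappa>)"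

definition pj :: "'l => ('p => 'a) => ('p => 'a) set" where
 "pj \<kappa> f = HF (e \<kappa>) \<kappa> +>\<^bsub>H \<kappa>\<^esub> f"

lemma Q_mod: "\<kappa> : \<Lambda> ==> left_module B (Q \<kappa>)" unfolding Q_def by (rule quotient_left_module[OF H_mod HF_sub])

lemma pj_hom: "\<kappa> : \<Lambda> ==> pj \<kappa> : mod_hom B (H \<kappa>) (Q \<kappa>)" unfolding Q_def pj_def by (rule quotient_proj[OF H_mod HF_sub])

lemma pj_surj: "\<kappa> : \<Lambda> ==> pj \<kappa> ` carrier (H \<kappa>) = carrier (Q \<kappa>)"
 unfolding Q_def pj_def by (rule quotient_carrier[OF H_mod HF_sub, symmetric])

lemma pj_eq_iff:
 assumes ka: "\<kappa> : \<Lambda>" and f: "f : carrier (H \<kappa>)" and g: "g : carrier (H \<kappa>)"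
 shows "pj \<kappa> f = pj \<kappa> g \<longleftrightarrow> (\<forall>y\<in>carrier (P \<kappa>). f y -[A] g y : T (e \<kappa>))"
 unfolding pj_def quotient_eq_iff[OF H_mod[OF ka] HF_sub[OF ka] f g] by (rule H_diff_iff[OF ka f g])

lemma pj_zero_iff:
 assumes ka: "\<kappa> : \<Lambda>" and f: "f : carrier (H \<kappa>)"
 shows "pj \<kappa> f = 0[Q \<kappa>] \<longleftrightarrow> f : HF (e \<kappa>) \<kappa>"
 unfolding pj_def Q_def by (rule quotient_proj_kernel[OF H_mod[OF ka] HF_sub[OF ka] f])

context
 fixes \<alpha> \<kappa> L Lx and Lm :: "('m \<times> ('m => 'r)) list"
 assumes al: "\<alpha> : \<Lambda>" and ka: "\<kappa> : \<Lambda>" and L: "layer \<kappa> (regular A) (T (Suc (e \<kappa>))) (T (e \<kappa>)) L"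
  and Lx: "!!x \<phi>. (x, \<phi>) : set Lx ==> x : carrier (P \<alpha>) & \<phi> : mod_hom A (P \<alpha>) (regular A)"
   "!!y. y : carrier (P \<alpha>) ==> y = lsum (P \<alpha>) (%(x, \<phi>). \<phi> y *[P \<alpha>] x) Lx"
  and Lm: "!!m \<xi>. (m, \<xi>) : set Lm ==> m : carrier (D \<kappa>) & \<xi> : carrier (dual R A (D \<kappa>))"
   "!!y. y : carrier (D \<kappa>) ==> y = lsum (D \<kappa>) (%(m, \<xi>). sc A (D \<kappa>) (\<xi> y) m) Lm"
begin

definition wmap :: "('p => 'a) => 'm => 'p => 'p" where
 "wmap \<phi> m y = \<phi> y *[P \<kappa>] inv_into (carrier (P \<kappa>)) (p \<kappa>) m"

lemma lift_m:
 assumes "m : carrier (D \<kappa>)"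
 shows "inv_into (carrier (P \<kappa>)) (p \<kappa>) m : carrier (P \<kappa>)" "p \<kappa> (inv_into (carrier (P \<kappa>)) (p \<kappa>) m) = m"
 using assms p_surj[OF ka] by (simp_all add: inv_into_into f_inv_into_f)

lemma wmap_hom:
 assumes "\<phi> : mod_hom A (P \<alpha>) (regular A)" "m : carrier (D \<kappa>)"
 shows "wmap \<phi> m : mod_hom A (P \<alpha>) (P \<kappa>)" unfolding wmap_def[abs_def]
 by (rule mod_hom_comp[OF assms(1) mod_hom_from_regular[OF P_mod[OF ka] lift_m(1)[OF assms(2)]]])

lemma p_wmap:
 assumes "\<phi> : mod_hom A (P \<alpha>) (regular A)" "m : carrier (D \<kappa>)" "y : carrier (P \<alpha>)"
 shows "p \<kappa> (wmap \<phi> m y) = \<phi> y *[D \<kappa>] m"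
 unfolding wmap_def using mod_hom_smult[OF p_hom[OF ka] _ lift_m(1)[OF assms(2)], of "\<phi> y"]
  mod_hom_closed[OF assms(1,3)] lift_m(2)[OF assms(2)] by simp

lemma Lx_c: "s : set Lx ==> fst s : carrier (P \<alpha>)" "s : set Lx ==> snd s : mod_hom A (P \<alpha>) (regular A)"
 using Lx(1)[of "fst s" "snd s"] by simp_all

lemma Lm_c: "s : set Lm ==> fst s : carrier (D \<kappa>)" "s : set Lm ==> snd s : carrier (dual R A (D \<kappa>))"
 using Lm(1)[of "fst s" "snd s"] by simp_all

abbreviation (input) "xval f u \<equiv> E L (f (fst (fst u))) (snd (snd u))"
abbreviation (input) "wval u \<equiv> wmap (snd (fst u)) (fst (snd u))"

lemma pair_c:
 assumes "u : set (List.product Lx Lm)"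
 shows "fst (fst u) : carrier (P \<alpha>)" "snd (fst u) : mod_hom A (P \<alpha>) (regular A)"
  "fst (snd u) : carrier (D \<kappa>)" "snd (snd u) : carrier (dual R A (D \<kappa>))"
  "wval u : mod_hom A (P \<alpha>) (P \<kappa>)"
proof -
 have u: "fst u : set Lx" "snd u : set Lm" using assms by auto
 show "fst (fst u) : carrier (P \<alpha>)" by (rule Lx_c(1)[OF u(1)])
 show 1: "snd (fst u) : mod_hom A (P \<alpha>) (regular A)" by (rule Lx_c(2)[OF u(1)])
 show 2: "fst (snd u) : carrier (D \<kappa>)" by (rule Lm_c(1)[OF u(2)])
 show "snd (snd u) : carrier (dual R A (D \<kappa>))" by (rule Lm_c(2)[OF u(2)])
 show "wval u : mod_hom A (P \<alpha>) (P \<kappa>)" by (rule wmap_hom[OF 1 2])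
qed

text \<open>Modulo the previous layer, \<open>f\<close> is the sum of the \<open>E L (f x\<^sub>j) \<xi>\<^sub>i \<circ> w\<^sub>j\<^sub>i\<close> where \<open>w\<^sub>j\<^sub>i\<close> lifts
 \<open>y \<mapsto> \<phi>\<^sub>j(y) m\<^sub>i\<close>: both sides have the same image under every \<open>b : T \<rightarrow> D \<kappa>\<close>.\<close>

lemma HF_expand:
 assumes f: "f : HF (Suc (e \<kappa>)) \<alpha>" and y: "y : carrier (P \<alpha>)"
 shows "f y -[A] lsum A (%u. xval f u (wval u y)) (List.product Lx Lm) : T (e \<kappa>)"
proof (rule layer_separates_diff[OF ka])
 let ?TW = "(regular A)(|carrier := T (Suc (e \<kappa>))|)"
 note TWm = TW[OF ka L] and Dm = D_mod[OF ka] and Pm = P_mod[OF al]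
 interpret Dk: left_module A "D \<kappa>" by (rule Dm)
 interpret Pa: left_module A "P \<alpha>" by (rule Pm)
 let ?F = "%u. xval f u (wval u y)"
 show "f y : T (Suc (e \<kappa>))" by (rule HF_val[OF f y])
 have Fc: "?F u : T (Suc (e \<kappa>))" if u: "u : set (List.product Lx Lm)" for u
  by (rule E_closed[OF ka L pair_c(4)[OF u] HF_val[OF f pair_c(1)[OF u]] mod_hom_closed[OF pair_c(5)[OF u] y]])
 have "lsum (regular A) ?F (List.product Lx Lm) : T (Suc (e \<kappa>))"
  by (rule lsum_in_submodule[OF tr_submodule[OF reg] Fc])
 then show "lsum A ?F (List.product Lx Lm) : T (Suc (e \<kappa>))" by simp
 fix b assume b: "b : mod_hom A ?TW (D \<kappa>)"
 have fW: "f : mod_hom A (P \<alpha>) ?TW" by (rule mod_hom_into_submodule[OF H_hom[OF HF_H[OF f]]]) (rule HF_val[OF f])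
 note bf = mod_hom_comp[OF fW b]
 have "b (lsum ?TW ?F (List.product Lx Lm)) = lsum (D \<kappa>) (%u. b (?F u)) (List.product Lx Lm)"
  by (rule lsum_hom[OF TWm Dm b]) (simp add: Fc del: set_product)
 then have "b (lsum A ?F (List.product Lx Lm)) = lsum (D \<kappa>) (%u. b (?F u)) (List.product Lx Lm)"
  by (simp only: lsum_carrier_update lsum_regular)
 also have "\<dots> = lsum (D \<kappa>) (%u. sc A (D \<kappa>) (snd (snd u) (b (f (fst (fst u))))) (snd (fst u) y *[D \<kappa>] fst (snd u))) (List.product Lx Lm)"
 proof (rule lsum_cong)
  fix u assume u: "u : set (List.product Lx Lm)"
  show "b (?F u) = sc A (D \<kappa>) (snd (snd u) (b (f (fst (fst u))))) (snd (fst u) y *[D \<kappa>] fst (snd u))"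
   using hom_E[OF ka L b pair_c(4)[OF u] HF_val[OF f pair_c(1)[OF u]] mod_hom_closed[OF pair_c(5)[OF u] y]]
    p_wmap[OF pair_c(2,3)[OF u] y] by simp
 qed
 also have "\<dots> = lsum (D \<kappa>) (%s. lsum (D \<kappa>) (%r. sc A (D \<kappa>) (snd r (b (f (fst s)))) (snd s y *[D \<kappa>] fst r)) Lm) Lx"
 proof -
  let ?g = "%u. sc A (D \<kappa>) (snd (snd u) (b (f (fst (fst u))))) (snd (fst u) y *[D \<kappa>] fst (snd u))"
  have "?g (s, r) : carrier (D \<kappa>)" if s: "s : set Lx" and r: "r : set Lm" for s r unfolding fst_conv snd_conv
  proof (rule sc_closed[OF Dm dual_closed[OF Lm_c(2)[OF r] mod_hom_closed[OF bf Lx_c(1)[OF s]]]])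
   show "snd s y *[D \<kappa>] fst r : carrier (D \<kappa>)"
    using Dk.smult_closed[OF _ Lm_c(1)[OF r]] mod_hom_closed[OF Lx_c(2)[OF s] y] by simp
  qed
  then have "lsum (D \<kappa>) ?g (List.product Lx Lm) = lsum (D \<kappa>) (%s. lsum (D \<kappa>) (%r. ?g (s, r)) Lm) Lx"
   by (rule Dk.M.lsum_product)
  then show ?thesis unfolding fst_conv snd_conv .
 qed
 also have "\<dots> = lsum (D \<kappa>) (%s. b (f (snd s y *[P \<alpha>] fst s))) Lx"
 proof (rule lsum_cong)
  fix s assume s: "s : set Lx"
  let ?d = "b (f (fst s))" and ?a = "snd s y"
  have d: "?d : carrier (D \<kappa>)" by (rule mod_hom_closed[OF bf Lx_c(1)[OF s]])
  have a: "?a : carrier A" using mod_hom_closed[OF Lx_c(2)[OF s] y] by simp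
  have "lsum (D \<kappa>) (%r. sc A (D \<kappa>) (snd r ?d) (?a *[D \<kappa>] fst r)) Lm
   = lsum (D \<kappa>) (%r. ?a *[D \<kappa>] sc A (D \<kappa>) (snd r ?d) (fst r)) Lm"
   by (rule lsum_cong) (rule sc_commute[OF Dm dual_closed[OF Lm_c(2) d] a Lm_c(1), symmetric])
  also have "\<dots> = ?a *[D \<kappa>] lsum (D \<kappa>) (%r. sc A (D \<kappa>) (snd r ?d) (fst r)) Lm"
   by (rule Dk.lsum_smult[OF a, symmetric]) (rule sc_closed[OF Dm dual_closed[OF Lm_c(2) d] Lm_c(1)])
  also have "lsum (D \<kappa>) (%r. sc A (D \<kappa>) (snd r ?d) (fst r)) Lm = ?d"
   using Lm(2)[OF d] by (simp add: case_prod_unfold)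
  also have "?a *[D \<kappa>] ?d = b (f (?a *[P \<alpha>] fst s))" by (rule mod_hom_smult[OF bf a Lx_c(1)[OF s], symmetric])
  finally show "lsum (D \<kappa>) (%r. sc A (D \<kappa>) (snd r ?d) (?a *[D \<kappa>] fst r)) Lm = b (f (?a *[P \<alpha>] fst s))" .
 qed
 also have "\<dots> = b (f (lsum (P \<alpha>) (%s. snd s y *[P \<alpha>] fst s) Lx))"
  by (rule lsum_hom[OF Pm Dm bf, symmetric]) (use mod_hom_closed[OF Lx_c(2) y] Lx_c(1) in simp)
 also have "lsum (P \<alpha>) (%s. snd s y *[P \<alpha>] fst s) Lx = y" using Lx(2)[OF y] by (simp add: case_prod_unfold)
 finally show "b (f y) = b (lsum A ?F (List.product Lx Lm))" by (rule sym)
qed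

lemma theta_hom:
 assumes x: "x : carrier (P \<alpha>)" and xi: "\<xi> : carrier (dual R A (D \<kappa>))"
 shows "(%f. pj \<kappa> (restrict (E L (f x) \<xi>) (carrier (P \<kappa>)))) : mod_hom B ((H \<alpha>)(|carrier := HF (Suc (e \<kappa>)) \<alpha>|)) (Q \<kappa>)"
proof (rule mod_homI)
 interpret Hk: left_module B "H \<kappa>" by (rule H_mod[OF ka])
 let ?r = "%f. restrict (E L (f x) \<xi>) (carrier (P \<kappa>))"
 have rc: "?r f : carrier (H \<kappa>)" if "f : HF (Suc (e \<kappa>)) \<alpha>" for f
  by (rule H_restrict[OF ka E_hom[OF ka L xi HF_val[OF that x]]])
 fix f assume "f : carrier ((H \<alpha>)(|carrier := HF (Suc (e \<kappa>)) \<alpha>|))"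
 then have f: "f : HF (Suc (e \<kappa>)) \<alpha>" by simp
 show "pj \<kappa> (?r f) : carrier (Q \<kappa>)" by (rule mod_hom_closed[OF pj_hom[OF ka] rc[OF f]])
 {
  fix g assume "g : carrier ((H \<alpha>)(|carrier := HF (Suc (e \<kappa>)) \<alpha>|))"
  then have g: "g : HF (Suc (e \<kappa>)) \<alpha>" by simp
  have "?r (f +[H \<alpha>] g) = ?r f +[H \<kappa>] ?r g" unfolding hom_module_simps(3)
   by (rule restrict_ext) (simp add: x E_add[OF ka L xi HF_val[OF f x] HF_val[OF g x]])
  then show "pj \<kappa> (?r (f +[(H \<alpha>)(|carrier := HF (Suc (e \<kappa>)) \<alpha>|)] g)) = pj \<kappa> (?r f) +[Q \<kappa>] pj \<kappa> (?r g)"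
   using mod_hom_add[OF pj_hom[OF ka] rc[OF f] rc[OF g]] by simp
 next
  fix c assume "c : carrier B"
  then have c: "c : carrier A" "c : carrier B" by simp_all
  have fc: "c *[H \<alpha>] f : HF (Suc (e \<kappa>)) \<alpha>" by (rule submodule_smult[OF HF_sub[OF al] c(2) f])
  have "pj \<kappa> (?r (c *[H \<alpha>] f)) = pj \<kappa> (c *[H \<kappa>] ?r f)"
   unfolding pj_eq_iff[OF ka rc[OF fc] Hk.smult_closed[OF c(2) rc[OF f]]]
  proof
   fix y assume y: "y : carrier (P \<kappa>)"
   show "?r (c *[H \<alpha>] f) y -[A] (c *[H \<kappa>] ?r f) y : T (e \<kappa>)"
    using E_right_linear[OF ka L xi HF_val[OF f x] c(1) y] x y by (simp add: hom_module_simps(4))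
  qed
  then show "pj \<kappa> (?r (c *[(H \<alpha>)(|carrier := HF (Suc (e \<kappa>)) \<alpha>|)] f)) = c *[Q \<kappa>] pj \<kappa> (?r f)"
   using mod_hom_smult[OF pj_hom[OF ka] c(2) rc[OF f]] by simp
 }
qed

text \<open>The expansion of \<open>f\<close> factors through \<open>Q \<kappa>\<close>: the maps \<open>f \<mapsto> [E L (f x\<^sub>j) \<xi>\<^sub>i]\<close> are right linear and
 kill the previous layer, and the maps back are precompositions with the \<open>w\<^sub>j\<^sub>i\<close>.\<close>

lemma HF_layer_aux:
 "add_of B {Q \<kappa>} (quotient_module ((H \<alpha>)(|carrier := HF (Suc (e \<kappa>)) \<alpha>|)) (HF (e \<kappa>) \<alpha>))"
proof -
 let ?Wb = "HF (Suc (e \<kappa>)) \<alpha>" and ?Wa = "HF (e \<kappa>) \<alpha>"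
 let ?W = "(H \<alpha>)(|carrier := ?Wb|)"
 let ?Y = "quotient_module ?W ?Wa"
 let ?PL = "List.product Lx Lm"
 note Ham = H_mod[OF al] and Hkm = H_mod[OF ka] and Qm = Q_mod[OF ka]
 have W: "left_module B ?W" by (rule submodule_module[OF Ham HF_sub[OF al]])
 interpret W: left_module B ?W by (rule W)
 have W0: "submodule ?Wa B ?W" by (rule submodule_of_submodule[OF Ham HF_sub[OF al] HF_sub[OF al] HF_mono]) simp
 have Y: "left_module B ?Y" by (rule quotient_left_module[OF W W0])
 define c where "c f = ?Wa +>\<^bsub>?W\<^esub> f" for f
 have ch: "c : mod_hom B ?W ?Y" unfolding c_def[abs_def] by (rule quotient_proj[OF W W0])
 have cs: "c ` carrier ?W = carrier ?Y" unfolding c_def[abs_def] by (rule quotient_carrier[OF W W0, symmetric])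
 have ck: "c f = 0[?Y] \<longleftrightarrow> f : ?Wa" if "f : carrier ?W" for f
  unfolding c_def by (rule quotient_proj_kernel[OF W W0 that])
 define tt where "tt u = (SOME t. t : mod_hom B ?Y (Q \<kappa>) \<and>
  (\<forall>f\<in>?Wb. t (c f) = pj \<kappa> (restrict (xval f u) (carrier (P \<kappa>)))))" for u :: "('p \<times> ('p => 'a)) \<times> ('m \<times> ('m => 'r))"
 define ss where "ss u = (SOME s. s : mod_hom B (Q \<kappa>) ?Y \<and>
  (\<forall>g\<in>carrier (H \<kappa>). s (pj \<kappa> g) = c (pc (wval u) \<alpha> g)))" for u :: "('p \<times> ('p => 'a)) \<times> ('m \<times> ('m => 'r))"
 have tt: "tt u : mod_hom B ?Y (Q \<kappa>) & (\<forall>f\<in>?Wb. tt u (c f) = pj \<kappa> (restrict (xval f u) (carrier (P \<kappa>))))"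
  if u: "u : set ?PL" for u
 proof -
  let ?h = "%f. pj \<kappa> (restrict (xval f u) (carrier (P \<kappa>)))"
  have k: "?h f = 0[Q \<kappa>]" if f: "f : carrier ?W" "c f = 0[?Y]" for f
  proof -
   have f0: "f : ?Wa" and f1: "f : ?Wb" using ck[OF f(1)] f by simp_all
   have m: "restrict (xval f u) (carrier (P \<kappa>)) : carrier (H \<kappa>)"
    by (rule H_restrict[OF ka E_hom[OF ka L pair_c(4)[OF u] HF_val[OF f1 pair_c(1)[OF u]]]])
   show ?thesis unfolding pj_zero_iff[OF ka m]
    using m E_zero[OF ka L pair_c(4)[OF u] HF_val[OF f0 pair_c(1)[OF u]]] T_zero by (simp add: HF_def)
  qed
  obtain t where "t : mod_hom B ?Y (Q \<kappa>)" "!!f. f : carrier ?W ==> t (c f) = ?h f"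
   by (rule mod_hom_factor[of B ?W ?Y "Q \<kappa>" c ?h, OF W Y Qm ch cs theta_hom[OF pair_c(1,4)[OF u]]]) (rule k, assumption, assumption, rule that)
  then have "\<exists>t. t : mod_hom B ?Y (Q \<kappa>) & (\<forall>f\<in>?Wb. t (c f) = ?h f)" by (intro exI[of _ t] conjI ballI) simp_all
  then show ?thesis unfolding tt_def by (rule someI_ex)
 qed
 have pcW: "pc (wval u) \<alpha> g : ?Wb" if u: "u : set ?PL" and g: "g : carrier (H \<kappa>)" for u g
  by (rule pc_HF[OF al pair_c(5)[OF u] HF_all[OF ka g]])
 have ss: "ss u : mod_hom B (Q \<kappa>) ?Y & (\<forall>g\<in>carrier (H \<kappa>). ss u (pj \<kappa> g) = c (pc (wval u) \<alpha> g))"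
  if u: "u : set ?PL" for u
 proof -
  have "pc (wval u) \<alpha> : mod_hom B (H \<kappa>) ?W"
   by (rule mod_hom_into_submodule[OF pc_hom[OF al pair_c(5)[OF u]] pcW[OF u]])
  from mod_hom_comp[OF this ch] have h: "(%g. c (pc (wval u) \<alpha> g)) : mod_hom B (H \<kappa>) ?Y" .
  have k: "c (pc (wval u) \<alpha> g) = 0[?Y]" if g: "g : carrier (H \<kappa>)" "pj \<kappa> g = 0[Q \<kappa>]" for g
  proof -
   have "g : HF (e \<kappa>) \<kappa>" using pj_zero_iff[OF ka g(1)] g(2) by simp
   from pc_HF[OF al pair_c(5)[OF u] this] show ?thesis using ck pcW[OF u g(1)] by simp
  qed
  obtain s where "s : mod_hom B (Q \<kappa>) ?Y" "!!g. g : carrier (H \<kappa>) ==> s (pj \<kappa> g) = c (pc (wval u) \<alpha> g)"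
   by (rule mod_hom_factor[of B "H \<kappa>" "Q \<kappa>" ?Y "pj \<kappa>" "%g. c (pc (wval u) \<alpha> g)", OF Hkm Qm Y pj_hom[OF ka] pj_surj[OF ka] h]) (rule k, assumption, assumption, rule that)
  then have "\<exists>s. s : mod_hom B (Q \<kappa>) ?Y & (\<forall>g\<in>carrier (H \<kappa>). s (pj \<kappa> g) = c (pc (wval u) \<alpha> g))"
   by (intro exI[of _ s] conjI ballI)
  then show ?thesis unfolding ss_def by (rule someI_ex)
 qed
 show ?thesis unfolding add_of_def
 proof (rule sum_factors_of_list[OF Y Y, of "map (%u. (tt u, ss u)) ?PL"])
  fix t s assume "(t, s) : set (map (%u. (tt u, ss u)) ?PL)"
  then obtain u where u: "u : set ?PL" "t = tt u" "s = ss u" by auto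
  show "t : mod_hom B ?Y (Q \<kappa>) & s : mod_hom B (Q \<kappa>) ?Y" unfolding u(2,3) using tt[OF u(1)] ss[OF u(1)] by blast
 next
  fix z assume "z : carrier ?Y"
  then obtain f where f: "f : ?Wb" "z = c f" unfolding cs[symmetric] by auto
  define F where "F u = pc (wval u) \<alpha> (restrict (xval f u) (carrier (P \<kappa>)))" for u
  have rc: "restrict (xval f u) (carrier (P \<kappa>)) : carrier (H \<kappa>)" if u: "u : set ?PL" for u
   by (rule H_restrict[OF ka E_hom[OF ka L pair_c(4)[OF u] HF_val[OF f(1) pair_c(1)[OF u]]]])
  have FW: "F u : ?Wb" if u: "u : set ?PL" for u unfolding F_def by (rule pcW[OF u rc[OF u]])
  have lW: "lsum ?W F ?PL : carrier ?W" by (rule W.M.lsum_closed) (simp add: FW del: set_product)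
  have ev: "(%f. f y) : mod_hom B ?W (regular B)" if "y : carrier (P \<alpha>)" for y
   by (rule mod_hom_from_submodule[OF H_eval[OF that] submodule_subset[OF HF_sub[OF al]]])
  have mB: "-[regular B] y = -[A] y" for y by (simp add: a_inv_def m_inv_def)
  have "f -[?W] lsum ?W F ?PL : ?Wa"
  proof -
   have m: "f +[?W] -[?W] lsum ?W F ?PL : carrier ?W" using f(1) lW by (intro W.M.a_closed W.M.a_inv_closed) simp_all
   have "(f +[?W] -[?W] lsum ?W F ?PL) y : T (e \<kappa>)" if y: "y : carrier (P \<alpha>)" for y
   proof -
    have "(lsum ?W F ?PL) y = lsum (regular B) (%u. F u y) ?PL"
     by (rule lsum_hom[OF W regB ev[OF y]]) (simp add: FW del: set_product)
    also have "\<dots> = lsum A (%u. F u y) ?PL" by (simp only: lsum_regular lsum_opposite)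
    also have "\<dots> = lsum A (%u. xval f u (wval u y)) ?PL"
    proof (rule lsum_cong)
     fix u assume u: "u : set ?PL"
     show "F u y = xval f u (wval u y)"
      unfolding F_def pc_def using y mod_hom_closed[OF pair_c(5)[OF u] y] by simp
    qed
    finally have l: "(lsum ?W F ?PL) y = lsum A (%u. xval f u (wval u y)) ?PL" .
    have "(f +[?W] -[?W] lsum ?W F ?PL) y = f y +[A] -[A] (lsum ?W F ?PL) y"
     using mod_hom_add[OF ev[OF y] _ W.M.a_inv_closed[OF lW], of f] f(1)
      mod_hom_minus[OF W regB ev[OF y] lW] mB[of "(lsum ?W F ?PL) y"] by simp
    then show ?thesis using HF_expand[OF f(1) y] unfolding l a_minus_def by simp
   qed
   moreover have "f +[?W] -[?W] lsum ?W F ?PL : carrier (H \<alpha>)" by (rule HF_H) (use m in simp)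
   ultimately show ?thesis unfolding a_minus_def HF_def by blast
  qed
  then have "c f = c (lsum ?W F ?PL)"
   unfolding c_def using quotient_eq_iff[OF W W0, of f "lsum ?W F ?PL"] f(1) lW by simp
  also have "\<dots> = lsum ?Y (%u. c (F u)) ?PL" by (rule lsum_hom[OF W Y ch]) (simp add: FW del: set_product)
  also have "\<dots> = lsum ?Y (%u. ss u (tt u z)) ?PL"
  proof (rule lsum_cong)
   fix u assume u: "u : set ?PL"
   have t: "tt u z = pj \<kappa> (restrict (xval f u) (carrier (P \<kappa>)))"
    unfolding f(2) by (rule bspec[OF conjunct2[OF tt[OF u]] f(1)])
   have "ss u (pj \<kappa> (restrict (xval f u) (carrier (P \<kappa>)))) = c (F u)"
    unfolding F_def by (rule bspec[OF conjunct2[OF ss[OF u]] rc[OF u]])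
   then show "c (F u) = ss u (tt u z)" unfolding t by (rule sym)
  qed
  finally show "z = lsum ?Y (%(t, s). s (t z)) (map (%u. (tt u, ss u)) ?PL)"
   unfolding f(2)[symmetric] lsum_map by simp
 qed
qed

text \<open>For \<open>\<alpha> = \<kappa>\<close> the expansion, written out in the maps of \<open>L\<close>, is a dual basis of \<open>Q \<kappa>\<close> over \<open>R\<close>.\<close>

lemma Q_lattice_aux:
 assumes eq: "\<alpha> = \<kappa>" shows "lattice R B (Q \<kappa>)"
proof -
 note pc1 = pair_c[unfolded eq]
 let ?PL = "List.product Lx Lm" and ?RQ = "restrict_scalars B (Q \<kappa>)" and ?RH = "restrict_scalars B (H \<kappa>)"
 note Hm = H_mod[OF ka] and Qm = Q_mod[OF ka]
 interpret Hk: left_module B "H \<kappa>" by (rule Hm)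
 interpret Bo: assoc_algebra R B by (rule opposite_algebra)
 have RQ: "left_module R ?RQ" by (rule Bo.restrict_left_module[OF Qm])
 have RH: "left_module R ?RH" by (rule Bo.restrict_left_module[OF Hm])
 have RR: "left_module R (regular R)" by (rule regular_left_module[OF ring_R])
 have pjR: "pj \<kappa> : mod_hom R ?RH ?RQ" by (rule Bo.mod_hom_restrict_scalars[OF pj_hom[OF ka]])
 have pjs: "pj \<kappa> ` carrier ?RH = carrier ?RQ" using pj_surj[OF ka] by simp
 let ?wv = "%u. wmap (snd (fst u)) (fst (snd u))"
 let ?val = "%u s f. snd (snd u) (snd s (f (fst (fst u))))"
 let ?el = "%u s. pc (?wv u) \<kappa> (fst s)"
 define \<Psi> where "\<Psi> v = (SOME t. t : mod_hom R ?RQ (regular R) \<and>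
  (\<forall>f\<in>carrier (H \<kappa>). t (pj \<kappa> f) = ?val (fst v) (snd v) f))"
  for v :: "(('p \<times> ('p => 'a)) \<times> ('m \<times> ('m => 'r))) \<times> (('p => 'a) \<times> ('a => 'm))"
 have fT: "f x : T (Suc (e \<kappa>))" if "f : carrier (H \<kappa>)" "x : carrier (P \<kappa>)" for f x
  by (rule HF_val[OF HF_all[OF ka that(1)] that(2)])
 have Psi: "\<Psi> v : mod_hom R ?RQ (regular R) & (\<forall>f\<in>carrier (H \<kappa>). \<Psi> v (pj \<kappa> f) = ?val (fst v) (snd v) f)"
  if v: "fst v : set ?PL" "snd v : set L" for v
 proof -
  note xc = pc1(1)[OF v(1)] and xic = pc1(4)[OF v(1)]
  let ?h = "?val (fst v) (snd v)"
  have h: "?h : mod_hom R ?RH (regular R)"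
  proof (rule mod_homI)
   fix f assume "f : carrier ?RH"
   then have f: "f : carrier (H \<kappa>)" by simp
   note d = L_snd[OF ka L v(2) fT[OF f xc]]
   show "?h f : carrier (regular R)" using dual_closed[OF xic d] by simp
   {
    fix g assume "g : carrier ?RH"
    then have g: "g : carrier (H \<kappa>)" by simp
    note d' = L_snd[OF ka L v(2) fT[OF g xc]]
    have "snd (snd v) (f (fst (fst (fst v))) +[A] g (fst (fst (fst v)))) =
     snd (snd v) (f (fst (fst (fst v)))) +[D \<kappa>] snd (snd v) (g (fst (fst (fst v))))"
     using mod_hom_add[OF layerD(2)[OF L v(2)], of "f (fst (fst (fst v)))" "g (fst (fst (fst v)))"] fT[OF f xc] fT[OF g xc]
     by simp
    then show "?h (f +[?RH] g) = ?h f +[regular R] ?h g"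
     using mod_hom_add[OF dual_hom[OF xic], of "snd (snd v) (f (fst (fst (fst v))))" "snd (snd v) (g (fst (fst (fst v))))"]
      d d' xc by (simp add: hom_module_simps(3))
   next
    fix r assume r: "r : carrier R"
    have "(sc B (H \<kappa>) r f) (fst (fst (fst v))) = r *[A] f (fst (fst (fst v)))" by (rule H_sc_apply[OF f r xc])
    then show "?h (r *[?RH] f) = r *[regular R] ?h f"
     using hom_T_scalar[OF ka L layerD(2)[OF L v(2)] r fT[OF f xc]] dual_sc[OF xic r d] by simp
   }
  qed
  have k: "?h f = 0[regular R]" if f: "f : carrier ?RH" "pj \<kappa> f = 0[?RQ]" for f
  proof -
   have fH: "f : carrier (H \<kappa>)" using f(1) by simp
   have "f : HF (e \<kappa>) \<kappa>" using pj_zero_iff[OF ka fH] f(2) by simp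
   then have "snd (snd v) (f (fst (fst (fst v)))) = 0[D \<kappa>]"
    by (rule hom_T_zero[OF ka L layerD(2)[OF L v(2)] HF_val[OF _ xc]])
   then show ?thesis using mod_hom_zero[OF restrict_left_module[OF D_mod[OF ka]] RR dual_hom[OF xic]] by simp
  qed
  obtain t where "t : mod_hom R ?RQ (regular R)" "!!f. f : carrier ?RH ==> t (pj \<kappa> f) = ?h f"
   by (rule mod_hom_factor[of R ?RH ?RQ "regular R" "pj \<kappa>" ?h, OF RH RQ RR pjR pjs h]) (rule k, assumption, assumption, rule that)
  then have "\<exists>t. t : mod_hom R ?RQ (regular R) & (\<forall>f\<in>carrier (H \<kappa>). t (pj \<kappa> f) = ?h f)"
   by (intro exI[of _ t] conjI ballI) simp_all
  then show ?thesis unfolding \<Psi>_def by (rule someI_ex)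
 qed
 have el: "?el u s : carrier (H \<kappa>)" if u: "u : set ?PL" and s: "s : set L" for u s
  by (rule pc_closed[OF ka pc1(5)[OF u] L_fst[OF ka L s]])
 let ?TL = "List.product ?PL L"
 have TLm: "fst v : set ?PL" "snd v : set L" if "v : set ?TL" for v using that by auto
 let ?m = "%v. (pj \<kappa> (?el (fst v) (snd v)), \<Psi> v)"
 have "add_of R {regular R} ?RQ"
 proof (rule add_of_regularI[OF RQ, of "map ?m ?TL"])
  fix x \<psi> assume "(x, \<psi>) : set (map ?m ?TL)"
  then obtain v where v: "v : set ?TL" "x = pj \<kappa> (?el (fst v) (snd v))" "\<psi> = \<Psi> v" by auto
  show "x : carrier ?RQ & \<psi> : mod_hom R ?RQ (regular R)"
   unfolding v(2,3) using Psi[OF TLm[OF v(1)]] mod_hom_closed[OF pj_hom[OF ka] el[OF TLm[OF v(1)]]] by simp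
 next
  fix z assume "z : carrier ?RQ"
  then have "z : carrier (Q \<kappa>)" by simp
  then obtain f where f: "f : carrier (H \<kappa>)" "z = pj \<kappa> f" unfolding pj_surj[OF ka, symmetric] by auto
  define F where "F v = sc B (H \<kappa>) (?val (fst v) (snd v) f) (?el (fst v) (snd v))"
   for v :: "(('p \<times> ('p => 'a)) \<times> ('m \<times> ('m => 'r))) \<times> (('p => 'a) \<times> ('a => 'm))"
  have vc: "?val u s f : carrier R" if u: "u : set ?PL" and s: "s : set L" for u s
   by (rule dual_closed[OF pc1(4)[OF u] L_snd[OF ka L s fT[OF f(1) pc1(1)[OF u]]]])
  have FH: "F v : carrier (H \<kappa>)" if v: "v : set ?TL" for v
   unfolding F_def by (rule Bo.sc_closed[OF Hm vc[OF TLm[OF v]] el[OF TLm[OF v]]])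
  have lH: "lsum (H \<kappa>) F ?TL : carrier (H \<kappa>)" by (rule Hk.M.lsum_closed[OF FH])
  have "pj \<kappa> f = pj \<kappa> (lsum (H \<kappa>) F ?TL)" unfolding pj_eq_iff[OF ka f(1) lH]
  proof
   fix y assume y: "y : carrier (P \<kappa>)"
   have Fy: "F (u, s) y = ?val u s f *[A] fst s (?wv u y)" if u: "u : set ?PL" and s: "s : set L" for u s
    unfolding F_def fst_conv snd_conv H_sc_apply[OF el[OF u s] vc[OF u s] y] by (simp add: pc_def y)
   have "(lsum (H \<kappa>) F ?TL) y = lsum A (%v. F v y) ?TL" by (rule H_lsum_apply[OF ka FH y])
   also have "\<dots> = lsum A (%u. lsum A (%s. F (u, s) y) L) ?PL"
   proof (rule abelian_monoid.lsum_product[OF abelian_group.axioms(1)[OF left_module_group[OF self_left_module]]])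
    fix u s assume u: "u : set ?PL" and s: "s : set L"
    have "(u, s) : set ?TL" using u s by simp
    from H_val[OF FH[OF this] y] show "F (u, s) y : carrier A" .
   qed
   also have "\<dots> = lsum A (%u. E L (f (fst (fst u))) (snd (snd u)) (?wv u y)) ?PL"
   proof (rule lsum_cong)
    fix u assume u: "u : set ?PL"
    show "lsum A (%s. F (u, s) y) L = E L (f (fst (fst u))) (snd (snd u)) (?wv u y)"
     unfolding E_def by (rule lsum_cong) (rule Fy[OF u])
   qed
   finally have l: "(lsum (H \<kappa>) F ?TL) y = lsum A (%u. E L (f (fst (fst u))) (snd (snd u)) (?wv u y)) ?PL" .
   show "f y -[A] (lsum (H \<kappa>) F ?TL) y : T (e \<kappa>)"
    unfolding l by (rule HF_expand[unfolded eq, OF HF_all[OF ka f(1)] y])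
  qed
  also have "\<dots> = lsum (Q \<kappa>) (%v. pj \<kappa> (F v)) ?TL" by (rule lsum_hom[OF Hm Qm pj_hom[OF ka] FH])
  also have "\<dots> = lsum (Q \<kappa>) (%v. \<Psi> v z *[?RQ] pj \<kappa> (?el (fst v) (snd v))) ?TL"
  proof (rule lsum_cong)
   fix v assume v: "v : set ?TL"
   have p: "\<Psi> v z = ?val (fst v) (snd v) f" unfolding f(2) by (rule bspec[OF conjunct2[OF Psi[OF TLm[OF v]]] f(1)])
   show "pj \<kappa> (F v) = \<Psi> v z *[?RQ] pj \<kappa> (?el (fst v) (snd v))" unfolding p F_def restrict_scalars_simps
    by (rule Bo.mod_hom_sc[OF pj_hom[OF ka] vc[OF TLm[OF v]] el[OF TLm[OF v]]])
  qed
  finally show "z = lsum ?RQ (%(x, \<psi>). \<psi> z *[?RQ] x) (map ?m ?TL)"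
   unfolding f(2)[symmetric] lsum_map lsum_restrict_scalars by simp
 qed
 then show ?thesis unfolding lattice_def using Qm by simp
qed

end

lemma HF_layer:
 assumes al: "\<alpha> : \<Lambda>" and ka: "\<kappa> : \<Lambda>"
 shows "add_of B {Q \<kappa>} (quotient_module ((H \<alpha>)(|carrier := HF (Suc (e \<kappa>)) \<alpha>|)) (HF (e \<kappa>) \<alpha>))"
proof -
 obtain L where L: "layer \<kappa> (regular A) (T (Suc (e \<kappa>))) (T (e \<kappa>)) L" by (rule regular_trace_layer[OF ka]) (rule that)
 obtain Lx where Lx: "!!x \<phi>. (x, \<phi>) : set Lx ==> x : carrier (P \<alpha>) & \<phi> : mod_hom A (P \<alpha>) (regular A)"
  "!!y. y : carrier (P \<alpha>) ==> y = lsum (P \<alpha>) (%(x, \<phi>). \<phi> y *[P \<alpha>] x) Lx" by (rule P_dual_basis[OF al]) (rule that)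
 obtain Lm where Lm: "!!m \<xi>. (m, \<xi>) : set Lm ==> m : carrier (D \<kappa>) & \<xi> : carrier (dual R A (D \<kappa>))"
  "!!y. y : carrier (D \<kappa>) ==> y = lsum (D \<kappa>) (%(m, \<xi>). sc A (D \<kappa>) (\<xi> y) m) Lm"
  by (rule dual_coordinates[OF D_lattice[OF ka]]) (rule that)
 show ?thesis by (rule HF_layer_aux[OF al ka L Lx Lm])
qed

lemma Q_lattice:
 assumes ka: "\<kappa> : \<Lambda>" shows "lattice R B (Q \<kappa>)"
proof -
 obtain L where L: "layer \<kappa> (regular A) (T (Suc (e \<kappa>))) (T (e \<kappa>)) L" by (rule regular_trace_layer[OF ka]) (rule that)
 obtain Lx where Lx: "!!x \<phi>. (x, \<phi>) : set Lx ==> x : carrier (P \<kappa>) & \<phi> : mod_hom A (P \<kappa>) (regular A)"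
  "!!y. y : carrier (P \<kappa>) ==> y = lsum (P \<kappa>) (%(x, \<phi>). \<phi> y *[P \<kappa>] x) Lx" by (rule P_dual_basis[OF ka]) (rule that)
 obtain Lm where Lm: "!!m \<xi>. (m, \<xi>) : set Lm ==> m : carrier (D \<kappa>) & \<xi> : carrier (dual R A (D \<kappa>))"
  "!!y. y : carrier (D \<kappa>) ==> y = lsum (D \<kappa>) (%(m, \<xi>). sc A (D \<kappa>) (\<xi> y) m) Lm"
  by (rule dual_coordinates[OF D_lattice[OF ka]]) (rule that)
 show ?thesis by (rule Q_lattice_aux[OF ka ka L Lx Lm refl])
qed

end

context standard_modules
begin

text \<open>Every homomorphism \<open>H \<alpha> \<rightarrow> Q \<beta>\<close> is precomposition with some \<open>P \<beta> \<rightarrow> P \<alpha>\<close>: evaluate it on a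
 dual basis of \<open>P \<alpha>\<close>.\<close>

lemma hom_H_Q:
 assumes al: "\<alpha> : \<Lambda>" and be: "\<beta> : \<Lambda>" and h: "h : mod_hom B (H \<alpha>) (Q \<beta>)"
 obtains g where "g : mod_hom A (P \<beta>) (P \<alpha>)" "!!f. f : carrier (H \<alpha>) ==> h f = pj \<beta> (pc g \<beta> f)"
proof -
 note Ham = H_mod[OF al] and Hbm = H_mod[OF be] and Qm = Q_mod[OF be] and Pm = P_mod[OF al]
 interpret Ha: left_module B "H \<alpha>" by (rule Ham)
 interpret Hb: left_module B "H \<beta>" by (rule Hbm)
 interpret Pa: left_module A "P \<alpha>" by (rule Pm)
 obtain Lx where Lx: "!!x \<phi>. (x, \<phi>) : set Lx ==> x : carrier (P \<alpha>) & \<phi> : mod_hom A (P \<alpha>) (regular A)"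
  "!!y. y : carrier (P \<alpha>) ==> y = lsum (P \<alpha>) (%(x, \<phi>). \<phi> y *[P \<alpha>] x) Lx" by (rule P_dual_basis[OF al]) (rule that)
 have Lc: "fst s : carrier (P \<alpha>)" "snd s : mod_hom A (P \<alpha>) (regular A)" if "s : set Lx" for s
  using Lx(1)[of "fst s" "snd s"] that by simp_all
 let ?r = "%s. restrict (snd s) (carrier (P \<alpha>))"
 have rH: "?r s : carrier (H \<alpha>)" if "s : set Lx" for s by (rule H_restrict[OF al Lc(2)[OF that]])
 define u where "u s = inv_into (carrier (H \<beta>)) (pj \<beta>) (h (?r s))" for s :: "'p \<times> ('p => 'a)"
 have u: "u s : carrier (H \<beta>)" "pj \<beta> (u s) = h (?r s)" if s: "s : set Lx" for s
 proof -
  have "h (?r s) : pj \<beta> ` carrier (H \<beta>)" using mod_hom_closed[OF h rH[OF s]] pj_surj[OF be] by simp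
  then show "u s : carrier (H \<beta>)" "pj \<beta> (u s) = h (?r s)" unfolding u_def by (simp_all add: inv_into_into f_inv_into_f)
 qed
 let ?g = "%y. lsum (P \<alpha>) (%s. u s y *[P \<alpha>] fst s) Lx"
 have g: "?g : mod_hom A (P \<beta>) (P \<alpha>)"
  by (rule mod_hom_lsum[OF Pm]) (rule mod_hom_comp[OF H_hom[OF u(1)] mod_hom_from_regular[OF Pm Lc(1)]])
 show ?thesis
 proof (rule that[OF g])
  fix f assume f: "f : carrier (H \<alpha>)"
  have fx: "f (fst s) : carrier B" if "s : set Lx" for s using H_val[OF f Lc(1)[OF that]] by simp
  have c: "f (fst s) *[H \<beta>] u s : carrier (H \<beta>)" if "s : set Lx" for s
   by (rule Hb.smult_closed[OF fx[OF that] u(1)[OF that]])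
  have "h f = h (lsum (H \<alpha>) (%s. f (fst s) *[H \<alpha>] ?r s) Lx)"
   using H_expand[OF al Lx f] by (simp add: case_prod_unfold)
  also have "\<dots> = lsum (Q \<beta>) (%s. h (f (fst s) *[H \<alpha>] ?r s)) Lx"
   by (rule lsum_hom[OF Ham Qm h]) (rule Ha.smult_closed[OF fx rH])
  also have "\<dots> = lsum (Q \<beta>) (%s. pj \<beta> (f (fst s) *[H \<beta>] u s)) Lx"
  proof (rule lsum_cong)
   fix s assume s: "s : set Lx"
   show "h (f (fst s) *[H \<alpha>] ?r s) = pj \<beta> (f (fst s) *[H \<beta>] u s)"
    unfolding mod_hom_smult[OF h fx[OF s] rH[OF s]] mod_hom_smult[OF pj_hom[OF be] fx[OF s] u(1)[OF s]] u(2)[OF s] ..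
  qed
  also have "\<dots> = pj \<beta> (lsum (H \<beta>) (%s. f (fst s) *[H \<beta>] u s) Lx)"
   by (rule lsum_hom[OF Hbm Qm pj_hom[OF be] c, symmetric])
  also have "lsum (H \<beta>) (%s. f (fst s) *[H \<beta>] u s) Lx = pc ?g \<beta> f"
  proof (rule hom_module_eqI[OF Hb.M.lsum_closed[OF c] pc_closed[OF be g H_hom[OF f]]])
   fix y assume y: "y : carrier (P \<beta>)"
   have uy: "u s y : carrier A" if "s : set Lx" for s by (rule H_val[OF u(1)[OF that] y])
   have "pc ?g \<beta> f y = f (?g y)" unfolding pc_def using y by simp
   also have "\<dots> = lsum (regular A) (%s. f (u s y *[P \<alpha>] fst s)) Lx"
    by (rule lsum_hom[OF Pm reg H_hom[OF f]]) (rule Pa.smult_closed[OF uy Lc(1)])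
   also have "\<dots> = lsum A (%s. (f (fst s) *[H \<beta>] u s) y) Lx" unfolding lsum_regular
   proof (rule lsum_cong)
    fix s assume s: "s : set Lx"
    show "f (u s y *[P \<alpha>] fst s) = (f (fst s) *[H \<beta>] u s) y"
     using mod_hom_smult[OF H_hom[OF f] uy[OF s] Lc(1)[OF s]] y by (simp add: hom_module_simps(4))
   qed
   also have "\<dots> = (lsum (H \<beta>) (%s. f (fst s) *[H \<beta>] u s) Lx) y" by (rule H_lsum_apply[OF be c y, symmetric])
   finally show "(lsum (H \<beta>) (%s. f (fst s) *[H \<beta>] u s) Lx) y = pc ?g \<beta> f y" by (rule sym)
  qed
  finally show "h f = pj \<beta> (pc ?g \<beta> f)" .
 qed
qed

text \<open>Unless \<open>\<alpha> \<le> \<beta>\<close>, every \<open>P \<beta> \<rightarrow> P \<alpha>\<close> lands in a trace that is divided out in "Q \<beta>".\<close>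

lemma Q_hom_order:
 assumes al: "\<alpha> : \<Lambda>" and be: "\<beta> : \<Lambda>" and nz: "hom_nonzero B (Q \<alpha>) (Q \<beta>)"
 shows "\<alpha> \<le> \<beta>"
proof (rule ccontr)
 assume n: "\<not> \<alpha> \<le> \<beta>"
 obtain h x where h: "h : mod_hom B (Q \<alpha>) (Q \<beta>)" and x: "x : carrier (Q \<alpha>)" "h x \<noteq> 0[Q \<beta>]"
  using nz unfolding hom_nonzero_def by blast
 obtain f where f: "f : carrier (H \<alpha>)" "x = pj \<alpha> f" using x(1) unfolding pj_surj[OF al, symmetric] by auto
 obtain g where g: "g : mod_hom A (P \<beta>) (P \<alpha>)" "!!f. f : carrier (H \<alpha>) ==> h (pj \<alpha> f) = pj \<beta> (pc g \<beta> f)"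
  by (rule hom_H_Q[OF al be mod_hom_comp[OF pj_hom[OF al] h]]) (rule that)
 have c: "pc g \<beta> f : carrier (H \<beta>)" by (rule pc_closed[OF be g(1) H_hom[OF f(1)]])
 have "pc g \<beta> f y : T (e \<beta>)" if y: "y : carrier (P \<beta>)" for y
  using tr_hom[OF P_mod[OF al] reg H_hom[OF f(1)] hom_P_into_tr[OF al be n g(1) y]] y by (simp add: pc_def)
 then have "pc g \<beta> f : HF (e \<beta>) \<beta>" using c by (simp add: HF_def)
 then have "h x = 0[Q \<beta>]" using pj_zero_iff[OF be c] g(2)[OF f(1)] f(2) by simp
 then show False using x(2) by simp
qed

text \<open>An endomorphism is precomposition with some \<open>g : P \<beta> \<rightarrow> P \<beta>\<close>, and \<open>p \<circ> g\<close> is a multiple \<open>r \<cdot> p\<close>; so \<open>g\<close>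
 and \<open>r\<close> differ by a map into the trace, which is invisible in "Q \<beta>".  A scalar killing \<open>Q \<beta>\<close> maps
 \<open>P \<beta>\<close> into that trace by a dual basis, hence kills \<open>D \<beta>\<close>.\<close>

lemma Q_scalar_end:
 assumes be: "\<beta> : \<Lambda>" shows "scalar_end R B (Q \<beta>)" unfolding scalar_end_def
proof (intro conjI ballI impI)
 note Pm = P_mod[OF be] and Hm = H_mod[OF be]
 interpret Pb: left_module A "P \<beta>" by (rule Pm)
 interpret Db: left_module A "D \<beta>" by (rule D_mod[OF be])
 interpret Bo: assoc_algebra R B by (rule opposite_algebra)
 {
  fix h assume h: "h : mod_hom B (Q \<beta>) (Q \<beta>)"
  obtain g where g: "g : mod_hom A (P \<beta>) (P \<beta>)" "!!f. f : carrier (H \<beta>) ==> h (pj \<beta> f) = pj \<beta> (pc g \<beta> f)"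
   by (rule hom_H_Q[OF be be mod_hom_comp[OF pj_hom[OF be] h]]) (rule that)
  obtain r where r: "r : carrier R" "!!y. y : carrier (P \<beta>) ==> p \<beta> (g y) = sc A (D \<beta>) r (p \<beta> y)"
   by (rule hom_P_D_scalar[OF be mod_hom_comp[OF g(1) p_hom[OF be]]]) (rule that)
  show "\<exists>r\<in>carrier R. \<forall>x\<in>carrier (Q \<beta>). h x = sc B (Q \<beta>) r x"
  proof (rule bexI[OF _ r(1)], rule ballI)
   fix x assume "x : carrier (Q \<beta>)"
   then obtain f where f: "f : carrier (H \<beta>)" "x = pj \<beta> f" unfolding pj_surj[OF be, symmetric] by auto
   note fh = H_hom[OF f(1)]
   have c: "pc g \<beta> f : carrier (H \<beta>)" by (rule pc_closed[OF be g(1) fh])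
   have rf: "sc B (H \<beta>) r f : carrier (H \<beta>)" by (rule Bo.sc_closed[OF Hm r(1) f(1)])
   have "pj \<beta> (pc g \<beta> f) = pj \<beta> (sc B (H \<beta>) r f)" unfolding pj_eq_iff[OF be c rf]
   proof
    fix y assume y: "y : carrier (P \<beta>)"
    let ?gy = "g y" and ?ry = "sc A (P \<beta>) r y"
    have gy: "?gy : carrier (P \<beta>)" by (rule mod_hom_closed[OF g(1) y])
    have ry: "?ry : carrier (P \<beta>)" by (rule sc_closed[OF Pm r(1) y])
    have "p \<beta> (?gy +[P \<beta>] -[P \<beta>] ?ry) = p \<beta> ?gy +[D \<beta>] -[D \<beta>] p \<beta> ?ry"
     using mod_hom_add[OF p_hom[OF be] gy Pb.M.a_inv_closed[OF ry]] mod_hom_minus[OF Pm D_mod[OF be] p_hom[OF be] ry] by simp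
    also have "p \<beta> ?ry = p \<beta> ?gy" using mod_hom_sc[OF p_hom[OF be] r(1) y] r(2)[OF y] by simp
    also have "p \<beta> ?gy +[D \<beta>] -[D \<beta>] p \<beta> ?gy = 0[D \<beta>]" by (rule Db.M.r_neg[OF mod_hom_closed[OF p_hom[OF be] gy]])
    finally have "?gy +[P \<beta>] -[P \<beta>] ?ry : K \<beta>" unfolding a_kernel_eq using gy ry by simp
    then have "?gy +[P \<beta>] -[P \<beta>] ?ry : tr (e \<beta>) (P \<beta>)" unfolding K_eq_tr[OF be] .
    from tr_hom[OF Pm reg fh this] have "f (?gy +[P \<beta>] -[P \<beta>] ?ry) : T (e \<beta>)" .
    moreover have "f (?gy +[P \<beta>] -[P \<beta>] ?ry) = f ?gy +[A] -[A] f ?ry"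
     using mod_hom_add[OF fh gy Pb.M.a_inv_closed[OF ry]] mod_hom_minus[OF Pm reg fh ry] by simp
    moreover have "f ?ry = r *[A] f y"
     using mod_hom_sc[OF fh r(1) y] scalar_mult_left[OF r(1) H_val[OF f(1) y]] by simp
    ultimately show "pc g \<beta> f y -[A] (sc B (H \<beta>) r f) y : T (e \<beta>)"
     unfolding H_sc_apply[OF f(1) r(1) y] using y by (simp add: pc_def a_minus_def)
   qed
   then show "h x = sc B (Q \<beta>) r x"
    unfolding f(2) g(2)[OF f(1)] using Bo.mod_hom_sc[OF pj_hom[OF be] r(1) f(1)] by simp
  qed
 next
  fix r assume r: "r : carrier R" and z: "\<forall>x\<in>carrier (Q \<beta>). sc B (Q \<beta>) r x = 0[Q \<beta>]"
  have rf: "r *[A] f y : T (e \<beta>)" if f: "f : carrier (H \<beta>)" and y: "y : carrier (P \<beta>)" for f y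
  proof -
   have c: "sc B (H \<beta>) r f : carrier (H \<beta>)" by (rule Bo.sc_closed[OF Hm r f])
   have "pj \<beta> (sc B (H \<beta>) r f) = 0[Q \<beta>]"
    unfolding Bo.mod_hom_sc[OF pj_hom[OF be] r f] by (rule bspec[OF z mod_hom_closed[OF pj_hom[OF be] f]])
   then have "sc B (H \<beta>) r f : HF (e \<beta>) \<beta>" using pj_zero_iff[OF be c] by simp
   from HF_val[OF this y] show ?thesis unfolding H_sc_apply[OF f r y] .
  qed
  obtain Lx where Lx: "!!x \<phi>. (x, \<phi>) : set Lx ==> x : carrier (P \<beta>) & \<phi> : mod_hom A (P \<beta>) (regular A)"
   "!!y. y : carrier (P \<beta>) ==> y = lsum (P \<beta>) (%(x, \<phi>). \<phi> y *[P \<beta>] x) Lx" by (rule P_dual_basis[OF be]) (rule that)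
  have Lc: "fst s : carrier (P \<beta>)" "snd s : mod_hom A (P \<beta>) (regular A)" if "s : set Lx" for s
   using Lx(1)[of "fst s" "snd s"] that by simp_all
  have "sc A (D \<beta>) r d = 0[D \<beta>]" if d: "d : carrier (D \<beta>)" for d
  proof -
   obtain y where y: "y : carrier (P \<beta>)" "d = p \<beta> y" using d p_surj[OF be] by auto
   have fc: "snd s y : carrier A" if "s : set Lx" for s using mod_hom_closed[OF Lc(2)[OF that] y(1)] by simp
   have "sc A (P \<beta>) r y = sc A (P \<beta>) r (lsum (P \<beta>) (%s. snd s y *[P \<beta>] fst s) Lx)"
    using Lx(2)[OF y(1)] by (simp add: case_prod_unfold)
   also have "\<dots> = lsum (P \<beta>) (%s. sc A (P \<beta>) r (snd s y *[P \<beta>] fst s)) Lx"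
    by (rule Pb.lsum_smult[OF one_scalar_closed[OF r]]) (rule Pb.smult_closed[OF fc Lc(1)])
   also have "\<dots> : tr (e \<beta>) (P \<beta>)"
   proof (rule lsum_in_submodule[OF tr_submodule[OF Pm]])
    fix s assume s: "s : set Lx"
    have "restrict (snd s) (carrier (P \<beta>)) : carrier (H \<beta>)" by (rule H_restrict[OF be Lc(2)[OF s]])
    from rf[OF this y(1)] have "r *[A] snd s y : T (e \<beta>)" using y(1) by simp
    from tr_hom[OF reg Pm mod_hom_from_regular[OF Pm Lc(1)[OF s]] this]
    have "(r *[A] snd s y) *[P \<beta>] fst s : tr (e \<beta>) (P \<beta>)" .
    moreover have "sc A (P \<beta>) r (snd s y *[P \<beta>] fst s) = (r *[A] snd s y) *[P \<beta>] fst s"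
     using Pb.smult_assoc1[OF one_scalar_closed[OF r] fc[OF s] Lc(1)[OF s]] scalar_mult_left[OF r fc[OF s]] by simp
    ultimately show "sc A (P \<beta>) r (snd s y *[P \<beta>] fst s) : tr (e \<beta>) (P \<beta>)" by simp
   qed
   finally have "sc A (P \<beta>) r y : K \<beta>" unfolding K_eq_tr[OF be] .
   then have "p \<beta> (sc A (P \<beta>) r y) = 0[D \<beta>]" unfolding a_kernel_eq by simp
   then show ?thesis unfolding y(2) using mod_hom_sc[OF p_hom[OF be] r y(1)] by simp
  qed
  then show "r = 0[R]" using D_end[OF be] r unfolding scalar_end_def by blast
 }
qed

lemma T_0: "T 0 = {0[A]}"
proof -
 have z: "y = 0[A]" if y: "y : T 0" for y
 proof -
  have "y = 0[regular A]" by (rule trace_eq_zero[OF tr_Ps reg _ y]) simp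
  then show ?thesis by simp
 qed
 show ?thesis
 proof (rule equalityI[OF subsetI])
  fix y assume "y : T 0"
  from z[OF this] show "y : {0[A]}" by (rule iffD2[OF singleton_iff])
 next
  show "{0[A]} <= T 0" by (rule iffD2[OF insert_subset conjI[OF T_zero empty_subsetI]])
 qed
qed

text \<open>The layer of \<open>H \<alpha>\<close> at \<open>\<kappa>\<close> vanishes unless \<open>\<alpha> \<le> \<kappa>\<close>, because \<open>Hom (P \<alpha>, D \<kappa>) = 0\<close>.\<close>

lemma HF_step_trivial:
 assumes al: "\<alpha> : \<Lambda>" and ka: "\<kappa> : \<Lambda>" and n: "\<not> \<alpha> \<le> \<kappa>"
 shows "HF (Suc (e \<kappa>)) \<alpha> <= HF (e \<kappa>) \<alpha>"
proof
 fix f assume f: "f : HF (Suc (e \<kappa>)) \<alpha>"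
 have fW: "f : mod_hom A (P \<alpha>) ((regular A)(|carrier := T (Suc (e \<kappa>))|))"
  by (rule mod_hom_into_submodule[OF H_hom[OF HF_H[OF f]]]) (rule HF_val[OF f])
 have "f x : T (e \<kappa>)" if x: "x : carrier (P \<alpha>)" for x
 proof (rule layer_separates[OF ka HF_val[OF f x]])
  fix b assume b: "b : mod_hom A ((regular A)(|carrier := T (Suc (e \<kappa>))|)) (D \<kappa>)"
  show "b (f x) = 0[D \<kappa>]"
  proof (rule ccontr)
   assume "b (f x) \<noteq> 0[D \<kappa>]"
   then have "hom_nonzero A (P \<alpha>) (D \<kappa>)" by (rule hom_nonzeroI[OF mod_hom_comp[OF fW b] x])
   then show False using hom_P_D[OF al ka] n by blast
  qed
 qed
 then show "f : HF (e \<kappa>) \<alpha>" using HF_H[OF f] by (simp add: HF_def)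
qed

text \<open>The steps numbered before \<open>\<alpha>\<close> are layers of type \<open>\<kappa> > \<alpha>\<close> or trivial.\<close>

lemma H_filt:
 assumes al: "\<alpha> : \<Lambda>"
 shows "Filt B (Q ` {\<mu> : \<Lambda>. \<alpha> < \<mu>}) (H \<alpha>) (HF (e \<alpha>) \<alpha>)"
proof -
 have "k \<le> e \<alpha> ==> Filt B (Q ` {\<mu> : \<Lambda>. \<alpha> < \<mu>}) (H \<alpha>) (HF k \<alpha>)" for k
 proof (induction k)
  case 0
  have "HF 0 \<alpha> = {0[H \<alpha>]}"
  proof (rule equalityI[OF subsetI])
   fix f assume f: "f : HF 0 \<alpha>"
   have "f = 0[H \<alpha>]"
   proof (rule hom_module_eqI[OF HF_H[OF f]])
    show "0[H \<alpha>] : carrier (H \<alpha>)" by (rule HF_H[OF submodule_zero[OF HF_sub[OF al, of 0]]])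
    show "f x = 0[H \<alpha>] x" if "x : carrier (P \<alpha>)" for x
     using HF_val[OF f that] that unfolding T_0 by (simp add: hom_module_simps(2))
   qed
   then show "f : {0[H \<alpha>]}" by simp
  next
   show "{0[H \<alpha>]} <= HF 0 \<alpha>" using submodule_zero[OF HF_sub[OF al]] by simp
  qed
  then show ?case using Filt.zero[of B "Q ` {\<mu> : \<Lambda>. \<alpha> < \<mu>}" "H \<alpha>"] by simp
 next
  case (Suc k)
  have IH: "Filt B (Q ` {\<mu> : \<Lambda>. \<alpha> < \<mu>}) (H \<alpha>) (HF k \<alpha>)" by (rule Suc.IH) (use Suc.prems in simp)
  consider (above) \<kappa> where "\<kappa> : \<Lambda>" "e \<kappa> = k" "\<alpha> \<le> \<kappa>" | (other) \<kappa> where "\<kappa> : \<Lambda>" "e \<kappa> = k" "\<not> \<alpha> \<le> \<kappa>"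
   | (none) "!!\<kappa>. \<kappa> : \<Lambda> ==> e \<kappa> \<noteq> k" by blast
  then show ?case
  proof cases
   case above
   have "\<alpha> < \<kappa>" using above(2,3) Suc.prems by (auto simp: order_le_less)
   then have m: "Q \<kappa> : Q ` {\<mu> : \<Lambda>. \<alpha> < \<mu>}" using above(1) by blast
   show ?thesis by (rule Filt.step[OF IH HF_sub[OF al] HF_mono m HF_layer[OF al above(1), unfolded above(2)]]) simp
  next
   case other
   have "HF (Suc k) \<alpha> = HF k \<alpha>"
    using HF_step_trivial[OF al other(1,3)] HF_mono[of k "Suc k" \<alpha>] unfolding other(2) by auto
   then show ?thesis using IH by simp
  next
   case none
   have "e \<mu> < Suc k \<longleftrightarrow> e \<mu> < k" if "\<mu> : \<Lambda>" for \<mu> using none[OF that] by linarith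
   then have "{\<mu> : \<Lambda>. e \<mu> < Suc k} = {\<mu> : \<Lambda>. e \<mu> < k}" by blast
   then have "HF (Suc k) \<alpha> = HF k \<alpha>" unfolding HF_def by simp
   then show ?thesis using IH by simp
  qed
 qed
 then show ?thesis by simp
qed

lemma pj_kernel:
 assumes al: "\<alpha> : \<Lambda>" shows "a_kernel (H \<alpha>) (Q \<alpha>) (pj \<alpha>) = HF (e \<alpha>) \<alpha>"
proof (rule Set.set_eqI)
 fix f
 show "f : a_kernel (H \<alpha>) (Q \<alpha>) (pj \<alpha>) \<longleftrightarrow> f : HF (e \<alpha>) \<alpha>"
  using pj_zero_iff[OF al, of f] HF_H[of f "e \<alpha>" \<alpha>] unfolding a_kernel_eq mem_Collect_eq by argo
qed

end

text \<open>A minimal element may be numbered last.\<close>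

lemma order_reversing_numbering:
 assumes "finite \<Lambda>"
 shows "\<exists>e :: 'l::order => nat. inj_on e \<Lambda> & (\<forall>\<alpha>\<in>\<Lambda>. \<forall>\<beta>\<in>\<Lambda>. \<alpha> < \<beta> \<longrightarrow> e \<beta> < e \<alpha>)" using assms
proof (induction "card \<Lambda>" arbitrary: \<Lambda>)
 case 0
 then show ?case by simp
next
 case (Suc n)
 then have "\<Lambda> \<noteq> {}" by auto
 then obtain m where m: "m : \<Lambda>" "!!x. x : \<Lambda> ==> x \<le> m ==> x = m" using finite_has_minimal[OF Suc.prems] by metis
 obtain e :: "'l => nat" where e: "inj_on e (\<Lambda> - {m})" "\<forall>\<alpha>\<in>\<Lambda> - {m}. \<forall>\<beta>\<in>\<Lambda> - {m}. \<alpha> < \<beta> \<longrightarrow> e \<beta> < e \<alpha>"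
 proof -
  have "n = card (\<Lambda> - {m})" "finite (\<Lambda> - {m})" using Suc.hyps(2) Suc.prems m(1) by simp_all
  from Suc.hyps(1)[OF this] show ?thesis using that by blast
 qed
 obtain N where N: "!!x. x : \<Lambda> - {m} ==> e x < N" using finite_nat_bounded[of "e ` (\<Lambda> - {m})"] Suc.prems by auto
 show ?case
 proof (intro exI[of _ "e(m := N)"] conjI ballI impI)
  show "inj_on (e(m := N)) \<Lambda>"
  proof (rule inj_onI)
   fix x y assume "x : \<Lambda>" "y : \<Lambda>" "(e(m := N)) x = (e(m := N)) y"
   then show "x = y" using N[of x] N[of y] inj_onD[OF e(1), of x y] by (auto split: if_splits)
  qed
  fix \<alpha> \<beta> assume ab: "\<alpha> : \<Lambda>" "\<beta> : \<Lambda>" "\<alpha> < \<beta>"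
  have "\<beta> \<noteq> m" using m(2)[OF ab(1)] ab(3) by (metis order_less_imp_le order_less_irrefl)
  then show "(e(m := N)) \<beta> < (e(m := N)) \<alpha>" using N[of \<beta>] e(2) ab by auto
 qed
qed

section \<open>Standard and costandard systems\<close>

text \<open>A split quasi-hereditary structure with modules of arbitrary element types.  The kernels of the
 \<open>p \<alpha>\<close> are filtered as submodules, and projective generation is reduced to the regular module.\<close>

definition standard_system where
 "standard_system R A \<Lambda> D P p \<longleftrightarrow>
   (\<forall>\<alpha>\<in>\<Lambda>. lattice R A (D \<alpha>) & scalar_end R A (D \<alpha>) \<and>
    left_module A (P \<alpha>) & add_of A {regular A} (P \<alpha>) \<and>
    p \<alpha> : mod_hom A (P \<alpha>) (D \<alpha>) & p \<alpha> ` carrier (P \<alpha>) = carrier (D \<alpha>) \<and>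
    Filt A (D ` {\<mu> : \<Lambda>. \<alpha> < \<mu>}) (P \<alpha>) (a_kernel (P \<alpha>) (D \<alpha>) (p \<alpha>))) \<and>
   (\<forall>\<alpha>\<in>\<Lambda>. \<forall>\<beta>\<in>\<Lambda>. hom_nonzero A (D \<alpha>) (D \<beta>) \<longrightarrow> \<alpha> \<le> \<beta>) \<and>
   add_of A (P ` \<Lambda>) (regular A)"

definition costandard_system where
 "costandard_system R A \<Lambda> N I \<iota> \<pi> K \<longleftrightarrow>
   (\<forall>\<alpha>\<in>\<Lambda>. lattice R A (N \<alpha>) & scalar_end R A (N \<alpha>) \<and>
    left_module A (I \<alpha>) & add_of A {dual_regular R A} (I \<alpha>) & left_module A (K \<alpha>) \<and>
    short_exact A (N \<alpha>) (\<iota> \<alpha>) (I \<alpha>) (\<pi> \<alpha>) (K \<alpha>) \<and>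
    Filt A (N ` {\<mu> : \<Lambda>. \<alpha> < \<mu>}) (K \<alpha>) (carrier (K \<alpha>))) \<and>
   (\<forall>\<alpha>\<in>\<Lambda>. \<forall>\<beta>\<in>\<Lambda>. hom_nonzero A (N \<alpha>) (N \<beta>) \<longrightarrow> \<beta> \<le> \<alpha>) \<and>
   add_of A (I ` \<Lambda>) (dual_regular R A)"

lemma standard_systemD:
 assumes "standard_system R A \<Lambda> D P p"
 shows "\<alpha> : \<Lambda> ==> lattice R A (D \<alpha>)" "\<alpha> : \<Lambda> ==> scalar_end R A (D \<alpha>)"
  "\<alpha> : \<Lambda> ==> left_module A (P \<alpha>)" "\<alpha> : \<Lambda> ==> add_of A {regular A} (P \<alpha>)"
  "\<alpha> : \<Lambda> ==> p \<alpha> : mod_hom A (P \<alpha>) (D \<alpha>)" "\<alpha> : \<Lambda> ==> p \<alpha> ` carrier (P \<alpha>) = carrier (D \<alpha>)"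
  "\<alpha> : \<Lambda> ==> Filt A (D ` {\<mu> : \<Lambda>. \<alpha> < \<mu>}) (P \<alpha>) (a_kernel (P \<alpha>) (D \<alpha>) (p \<alpha>))"
  "[|\<alpha> : \<Lambda>; \<beta> : \<Lambda>; hom_nonzero A (D \<alpha>) (D \<beta>)|] ==> \<alpha> \<le> \<beta>"
  "add_of A (P ` \<Lambda>) (regular A)" using assms unfolding standard_system_def by simp_all

lemma costandard_systemD:
 assumes "costandard_system R A \<Lambda> N I \<iota> \<pi> K"
 shows "\<alpha> : \<Lambda> ==> lattice R A (N \<alpha>)" "\<alpha> : \<Lambda> ==> scalar_end R A (N \<alpha>)"
  "\<alpha> : \<Lambda> ==> left_module A (I \<alpha>)" "\<alpha> : \<Lambda> ==> add_of A {dual_regular R A} (I \<alpha>)"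
  "\<alpha> : \<Lambda> ==> left_module A (K \<alpha>)" "\<alpha> : \<Lambda> ==> short_exact A (N \<alpha>) (\<iota> \<alpha>) (I \<alpha>) (\<pi> \<alpha>) (K \<alpha>)"
  "\<alpha> : \<Lambda> ==> Filt A (N ` {\<mu> : \<Lambda>. \<alpha> < \<mu>}) (K \<alpha>) (carrier (K \<alpha>))"
  "[|\<alpha> : \<Lambda>; \<beta> : \<Lambda>; hom_nonzero A (N \<alpha>) (N \<beta>)|] ==> \<beta> \<le> \<alpha>"
  "add_of A (I ` \<Lambda>) (dual_regular R A)" using assms unfolding costandard_system_def by simp_all

context assoc_algebra
begin

text \<open>Over the opposite algebra the standard modules are the \<open>Q \<kappa>\<close> and their projective covers the \<open>H \<alpha>\<close>.\<close>

lemma opposite_standard_system: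
 fixes \<Lambda> :: "'l::order set" and P :: "'l => ('a, 'p, 'w) module_scheme"
 assumes fin: "finite \<Lambda>" and s: "standard_system R A \<Lambda> D P p"
 obtains Q :: "'l => ('a, ('p => 'a) set) module" and H :: "'l => ('a, 'p => 'a) module" and q
 where "standard_system R (opposite A) \<Lambda> Q H q"
proof -
 note sD = standard_systemD[OF s]
 obtain e :: "'l => nat" where e: "inj_on e \<Lambda>" "\<forall>\<alpha>\<in>\<Lambda>. \<forall>\<beta>\<in>\<Lambda>. \<alpha> < \<beta> \<longrightarrow> e \<beta> < e \<alpha>"
  using order_reversing_numbering[OF fin] by (elim exE conjE) (rule that)
 have "standard_modules R A \<Lambda> D P p e"
 proof (rule standard_modules.intro[OF assoc_algebra_axioms standard_modules_axioms.intro])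
  fix \<alpha> \<beta> assume al: "\<alpha> : \<Lambda>" and be: "\<beta> : \<Lambda>"
  show "e \<beta> < e \<alpha>" if "\<alpha> < \<beta>" using e(2) al be that by simp
  show "\<alpha> \<le> \<beta>" if "hom_nonzero A (D \<alpha>) (D \<beta>)" by (rule sD(8)[OF al be that])
 next
  fix \<alpha> assume al: "\<alpha> : \<Lambda>"
  show "lattice R A (D \<alpha>)" by (rule sD(1)[OF al])
  show "scalar_end R A (D \<alpha>)" by (rule sD(2)[OF al])
  show "left_module A (P \<alpha>)" by (rule sD(3)[OF al])
  show "add_of A {regular A} (P \<alpha>)" by (rule sD(4)[OF al])
  show "p \<alpha> : mod_hom A (P \<alpha>) (D \<alpha>)" by (rule sD(5)[OF al])
  show "p \<alpha> ` carrier (P \<alpha>) = carrier (D \<alpha>)" by (rule sD(6)[OF al])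
  show "Filt A (D ` {\<mu> : \<Lambda>. \<alpha> < \<mu>}) (P \<alpha>) (a_kernel (P \<alpha>) (D \<alpha>) (p \<alpha>))" by (rule sD(7)[OF al])
 next
  show "inj_on e \<Lambda>" by (rule e(1))
  show "add_of A (P ` \<Lambda>) (regular A)" by (rule sD(9))
 qed
 then interpret S: standard_modules R A \<Lambda> D P p e .
 have "standard_system R (opposite A) \<Lambda> S.Q S.H S.pj" unfolding standard_system_def
 proof (intro conjI ballI impI)
  fix \<alpha> assume al: "\<alpha> : \<Lambda>"
  show "lattice R (opposite A) (S.Q \<alpha>)" by (rule S.Q_lattice[OF al])
  show "scalar_end R (opposite A) (S.Q \<alpha>)" by (rule S.Q_scalar_end[OF al])
  show "left_module (opposite A) (S.H \<alpha>)" by (rule S.H_mod[OF al])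
  show "add_of (opposite A) {regular (opposite A)} (S.H \<alpha>)" by (rule S.H_proj[OF al])
  show "S.pj \<alpha> : mod_hom (opposite A) (S.H \<alpha>) (S.Q \<alpha>)" by (rule S.pj_hom[OF al])
  show "S.pj \<alpha> ` carrier (S.H \<alpha>) = carrier (S.Q \<alpha>)" by (rule S.pj_surj[OF al])
  show "Filt (opposite A) (S.Q ` {\<mu> : \<Lambda>. \<alpha> < \<mu>}) (S.H \<alpha>) (a_kernel (S.H \<alpha>) (S.Q \<alpha>) (S.pj \<alpha>))"
   unfolding S.pj_kernel[OF al] by (rule S.H_filt[OF al])
  fix \<beta> assume be: "\<beta> : \<Lambda>" and nz: "hom_nonzero (opposite A) (S.Q \<alpha>) (S.Q \<beta>)"
  show "\<alpha> \<le> \<beta>" by (rule S.Q_hom_order[OF al be nz])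
 next
  show "add_of (opposite A) (S.H ` \<Lambda>) (regular (opposite A))" by (rule S.regular_in_add_H)
 qed
 then show ?thesis by (rule that)
qed

lemma dual_of_standard_system:
 assumes s: "standard_system R A \<Lambda> D P p"
 shows "costandard_system R (opposite A) \<Lambda> (%\<alpha>. dual R A (D \<alpha>)) (%\<alpha>. dual R A (P \<alpha>))
  (%\<alpha>. dual_map (P \<alpha>) (p \<alpha>)) (%\<alpha>. dual_map ((P \<alpha>)(|carrier := a_kernel (P \<alpha>) (D \<alpha>) (p \<alpha>)|)) (%x. x))
  (%\<alpha>. dual R A ((P \<alpha>)(|carrier := a_kernel (P \<alpha>) (D \<alpha>) (p \<alpha>)|)))" unfolding costandard_system_def
proof (intro conjI ballI impI)
 note sD = standard_systemD[OF s]
 have dr: "dual_regular R (opposite A) = dual R A (regular A)" by (simp add: dual_regular_def)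
 have reg: "left_module A (regular A)" by (rule regular_left_module[OF ring_A])
 {
  fix \<alpha> assume al: "\<alpha> : \<Lambda>"
  let ?K = "(P \<alpha>)(|carrier := a_kernel (P \<alpha>) (D \<alpha>) (p \<alpha>)|)"
  note Dm = lattice_module[OF sD(1)[OF al]]
  have Ks: "submodule (a_kernel (P \<alpha>) (D \<alpha>) (p \<alpha>)) A (P \<alpha>)" by (rule kernel_submodule[OF sD(3)[OF al] Dm sD(5)[OF al]])
  have Km: "left_module A ?K" by (rule submodule_module[OF sD(3)[OF al] Ks])
  show "lattice R (opposite A) (dual R A (D \<alpha>))" by (rule dual_lattice[OF sD(1)[OF al]])
  show "scalar_end R (opposite A) (dual R A (D \<alpha>))" by (rule dual_scalar_end[OF sD(1,2)[OF al]])
  show "left_module (opposite A) (dual R A (P \<alpha>))" by (rule dual_left_module[OF sD(3)[OF al]])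
  show "left_module (opposite A) (dual R A ?K)" by (rule dual_left_module[OF Km])
  have "add_of (opposite A) (dual R A ` {regular A}) (dual R A (P \<alpha>))"
   by (rule dual_add_of[OF sD(3)[OF al] _ sD(4)[OF al]]) (use reg in simp)
  then show "add_of (opposite A) {dual_regular R (opposite A)} (dual R A (P \<alpha>))" unfolding dr by simp
  have "short_exact A ?K (%x. x) (P \<alpha>) (p \<alpha>) (D \<alpha>)" unfolding short_exact_def
   using mod_hom_from_submodule[OF mod_hom_id submodule_subset[OF Ks]] sD(5,6)[OF al] by simp
  then show "short_exact (opposite A) (dual R A (D \<alpha>)) (dual_map (P \<alpha>) (p \<alpha>)) (dual R A (P \<alpha>)) (dual_map ?K (%x. x)) (dual R A ?K)"
   by (rule dual_short_exact[OF Km sD(3)[OF al] sD(1)[OF al]])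
  have "lattice R A ?K & Filt (opposite A) (dual R A ` D ` {\<mu> : \<Lambda>. \<alpha> < \<mu>}) (dual R A ?K) (carrier (dual R A ?K))"
   by (rule dual_Filt[OF sD(3)[OF al] _ sD(7)[OF al]]) (use sD(1) in auto)
  then show "Filt (opposite A) ((%\<alpha>. dual R A (D \<alpha>)) ` {\<mu> : \<Lambda>. \<alpha> < \<mu>}) (dual R A ?K) (carrier (dual R A ?K))"
   by (simp add: image_image)
  fix \<beta> assume be: "\<beta> : \<Lambda>" and nz: "hom_nonzero (opposite A) (dual R A (D \<alpha>)) (dual R A (D \<beta>))"
  show "\<beta> \<le> \<alpha>" by (rule sD(8)[OF be al dual_hom_nonzero[OF lattice_module[OF sD(1)[OF be]] sD(1)[OF al] nz]])
 }
 have "add_of (opposite A) (dual R A ` P ` \<Lambda>) (dual R A (regular A))"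
  by (rule dual_add_of[OF reg _ sD(9)]) (use sD(3) in auto)
 then show "add_of (opposite A) ((%\<alpha>. dual R A (P \<alpha>)) ` \<Lambda>) (dual_regular R (opposite A))"
  unfolding dr by (simp add: image_image)
qed

text \<open>The kernel of \<open>D I \<rightarrow> D N\<close> is the dual of \<open>K\<close>, and \<open>D (D A) = A\<close> turns relative injectives into
 projectives.\<close>

lemma dual_of_costandard_system:
 assumes latB: "lattice R (opposite A) (regular (opposite A))" and s: "costandard_system R A \<Lambda> N I \<iota> \<pi> K"
 shows "standard_system R (opposite A) \<Lambda> (%\<alpha>. dual R A (N \<alpha>)) (%\<alpha>. dual R A (I \<alpha>)) (%\<alpha>. dual_map (N \<alpha>) (\<iota> \<alpha>))"
 unfolding standard_system_def
proof (intro conjI ballI impI)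
 note sD = costandard_systemD[OF s]
 interpret Bo: assoc_algebra R "opposite A" by (rule opposite_algebra)
 let ?B = "opposite A"
 have regB: "left_module ?B (regular ?B)" by (rule regular_left_module[OF Bo.ring_A])
 have drm: "left_module A (dual_regular R A)" using Bo.dual_left_module[OF regB] by (simp add: dual_regular_def)
 have iso: "mod_iso ?B (regular ?B) (dual R A (dual_regular R A))"
  using Bo.dual_dual_iso[OF latB] by (simp add: dual_regular_def)
 have ddm: "left_module ?B (dual R A (dual_regular R A))" by (rule dual_left_module[OF drm])
 {
  fix \<alpha> assume al: "\<alpha> : \<Lambda>"
  note Nm = lattice_module[OF sD(1)[OF al]]
  show "lattice R ?B (dual R A (N \<alpha>))" by (rule dual_lattice[OF sD(1)[OF al]])
  show "scalar_end R ?B (dual R A (N \<alpha>))" by (rule dual_scalar_end[OF sD(1,2)[OF al]])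
  show Im: "left_module ?B (dual R A (I \<alpha>))" by (rule dual_left_module[OF sD(3)[OF al]])
  have "add_of ?B (dual R A ` {dual_regular R A}) (dual R A (I \<alpha>))"
   by (rule dual_add_of[OF sD(3)[OF al] _ sD(4)[OF al]]) (use drm in simp)
  then have a: "add_of ?B {dual R A (dual_regular R A)} (dual R A (I \<alpha>))" by simp
  have "add_of ?B {regular ?B} (dual R A (dual_regular R A))"
   by (rule add_of_iso[OF ddm regB mod_iso_sym[OF regB iso] add_of_self[OF regB]]) simp
  then show "add_of ?B {regular ?B} (dual R A (I \<alpha>))" using ddm by (intro add_of_trans[OF Im _ a]) simp
  have lf: "lattice R A ((K \<alpha>)(|carrier := carrier (K \<alpha>)|)) \<and>
   Filt ?B (dual R A ` N ` {\<mu> : \<Lambda>. \<alpha> < \<mu>}) (dual R A ((K \<alpha>)(|carrier := carrier (K \<alpha>)|))) (carrier (dual R A ((K \<alpha>)(|carrier := carrier (K \<alpha>)|))))"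
   by (rule dual_Filt[OF sD(5)[OF al] _ sD(7)[OF al]]) (use sD(1) in auto)
  then have Kl: "lattice R A (K \<alpha>)" by simp
  from lf have Kf: "Filt ?B ((%\<alpha>. dual R A (N \<alpha>)) ` {\<mu> : \<Lambda>. \<alpha> < \<mu>}) (dual R A (K \<alpha>)) (carrier (dual R A (K \<alpha>)))"
   by (simp add: image_image)
  have ex: "short_exact ?B (dual R A (K \<alpha>)) (dual_map (I \<alpha>) (\<pi> \<alpha>)) (dual R A (I \<alpha>)) (dual_map (N \<alpha>) (\<iota> \<alpha>)) (dual R A (N \<alpha>))"
   by (rule dual_short_exact[OF Nm sD(3)[OF al] Kl sD(6)[OF al]])
  then have e: "dual_map (I \<alpha>) (\<pi> \<alpha>) : mod_hom ?B (dual R A (K \<alpha>)) (dual R A (I \<alpha>))"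
   "dual_map (N \<alpha>) (\<iota> \<alpha>) : mod_hom ?B (dual R A (I \<alpha>)) (dual R A (N \<alpha>))"
   "inj_on (dual_map (I \<alpha>) (\<pi> \<alpha>)) (carrier (dual R A (K \<alpha>)))"
   "dual_map (I \<alpha>) (\<pi> \<alpha>) ` carrier (dual R A (K \<alpha>)) = a_kernel (dual R A (I \<alpha>)) (dual R A (N \<alpha>)) (dual_map (N \<alpha>) (\<iota> \<alpha>))"
   "dual_map (N \<alpha>) (\<iota> \<alpha>) ` carrier (dual R A (I \<alpha>)) = carrier (dual R A (N \<alpha>))"
   unfolding short_exact_def by simp_all
  show "dual_map (N \<alpha>) (\<iota> \<alpha>) : mod_hom ?B (dual R A (I \<alpha>)) (dual R A (N \<alpha>))" by (rule e(2))
  show "dual_map (N \<alpha>) (\<iota> \<alpha>) ` carrier (dual R A (I \<alpha>)) = carrier (dual R A (N \<alpha>))" by (rule e(5))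
  show "Filt ?B ((%\<alpha>. dual R A (N \<alpha>)) ` {\<mu> : \<Lambda>. \<alpha> < \<mu>}) (dual R A (I \<alpha>))
    (a_kernel (dual R A (I \<alpha>)) (dual R A (N \<alpha>)) (dual_map (N \<alpha>) (\<iota> \<alpha>)))"
   using Filt_image[OF dual_left_module[OF lattice_module[OF Kl]] Im e(1,3) Kf] unfolding e(4) .
  fix \<beta> assume be: "\<beta> : \<Lambda>" and nz: "hom_nonzero ?B (dual R A (N \<alpha>)) (dual R A (N \<beta>))"
  show "\<alpha> \<le> \<beta>" by (rule sD(8)[OF be al dual_hom_nonzero[OF lattice_module[OF sD(1)[OF be]] sD(1)[OF al] nz]])
 }
 have "add_of ?B (dual R A ` I ` \<Lambda>) (dual R A (dual_regular R A))"
  by (rule dual_add_of[OF drm _ sD(9)]) (use sD(3) in auto)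
 from add_of_iso[OF regB ddm iso this]
 show "add_of ?B ((%\<alpha>. dual R A (I \<alpha>)) ` \<Lambda>) (regular ?B)" by (simp add: image_image)
qed

end

lemma short_exact_iso:
 assumes L: "left_module A L" and M: "left_module A M" and N: "left_module A N"
  and L': "left_module A L'" and M': "left_module A M'" and N': "left_module A N'"
  and iL: "mod_iso A L' L" and iM: "mod_iso A M' M" and iN: "mod_iso A N' N" and ex: "short_exact A L i M p N"
 obtains i' p' where "short_exact A L' i' M' p' N'"
proof -
 obtain l l' where l: "l : mod_hom A L' L" "l' : mod_hom A L L'"
  "!!x. x : carrier L' ==> l' (l x) = x" "!!x. x : carrier L ==> l (l' x) = x"
  by (rule mod_iso_obtain[OF L' iL]) (rule that)
 obtain m m' where m: "m : mod_hom A M' M" "m' : mod_hom A M M'"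
  "!!x. x : carrier M' ==> m' (m x) = x" "!!x. x : carrier M ==> m (m' x) = x"
  by (rule mod_iso_obtain[OF M' iM]) (rule that)
 obtain n n' where n: "n : mod_hom A N' N" "n' : mod_hom A N N'"
  "!!x. x : carrier N' ==> n' (n x) = x" "!!x. x : carrier N ==> n (n' x) = x"
  by (rule mod_iso_obtain[OF N' iN]) (rule that)
 have e: "i : mod_hom A L M" "p : mod_hom A M N" "inj_on i (carrier L)" "i ` carrier L = a_kernel M N p" "p ` carrier M = carrier N"
  using ex unfolding short_exact_def by simp_all
 have c1: "(%x. i (l x)) : mod_hom A L' M" by (rule mod_hom_comp[OF l(1) e(1)])
 have c2: "(%x. m' (i (l x))) : mod_hom A L' M'" by (rule mod_hom_comp[OF c1 m(2)])
 have d1: "(%x. p (m x)) : mod_hom A M' N" by (rule mod_hom_comp[OF m(1) e(2)])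
 have d2: "(%x. n' (p (m x))) : mod_hom A M' N'" by (rule mod_hom_comp[OF d1 n(2)])
 have nz: "n' y = 0[N'] \<longleftrightarrow> y = 0[N]" if y: "y : carrier N" for y
 proof
  assume "n' y = 0[N']"
  then have "n (n' y) = 0[N]" using mod_hom_zero[OF N' N n(1)] by simp
  then show "y = 0[N]" using n(4)[OF y] by simp
 qed (simp add: mod_hom_zero[OF N N' n(2)])
 have inj: "inj_on (%x. m' (i (l x))) (carrier L')"
 proof (rule inj_onI)
  fix x y assume x: "x : carrier L'" and y: "y : carrier L'" and eq: "m' (i (l x)) = m' (i (l y))"
  note lx = mod_hom_closed[OF l(1) x] and ly = mod_hom_closed[OF l(1) y]
  have "i (l x) = i (l y)"
   using arg_cong[OF eq, of m] unfolding m(4)[OF mod_hom_closed[OF e(1) lx]] m(4)[OF mod_hom_closed[OF e(1) ly]] .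
  then have "l x = l y" by (rule inj_onD[OF e(3) _ lx ly])
  from arg_cong[OF this, of l'] show "x = y" unfolding l(3)[OF x] l(3)[OF y] .
 qed
 have ker: "(%x. m' (i (l x))) ` carrier L' = a_kernel M' N' (%x. n' (p (m x)))"
 proof (rule equalityI[OF subsetI subsetI])
  fix z assume "z : (%x. m' (i (l x))) ` carrier L'"
  then obtain x where x: "x : carrier L'" "z = m' (i (l x))" by blast
  note lx = mod_hom_closed[OF l(1) x(1)]
  note ilx = mod_hom_closed[OF e(1) lx]
  have "i (l x) : a_kernel M N p" using lx e(4) by blast
  then have "p (i (l x)) = 0[N]" by (simp add: a_kernel_eq)
  then show "z : a_kernel M' N' (%x. n' (p (m x)))"
   unfolding x(2) a_kernel_eq using mod_hom_closed[OF m(2) ilx] m(4)[OF ilx] mod_hom_zero[OF N N' n(2)] by simp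
 next
  fix z assume "z : a_kernel M' N' (%x. n' (p (m x)))"
  then have z: "z : carrier M'" "n' (p (m z)) = 0[N']" by (simp_all add: a_kernel_eq)
  note mz = mod_hom_closed[OF m(1) z(1)]
  have "p (m z) = 0[N]" using nz[OF mod_hom_closed[OF e(2) mz]] z(2) by simp
  then have "m z : i ` carrier L" unfolding e(4) a_kernel_eq using mz by simp
  then obtain x where x: "x : carrier L" "m z = i x" by blast
  have "z = m' (i (l (l' x)))" using m(3)[OF z(1)] x(2) l(4)[OF x(1)] by simp
  then show "z : (%x. m' (i (l x))) ` carrier L'" using mod_hom_closed[OF l(2) x(1)] by (rule image_eqI)
 qed
 have sur: "(%x. n' (p (m x))) ` carrier M' = carrier N'"
 proof (rule equalityI[OF subsetI subsetI])
  fix z assume "z : (%x. n' (p (m x))) ` carrier M'"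
  then show "z : carrier N'" using mod_hom_closed[OF d2] by auto
 next
  fix z assume z: "z : carrier N'"
  have "n z : p ` carrier M" using mod_hom_closed[OF n(1) z] e(5) by simp
  then obtain y where y: "y : carrier M" "n z = p y" by blast
  have "z = n' (p (m (m' y)))" using n(3)[OF z] y(2) m(4)[OF y(1)] by simp
  then show "z : (%x. n' (p (m x))) ` carrier M'" using mod_hom_closed[OF m(2) y(1)] by (rule image_eqI)
 qed
 have "short_exact A L' (%x. m' (i (l x))) M' (%x. n' (p (m x))) N'"
  unfolding short_exact_def by (rule conjI[OF c2 conjI[OF d2 conjI[OF inj conjI[OF ker sur]]]])
 then show ?thesis by (rule that)
qed

section \<open>Comparison with the definitions\<close>

text \<open>The definitions quantify over modules of one element type, so each module is replaced by an isomorphic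
 copy of that type.\<close>

lemma fgmod_copies:
 assumes "!!\<alpha>. \<alpha> : \<Lambda> ==> fg_module A (D \<alpha>)"
 obtains \<Delta> :: "'l => 'a fgmod" where "!!\<alpha>. \<alpha> : \<Lambda> ==> fg_module A (\<Delta> \<alpha>)" "!!\<alpha>. \<alpha> : \<Lambda> ==> mod_iso A (\<Delta> \<alpha>) (D \<alpha>)"
proof -
 define \<Delta> where "\<Delta> \<alpha> = (SOME M :: 'a fgmod. fg_module A M & mod_iso A M (D \<alpha>))" for \<alpha>
 have *: "fg_module A (\<Delta> \<alpha>) & mod_iso A (\<Delta> \<alpha>) (D \<alpha>)" if al: "\<alpha> : \<Lambda>" for \<alpha>
 proof -
  obtain M :: "'a fgmod" where "fg_module A M" "mod_iso A M (D \<alpha>)" by (rule fgmod_copy[OF assms[OF al]]) (rule that)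
  then have "\<exists>M :: 'a fgmod. fg_module A M & mod_iso A M (D \<alpha>)" by (intro exI conjI)
  then show ?thesis unfolding \<Delta>_def by (rule someI_ex)
 qed
 show ?thesis by (rule that[OF conjunct1[OF *] conjunct2[OF *]])
qed

lemma add_of_family_iso:
 assumes "left_module A X" and P: "!!\<alpha>. \<alpha> : S ==> left_module A (P \<alpha>)" and P': "!!\<alpha>. \<alpha> : S ==> left_module A (P' \<alpha>)"
  and iso: "!!\<alpha>. \<alpha> : S ==> mod_iso A (P' \<alpha>) (P \<alpha>)" and a: "add_of A (P ` S) X"
 shows "add_of A (P' ` S) X"
proof (rule add_of_trans[OF assms(1) _ a])
 fix M assume "M : P ` S"
 then obtain \<alpha> where al: "\<alpha> : S" "M = P \<alpha>" by blast
 have "add_of A (P' ` S) (P \<alpha>)"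
  by (rule add_of_iso[OF P[OF al(1)] P'[OF al(1)] mod_iso_sym[OF P'[OF al(1)] iso[OF al(1)]] add_of_self[OF P'[OF al(1)] imageI[OF al(1), of P']]])
 then show "left_module A M & add_of A (P' ` S) M" unfolding al(2) using P[OF al(1)] by blast
qed

lemma Filt_family_iso:
 assumes "left_module A M" and P: "!!\<alpha>. \<alpha> : S ==> left_module A (P \<alpha>)" and P': "!!\<alpha>. \<alpha> : S ==> left_module A (P' \<alpha>)"
  and iso: "!!\<alpha>. \<alpha> : S ==> mod_iso A (P' \<alpha>) (P \<alpha>)" and f: "Filt A (P ` S) M F"
 shows "Filt A (P' ` S) M F"
proof (rule Filt_change[OF assms(1) _ f])
 fix X assume "X : P ` S"
 then obtain \<alpha> where al: "\<alpha> : S" "X = P \<alpha>" by blast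
 have "add_of A {P' \<alpha>} (P \<alpha>)"
  by (rule add_of_iso[OF P[OF al(1)] P'[OF al(1)] mod_iso_sym[OF P'[OF al(1)] iso[OF al(1)]] add_of_self[OF P'[OF al(1)]]]) simp
 then show "left_module A X & (\<exists>Y\<in>P' ` S. add_of A {Y} X)" unfolding al(2) using P[OF al(1)] al(1) by blast
qed

lemma Filt_restrict:
 assumes M: "left_module A M" and f: "Filt A Ms M F" and V: "submodule V A M" "F <= V"
 shows "Filt A Ms (M(|carrier := V|)) F" using f V(2)
proof induction
 case zero
 show ?case using Filt.zero[of A Ms "M(|carrier := V|)"] by simp
next
 case (step F W X)
 have "Filt A Ms (M(|carrier := V|)) F" by (rule step.IH) (use step(3) step.prems in blast)
 then show ?case
  by (rule Filt.step[OF _ submodule_of_submodule[OF M V(1) step(2) step.prems] step(3,4)]) (simp add: step(5))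
qed

lemma fg_moduleD: "fg_module A M ==> left_module A M" "fg_module A M ==> fin_gen A M" by (simp_all add: fg_module_def)

text \<open>The right-hand side of the theorem, as a property of the family \<open>N\<close>.\<close>

definition costandard_modules ::
 "('r, 'x) ring_scheme => ('r, 'a, 'y) module_scheme => 'l::order set => ('l => 'a fgmod) => bool" where
 "costandard_modules R A \<Lambda> N \<longleftrightarrow>
   (\<forall>\<alpha>\<in>\<Lambda>. fg_module A (N \<alpha>) & projective_module R (restrict_scalars A (N \<alpha>))) \<and>
   (\<forall>\<alpha>\<in>\<Lambda>. \<forall>\<beta>\<in>\<Lambda>. hom_nonzero A (N \<alpha>) (N \<beta>) \<longrightarrow> \<alpha> \<ge> \<beta>) \<and>
   (\<forall>\<alpha>\<in>\<Lambda>. algebra_iso R (End_algebra A (N \<alpha>)) (regular R)) \<and>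
   (\<exists>I :: 'l => 'a fgmod.
    (\<forall>\<alpha>\<in>\<Lambda>. relative_injective R A (I \<alpha>) \<and>
      projective_module R (restrict_scalars A (I \<alpha>)) \<and>
      (\<exists>(K :: 'a fgmod) i p. short_exact A (N \<alpha>) i (I \<alpha>) p K \<and>
       filtered A (tensor_above R A \<Lambda> N \<alpha>) K)) \<and>
    in_add A (direct_sum \<Lambda> I) (dual_regular R A))"

context assoc_algebra
begin

lemma regular_lattice:
 assumes "add_of R {regular R} A" shows "lattice R A (regular A)"
proof -
 have m: "left_module A (regular A)" by (rule regular_left_module[OF ring_A])
 have "mod_iso R (restrict_scalars A (regular A)) A"
  by (rule mod_isoI[of "%x. x" _ _ _ "%x. x"]) (auto intro!: mod_homI simp: scalar_mult_left)
 from add_of_iso[OF restrict_left_module[OF m] self_left_module this assms] show ?thesis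
  unfolding lattice_def using m by blast
qed

lemma opposite_add_of:
 assumes "add_of R {regular R} A" shows "add_of R {regular R} (opposite A)"
proof -
 have "mod_iso R (opposite A) A" by (rule mod_isoI[of "%x. x" _ _ _ "%x. x"]) (auto intro!: mod_homI)
 from add_of_iso[OF assoc_algebra.self_left_module[OF opposite_algebra] self_left_module this assms] show ?thesis .
qed

lemma dual_regular_lattice:
 assumes "add_of R {regular R} A" shows "lattice R A (dual_regular R A)"
 using assoc_algebra.dual_lattice[OF opposite_algebra assoc_algebra.regular_lattice[OF opposite_algebra opposite_add_of[OF assms]]]
 by (simp add: dual_regular_def)

lemma split_quasi_hereditary_imp_standard_system:
 fixes \<Lambda> :: "'l::order set" and \<Delta> :: "'l => 'a fgmod"
 assumes fg: "fin_gen R A" and fin: "finite \<Lambda>" and s: "split_quasi_hereditary R A \<Lambda> \<Delta>"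
 obtains P :: "'l => 'a fgmod" and p where "standard_system R A \<Lambda> \<Delta> P p"
proof -
 have D: "!!\<alpha>. \<alpha> : \<Lambda> ==> fg_module A (\<Delta> \<alpha>)"
  "!!\<alpha>. \<alpha> : \<Lambda> ==> projective_module R (restrict_scalars A (\<Delta> \<alpha>))"
  "!!\<alpha> \<beta>. [|\<alpha> : \<Lambda>; \<beta> : \<Lambda>; hom_nonzero A (\<Delta> \<alpha>) (\<Delta> \<beta>)|] ==> \<alpha> \<le> \<beta>"
  "!!\<alpha>. \<alpha> : \<Lambda> ==> algebra_iso R (End_algebra A (\<Delta> \<alpha>)) (regular R)"
  using s unfolding split_quasi_hereditary_def by simp_all
 obtain P :: "'l => 'a fgmod" where P: "\<forall>\<alpha>\<in>\<Lambda>. fg_projective A (P \<alpha>) \<and>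
   (\<exists>(C :: 'a fgmod) i p. short_exact A C i (P \<alpha>) p (\<Delta> \<alpha>) & filtered A (tensor_above R A \<Lambda> \<Delta> \<alpha>) C)"
  and gen: "\<forall>M :: 'a fgmod. in_add A (direct_sum \<Lambda> P) M \<longleftrightarrow> fg_projective A M"
  using s unfolding split_quasi_hereditary_def by (elim conjE exE) (rule that)
 note Dm = fg_moduleD(1)[OF D(1)]
 have se: "scalar_end R A (\<Delta> \<alpha>)" if "\<alpha> : \<Lambda>" for \<alpha> using End_algebra_iff[OF Dm[OF that]] D(4)[OF that] by simp
 have Pp: "left_module A (P \<alpha>)" "add_of A {regular A} (P \<alpha>)" if "\<alpha> : \<Lambda>" for \<alpha>
  using bspec[OF P that] fg_projective_iff[OF ring_A, of "P \<alpha>"] by simp_all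
 have "\<exists>p. p : mod_hom A (P \<alpha>) (\<Delta> \<alpha>) & p ` carrier (P \<alpha>) = carrier (\<Delta> \<alpha>) \<and>
   Filt A (\<Delta> ` {\<mu> : \<Lambda>. \<alpha> < \<mu>}) (P \<alpha>) (a_kernel (P \<alpha>) (\<Delta> \<alpha>) p)" if al: "\<alpha> : \<Lambda>" for \<alpha>
 proof -
  obtain C :: "'a fgmod" and i p where ex: "short_exact A C i (P \<alpha>) p (\<Delta> \<alpha>)" and f: "filtered A (tensor_above R A \<Lambda> \<Delta> \<alpha>) C"
   using bspec[OF P al] by (elim conjE exE) (rule that)
  have C: "fg_module A C" using f unfolding filtered_def by simp
  have e: "i : mod_hom A C (P \<alpha>)" "p : mod_hom A (P \<alpha>) (\<Delta> \<alpha>)" "inj_on i (carrier C)"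
   "i ` carrier C = a_kernel (P \<alpha>) (\<Delta> \<alpha>) p" "p ` carrier (P \<alpha>) = carrier (\<Delta> \<alpha>)"
   using ex unfolding short_exact_def by simp_all
  have "Filt A (\<Delta> ` {\<mu> : \<Lambda>. \<alpha> < \<mu>}) C (carrier C)"
   by (rule iffD1[OF filtered_tensor_above_iff[where D = \<Delta> and \<Lambda> = \<Lambda> and \<alpha> = \<alpha>, OF fg_moduleD[OF C] Dm se] f])
  from Filt_image[OF fg_moduleD(1)[OF C] Pp(1)[OF al] e(1,3) this]
  show ?thesis unfolding e(4) using e(2,5) by (intro exI[of _ p] conjI)
 qed
 then have "\<forall>\<alpha>\<in>\<Lambda>. \<exists>p. p : mod_hom A (P \<alpha>) (\<Delta> \<alpha>) & p ` carrier (P \<alpha>) = carrier (\<Delta> \<alpha>) \<and>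
   Filt A (\<Delta> ` {\<mu> : \<Lambda>. \<alpha> < \<mu>}) (P \<alpha>) (a_kernel (P \<alpha>) (\<Delta> \<alpha>) p)" by (rule ballI)
 from bchoice[OF this] obtain p where p: "\<forall>\<alpha>\<in>\<Lambda>. p \<alpha> : mod_hom A (P \<alpha>) (\<Delta> \<alpha>) & p \<alpha> ` carrier (P \<alpha>) = carrier (\<Delta> \<alpha>) \<and>
   Filt A (\<Delta> ` {\<mu> : \<Lambda>. \<alpha> < \<mu>}) (P \<alpha>) (a_kernel (P \<alpha>) (\<Delta> \<alpha>) (p \<alpha>))" by (elim exE) (rule that)
 have reg: "left_module A (regular A)" by (rule regular_left_module[OF ring_A])
 have "fg_projective A (regular A)" unfolding fg_projective_iff[OF ring_A] using reg add_of_self[OF reg] by simp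
 then have "fg_module A (regular A)" by (simp add: fg_projective_def)
 then obtain M :: "'a fgmod" where M: "fg_module A M" "mod_iso A M (regular A)" by (rule fgmod_copy) (rule that)
 note Mm = fg_moduleD(1)[OF M(1)]
 have "add_of A {regular A} M" by (rule add_of_iso[OF Mm reg M(2) add_of_self[OF reg]]) simp
 then have "fg_projective A M" unfolding fg_projective_iff[OF ring_A] using Mm by simp
 then have "in_add A (direct_sum \<Lambda> P) M" using gen by simp
 from conjunct2[OF iffD1[OF in_add_direct_sum_iff[where M = P, OF ring_A fin Pp(1)] this]] have "add_of A (P ` \<Lambda>) M" .
 from add_of_iso[OF reg Mm mod_iso_sym[OF Mm M(2)] this] have "add_of A (P ` \<Lambda>) (regular A)" .
 then have "standard_system R A \<Lambda> \<Delta> P p"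
  unfolding standard_system_def using latticeI[OF fg D(1,2)] se Pp p D(3) by simp
 then show ?thesis by (rule that)
qed

lemma standard_system_imp_split_quasi_hereditary:
 fixes \<Lambda> :: "'l::order set"
 assumes fin: "finite \<Lambda>" and s: "standard_system R A \<Lambda> D P p"
 obtains \<Delta> :: "'l => 'a fgmod" where "split_quasi_hereditary R A \<Lambda> \<Delta>"
proof -
 note sD = standard_systemD[OF s]
 note Dm = lattice_module[OF sD(1)]
 obtain \<Delta> :: "'l => 'a fgmod" where X: "!!\<alpha>. \<alpha> : \<Lambda> ==> fg_module A (\<Delta> \<alpha>)" "!!\<alpha>. \<alpha> : \<Lambda> ==> mod_iso A (\<Delta> \<alpha>) (D \<alpha>)"
  by (rule fgmod_copies[OF lattice_fg_projective(1)[OF sD(1)]]) (assumption, rule that)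
 note Xm = fg_moduleD(1)[OF X(1)]
 have Pfg: "fg_module A (P \<alpha>)" if "\<alpha> : \<Lambda>" for \<alpha>
  using fg_projective_iff[OF ring_A, of "P \<alpha>"] sD(3,4)[OF that] by (simp add: fg_projective_def)
 obtain P' :: "'l => 'a fgmod" where Y: "!!\<alpha>. \<alpha> : \<Lambda> ==> fg_module A (P' \<alpha>)" "!!\<alpha>. \<alpha> : \<Lambda> ==> mod_iso A (P' \<alpha>) (P \<alpha>)"
  by (rule fgmod_copies[OF Pfg]) (assumption, rule that)
 note Ym = fg_moduleD(1)[OF Y(1)]
 have Xl: "lattice R A (\<Delta> \<alpha>)" if "\<alpha> : \<Lambda>" for \<alpha> by (rule lattice_iso[OF Xm[OF that] sD(1)[OF that] X(2)[OF that]])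
 have Xe: "scalar_end R A (\<Delta> \<alpha>)" if "\<alpha> : \<Lambda>" for \<alpha>
  by (rule scalar_end_iso[OF Xm[OF that] Dm[OF that] X(2)[OF that] sD(2)[OF that]])
 have Ya: "add_of A {regular A} (P' \<alpha>)" if "\<alpha> : \<Lambda>" for \<alpha>
  by (rule add_of_iso[OF Ym[OF that] sD(3)[OF that] Y(2)[OF that] sD(4)[OF that]])
 have reg: "left_module A (regular A)" by (rule regular_left_module[OF ring_A])
 have gen: "add_of A (P' ` \<Lambda>) (regular A)" by (rule add_of_family_iso[OF reg sD(3) Ym Y(2) sD(9)])
 have ex: "\<exists>(C :: 'a fgmod) i p. short_exact A C i (P' \<alpha>) p (\<Delta> \<alpha>) & filtered A (tensor_above R A \<Lambda> \<Delta> \<alpha>) C"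
  if al: "\<alpha> : \<Lambda>" for \<alpha>
 proof -
  let ?K = "(P \<alpha>)(|carrier := a_kernel (P \<alpha>) (D \<alpha>) (p \<alpha>)|)" and ?S = "{\<mu> : \<Lambda>. \<alpha> < \<mu>}"
  have Ks: "submodule (a_kernel (P \<alpha>) (D \<alpha>) (p \<alpha>)) A (P \<alpha>)" by (rule kernel_submodule[OF sD(3)[OF al] Dm[OF al] sD(5)[OF al]])
  have Km: "left_module A ?K" by (rule submodule_module[OF sD(3)[OF al] Ks])
  have "lattice R A ?K" by (rule conjunct1[OF dual_Filt[OF sD(3)[OF al] _ sD(7)[OF al]]]) (use sD(1) in auto)
  then have "fg_module A ?K" by (rule lattice_fg_projective(1))
  then obtain C :: "'a fgmod" where C: "fg_module A C" "mod_iso A C ?K" by (rule fgmod_copy) (rule that)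
  note Cm = fg_moduleD(1)[OF C(1)]
  have e: "short_exact A ?K (%x. x) (P \<alpha>) (p \<alpha>) (D \<alpha>)" unfolding short_exact_def
   using mod_hom_from_submodule[OF mod_hom_id submodule_subset[OF Ks]] sD(5,6)[OF al] by simp
  obtain i' p' where e': "short_exact A C i' (P' \<alpha>) p' (\<Delta> \<alpha>)"
   by (rule short_exact_iso[OF Km sD(3)[OF al] Dm[OF al] Cm Ym[OF al] Xm[OF al] C(2) Y(2)[OF al] X(2)[OF al] e]) (rule that)
  have id: "(%x. x) : mod_hom A C C" by (rule mod_hom_id)
  have "Filt A (\<Delta> ` ?S) (P \<alpha>) (a_kernel (P \<alpha>) (D \<alpha>) (p \<alpha>))"
   by (rule Filt_family_iso[OF sD(3)[OF al] _ _ _ sD(7)[OF al]]) (use Dm Xm X(2) in auto)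
  from Filt_restrict[OF sD(3)[OF al] this Ks] have "Filt A (\<Delta> ` ?S) ?K (carrier ?K)" by simp
  then have Cf: "Filt A (\<Delta> ` ?S) C (carrier C)" by (rule Filt_iso[OF Cm Km C(2)])
  have "filtered A (tensor_above R A \<Lambda> \<Delta> \<alpha>) C"
   by (rule iffD2[OF filtered_tensor_above_iff[where D = \<Delta> and \<Lambda> = \<Lambda> and \<alpha> = \<alpha>, OF fg_moduleD[OF C(1)] Xm Xe] Cf])
  then show ?thesis using e' by (intro exI conjI)
 qed
 have "split_quasi_hereditary R A \<Lambda> \<Delta>" unfolding split_quasi_hereditary_def
 proof (intro conjI ballI impI exI[of _ P'] allI)
  fix \<alpha> assume al: "\<alpha> : \<Lambda>"
  show "fg_module A (\<Delta> \<alpha>)" by (rule X(1)[OF al])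
  show "projective_module R (restrict_scalars A (\<Delta> \<alpha>))" by (rule lattice_fg_projective(2)[OF Xl[OF al]])
  show "algebra_iso R (End_algebra A (\<Delta> \<alpha>)) (regular R)" using End_algebra_iff[OF Xm[OF al]] Xe[OF al] by simp
  show "fg_projective A (P' \<alpha>)" using fg_projective_iff[OF ring_A, of "P' \<alpha>"] Ym[OF al] Ya[OF al] by simp
  show "\<exists>(C :: 'a fgmod) i p. short_exact A C i (P' \<alpha>) p (\<Delta> \<alpha>) & filtered A (tensor_above R A \<Lambda> \<Delta> \<alpha>) C" by (rule ex[OF al])
  fix \<beta> assume be: "\<beta> : \<Lambda>" and nz: "hom_nonzero A (\<Delta> \<alpha>) (\<Delta> \<beta>)"
  show "\<alpha> \<le> \<beta>"
   by (rule sD(8)[OF al be hom_nonzero_iso[OF Xm[OF al] Dm[OF al] Xm[OF be] Dm[OF be] X(2)[OF al] X(2)[OF be] nz]])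
 next
  fix M :: "'a fgmod"
  have iff: "in_add A (direct_sum \<Lambda> P') M \<longleftrightarrow> left_module A M & add_of A (P' ` \<Lambda>) M"
   by (rule in_add_direct_sum_iff[OF ring_A fin Ym])
  show "in_add A (direct_sum \<Lambda> P') M \<longleftrightarrow> fg_projective A M" unfolding iff fg_projective_iff[OF ring_A]
  proof (rule conj_cong[OF refl iffI])
   assume M: "left_module A M"
   show "add_of A {regular A} M" if "add_of A (P' ` \<Lambda>) M" by (rule add_of_trans[OF M _ that]) (use Ym Ya in auto)
   show "add_of A (P' ` \<Lambda>) M" if "add_of A {regular A} M" by (rule add_of_trans[OF M _ that]) (use reg gen in simp)
  qed
 qed
 then show ?thesis by (rule that)
qed

lemma costandard_modules_imp_costandard_system:
 fixes \<Lambda> :: "'l::order set" and N :: "'l => 'a fgmod"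
 assumes fg: "fin_gen R A" and pr: "add_of R {regular R} A" and fin: "finite \<Lambda>" and s: "costandard_modules R A \<Lambda> N"
 obtains I K :: "'l => 'a fgmod" and \<iota> \<pi> where "costandard_system R A \<Lambda> N I \<iota> \<pi> K"
proof -
 have D: "!!\<alpha>. \<alpha> : \<Lambda> ==> fg_module A (N \<alpha>)"
  "!!\<alpha>. \<alpha> : \<Lambda> ==> projective_module R (restrict_scalars A (N \<alpha>))"
  "!!\<alpha> \<beta>. [|\<alpha> : \<Lambda>; \<beta> : \<Lambda>; hom_nonzero A (N \<alpha>) (N \<beta>)|] ==> \<beta> \<le> \<alpha>"
  "!!\<alpha>. \<alpha> : \<Lambda> ==> algebra_iso R (End_algebra A (N \<alpha>)) (regular R)"
  using s unfolding costandard_modules_def by simp_all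
 obtain I :: "'l => 'a fgmod" where I: "\<forall>\<alpha>\<in>\<Lambda>. relative_injective R A (I \<alpha>) \<and>
      projective_module R (restrict_scalars A (I \<alpha>)) \<and>
      (\<exists>(K :: 'a fgmod) i p. short_exact A (N \<alpha>) i (I \<alpha>) p K & filtered A (tensor_above R A \<Lambda> N \<alpha>) K)"
  and gen: "in_add A (direct_sum \<Lambda> I) (dual_regular R A)"
  using s unfolding costandard_modules_def by (elim conjE exE) (rule that)
 note Nm = fg_moduleD(1)[OF D(1)]
 note drm = lattice_module[OF dual_regular_lattice[OF pr]]
 have se: "scalar_end R A (N \<alpha>)" if "\<alpha> : \<Lambda>" for \<alpha> using End_algebra_iff[OF Nm[OF that]] D(4)[OF that] by simp
 have Ip: "left_module A (I \<alpha>)" "add_of A {dual_regular R A} (I \<alpha>)" if "\<alpha> : \<Lambda>" for \<alpha>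
  using bspec[OF I that] in_add_iff[OF drm, of "I \<alpha>"] unfolding relative_injective_def by simp_all
 have "\<exists>K :: 'a fgmod. \<exists>i p. short_exact A (N \<alpha>) i (I \<alpha>) p K & left_module A K & Filt A (N ` {\<mu> : \<Lambda>. \<alpha> < \<mu>}) K (carrier K)"
  if al: "\<alpha> : \<Lambda>" for \<alpha>
 proof -
  obtain K :: "'a fgmod" and i p where ex: "short_exact A (N \<alpha>) i (I \<alpha>) p K" and f: "filtered A (tensor_above R A \<Lambda> N \<alpha>) K"
   using bspec[OF I al] by (elim conjE exE) (rule that)
  have K: "fg_module A K" using f unfolding filtered_def by simp
  have "Filt A (N ` {\<mu> : \<Lambda>. \<alpha> < \<mu>}) K (carrier K)"
   by (rule iffD1[OF filtered_tensor_above_iff[where D = N and \<Lambda> = \<Lambda> and \<alpha> = \<alpha>, OF fg_moduleD[OF K] Nm se] f])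
  then show ?thesis using ex fg_moduleD(1)[OF K] by (intro exI conjI)
 qed
 then have "\<forall>\<alpha>\<in>\<Lambda>. \<exists>K :: 'a fgmod. \<exists>i p. short_exact A (N \<alpha>) i (I \<alpha>) p K & left_module A K & Filt A (N ` {\<mu> : \<Lambda>. \<alpha> < \<mu>}) K (carrier K)"
  by (rule ballI)
 from bchoice[OF this] obtain K :: "'l => 'a fgmod"
  where "\<forall>\<alpha>\<in>\<Lambda>. \<exists>i p. short_exact A (N \<alpha>) i (I \<alpha>) p (K \<alpha>) & left_module A (K \<alpha>) & Filt A (N ` {\<mu> : \<Lambda>. \<alpha> < \<mu>}) (K \<alpha>) (carrier (K \<alpha>))"
  by (elim exE) (rule that)
 from bchoice[OF this] obtain \<iota>
  where "\<forall>\<alpha>\<in>\<Lambda>. \<exists>p. short_exact A (N \<alpha>) (\<iota> \<alpha>) (I \<alpha>) p (K \<alpha>) & left_module A (K \<alpha>) & Filt A (N ` {\<mu> : \<Lambda>. \<alpha> < \<mu>}) (K \<alpha>) (carrier (K \<alpha>))"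
  by (elim exE) (rule that)
 from bchoice[OF this] obtain \<pi>
  where K: "\<forall>\<alpha>\<in>\<Lambda>. short_exact A (N \<alpha>) (\<iota> \<alpha>) (I \<alpha>) (\<pi> \<alpha>) (K \<alpha>) & left_module A (K \<alpha>) & Filt A (N ` {\<mu> : \<Lambda>. \<alpha> < \<mu>}) (K \<alpha>) (carrier (K \<alpha>))"
  by (elim exE) (rule that)
 from conjunct2[OF iffD1[OF in_add_direct_sum_iff[where M = I, OF ring_A fin Ip(1)] gen]]
 have "add_of A (I ` \<Lambda>) (dual_regular R A)" .
 then have "costandard_system R A \<Lambda> N I \<iota> \<pi> K"
  unfolding costandard_system_def using latticeI[OF fg D(1,2)] se Ip K D(3) by simp
 then show ?thesis by (rule that)
qed

lemma costandard_system_imp_costandard_modules: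
 fixes \<Lambda> :: "'l::order set"
 assumes pr: "add_of R {regular R} A" and fin: "finite \<Lambda>" and s: "costandard_system R A \<Lambda> N I \<iota> \<pi> K"
 obtains N' :: "'l => 'a fgmod" where "costandard_modules R A \<Lambda> N'"
proof -
 note sD = costandard_systemD[OF s]
 note Nm = lattice_module[OF sD(1)]
 note drl = dual_regular_lattice[OF pr]
 note drm = lattice_module[OF drl]
 obtain N' :: "'l => 'a fgmod" where X: "!!\<alpha>. \<alpha> : \<Lambda> ==> fg_module A (N' \<alpha>)" "!!\<alpha>. \<alpha> : \<Lambda> ==> mod_iso A (N' \<alpha>) (N \<alpha>)"
  by (rule fgmod_copies[OF lattice_fg_projective(1)[OF sD(1)]]) (assumption, rule that)
 note Xm = fg_moduleD(1)[OF X(1)]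
 have Il: "lattice R A (I \<alpha>)" if "\<alpha> : \<Lambda>" for \<alpha>
  by (rule lattice_add_of[OF sD(3)[OF that] _ sD(4)[OF that]]) (use drl in simp)
 obtain I' :: "'l => 'a fgmod" where Y: "!!\<alpha>. \<alpha> : \<Lambda> ==> fg_module A (I' \<alpha>)" "!!\<alpha>. \<alpha> : \<Lambda> ==> mod_iso A (I' \<alpha>) (I \<alpha>)"
  by (rule fgmod_copies[OF lattice_fg_projective(1)[OF Il]]) (assumption, rule that)
 note Ym = fg_moduleD(1)[OF Y(1)]
 have Xl: "lattice R A (N' \<alpha>)" if "\<alpha> : \<Lambda>" for \<alpha> by (rule lattice_iso[OF Xm[OF that] sD(1)[OF that] X(2)[OF that]])
 have Xe: "scalar_end R A (N' \<alpha>)" if "\<alpha> : \<Lambda>" for \<alpha>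
  by (rule scalar_end_iso[OF Xm[OF that] Nm[OF that] X(2)[OF that] sD(2)[OF that]])
 have Yl: "lattice R A (I' \<alpha>)" if "\<alpha> : \<Lambda>" for \<alpha> by (rule lattice_iso[OF Ym[OF that] Il[OF that] Y(2)[OF that]])
 have Ya: "add_of A {dual_regular R A} (I' \<alpha>)" if "\<alpha> : \<Lambda>" for \<alpha>
  by (rule add_of_iso[OF Ym[OF that] sD(3)[OF that] Y(2)[OF that] sD(4)[OF that]])
 have gen: "add_of A (I' ` \<Lambda>) (dual_regular R A)" by (rule add_of_family_iso[OF drm sD(3) Ym Y(2) sD(9)])
 have ex: "\<exists>(C :: 'a fgmod) i p. short_exact A (N' \<alpha>) i (I' \<alpha>) p C & filtered A (tensor_above R A \<Lambda> N' \<alpha>) C"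
  if al: "\<alpha> : \<Lambda>" for \<alpha>
 proof -
  let ?S = "{\<mu> : \<Lambda>. \<alpha> < \<mu>}"
  note Km = sD(5)[OF al]
  have "lattice R A ((K \<alpha>)(|carrier := carrier (K \<alpha>)|))"
   by (rule conjunct1[OF dual_Filt[OF Km _ sD(7)[OF al]]]) (use sD(1) in auto)
  then have "fg_module A (K \<alpha>)" using lattice_fg_projective(1)[of "K \<alpha>"] by simp
  then obtain C :: "'a fgmod" where C: "fg_module A C" "mod_iso A C (K \<alpha>)" by (rule fgmod_copy) (rule that)
  note Cm = fg_moduleD(1)[OF C(1)]
  obtain i' p' where e': "short_exact A (N' \<alpha>) i' (I' \<alpha>) p' C"
   by (rule short_exact_iso[OF Nm[OF al] sD(3)[OF al] Km Xm[OF al] Ym[OF al] Cm X(2)[OF al] Y(2)[OF al] C(2) sD(6)[OF al]]) (rule that)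
  have "Filt A (N' ` ?S) (K \<alpha>) (carrier (K \<alpha>))"
   by (rule Filt_family_iso[OF Km _ _ _ sD(7)[OF al]]) (use Nm Xm X(2) in auto)
  then have Cf: "Filt A (N' ` ?S) C (carrier C)" by (rule Filt_iso[OF Cm Km C(2)])
  have "filtered A (tensor_above R A \<Lambda> N' \<alpha>) C"
   by (rule iffD2[OF filtered_tensor_above_iff[where D = N' and \<Lambda> = \<Lambda> and \<alpha> = \<alpha>, OF fg_moduleD[OF C(1)] Xm Xe] Cf])
  then show ?thesis using e' by (intro exI conjI)
 qed
 have "costandard_modules R A \<Lambda> N'" unfolding costandard_modules_def
 proof (intro conjI ballI impI exI[of _ I'])
  fix \<alpha> assume al: "\<alpha> : \<Lambda>"
  show "fg_module A (N' \<alpha>)" by (rule X(1)[OF al])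
  show "projective_module R (restrict_scalars A (N' \<alpha>))" by (rule lattice_fg_projective(2)[OF Xl[OF al]])
  show "algebra_iso R (End_algebra A (N' \<alpha>)) (regular R)" using End_algebra_iff[OF Xm[OF al]] Xe[OF al] by simp
  show "projective_module R (restrict_scalars A (I' \<alpha>))" by (rule lattice_fg_projective(2)[OF Yl[OF al]])
  then show "relative_injective R A (I' \<alpha>)"
   unfolding relative_injective_def in_add_iff[OF drm] using Y(1)[OF al] Ym[OF al] Ya[OF al] by simp
  show "\<exists>(C :: 'a fgmod) i p. short_exact A (N' \<alpha>) i (I' \<alpha>) p C & filtered A (tensor_above R A \<Lambda> N' \<alpha>) C" by (rule ex[OF al])
  fix \<beta> assume be: "\<beta> : \<Lambda>" and nz: "hom_nonzero A (N' \<alpha>) (N' \<beta>)"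
  show "\<beta> \<le> \<alpha>"
   by (rule sD(8)[OF al be hom_nonzero_iso[OF Xm[OF al] Nm[OF al] Xm[OF be] Nm[OF be] X(2)[OF al] X(2)[OF be] nz]])
 next
  have "in_add A (direct_sum \<Lambda> I') (dual_regular R A) \<longleftrightarrow>
    left_module A (dual_regular R A) & add_of A (I' ` \<Lambda>) (dual_regular R A)"
   by (rule in_add_direct_sum_iff[OF ring_A fin Ym])
  then show "in_add A (direct_sum \<Lambda> I') (dual_regular R A)" using drm gen by simp
 qed
 then show ?thesis by (rule that)
qed

end

theorem theorem3p5:
  fixes R :: "('r, 'x) ring_scheme" and A :: "('r, 'a, 'y) module_scheme"
    and \<Lambda> :: "'l::order set"
  assumes "cring R" and "noetherian_ring R"
    and "projective_noetherian_algebra R A"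
    and "finite \<Lambda>"
  shows "(\<exists>\<Delta> :: 'l \<Rightarrow> 'a fgmod. split_quasi_hereditary R A \<Lambda> \<Delta>) \<longleftrightarrow>
    (\<exists>N :: 'l \<Rightarrow> 'a fgmod.
       (\<forall>\<alpha>\<in>\<Lambda>. fg_module A (N \<alpha>) \<and> projective_module R (restrict_scalars A (N \<alpha>))) \<and>
       (\<forall>\<alpha>\<in>\<Lambda>. \<forall>\<beta>\<in>\<Lambda>. hom_nonzero A (N \<alpha>) (N \<beta>) \<longrightarrow> \<alpha> \<ge> \<beta>) \<and>
       (\<forall>\<alpha>\<in>\<Lambda>. algebra_iso R (End_algebra A (N \<alpha>)) (regular R)) \<and>
       (\<exists>I :: 'l \<Rightarrow> 'a fgmod.
          (\<forall>\<alpha>\<in>\<Lambda>. relative_injective R A (I \<alpha>) \<and>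
             projective_module R (restrict_scalars A (I \<alpha>)) \<and>
             (\<exists>(K :: 'a fgmod) i p. short_exact A (N \<alpha>) i (I \<alpha>) p K \<and>
                filtered A (tensor_above R A \<Lambda> N \<alpha>) K)) \<and>
          in_add A (direct_sum \<Lambda> I) (dual_regular R A)))"
  unfolding costandard_modules_def[symmetric]
proof
 interpret A: assoc_algebra R A using assms(3) by (simp add: projective_noetherian_algebra_def)
 interpret B: assoc_algebra R "opposite A" by (rule A.opposite_algebra)
 have fgp: "fg_projective R A" using assms(3) by (simp add: projective_noetherian_algebra_def)
 have fg: "fin_gen R A" using fgp by (simp add: fg_projective_def fg_module_def)
 have pr: "add_of R {regular R} A" using fgp fg_projective_iff[OF A.ring_R, of A] by simp
 show "\<exists>N :: 'l => 'a fgmod. costandard_modules R A \<Lambda> N" if ex: "\<exists>\<Delta> :: 'l => 'a fgmod. split_quasi_hereditary R A \<Lambda> \<Delta>"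
 proof -
  obtain \<Delta> :: "'l => 'a fgmod" where \<Delta>: "split_quasi_hereditary R A \<Lambda> \<Delta>" using ex by blast
  obtain P :: "'l => 'a fgmod" and p where s: "standard_system R A \<Lambda> \<Delta> P p"
   by (rule A.split_quasi_hereditary_imp_standard_system[OF fg assms(4) \<Delta>]) (rule that)
  obtain Q H q where "standard_system R (opposite A) \<Lambda> (Q :: 'l => ('a, ((nat => 'a) set => 'a) set) module)
    (H :: 'l => ('a, (nat => 'a) set => 'a) module) q"
   by (rule A.opposite_standard_system[OF assms(4) s]) (rule that)
  from B.dual_of_standard_system[OF this, unfolded opposite_opposite]
  obtain N :: "'l => 'a fgmod" where "costandard_modules R A \<Lambda> N"
   by (rule A.costandard_system_imp_costandard_modules[OF pr assms(4)]) (rule that)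
  then show ?thesis by (rule exI[of _ N])
 qed
 show "\<exists>\<Delta> :: 'l => 'a fgmod. split_quasi_hereditary R A \<Lambda> \<Delta>" if ex: "\<exists>N :: 'l => 'a fgmod. costandard_modules R A \<Lambda> N"
 proof -
  obtain N :: "'l => 'a fgmod" where N: "costandard_modules R A \<Lambda> N" using ex by blast
  obtain I K :: "'l => 'a fgmod" and \<iota> \<pi> where s: "costandard_system R A \<Lambda> N I \<iota> \<pi> K"
   by (rule A.costandard_modules_imp_costandard_system[OF fg pr assms(4) N]) (rule that)
  note d = A.dual_of_costandard_system[OF B.regular_lattice[OF A.opposite_add_of[OF pr]] s]
  obtain Q H q where "standard_system R (opposite (opposite A)) \<Lambda> (Q :: 'l => ('a, (((nat => 'a) set => 'r) => 'a) set) module)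
    (H :: 'l => ('a, ((nat => 'a) set => 'r) => 'a) module) q"
   by (rule B.opposite_standard_system[OF assms(4) d]) (rule that)
  from this[unfolded opposite_opposite]
  obtain \<Delta> :: "'l => 'a fgmod" where "split_quasi_hereditary R A \<Lambda> \<Delta>"
   by (rule A.standard_system_imp_split_quasi_hereditary[OF assms(4)]) (rule that)
  then show ?thesis by (rule exI[of _ \<Delta>])
 qed
qed

end
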